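(* Let $x:[0,\infty)\to\mathbb{R}$ be a continuous function and fix a sequence of partitions $\Pi=(\pi_n)_n$ of $[0,\infty)$ such that $O_t(x,\pi_n)\to 0$ as $n\to\infty$ for all $t\in[0,\infty)$. Then, for $1<p<\infty$ and $q=p/(p-1)$, the following are equivalent: (1) for every $g\in W^{1,q}$ and $t\in[0,\infty)$, $\sum_{t_j\in\pi_n} g(x_{t_j})(x_{t_{j+1}\wedge t}-x_{t_j\wedge t})$ converges as $n\to\infty$, and the limit, denoted $\int_0^t g(x_s)\,dx_s$, is a continuous function of $t$; (2) for every $g\in W^{1,q}$, $\sum_{t_j\in\pi_n} g(x_{t_j})(x_{t_{j+1}\wedge \cdot}-x_{t_j\wedge \cdot})$ converges uniformly on compacts; (3) $(L^{\pi_n}_t)_n$ converges weakly in $L^p$ to some $L_t$ for all $t\in[0,\infty)$, and $[0,\infty)\ni t\mapsto L_t\in L^p$ is continuous when $L^p$ is endowed with the weak topology; (4) for all $t\in[0,\infty)$ there exists $L_t\in L^p$ such that, for every $h\in L^q$, $\int_{\mathbb{R}} L^{\pi_n}_\cdot(u)h(u)\,du\to\int_{\mathbb{R}} L_\cdot(u)h(u)\,du$ uniformly on compacts; (5) $x$ has quadratic variation along $\Pi$, and for all $M\in[0,\infty)$ there exists $t\ge M$ such that $(L^{\pi_n}_t)_n$ is bounded in $L^p$. If these conditions are satisfied, then $(L^{\pi_n}_t)_n$ is bounded in $L^p$ for all $t\in[0,\infty)$; for all $f\in W^{2,q}$ and $t\in[0,\infty)$ $$f(x_t)-f(x_0)=\int_0^t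 f'(x_s)\,dx_s+\frac12\int_{\mathbb{R}}L_t(u)f''(u)\,du;$$ and for all $t\in[0,\infty)$ and all bounded Borel $h:\mathbb{R}\to\mathbb{R}$ $$\int_0^t h(x_s)\,d\langle x\rangle_s=\int_{\mathbb{R}}L_t(u)h(u)\,du.$$ The statements above also hold for $p=\infty$, $q=1$ if the weak topology on $L^p$ is replaced by the weak$^*$ topology on $L^\infty$. Moreover, they also hold for $p=1$, $q=\infty$ if in item (5) boundedness in $L^p$ is replaced by equi-integrability.
   Context: A partition of $[0,\infty)$ is a sequence $\pi=(t_k)_{k\in\mathbb{N}}$ in $[0,\infty]$ with $t_0=0$, $t_k<t_{k+1}$ whenever $t_{k+1}<\infty$, and $\lim_k t_k=\infty$. For a continuous $x:[0,\infty)\to\mathbb{R}$ set $x_\infty:=0$ and $$O_t(x,\pi):=\max\{|x(b)-x(a)|: a,b\in[t_k,t_{k+1})\cap[0,t]\text{ for some }k\in\mathbb{N}\}$$ (understood as a supremum). All sums over $t_j\in\pi$ are finite sums for fixed $t$, since partitions are finite on compacts. Quadratic variation: $\langle x\rangle^{\pi}_t:=\sum_{t_j\in\pi}(x_{t_{j+1}\wedge t}-x_{t_j\wedge t})^2$. Given that $O_T(x,\pi_n)\to0$ for all $T<\infty$, we say that $x$ has quadratic variation along $\Pi=(\pi_n)_n$ if $\langle x\rangle^{\pi_n}_t$ converges for every $t\ge 0$ to a limit $\langle x\rangle_t$ which is a continuous function of $t$; the (nondecreasing) function $\langle x\rangle$ is then called the quadratic variation of $x$. Discrete local time: for $a,b\in\mathbb{R}$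 let $[\![a,b)\!)$ denote $[a,b)$ if $a\le b$ and $[b,a)$ if $a>b$. For a partition $\pi$, $t\ge0$, $u\in\mathbb{R}$, $$L^{\pi}_t(u):=2\sum_{t_j\in\pi}\mathbf{1}_{[\![x_{t_j\wedge t},\,x_{t_{j+1}\wedge t})\!)}(u)\,|x_{t_{j+1}\wedge t}-u|.$$ $L^p=L^p(\mathbb{R},du)$. $W^{k,p}$ is the space of functions on $\mathbb{R}$ whose $k$-th distributional derivative is in $L^p$ (no integrability is required of the function itself): $W^{1,p}$ is the set of (locally) absolutely continuous functions whose a.e. derivative is in $L^p$, and $W^{2,p}$ is the set of $C^1$ functions whose derivative is in $W^{1,p}$. *)

theory Defs
  imports "HOL-Analysis.Analysis" "HOL-Probability.Essential_Supremum"
begin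

section \<open>Partitions, quadratic variation, local time\<close>

definition partition :: "(nat \<Rightarrow> ennreal) \<Rightarrow> bool" where
  "partition \<pi> \<longleftrightarrow>
     \<pi> 0 = 0 \<and> (\<forall>k. \<pi> (Suc k) < \<infinity> \<longrightarrow> \<pi> k < \<pi> (Suc k)) \<and> \<pi> \<longlonglongrightarrow> \<infinity>"

text \<open>A path is a function on the reals of which only the values on \<open>{0..}\<close> matter.
  \<open>path_at x s\<close> is $x_s$ for $s \in [0,\infty]$, with the convention $x_\infty = 0$;
  \<open>stopped x s t\<close> is $x_{s \wedge t}$ for $s \in [0,\infty]$ and real $t \ge 0$.\<close>

definition path_at :: "(real \<Rightarrow> real) \<Rightarrow> ennreal \<Rightarrow> real" where
  "path_at x s = (if s = \<infinity> then 0 else x (enn2real s))"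

definition stopped :: "(real \<Rightarrow> real) \<Rightarrow> ennreal \<Rightarrow> real \<Rightarrow> real" where
  "stopped x s t = path_at x (min s (ennreal t))"

definition oscillation :: "(real \<Rightarrow> real) \<Rightarrow> (nat \<Rightarrow> ennreal) \<Rightarrow> real \<Rightarrow> real" where
  "oscillation x \<pi> t =
     Sup {\<bar>x b - x a\<bar> | a b. a \<in> {0..t} \<and> b \<in> {0..t} \<and>
       (\<exists>k. ennreal a \<in> {\<pi> k..<\<pi> (Suc k)} \<and> ennreal b \<in> {\<pi> k..<\<pi> (Suc k)})}"

text \<open>In the series below all terms with $t_j \ge t$ vanish, so that they are finite sums
  for a partition.\<close>

definition discrete_qv :: "(real \<Rightarrow> real) \<Rightarrow> (nat \<Rightarrow> ennreal) \<Rightarrow> real \<Rightarrow> real" where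
  "discrete_qv x \<pi> t = (\<Sum>j. (stopped x (\<pi> (Suc j)) t - stopped x (\<pi> j) t)\<^sup>2)"

definition riemann_sum ::
    "(real \<Rightarrow> real) \<Rightarrow> (nat \<Rightarrow> ennreal) \<Rightarrow> (real \<Rightarrow> real) \<Rightarrow> real \<Rightarrow> real" where
  "riemann_sum x \<pi> g t =
     (\<Sum>j. g (path_at x (\<pi> j)) * (stopped x (\<pi> (Suc j)) t - stopped x (\<pi> j) t))"

definition oriented_Ico :: "real \<Rightarrow> real \<Rightarrow> real set" where
  "oriented_Ico a b = (if a \<le> b then {a..<b} else {b..<a})"

definition discrete_local_time ::
    "(real \<Rightarrow> real) \<Rightarrow> (nat \<Rightarrow> ennreal) \<Rightarrow> real \<Rightarrow> real \<Rightarrow> real" where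
  "discrete_local_time x \<pi> t u =
     2 * (\<Sum>j. indicator (oriented_Ico (stopped x (\<pi> j) t) (stopped x (\<pi> (Suc j)) t)) u
              * \<bar>stopped x (\<pi> (Suc j)) t - u\<bar>)"

definition quadratic_variation ::
    "(real \<Rightarrow> real) \<Rightarrow> (nat \<Rightarrow> nat \<Rightarrow> ennreal) \<Rightarrow> real \<Rightarrow> real" where
  "quadratic_variation x \<P> t = lim (\<lambda>n. discrete_qv x (\<P> n) t)"

definition has_quadratic_variation ::
    "(real \<Rightarrow> real) \<Rightarrow> (nat \<Rightarrow> nat \<Rightarrow> ennreal) \<Rightarrow> bool" where
  "has_quadratic_variation x \<P> \<longleftrightarrow>
     (\<forall>t\<ge>0. convergent (\<lambda>n. discrete_qv x (\<P> n) t)) \<and>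
     continuous_on {0..} (quadratic_variation x \<P>)"

text \<open>The Stieltjes measure $d\langle x\rangle$; the quadratic variation is extended by its
  value at 0 to the negative half-line, which thus carries no mass.\<close>

definition qv_measure :: "(real \<Rightarrow> real) \<Rightarrow> (nat \<Rightarrow> nat \<Rightarrow> ennreal) \<Rightarrow> real measure" where
  "qv_measure x \<P> = interval_measure (\<lambda>s. quadratic_variation x \<P> (max 0 s))"

definition pathwise_integral ::
    "(real \<Rightarrow> real) \<Rightarrow> (nat \<Rightarrow> nat \<Rightarrow> ennreal) \<Rightarrow> (real \<Rightarrow> real) \<Rightarrow> real \<Rightarrow> real" where
  "pathwise_integral x \<P> g t = lim (\<lambda>n. riemann_sum x (\<P> n) g t)"


section \<open>Lebesgue spaces on the real line\<close>

text \<open>Elements of $L^p$ are represented by Borel functions rather than by classes modulo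
  almost everywhere equality, so the weak topologies below are not Hausdorff: limits are
  determined up to null sets only.\<close>

definition Lp :: "ennreal \<Rightarrow> (real \<Rightarrow> real) set" where
  "Lp p = (if p = \<infinity>
     then {f \<in> borel_measurable lborel. esssup lborel (\<lambda>u. ereal \<bar>f u\<bar>) < \<infinity>}
     else {f \<in> borel_measurable lborel. integrable lborel (\<lambda>u. \<bar>f u\<bar> powr enn2real p)})"

definition Lp_norm :: "ennreal \<Rightarrow> (real \<Rightarrow> real) \<Rightarrow> real" where
  "Lp_norm p f = (if p = \<infinity>
     then real_of_ereal (esssup lborel (\<lambda>u. ereal \<bar>f u\<bar>))
     else (LINT u|lborel. \<bar>f u\<bar> powr enn2real p) powr (1 / enn2real p))"

definition bounded_in_Lp :: "ennreal \<Rightarrow> (nat \<Rightarrow> real \<Rightarrow> real) \<Rightarrow> bool" where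
  "bounded_in_Lp p F \<longleftrightarrow> (\<exists>C. \<forall>n. F n \<in> Lp p \<and> Lp_norm p (F n) \<le> C)"

definition equi_integrable :: "(nat \<Rightarrow> real \<Rightarrow> real) \<Rightarrow> bool" where
  "equi_integrable F \<longleftrightarrow>
     (\<forall>n. F n \<in> Lp 1) \<and>
     (\<forall>\<epsilon>>0. \<exists>K. \<forall>n. (LINT u:{u. \<bar>F n u\<bar> > K}|lborel. \<bar>F n u\<bar>) \<le> \<epsilon>)"

text \<open>Continuous linear functionals on $L^p$. The norm bound forces them to be constant on
  classes of almost everywhere equal functions.\<close>

definition Lp_dual :: "ennreal \<Rightarrow> ((real \<Rightarrow> real) \<Rightarrow> real) set" where
  "Lp_dual p = {\<phi>.
     (\<forall>f\<in>Lp p. \<forall>g\<in>Lp p. \<phi> (\<lambda>u. f u + g u) = \<phi> f + \<phi> g) \<and>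
     (\<forall>c. \<forall>f\<in>Lp p. \<phi> (\<lambda>u. c * f u) = c * \<phi> f) \<and>
     (\<exists>C. \<forall>f\<in>Lp p. \<bar>\<phi> f\<bar> \<le> C * Lp_norm p f)}"

definition initial_topology :: "'a set \<Rightarrow> ('a \<Rightarrow> real) set \<Rightarrow> 'a topology" where
  "initial_topology S \<Phi> =
     topology_generated_by {{f \<in> S. \<phi> f \<in> U} | \<phi> U. \<phi> \<in> \<Phi> \<and> open U}"

definition weak_topology :: "ennreal \<Rightarrow> (real \<Rightarrow> real) topology" where
  "weak_topology p = initial_topology (Lp p) (Lp_dual p)"

definition weak_star_topology :: "(real \<Rightarrow> real) topology" where
  "weak_star_topology = initial_topology (Lp \<infinity>) {\<lambda>f. LINT u|lborel. f u * h u | h. h \<in> Lp 1}"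


section \<open>Sobolev spaces on the real line\<close>

definition locally_abs_continuous :: "(real \<Rightarrow> real) \<Rightarrow> bool" where
  "locally_abs_continuous g \<longleftrightarrow>
     (\<forall>a b. \<forall>\<epsilon>>0. \<exists>\<delta>>0. \<forall>D.
        finite D \<and> (\<forall>(c, d)\<in>D. a \<le> c \<and> c \<le> d \<and> d \<le> b) \<and>
        disjoint_family_on (\<lambda>(c, d). {c<..<d}) D \<and> (\<Sum>(c, d)\<in>D. d - c) < \<delta> \<longrightarrow>
        (\<Sum>(c, d)\<in>D. \<bar>g d - g c\<bar>) < \<epsilon>)"

definition ae_derivative :: "(real \<Rightarrow> real) \<Rightarrow> (real \<Rightarrow> real) \<Rightarrow> bool" where
  "ae_derivative g h \<longleftrightarrow>
     h \<in> borel_measurable lborel \<and> (AE u in lborel. (g has_real_derivative h u) (at u))"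

definition W1 :: "ennreal \<Rightarrow> (real \<Rightarrow> real) set" where
  "W1 p = {g. locally_abs_continuous g \<and> (\<exists>h\<in>Lp p. ae_derivative g h)}"

definition W2 :: "ennreal \<Rightarrow> (real \<Rightarrow> real) set" where
  "W2 p = {f. (\<forall>u. f field_differentiable (at u)) \<and> continuous_on UNIV (deriv f) \<and>
              deriv f \<in> W1 p}"

end

theory Submission
  imports Defs
begin

text \<open>Write \<open>L\<^sup>n\<^sub>t\<close> for the discrete local times and call the pairing
  \<open>\<integral> L\<^sup>n\<^sub>t h\<close> with a weight \<open>h\<close> the occupation
  integral of \<open>h\<close>. Taylor's formula with integral remainder on one step from
  \<open>a\<close> to \<open>b\<close> reads \<open>F b - F a = F' a (b - a) + 1/2 \<integral> k
  F''\<close>, where the kernel \<open>k\<close> is exactly one summand of the discrete local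
  time. Summed along a partition it becomes the discrete Tanaka formula
  (\<open>discrete_Tanaka\<close>), which holds without any error term: the Riemann sum of
  \<open>g\<close> and half the occupation integral of \<open>g'\<close> add up to \<open>F (x t)
  - F (x 0)\<close>, where \<open>F' = g\<close>. Since every \<open>h \<in> L\<^sup>q\<close> is
  the derivative of some \<open>g \<in> W\<^sup>1\<^sup>,\<^sup>q\<close>
  (\<open>ae_derivative_antiderivative\<close>), convergence of all Riemann sums is the same as
  convergence of all occupation integrals with weights in \<open>L\<^sup>q\<close>. Each of the
  five conditions is compared with this last one, called \<open>occupations_converge\<close>, in
  which the limits are also asked to be continuous in time.

  In time: for \<open>h \<ge> 0\<close> the occupation integral increases with \<open>t\<close>,
  except that the one partition interval containing \<open>t\<close> may spoil this by at most
  twice the oscillation times \<open>\<integral> \<bar>h\<bar>\<close>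
  (\<open>discrete_local_time_almost_mono\<close>). Functions that are monotone up to vanishing
  errors and converge pointwise to a continuous limit converge uniformly on compact intervals
  (\<open>uniform_limit_almost_mono\<close>). Hence the uniform versions of the conditions follow
  from the pointwise ones.

  In space: the densities \<open>L\<^sup>n\<^sub>t\<close> are nonnegative and live on one compact
  interval for all \<open>t \<le> T\<close>. If their pairings with all of
  \<open>L\<^sup>q\<close> converge, then they are uniformly absolutely continuous
  (\<open>Vitali_Hahn_Saks\<close>) and bounded in \<open>L\<^sup>p\<close>
  (\<open>Banach_Steinhaus_nonneg\<close>), so that the limit functional has a density in
  \<open>L\<^sup>p\<close> by Radon--Nikodym (\<open>weak_limit_exists\<close>). For \<open>p <
  \<infinity>\<close> every continuous functional acts on such functions as a weight in
  \<open>L\<^sup>q\<close> (\<open>Riesz_representation_Icc\<close>), and for the weak-star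
  topology this is so by definition; the locale \<open>weak_duality\<close> records what both
  topologies have in common, and makes one argument serve all exponents.

  Conversely, the occupation integral of the weight \<open>1\<close> is the discrete quadratic
  variation. If that converges to a continuous limit, then freezing \<open>\<phi> (x s)\<close> on
  short time intervals gives \<open>\<integral> L\<^sup>n\<^sub>t \<phi> \<longlonglongrightarrow>
  \<integral>\<^sub>0\<^sup>t \<phi> (x s) d\<langle>x\<rangle>\<^sub>s\<close> for continuous
  \<open>\<phi>\<close> (\<open>occupation_continuous_limit\<close>). Bounds in
  \<open>L\<^sup>p\<close> together with uniform absolute continuity extend the convergence from
  continuous weights to all of \<open>L\<^sup>q\<close>
  (\<open>convergent_if_convergent_continuous\<close>). Uniform absolute continuity comes for free
  from bounds in \<open>L\<^sup>p\<close> if \<open>p > 1\<close>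
  (\<open>uniformly_abs_continuous_if_bounded\<close>), and it is what equi-integrability provides
  if \<open>p = 1\<close> (\<open>equi_integrable_iff\<close>). The limit just found also
  identifies \<open>L\<^sub>t\<close> as the density of the occupation measure of \<open>x\<close>
  with respect to \<open>d\<langle>x\<rangle>\<close>, which is the occupation times formula,
  while the Tanaka formula is the limit of its discrete version.\<close>

section \<open>Absolutely continuous functions and their derivatives\<close>

text \<open>Splitting \<open>\<bar>f\<bar>\<close> at a level \<open>k\<close>: the part above
  \<open>k\<close> has small integral on the whole space by dominated convergence, and the part
  below contributes at most \<open>k\<close> times the measure of \<open>A\<close>.\<close>

lemma integrable_abs_continuity:
  fixes f :: "'a \<Rightarrow> real"
  assumes f: "integrable M f" and e: "0 < \<epsilon>"
  shows "\<exists>\<delta>>0. \<forall>A\<in>sets M. emeasure M A < ennreal \<delta> \<longrightarrow> (LINT u:A|M. \<bar>f u\<bar>) < \<epsilon>"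
proof -
  have [measurable]: "f \<in> borel_measurable M" using f by auto
  have "(\<lambda>k::nat. LINT u|M. indicator {u. \<bar>f u\<bar> > real k} u * \<bar>f u\<bar>) \<longlonglongrightarrow> (LINT u|M. 0)"
  proof (rule integral_dominated_convergence[where w="\<lambda>u. \<bar>f u\<bar>"])
    show "AE u in M. (\<lambda>k::nat. indicator {u. \<bar>f u\<bar> > real k} u * \<bar>f u\<bar>) \<longlonglongrightarrow> 0"
    proof (rule AE_I2)
      fix u
      obtain N :: nat where "\<bar>f u\<bar> \<le> real N" using real_arch_simple by blast
      then have "eventually (\<lambda>k. indicator {u. \<bar>f u\<bar> > real k} u * \<bar>f u\<bar> = 0) sequentially"
        by (intro eventually_sequentiallyI[of N]) (auto simp: indicator_def)
      then show "(\<lambda>k::nat. indicator {u. \<bar>f u\<bar> > real k} u * \<bar>f u\<bar>) \<longlonglongrightarrow> 0"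
        by (rule tendsto_eventually)
    qed
  qed (use f in \<open>auto simp: indicator_def\<close>)
  then have "(\<lambda>k::nat. LINT u|M. indicator {u. \<bar>f u\<bar> > real k} u * \<bar>f u\<bar>) \<longlonglongrightarrow> 0" by simp
  then have "eventually (\<lambda>k::nat. (LINT u|M. indicator {u. \<bar>f u\<bar> > real k} u * \<bar>f u\<bar>) < \<epsilon>/2) sequentially"
    using e by (intro order_tendstoD(2)) auto
  then obtain k :: nat where k: "(LINT u|M. indicator {u. \<bar>f u\<bar> > real k} u * \<bar>f u\<bar>) < \<epsilon>/2"
    by (auto simp: eventually_sequentially)
  have int1: "integrable M (\<lambda>u. indicator {u. \<bar>f u\<bar> > real k} u * \<bar>f u\<bar>)"
    by (rule Bochner_Integration.integrable_bound[OF f]) (auto simp: indicator_def)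
  define d where "d = \<epsilon> / (2 * (real k + 1))"
  have d: "d > 0" using e by (simp add: d_def)
  show ?thesis
  proof (intro exI[of _ d] conjI ballI impI d)
    fix A assume A [measurable]: "A \<in> sets M" and l: "emeasure M A < ennreal d"
    have fin: "emeasure M A \<noteq> \<infinity>" using l by auto
    have m: "measure M A < d" using l d by (metis emeasure_eq_ennreal_measure ennreal_less_iff fin infinity_ennreal_def measure_nonneg)
    have int2: "integrable M (\<lambda>u. real k * indicator A u)"
      using fin A by (simp add: top.not_eq_extremum)
    have "(LINT u:A|M. \<bar>f u\<bar>) \<le> (LINT u|M. real k * indicator A u + indicator {u. \<bar>f u\<bar> > real k} u * \<bar>f u\<bar>)"
      unfolding set_lebesgue_integral_def
    proof (rule integral_mono)
      show "integrable M (\<lambda>x. indicat_real A x *\<^sub>R \<bar>f x\<bar>)"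
        by (rule Bochner_Integration.integrable_bound[OF f]) (auto simp: indicator_def)
      show "integrable M (\<lambda>u. real k * indicat_real A u + indicat_real {u. real k < \<bar>f u\<bar>} u * \<bar>f u\<bar>)"
        using int1 int2 by (rule Bochner_Integration.integrable_add[rotated])
    qed (auto simp: indicator_def)
    also have "\<dots> = real k * measure M A + (LINT u|M. indicator {u. \<bar>f u\<bar> > real k} u * \<bar>f u\<bar>)"
      using int1 int2 fin A by (subst Bochner_Integration.integral_add) (auto simp: top.not_eq_extremum)
    also have "\<dots> \<le> real k * d + (LINT u|M. indicator {u. \<bar>f u\<bar> > real k} u * \<bar>f u\<bar>)"
      using m by (intro add_mono mult_left_mono) auto
    also have "\<dots> < \<epsilon>/2 + \<epsilon>/2"
    proof -
      have "real k * d \<le> \<epsilon>/2" using e unfolding d_def by (simp add: field_simps)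
      then show ?thesis using k by linarith
    qed
    finally show "(LINT u:A|M. \<bar>f u\<bar>) < \<epsilon>" by simp
  qed
qed

lemma locally_abs_continuousD:
  assumes "locally_abs_continuous g" "0 < \<epsilon>"
  shows "\<exists>\<delta>>0. \<forall>D. finite D \<and> (\<forall>(c, d)\<in>D. a \<le> c \<and> c \<le> d \<and> d \<le> b) \<and>
        disjoint_family_on (\<lambda>(c, d). {c<..<d}) D \<and> (\<Sum>(c, d)\<in>D. d - c) < \<delta> \<longrightarrow>
        (\<Sum>(c, d)\<in>D. \<bar>g d - g c\<bar>) < \<epsilon>"
  using assms(1)[unfolded locally_abs_continuous_def, THEN spec, THEN spec, THEN spec, THEN mp, OF assms(2)] .

text \<open>The fundamental theorem of calculus for absolutely continuous functions, read off directly from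
  the gauge integral. The gauge makes differentiability effective at tags outside the exceptional
  null set, and keeps intervals tagged inside it within a small open set, where absolute
  continuity bounds the sum of all increments of \<open>F\<close> at once.\<close>

lemma has_integral_ae_derivative:
  fixes F h :: "real \<Rightarrow> real"
  assumes ac: "locally_abs_continuous F" and ab: "a \<le> b"
    and der: "AE u in lborel. (F has_real_derivative h u) (at u)"
  shows "(h has_integral (F b - F a)) {a..b}"
proof (cases "a = b")
  case True then show ?thesis by auto
next
  case False
  with ab have ab': "a < b" by simp
  obtain N where N: "N \<in> null_sets lborel" and Nd: "\<And>u. u \<notin> N \<Longrightarrow> (F has_real_derivative h u) (at u)"
    using AE_E3[OF der] by auto
  have negN: "negligible N"
    using N by (simp add: negligible_iff_null_sets null_sets_completionI)
  \<comment> \<open>Changing the integrand on the null set \<open>N\<close> leaves Riemann sums with tags in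
    \<open>N\<close> without contribution.\<close>
  define g where "g u = (if u \<in> N then 0 else h u)" for u
  have "(g has_integral (F b - F a)) {a..b}"
    unfolding has_integral_factor_content box_real[symmetric]
  proof safe
    fix e :: real assume e: "e > 0"
    have "e * (b - a) / 2 > 0" using e ab' by simp
    then obtain \<delta> where \<delta>: "\<delta> > 0" and D: "\<forall>D. finite D \<and> (\<forall>(c, d)\<in>D. a \<le> c \<and> c \<le> d \<and> d \<le> b) \<and>
        disjoint_family_on (\<lambda>(c, d). {c<..<d}) D \<and> (\<Sum>(c, d)\<in>D. d - c) < \<delta> \<longrightarrow>
        (\<Sum>(c, d)\<in>D. \<bar>F d - F c\<bar>) < e * (b - a) / 2"
      using locally_abs_continuousD[OF ac] by blast
    have Nl: "N \<in> null_sets lebesgue" using N by (simp add: null_sets_completionI)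
    obtain T where T: "open T" "N \<subseteq> T" "emeasure lebesgue (T - N) < ennreal \<delta>"
      using sets_lebesgue_outer_open[of N \<delta>] Nl \<delta> by (metis null_setsD2)
    have TN: "emeasure lebesgue T < ennreal \<delta>"
      using T Nl emeasure_Diff_null_set[OF Nl, of T] by simp
    have "\<exists>d>0. (x \<notin> N \<longrightarrow> (\<forall>y. \<bar>y - x\<bar> < d \<longrightarrow> \<bar>F y - F x - h x * (y - x)\<bar> \<le> e/2 * \<bar>y - x\<bar>)) \<and> (x \<in> N \<longrightarrow> ball x d \<subseteq> T)" for x
    proof (cases "x \<in> N")
      case True
      then show ?thesis using T open_contains_ball by blast
    next
      case False
      then have "(F has_derivative (*) (h x)) (at x)" using Nd by (simp add: has_field_derivative_def)
      then have "\<forall>\<epsilon>>0. \<exists>d>0. \<forall>y. norm (y - x) < d \<longrightarrow> norm (F y - F x - h x * (y - x)) \<le> \<epsilon> * norm (y - x)"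
        unfolding has_derivative_at_alt by (rule conjunct2)
      then have "\<exists>d>0. \<forall>y. norm (y - x) < d \<longrightarrow> norm (F y - F x - h x * (y - x)) \<le> e/2 * norm (y - x)"
        using e by (elim allE[of _ "e/2"]) simp
      then show ?thesis using False by simp
    qed
    then have "\<exists>d. \<forall>x. d x > 0 \<and> (x \<notin> N \<longrightarrow> (\<forall>y. \<bar>y - x\<bar> < d x \<longrightarrow> \<bar>F y - F x - h x * (y - x)\<bar> \<le> e/2 * \<bar>y - x\<bar>)) \<and> (x \<in> N \<longrightarrow> ball x (d x) \<subseteq> T)"
      by (intro choice) blast
    then obtain d where d0: "\<And>x. d x > 0"
      and d1: "\<And>x y. x \<notin> N \<Longrightarrow> \<bar>y - x\<bar> < d x \<Longrightarrow> \<bar>F y - F x - h x * (y - x)\<bar> \<le> e/2 * \<bar>y - x\<bar>"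
      and d2: "\<And>x. x \<in> N \<Longrightarrow> ball x (d x) \<subseteq> T" by auto
    show "\<exists>d. gauge d \<and> (\<forall>p. p tagged_division_of cbox a b \<and> d fine p \<longrightarrow>
        norm ((\<Sum>(x, k)\<in>p. measure lborel k *\<^sub>R g x) - (F b - F a)) \<le> e * measure lborel (cbox a b))"
    proof (rule exI[of _ "\<lambda>x. ball x (d x)"], safe)
      show "gauge (\<lambda>x. ball x (d x))" using d0 gauge_ball_dependent by blast
    next
      fix p assume p: "p tagged_division_of cbox a b" and fine: "(\<lambda>x. ball x (d x)) fine p"
      have finp: "finite p" using p by blast
      have ba: "b - a = (\<Sum>(x,K)\<in>p. Sup K - Inf K)" "F b - F a = (\<Sum>(x,K)\<in>p. F(Sup K) - F(Inf K))"
        using additive_tagged_division_1[where f= "\<lambda>x. x"] additive_tagged_division_1[where f= F]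
            \<open>a \<le> b\<close> p by auto
      have K: "\<exists>u v. K = {u..v} \<and> u \<le> v \<and> Inf K = u \<and> Sup K = v \<and> x \<in> {u..v} \<and> a \<le> u \<and> v \<le> b \<and> {u..v} \<subseteq> ball x (d x)"
        if xK: "(x,K) \<in> p" for x K
      proof -
        have 1: "x \<in> K" "K \<subseteq> cbox a b" using tagged_division_ofD(2,3)[OF p xK] by auto
        obtain u v where uv: "K = cbox u v" using tagged_division_ofD(4)[OF p xK] by auto
        have 2: "K \<subseteq> ball x (d x)" using fine xK unfolding fine_def by blast
        have "u \<le> v" using 1 uv by auto
        moreover have "a \<le> u" "v \<le> b" using 1(2) uv \<open>u \<le> v\<close> by auto
        ultimately show ?thesis using 1 2 uv by (intro exI[of _ u] exI[of _ v]) simp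
      qed
      \<comment> \<open>Degenerate intervals are left out so that \<open>\<iota>\<close>, which forgets the tags, is
        injective on \<open>P\<close>.\<close>
      define P where "P = {(x,K)\<in>p. x \<in> N \<and> Inf K < Sup K}"
      define \<iota> where "\<iota> = (\<lambda>(x::real, K). (Inf K :: real, Sup K :: real))"
      have finP: "finite P" unfolding P_def by (rule finite_subset[OF _ finp]) auto
      have disj: "{Inf K<..<Sup K} \<inter> {Inf K'<..<Sup K'} = {}"
        if xK: "(x,K) \<in> p" "(x',K') \<in> p" "(x,K) \<noteq> (x',K')" for x x' K K'
      proof -
        have "interior K \<inter> interior K' = {}"
          using p xK by (metis tagged_division_ofD(5))
        moreover obtain u v u' v' where "K = {u..v}" "Inf K = u" "Sup K = v" "K' = {u'..v'}" "Inf K' = u'" "Sup K' = v'"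
          using K[OF xK(1)] K[OF xK(2)] by blast
        ultimately show ?thesis by (metis interior_atLeastAtMost_real)
      qed
      have inj: "inj_on \<iota> P"
      proof (rule inj_onI, rule ccontr)
        fix z z' assume z: "z \<in> P" "z' \<in> P" "\<iota> z = \<iota> z'" "z \<noteq> z'"
        obtain x K x' K' where zz: "z = (x,K)" "z' = (x',K')" by (metis surj_pair)
        have "{Inf K<..<Sup K} \<inter> {Inf K'<..<Sup K'} = {}"
          by (rule disj) (use z zz in \<open>auto simp: P_def\<close>)
        moreover have "Inf K = Inf K'" "Sup K = Sup K'" "Inf K < Sup K" using z zz by (auto simp: \<iota>_def P_def)
        ultimately show False by simp
      qed
      have dis: "disjoint_family_on (\<lambda>(c, d). {c<..<d}) (\<iota> ` P)"
      unfolding disjoint_family_on_def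
      proof (intro ballI impI)
        fix w w' assume w: "w \<in> \<iota> ` P" "w' \<in> \<iota> ` P" "w \<noteq> w'"
        then obtain x K x' K' where *: "(x,K) \<in> P" "(x',K') \<in> P" "w = (Inf K, Sup K)" "w' = (Inf K', Sup K')"
          by (auto simp: \<iota>_def)
        have "{Inf K<..<Sup K} \<inter> {Inf K'<..<Sup K'} = {}"
          by (rule disj) (use * w in \<open>auto simp: P_def\<close>)
        then show "(case w of (c, d) \<Rightarrow> {c<..<d}) \<inter> (case w' of (c, d) \<Rightarrow> {c<..<d}) = {}" using * by simp
      qed
      have sumlt: "(\<Sum>(c, d)\<in>\<iota> ` P. d - c) < \<delta>"
      proof -
        have le: "c \<le> d" if "(c,d) \<in> \<iota> ` P" for c d using that by (auto simp: \<iota>_def P_def)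
        have "ennreal (\<Sum>(c, d)\<in>\<iota> ` P. d - c) = (\<Sum>z\<in>\<iota> ` P. emeasure lebesgue (case z of (c,d) \<Rightarrow> {c<..<d}))"
          using le by (subst sum_ennreal[symmetric]) (auto intro!: sum.cong)
        also have "\<dots> = emeasure lebesgue (\<Union>z\<in>\<iota> ` P. (case z of (c,d) \<Rightarrow> {c<..<d}))"
          by (rule sum_emeasure) (use finP dis in auto)
        also have "\<dots> \<le> emeasure lebesgue T"
        proof (rule emeasure_mono)
          show "(\<Union>z\<in>\<iota> ` P. (case z of (c,d) \<Rightarrow> {c<..<d})) \<subseteq> T"
          proof
            fix u assume "u \<in> (\<Union>z\<in>\<iota> ` P. (case z of (c,d) \<Rightarrow> {c<..<d}))"
            then obtain x K where "(x,K) \<in> p" "x \<in> N" "Inf K < u" "u < Sup K" by (auto simp: \<iota>_def P_def)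
            then show "u \<in> T" using K[of x K] d2[of x] by fastforce
          qed
        qed (use T in auto)
        finally have "ennreal (\<Sum>(c, d)\<in>\<iota> ` P. d - c) < ennreal \<delta>" using TN by (rule order.strict_trans1)
        moreover have "0 \<le> (\<Sum>(c, d)\<in>\<iota> ` P. d - c)"
          by (intro sum_nonneg) (use le in \<open>metis (mono_tags, lifting) case_prod_conv diff_ge_0_iff_ge surj_pair\<close>)
        ultimately show ?thesis by (simp add: ennreal_less_iff)
      qed
      have N_part: "(\<Sum>(x,K)\<in>P. \<bar>F (Sup K) - F (Inf K)\<bar>) < e * (b-a) / 2"
      proof -
        have "(\<Sum>(c, d)\<in>\<iota> ` P. \<bar>F d - F c\<bar>) < e * (b - a) / 2"
        proof (rule D[rule_format], intro conjI dis sumlt)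
          show "finite (\<iota> ` P)" using finP by simp
          show "\<forall>(c, d)\<in>\<iota> ` P. a \<le> c \<and> c \<le> d \<and> d \<le> b" using K by (fastforce simp: \<iota>_def P_def)
        qed
        then show ?thesis
          by (subst (asm) sum.reindex[OF inj]) (simp add: \<iota>_def case_prod_unfold)
      qed
      have "norm ((\<Sum>(x, K)\<in>p. measure lborel K *\<^sub>R g x) - (F b - F a)) \<le>
          (\<Sum>(x, K)\<in>p. \<bar>measure lborel K * g x - (F (Sup K) - F (Inf K))\<bar>)"
        unfolding ba(2) sum_subtractf[symmetric] by (rule order_trans[OF norm_sum]) (simp add: case_prod_unfold)
      also have "\<dots> \<le> (\<Sum>(x, K)\<in>p. e/2 * (Sup K - Inf K) + (if (x,K) \<in> P then \<bar>F (Sup K) - F (Inf K)\<bar> else 0))"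
      proof (rule sum_mono, clarify)
        fix x K assume xK: "(x,K) \<in> p"
        obtain u v where uv: "K = {u..v}" "u \<le> v" "Inf K = u" "Sup K = v" "x \<in> {u..v}" "{u..v} \<subseteq> ball x (d x)"
          using K[OF xK] by blast
        show "\<bar>measure lborel K * g x - (F (Sup K) - F (Inf K))\<bar> \<le> e/2 * (Sup K - Inf K) + (if (x,K) \<in> P then \<bar>F (Sup K) - F (Inf K)\<bar> else 0)"
        proof (cases "x \<in> N")
          case True
          have "0 \<le> e * (v - u)" using uv e by simp
          then show ?thesis using uv xK True abs_minus_commute[of "F u" "F v"]
            by (cases "u < v") (auto simp: g_def P_def)
        next
          case False
          have "\<bar>F u - F x - h x * (u - x)\<bar> \<le> e/2 * \<bar>u - x\<bar>" "\<bar>F v - F x - h x * (v - x)\<bar> \<le> e/2 * \<bar>v - x\<bar>"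
          proof -
            have "u \<in> ball x (d x)" "v \<in> ball x (d x)" using uv(6)[THEN subsetD] uv(2) by simp_all
            then have "\<bar>u - x\<bar> < d x" "\<bar>v - x\<bar> < d x" by (auto simp: dist_real_def)
            then show "\<bar>F u - F x - h x * (u - x)\<bar> \<le> e/2 * \<bar>u - x\<bar>" "\<bar>F v - F x - h x * (v - x)\<bar> \<le> e/2 * \<bar>v - x\<bar>"
              using d1[OF False] by blast+
          qed
          moreover have "measure lborel K = v - u" using uv by simp
          moreover have "(v - u) * h x - (F v - F u) = (F u - F x - h x * (u - x)) - (F v - F x - h x * (v - x))"
            by (simp add: algebra_simps)
          moreover have "e/2 * \<bar>u - x\<bar> + e/2 * \<bar>v - x\<bar> = e/2 * (v - u)"
            using uv by (simp flip: distrib_left)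
          ultimately have "\<bar>measure lborel K * g x - (F (Sup K) - F (Inf K))\<bar> \<le> e/2 * (v - u)" 
            using False uv unfolding g_def by (simp add: abs_if split: if_splits)
          then show ?thesis using uv False by (auto simp: P_def)
        qed
      qed
      also have "\<dots> = (\<Sum>(x, K)\<in>p. e/2 * (Sup K - Inf K)) + (\<Sum>(x,K)\<in>P. \<bar>F (Sup K) - F (Inf K)\<bar>)"
      proof -
        have "(\<Sum>(x, K)\<in>p. (if (x,K) \<in> P then \<bar>F (Sup K) - F (Inf K)\<bar> else 0)) = (\<Sum>z\<in>p. (if z \<in> P then (case z of (x,K) \<Rightarrow> \<bar>F (Sup K) - F (Inf K)\<bar>) else 0))"
          by (rule sum.cong) auto
        also have "\<dots> = (\<Sum>(x,K)\<in>P. \<bar>F (Sup K) - F (Inf K)\<bar>)"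
          by (subst sum.inter_restrict[OF finp, symmetric]) (auto intro!: sum.cong simp: P_def)
        finally show ?thesis by (simp add: sum.distrib case_prod_unfold)
      qed
      also have "(\<Sum>(x, K)\<in>p. e/2 * (Sup K - Inf K)) = e/2 * (b - a)"
        unfolding ba(1) sum_distrib_left by (simp add: case_prod_unfold)
      also have "e/2 * (b-a) + (\<Sum>(x,K)\<in>P. \<bar>F (Sup K) - F (Inf K)\<bar>) \<le> e * measure lborel (cbox a b)"
        using N_part ab by simp
      finally show "norm ((\<Sum>(x, k)\<in>p. measure lborel k *\<^sub>R g x) - (F b - F a)) \<le> e * measure lborel (cbox a b)" .
    qed
  qed
  then show ?thesis
    by (rule has_integral_spike[OF negN, rotated]) (auto simp: g_def)
qed


text \<open>The growth condition says that \<open>F\<close> is locally no rougher than \<open>g\<close> and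
  the identity together; it is the form in which products with a Lipschitz factor arise.\<close>

lemma locally_abs_continuous_if_dominated:
  assumes g: "locally_abs_continuous g"
    and bd: "\<And>a b. \<exists>K\<ge>0. \<forall>c d. a \<le> c \<and> c \<le> d \<and> d \<le> b \<longrightarrow> \<bar>F d - F c\<bar> \<le> K * (\<bar>g d - g c\<bar> + (d - c))"
  shows "locally_abs_continuous F"
  unfolding locally_abs_continuous_def
proof (intro allI impI)
  fix a b \<epsilon> :: real assume e: "\<epsilon> > 0"
  obtain K where K: "K \<ge> 0" "\<And>c d. a \<le> c \<Longrightarrow> c \<le> d \<Longrightarrow> d \<le> b \<Longrightarrow> \<bar>F d - F c\<bar> \<le> K * (\<bar>g d - g c\<bar> + (d - c))"
    using bd[of a b] by blast
  define \<eta> where "\<eta> = \<epsilon> / (2 * (K + 1))"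
  have \<eta>: "\<eta> > 0" using e K(1) by (simp add: \<eta>_def)
  obtain \<delta> where \<delta>: "\<delta> > 0" and D: "\<forall>D. finite D \<and> (\<forall>(c, d)\<in>D. a \<le> c \<and> c \<le> d \<and> d \<le> b) \<and>
        disjoint_family_on (\<lambda>(c, d). {c<..<d}) D \<and> (\<Sum>(c, d)\<in>D. d - c) < \<delta> \<longrightarrow>
        (\<Sum>(c, d)\<in>D. \<bar>g d - g c\<bar>) < \<eta>"
    using locally_abs_continuousD[OF g \<eta>] by blast
  show "\<exists>\<delta>>0. \<forall>D. finite D \<and> (\<forall>(c, d)\<in>D. a \<le> c \<and> c \<le> d \<and> d \<le> b) \<and>
        disjoint_family_on (\<lambda>(c, d). {c<..<d}) D \<and> (\<Sum>(c, d)\<in>D. d - c) < \<delta> \<longrightarrow>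
        (\<Sum>(c, d)\<in>D. \<bar>F d - F c\<bar>) < \<epsilon>"
  proof (intro exI[of _ "min \<delta> \<eta>"] conjI allI impI)
    show "min \<delta> \<eta> > 0" using \<delta> \<eta> by simp
    fix D assume *: "finite D \<and> (\<forall>(c, d)\<in>D. a \<le> c \<and> c \<le> d \<and> d \<le> b) \<and>
        disjoint_family_on (\<lambda>(c, d). {c<..<d}) D \<and> (\<Sum>(c, d)\<in>D. d - c) < min \<delta> \<eta>"
    have 1: "(\<Sum>(c, d)\<in>D. \<bar>g d - g c\<bar>) < \<eta>"
      by (rule D[rule_format]) (use * in auto)
    have 2: "(\<Sum>(c, d)\<in>D. d - c) < \<eta>" using * by simp
    have "(\<Sum>(c, d)\<in>D. \<bar>F d - F c\<bar>) \<le> (\<Sum>(c, d)\<in>D. K * (\<bar>g d - g c\<bar> + (d - c)))"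
      by (rule sum_mono) (use * K in auto)
    also have "\<dots> = K * ((\<Sum>(c, d)\<in>D. \<bar>g d - g c\<bar>) + (\<Sum>(c, d)\<in>D. d - c))"
      by (simp add: sum_distrib_left case_prod_unfold flip: sum.distrib)
    also have "\<dots> \<le> K * (2 * \<eta>)"
      using 1 2 K(1) by (intro mult_left_mono) auto
    also have "\<dots> < \<epsilon>"
      unfolding \<eta>_def using e K(1) by (simp add: field_simps)
    finally show "(\<Sum>(c, d)\<in>D. \<bar>F d - F c\<bar>) < \<epsilon>" .
  qed
qed

text \<open>At least one of the two intervals is empty or a point, so that this is the oriented integral
  from \<open>0\<close> to \<open>u\<close>.\<close>

definition antiderivative :: "(real \<Rightarrow> real) \<Rightarrow> real \<Rightarrow> real" where
  "antiderivative h u = integral {0..u} h - integral {u..0} h"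

definition locally_integrable :: "(real \<Rightarrow> real) \<Rightarrow> bool" where
  "locally_integrable h \<longleftrightarrow> h \<in> borel_measurable borel \<and> (\<forall>a b. set_integrable lborel {a..b} h)"

lemma locally_integrable_integrable_on:
  assumes "locally_integrable h" shows "h integrable_on {a..b}"
    "(LINT u:{a..b}|lborel. h u) = integral {a..b} h"
  using assms set_borel_integral_eq_integral[of "{a..b}" h] unfolding locally_integrable_def by auto

lemma antiderivative_diff:
  assumes h: "locally_integrable h" and cd: "c \<le> d"
  shows "antiderivative h d - antiderivative h c = (LINT u:{c..d}|lborel. h u)"
proof -
  note i = locally_integrable_integrable_on[OF h]
  consider "0 \<le> c" | "c \<le> 0" "0 \<le> d" | "d \<le> 0" using cd by linarith
  then show ?thesis
  proof cases
    case 1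
    then have "integral {0..c} h + integral {c..d} h = integral {0..d} h"
      using cd i by (intro Henstock_Kurzweil_Integration.integral_combine) auto
    moreover have "integral {c..0} h = 0" "integral {d..0} h = 0"
      using 1 cd by (cases "c = 0"; cases "d = 0"; simp)+
    ultimately show ?thesis using i(2) unfolding antiderivative_def by simp
  next
    case 2
    then have "integral {c..0} h + integral {0..d} h = integral {c..d} h"
      using cd i by (intro Henstock_Kurzweil_Integration.integral_combine) auto
    moreover have "integral {0..c} h = 0" "integral {d..0} h = 0"
      using 2 cd by (cases "c = 0"; cases "d = 0"; simp)+
    ultimately show ?thesis using i(2) unfolding antiderivative_def by simp
  next
    case 3
    then have "integral {c..d} h + integral {d..0} h = integral {c..0} h"
      using cd i by (intro Henstock_Kurzweil_Integration.integral_combine) auto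
    moreover have "integral {0..c} h = 0" "integral {0..d} h = 0"
      using 3 cd by (cases "c = 0"; cases "d = 0"; simp)+
    ultimately show ?thesis using i(2) unfolding antiderivative_def by simp
  qed
qed

lemma locally_abs_continuous_antiderivative:
  assumes h: "locally_integrable h"
  shows "locally_abs_continuous (antiderivative h)"
  unfolding locally_abs_continuous_def
proof (intro allI impI)
  fix a b \<epsilon> :: real assume e: "\<epsilon> > 0"
  have [measurable]: "h \<in> borel_measurable borel" and si: "\<And>a b. set_integrable lborel {a..b} h"
    using h by (auto simp: locally_integrable_def)
  have int: "integrable lborel (\<lambda>u. indicator {a..b} u * h u)"
    using si[of a b] by (simp add: set_integrable_def)
  obtain \<delta> where \<delta>: "\<delta> > 0" and A: "\<forall>A\<in>sets lborel. emeasure lborel A < ennreal \<delta> \<longrightarrow>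
       (LINT u:A|lborel. \<bar>indicator {a..b} u * h u\<bar>) < \<epsilon>"
    using integrable_abs_continuity[OF int e] by blast
  show "\<exists>\<delta>>0. \<forall>D. finite D \<and> (\<forall>(c, d)\<in>D. a \<le> c \<and> c \<le> d \<and> d \<le> b) \<and>
        disjoint_family_on (\<lambda>(c, d). {c<..<d}) D \<and> (\<Sum>(c, d)\<in>D. d - c) < \<delta> \<longrightarrow>
        (\<Sum>(c, d)\<in>D. \<bar>antiderivative h d - antiderivative h c\<bar>) < \<epsilon>"
  proof (intro exI[of _ \<delta>] conjI allI impI \<delta>)
    fix D assume *: "finite D \<and> (\<forall>(c, d)\<in>D. a \<le> c \<and> c \<le> d \<and> d \<le> b) \<and>
        disjoint_family_on (\<lambda>(c, d). {c<..<d}) D \<and> (\<Sum>(c, d)\<in>D. d - c) < \<delta>"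
    then have fin: "finite D" and dis: "disjoint_family_on (\<lambda>(c, d). {c<..<d}) D"
      and cd: "\<And>c d. (c,d) \<in> D \<Longrightarrow> a \<le> c \<and> c \<le> d \<and> d \<le> b" by auto
    define I where "I = (\<lambda>(c::real, d). {c<..<d})"
    define U where "U = (\<Union>z\<in>D. I z)"
    have [measurable]: "U \<in> sets borel" unfolding U_def I_def using fin by (auto intro!: sets.finite_UN)
    have "emeasure lborel U = (\<Sum>z\<in>D. emeasure lborel (I z))"
      unfolding U_def by (rule sum_emeasure[symmetric]) (use fin dis in \<open>auto simp: I_def\<close>)
    also have "\<dots> = (\<Sum>(c,d)\<in>D. ennreal (d - c))" using cd by (auto simp: I_def intro!: sum.cong)
    also have "\<dots> = ennreal (\<Sum>(c,d)\<in>D. d - c)"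
      using cd by (subst sum_ennreal[symmetric]) (auto simp: case_prod_unfold intro!: sum.cong)
    also have "\<dots> < ennreal \<delta>" using * \<delta> by (subst ennreal_less_iff) (auto intro!: sum_nonneg)
    finally have Ulim: "(LINT u:U|lborel. \<bar>indicator {a..b} u * h u\<bar>) < \<epsilon>" using A by auto
    have isum: "integrable lborel (\<lambda>u. indicator (I z) u * \<bar>indicator {a..b} u * h u\<bar>)" for z
      by (rule Bochner_Integration.integrable_bound[OF int]) (auto simp: indicator_def I_def case_prod_unfold)
    have "(\<Sum>(c, d)\<in>D. \<bar>antiderivative h d - antiderivative h c\<bar>) \<le>
        (\<Sum>z\<in>D. LINT u|lborel. indicator (I z) u * \<bar>indicator {a..b} u * h u\<bar>)"
    proof (rule sum_mono, clarify)
      fix c d assume "(c,d) \<in> D"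
      note cd' = cd[OF this]
      have "\<bar>antiderivative h d - antiderivative h c\<bar> = \<bar>LINT u|lborel. indicator {c..d} u * h u\<bar>"
        using antiderivative_diff[OF h] cd' by (simp add: set_lebesgue_integral_def)
      also have "\<dots> \<le> (LINT u|lborel. \<bar>indicator {c..d} u * h u\<bar>)"
        by (rule integral_abs_bound)
      also have "\<dots> = (LINT u|lborel. indicator (I (c,d)) u * \<bar>indicator {a..b} u * h u\<bar>)"
      proof (rule integral_cong_AE)
        show "AE u in lborel. \<bar>indicator {c..d} u * h u\<bar> = indicator (I (c,d)) u * \<bar>indicator {a..b} u * h u\<bar>"
          using AE_lborel_singleton[of c] AE_lborel_singleton[of d]
          by eventually_elim (use cd' in \<open>auto simp: I_def indicator_def\<close>)
      qed (auto simp: I_def)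
      finally show "\<bar>antiderivative h d - antiderivative h c\<bar> \<le> (LINT u|lborel. indicator (I (c,d)) u * \<bar>indicator {a..b} u * h u\<bar>)" .
    qed
    also have "\<dots> = (LINT u|lborel. (\<Sum>z\<in>D. indicator (I z) u * \<bar>indicator {a..b} u * h u\<bar>))"
      by (rule Bochner_Integration.integral_sum[symmetric]) (rule isum)
    also have "\<dots> = (LINT u:U|lborel. \<bar>indicator {a..b} u * h u\<bar>)"
    proof -
      have "(\<Sum>z\<in>D. indicator (I z) u :: real) = indicator U u" for u
        unfolding U_def by (rule indicator_UN_disjoint[symmetric]) (use fin dis in \<open>auto simp: I_def\<close>)
      then show ?thesis unfolding set_lebesgue_integral_def by (simp add: sum_distrib_right[symmetric])
    qed
    finally show "(\<Sum>(c, d)\<in>D. \<bar>antiderivative h d - antiderivative h c\<bar>) < \<epsilon>" using Ulim by simp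
  qed
qed

text \<open>The Lebesgue differentiation theorem for intervals with left endpoint \<open>x\<close>. It
  yields the right derivative of the antiderivative; the left derivative is obtained from it by
  reflection.\<close>

lemma antiderivative_right_derivative:
  assumes h: "locally_integrable h"
  obtains N where "negligible N"
    "\<And>x \<epsilon>. x \<notin> N \<Longrightarrow> 0 < \<epsilon> \<Longrightarrow> \<exists>d>0. \<forall>k. 0 < k \<and> k < d \<longrightarrow> \<bar>(LINT u:{x..x+k}|lborel. h u) / k - h x\<bar> < \<epsilon>"
proof -
  obtain N where N: "negligible N" and d: "\<And>x e. \<lbrakk>x \<notin> N; 0 < e\<rbrakk> \<Longrightarrow>
               \<exists>d>0. \<forall>k. 0 < k \<and> k < d \<longrightarrow> norm(integral (cbox x (x + k *\<^sub>R One)) h /\<^sub>R k ^ DIM(real) - h x) < e"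
    using integrable_ccontinuous_explicit[of h] locally_integrable_integrable_on[OF h] by (metis cbox_interval)
  show ?thesis
    by (rule that[OF N]) (use d locally_integrable_integrable_on(2)[OF h] in \<open>simp add: divide_inverse mult.commute\<close>)
qed

lemma locally_integrable_reflect:
  assumes h: "locally_integrable h"
  shows "locally_integrable (\<lambda>u. h (- u))"
  unfolding locally_integrable_def
proof (intro conjI allI)
  have [measurable]: "h \<in> borel_measurable borel" using h by (simp add: locally_integrable_def)
  show "(\<lambda>u. h (- u)) \<in> borel_measurable borel" by measurable
  fix a b
  have "integrable lborel (\<lambda>u. indicator {-b..-a} u * h u)"
    using h by (auto simp: locally_integrable_def set_integrable_def)
  then have "integrable lborel (\<lambda>u. indicator {-b..-a} (0 + (-1) * u) * h (0 + (-1) * u))"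
    by (rule lborel_integrable_real_affine) simp
  moreover have "(\<lambda>u. indicator {-b..-a} (0 + (-1) * u) * h (0 + (-1) * u)) = (\<lambda>u. indicator {a..b} u *\<^sub>R h (- u))"
    by (auto simp: indicator_def fun_eq_iff)
  ultimately show "set_integrable lborel {a..b} (\<lambda>u. h (- u))"
    by (simp only: set_integrable_def)
qed

text \<open>Hence \<open>W\<^sup>1\<^sup>,\<^sup>q\<close> contains an antiderivative of every weight in
  \<open>L\<^sup>q\<close>. The set \<open>N'\<close> below is exceptional for the reflected
  function, whose right derivatives are the left derivatives sought.\<close>

lemma ae_derivative_antiderivative:
  assumes h: "locally_integrable h"
  shows "ae_derivative (antiderivative h) h"
  unfolding ae_derivative_def
proof
  show "h \<in> borel_measurable lborel" using h by (simp add: locally_integrable_def)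
  let ?G = "antiderivative h"
  obtain N where N: "negligible N"
    and R: "\<And>x \<epsilon>. x \<notin> N \<Longrightarrow> 0 < \<epsilon> \<Longrightarrow> \<exists>d>0. \<forall>k. 0 < k \<and> k < d \<longrightarrow> \<bar>(LINT u:{x..x+k}|lborel. h u) / k - h x\<bar> < \<epsilon>"
    using antiderivative_right_derivative[OF h] by blast
  obtain N' where N': "negligible N'"
    and L: "\<And>x \<epsilon>. x \<notin> N' \<Longrightarrow> 0 < \<epsilon> \<Longrightarrow> \<exists>d>0. \<forall>k. 0 < k \<and> k < d \<longrightarrow> \<bar>(LINT u:{x..x+k}|lborel. h (-u)) / k - h (-x)\<bar> < \<epsilon>"
    using antiderivative_right_derivative[OF locally_integrable_reflect[OF h]] by blast
  have refl: "(LINT u:{- x..- x + k}|lborel. h (- u)) = (LINT u:{x - k..x}|lborel. h u)" for x k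
  proof -
    have "(LINT u|lborel. indicator {x-k..x} u * h u) = (LINT u|lborel. indicator {x-k..x} (0 + (-1) * u) * h (0 + (-1) * u))"
      by (subst lborel_integral_real_affine[where c="-1" and t=0]) auto
    also have "\<dots> = (LINT u|lborel. indicator {-x..-x+k} u * h (- u))"
      by (intro Bochner_Integration.integral_cong) (auto simp: indicator_def)
    finally show ?thesis by (simp add: set_lebesgue_integral_def)
  qed
  have neg: "negligible (uminus ` N')" using N'
    by (intro negligible_differentiable_image_negligible) (auto intro!: derivative_intros differentiable_on_minus simp: differentiable_on_id[unfolded id_def])
  have der: "(?G has_real_derivative h x) (at x)" if x: "x \<notin> N" "x \<notin> uminus ` N'" for x
    unfolding has_field_derivative_iff
  proof (rule LIM_I)
    fix r :: real assume r: "0 < r"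
    obtain d where d: "d > 0" and R1: "\<And>k. 0 < k \<Longrightarrow> k < d \<Longrightarrow> \<bar>(LINT u:{x..x+k}|lborel. h u) / k - h x\<bar> < r"
      using R[OF x(1) r] by blast
    have "- x \<notin> N'" using x(2) by (metis image_eqI minus_minus)
    from L[OF this r] obtain d' where d': "d' > 0" and L1: "\<And>k. 0 < k \<Longrightarrow> k < d' \<Longrightarrow> \<bar>(LINT u:{x - k..x}|lborel. h u) / k - h x\<bar> < r"
      unfolding refl by auto
    show "\<exists>s>0. \<forall>y. y \<noteq> x \<and> norm (y - x) < s \<longrightarrow> norm ((?G y - ?G x) / (y - x) - h x) < r"
    proof (intro exI[of _ "min d d'"] conjI allI impI)
      show "0 < min d d'" using d d' by simp
      fix y assume y: "y \<noteq> x \<and> norm (y - x) < min d d'"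
      show "norm ((?G y - ?G x) / (y - x) - h x) < r"
      proof (cases "x < y")
        case True
        then have "?G y - ?G x = (LINT u:{x..x + (y - x)}|lborel. h u)" using antiderivative_diff[OF h, of x y] by simp
        then show ?thesis using R1[of "y - x"] y True by simp
      next
        case False
        then have "?G x - ?G y = (LINT u:{x - (x - y)..x}|lborel. h u)" using antiderivative_diff[OF h, of y x] by simp
        moreover have "(?G y - ?G x) / (y - x) = (?G x - ?G y) / (x - y)"
          by (metis minus_diff_eq minus_divide_divide)
        ultimately show ?thesis using L1[of "x - y"] y False by simp
      qed
    qed
  qed
  have "negligible (N \<union> uminus ` N')" using N neg by (rule negligible_Un)
  then have "AE x in lebesgue. x \<notin> N \<union> uminus ` N'"
    unfolding negligible_iff_null_sets by (rule AE_not_in)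
  then have "AE x in lebesgue. (?G has_real_derivative h x) (at x)"
    by (rule eventually_mono) (use der in auto)
  then show "AE x in lborel. (?G has_real_derivative h x) (at x)"
    by (simp add: AE_completion_iff)
qed

section \<open>Lebesgue spaces with conjugate exponents\<close>

text \<open>The three cases of exponents are kept apart because the finite one is a statement about real
  numbers; the relation is symmetric, so that duality arguments can be used in both directions.\<close>

definition conjugate :: "ennreal \<Rightarrow> ennreal \<Rightarrow> bool" where
  "conjugate p q \<longleftrightarrow> (\<exists>r s. 1 < r \<and> 1 < s \<and> 1 / r + 1 / s = (1::real) \<and> p = ennreal r \<and> q = ennreal s)
     \<or> (p = top \<and> q = 1) \<or> (p = 1 \<and> q = top)"

lemma conjugate_sym: "conjugate p q \<Longrightarrow> conjugate q p"
  unfolding conjugate_def by (metis add.commute)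

lemma conjugate_cases [consumes 1, case_names finite infinite one]:
  assumes "conjugate p q"
  obtains r s :: real where "1 < r" "1 < s" "1 / r + 1 / s = 1" "p = ennreal r" "q = ennreal s"
  | "p = top" "q = 1" | "p = 1" "q = top"
  using assms unfolding conjugate_def by blast

lemma conjugate_ge_1: assumes "conjugate p q" shows "1 \<le> p" "1 \<le> q"
proof -
  have "1 \<le> p" if "conjugate p q" for p q
    using that by (cases rule: conjugate_cases) (auto simp: ennreal_1[symmetric] ennreal_leI simp del: ennreal_1)
  then show "1 \<le> p" "1 \<le> q" using assms conjugate_sym by blast+
qed

lemma conjugate_divide:
  assumes "1 < p" "p < \<infinity>"
  shows "conjugate p (p / (p - 1))"
proof -
  obtain r where r: "p = ennreal r" "0 \<le> r" using assms by (cases p) auto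
  then have r1: "1 < r" using assms by (metis ennreal_1 ennreal_less_iff zero_le_one)
  have "p - 1 = ennreal (r - 1)" using r r1 by (metis ennreal_1 ennreal_minus zero_le_one)
  then have "p / (p - 1) = ennreal (r / (r - 1))" using r r1 by (simp add: divide_ennreal)
  moreover have "1 < r / (r - 1)" "1 / r + 1 / (r / (r - 1)) = 1" using r1 by (auto simp: field_simps)
  ultimately show ?thesis unfolding conjugate_def using r r1 by blast
qed

lemma exponent_cases [consumes 1, case_names finite infinite]:
  assumes "(1::ennreal) \<le> p"
  obtains r :: real where "1 \<le> r" "p = ennreal r" | "p = top"
proof (cases p)
  case (real r)
  then have "1 \<le> r" using assms by (metis ennreal_1 ennreal_le_iff)
  then show ?thesis using real that by blast
qed (use that in auto)

lemma Lp_finite_iff: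
  assumes "0 \<le> r"
  shows "f \<in> Lp (ennreal r) \<longleftrightarrow> f \<in> borel_measurable borel \<and> integrable lborel (\<lambda>u. \<bar>f u\<bar> powr r)"
  using assms by (simp add: Lp_def)

lemma Lp_1_iff: "f \<in> Lp 1 \<longleftrightarrow> integrable lborel f"
  by (auto simp: Lp_finite_iff[of 1, simplified] integrable_abs_iff)

lemma Lp_norm_finite:
  assumes "0 \<le> r"
  shows "Lp_norm (ennreal r) f = (LINT u|lborel. \<bar>f u\<bar> powr r) powr (1 / r)"
  using assms by (simp add: Lp_norm_def)

lemma Lp_norm_1: "Lp_norm 1 f = (LINT u|lborel. \<bar>f u\<bar>)"
  by (simp add: Lp_norm_finite[of 1, simplified])

lemma Lp_norm_powr:
  assumes "1 \<le> r"
  shows "Lp_norm (ennreal r) f powr r = (LINT u|lborel. \<bar>f u\<bar> powr r)"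
proof -
  have "0 \<le> (LINT u|lborel. \<bar>f u\<bar> powr r)" by simp
  then show ?thesis using assms by (simp add: Lp_norm_finite powr_powr)
qed

lemma Lp_infty_iff: "f \<in> Lp top \<longleftrightarrow> f \<in> borel_measurable borel \<and> (\<exists>C. AE u in lborel. \<bar>f u\<bar> \<le> C)"
proof (cases "f \<in> borel_measurable borel")
  case True
  then have [measurable]: "f \<in> borel_measurable borel" .
  have "(esssup lborel (\<lambda>u. ereal \<bar>f u\<bar>) < \<infinity>) \<longleftrightarrow> (\<exists>C. AE u in lborel. \<bar>f u\<bar> \<le> C)"
  proof
    assume a: "esssup lborel (\<lambda>u. ereal \<bar>f u\<bar>) < \<infinity>"
    have "AE u in lborel. ereal \<bar>f u\<bar> \<le> ereal (real_of_ereal (esssup lborel (\<lambda>u. ereal \<bar>f u\<bar>)))"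
      using esssup_AE[of "\<lambda>u. ereal \<bar>f u\<bar>" lborel]
    proof eventually_elim
      case (elim u)
      then show ?case using a by (cases "esssup lborel (\<lambda>u. ereal \<bar>f u\<bar>)") auto
    qed
    then show "\<exists>C. AE u in lborel. \<bar>f u\<bar> \<le> C" by auto
  next
    assume "\<exists>C. AE u in lborel. \<bar>f u\<bar> \<le> C"
    then obtain C where "AE u in lborel. ereal \<bar>f u\<bar> \<le> ereal C" by auto
    then have "esssup lborel (\<lambda>u. ereal \<bar>f u\<bar>) \<le> ereal C" by (intro esssup_I) auto
    then show "esssup lborel (\<lambda>u. ereal \<bar>f u\<bar>) < \<infinity>" by auto
  qed
  then show ?thesis by (simp add: Lp_def)
qed (simp add: Lp_def)

lemma Lp_measurable: "f \<in> Lp p \<Longrightarrow> f \<in> borel_measurable borel"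
  by (auto simp: Lp_def split: if_splits)

lemma esssup_abs_nonneg:
  fixes f :: "real \<Rightarrow> real"
  shows "0 \<le> esssup lborel (\<lambda>u. ereal \<bar>f u\<bar>)"
proof (rule ccontr)
  assume n: "\<not> ?thesis"
  have "AE u in (lborel :: real measure). False"
    using esssup_AE[of "\<lambda>u. ereal \<bar>f u\<bar>" lborel]
  proof (rule eventually_mono)
    fix u assume "ereal \<bar>f u\<bar> \<le> esssup lborel (\<lambda>u. ereal \<bar>f u\<bar>)"
    moreover have "0 \<le> ereal \<bar>f u\<bar>" by simp
    ultimately show False using n order_trans by blast
  qed
  then have "ae_filter (lborel :: real measure) = bot" by (simp add: trivial_limit_def)
  then show False by (simp add: ae_filter_eq_bot_iff)
qed

lemma emeasure_lborel_Icc_finite: "emeasure lborel {a..b::real} < top"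
  by (simp add: emeasure_lborel_Icc_eq)

lemma integrable_indicator_Icc: "integrable lborel (indicator {a..b::real} :: real \<Rightarrow> real)"
  by (rule integrable_real_indicator) (simp_all add: emeasure_lborel_Icc_eq)

lemma Lp_norm_nonneg: "0 \<le> Lp_norm p f"
  unfolding Lp_norm_def using esssup_abs_nonneg[of f] by (simp add: real_of_ereal_pos)

lemma AE_le_Lp_norm_infty:
  assumes "f \<in> Lp top"
  shows "AE u in lborel. \<bar>f u\<bar> \<le> Lp_norm top f"
  using esssup_AE[of "\<lambda>u. ereal \<bar>f u\<bar>" lborel]
proof eventually_elim
  case (elim u)
  have "esssup lborel (\<lambda>u. ereal \<bar>f u\<bar>) < \<infinity>" using assms by (simp add: Lp_def)
  then show ?case using elim unfolding Lp_norm_def by (cases "esssup lborel (\<lambda>u. ereal \<bar>f u\<bar>)") auto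
qed

lemma Lp_norm_infty_le:
  assumes [measurable]: "f \<in> borel_measurable borel" and "AE u in lborel. \<bar>f u\<bar> \<le> C"
  shows "Lp_norm top f \<le> C"
proof -
  have "esssup lborel (\<lambda>u. ereal \<bar>f u\<bar>) \<le> ereal C" using assms by (intro esssup_I) auto
  then show ?thesis using esssup_abs_nonneg[of f] unfolding Lp_norm_def
    by (cases "esssup lborel (\<lambda>u. ereal \<bar>f u\<bar>)") auto
qed

lemma Lp_mono:
  assumes p: "1 \<le> p" and g: "g \<in> Lp p" and f [measurable]: "f \<in> borel_measurable borel"
    and le: "AE u in lborel. \<bar>f u\<bar> \<le> \<bar>g u\<bar>"
  shows "f \<in> Lp p" "Lp_norm p f \<le> Lp_norm p g"
proof -
  have [measurable]: "g \<in> borel_measurable borel" using g by (rule Lp_measurable)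
  have "f \<in> Lp p \<and> Lp_norm p f \<le> Lp_norm p g"
    using p
  proof (cases rule: exponent_cases)
    case (finite r)
    have ig: "integrable lborel (\<lambda>u. \<bar>g u\<bar> powr r)" using g finite by (simp add: Lp_finite_iff)
    have le': "AE u in lborel. \<bar>f u\<bar> powr r \<le> \<bar>g u\<bar> powr r"
      using le by eventually_elim (use finite in \<open>auto intro: powr_mono2\<close>)
    have if': "integrable lborel (\<lambda>u. \<bar>f u\<bar> powr r)"
      by (rule Bochner_Integration.integrable_bound[OF ig]) (use le' in auto)
    have "(LINT u|lborel. \<bar>f u\<bar> powr r) \<le> (LINT u|lborel. \<bar>g u\<bar> powr r)"
      by (rule integral_mono_AE[OF if' ig le'])
    then show ?thesis using if' finite by (auto simp: Lp_finite_iff Lp_norm_finite intro!: powr_mono2)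
  next
    case infinite
    have "AE u in lborel. \<bar>f u\<bar> \<le> Lp_norm top g"
      using le AE_le_Lp_norm_infty[of g] g infinite by auto
    then show ?thesis using infinite by (auto simp: Lp_infty_iff intro: Lp_norm_infty_le)
  qed
  then show "f \<in> Lp p" "Lp_norm p f \<le> Lp_norm p g" by auto
qed

lemma Lp_cmult:
  assumes p: "1 \<le> p" and f: "f \<in> Lp p"
  shows "(\<lambda>u. c * f u) \<in> Lp p"
proof -
  have [measurable]: "f \<in> borel_measurable borel" using f by (rule Lp_measurable)
  show ?thesis using p
  proof (cases rule: exponent_cases)
    case (finite r)
    then show ?thesis using f by (simp add: Lp_finite_iff abs_mult powr_mult)
  next
    case infinite
    then obtain C where "AE u in lborel. \<bar>f u\<bar> \<le> C" using f by (auto simp: Lp_infty_iff)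
    then have "AE u in lborel. \<bar>c * f u\<bar> \<le> \<bar>c\<bar> * C"
      by eventually_elim (simp add: abs_mult mult_left_mono)
    then show ?thesis using infinite by (auto simp: Lp_infty_iff)
  qed
qed

lemma Lp_add:
  assumes p: "1 \<le> p" and f: "f \<in> Lp p" and g: "g \<in> Lp p"
  shows "(\<lambda>u. f u + g u) \<in> Lp p"
proof -
  have [measurable]: "f \<in> borel_measurable borel" "g \<in> borel_measurable borel"
    using f g by (auto intro: Lp_measurable)
  show ?thesis using p
  proof (cases rule: exponent_cases)
    case (finite r)
    have b: "\<bar>f u + g u\<bar> powr r \<le> 2 powr r * (\<bar>f u\<bar> powr r + \<bar>g u\<bar> powr r)" for u
    proof -
      have "\<bar>f u + g u\<bar> \<le> 2 * max \<bar>f u\<bar> \<bar>g u\<bar>" by linarith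
      then have "\<bar>f u + g u\<bar> powr r \<le> (2 * max \<bar>f u\<bar> \<bar>g u\<bar>) powr r"
        using finite by (intro powr_mono2) auto
      also have "\<dots> = 2 powr r * (max \<bar>f u\<bar> \<bar>g u\<bar>) powr r" by (simp add: powr_mult)
      also have "\<dots> \<le> 2 powr r * (\<bar>f u\<bar> powr r + \<bar>g u\<bar> powr r)"
        by (intro mult_left_mono) (auto simp: max_def)
      finally show ?thesis .
    qed
    have "integrable lborel (\<lambda>u. \<bar>f u + g u\<bar> powr r)"
    proof (rule Bochner_Integration.integrable_bound)
      show "integrable lborel (\<lambda>u. 2 powr r * (\<bar>f u\<bar> powr r + \<bar>g u\<bar> powr r))"
        using f g finite by (auto simp: Lp_finite_iff)
    qed (use b in auto)
    then show ?thesis using finite by (simp add: Lp_finite_iff)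
  next
    case infinite
    then obtain C D where "AE u in lborel. \<bar>f u\<bar> \<le> C" "AE u in lborel. \<bar>g u\<bar> \<le> D"
      using f g by (auto simp: Lp_infty_iff)
    then have "AE u in lborel. \<bar>f u + g u\<bar> \<le> C + D"
      by eventually_elim linarith
    then show ?thesis using infinite by (auto simp: Lp_infty_iff)
  qed
qed

text \<open>Discrete local times up to a fixed time belong to this class for one common \<open>M\<close>. It
  is contained in every Lebesgue space, which lets the same functions serve as densities and as
  weights.\<close>

definition bounded_on_Icc :: "real \<Rightarrow> (real \<Rightarrow> real) \<Rightarrow> bool" where
  "bounded_on_Icc M f \<longleftrightarrow> f \<in> borel_measurable borel \<and> (\<exists>B\<ge>0. \<forall>u. \<bar>f u\<bar> \<le> B * indicator {-M..M} u)"

lemma bounded_on_IccI: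
  assumes "f \<in> borel_measurable borel" "\<And>u. \<bar>f u\<bar> \<le> B" "\<And>u. u \<notin> {-M..M} \<Longrightarrow> f u = 0"
  shows "bounded_on_Icc M f"
  unfolding bounded_on_Icc_def
proof (intro conjI exI[of _ "\<bar>B\<bar>"] allI assms(1))
  fix u show "\<bar>f u\<bar> \<le> \<bar>B\<bar> * indicator {-M..M} u"
    using assms(2)[of u] assms(3)[of u] by (cases "u \<in> {-M..M}") auto
qed simp

lemma bounded_on_Icc_outside: "bounded_on_Icc M f \<Longrightarrow> u \<notin> {-M..M} \<Longrightarrow> f u = 0"
  unfolding bounded_on_Icc_def by (metis abs_le_zero_iff indicator_simps(2) mult_zero_right)

lemma bounded_on_Icc_bound: "bounded_on_Icc M f \<Longrightarrow> \<exists>B>0. \<forall>u. \<bar>f u\<bar> \<le> B"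
  unfolding bounded_on_Icc_def
proof (elim conjE exE)
  fix B assume "0 \<le> B" "\<forall>u. \<bar>f u\<bar> \<le> B * indicator {-M..M} u"
  then have "\<bar>f u\<bar> \<le> B + 1" for u by (cases "u \<in> {-M..M}") (auto dest!: spec[of _ u])
  then show ?thesis using \<open>0 \<le> B\<close> by (intro exI[of _ "B+1"]) auto
qed

lemma bounded_on_Icc_measurable: "bounded_on_Icc M f \<Longrightarrow> f \<in> borel_measurable borel"
  by (simp add: bounded_on_Icc_def)

lemma bounded_on_Icc_Lp:
  assumes p: "1 \<le> p" and f: "bounded_on_Icc M f"
  shows "f \<in> Lp p"
proof -
  have [measurable]: "f \<in> borel_measurable borel" using f by (rule bounded_on_Icc_measurable)
  obtain B where B: "B \<ge> 0" "\<And>u. \<bar>f u\<bar> \<le> B * indicator {-M..M} u"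
    using f by (auto simp: bounded_on_Icc_def)
  show ?thesis using p
  proof (cases rule: exponent_cases)
    case (finite r)
    have "integrable lborel (\<lambda>u. \<bar>f u\<bar> powr r)"
    proof (rule Bochner_Integration.integrable_bound)
      show "integrable lborel (\<lambda>u. B powr r * indicator {-M..M} u)"
        using integrable_indicator_Icc by (rule integrable_mult_right)
      show "AE u in lborel. norm (\<bar>f u\<bar> powr r) \<le> norm (B powr r * indicator {-M..M} u)"
      proof (rule AE_I2)
        fix u show "norm (\<bar>f u\<bar> powr r) \<le> norm (B powr r * indicator {-M..M} u)"
          using B(2)[of u] B(1) finite by (cases "u \<in> {-M..M}") (auto intro: powr_mono2)
      qed
    qed auto
    then show ?thesis using finite by (simp add: Lp_finite_iff)
  next
    case infinite
    obtain C where "\<And>u. \<bar>f u\<bar> \<le> C" using bounded_on_Icc_bound[OF f] by blast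
    then show ?thesis using infinite by (auto simp: Lp_infty_iff)
  qed
qed

lemma bounded_on_Icc_integrable: "bounded_on_Icc M f \<Longrightarrow> integrable lborel f"
  using bounded_on_Icc_Lp[of 1 M f] by (simp add: Lp_1_iff)

lemma bounded_on_Icc_mult:
  assumes "bounded_on_Icc M f" "g \<in> borel_measurable borel" "\<And>u. u \<in> {-M..M} \<Longrightarrow> \<bar>g u\<bar> \<le> B"
  shows "bounded_on_Icc M (\<lambda>u. f u * g u)"
proof -
  have [measurable]: "f \<in> borel_measurable borel" "g \<in> borel_measurable borel"
    using assms bounded_on_Icc_measurable by auto
  obtain C where C: "C > 0" "\<And>u. \<bar>f u\<bar> \<le> C" using bounded_on_Icc_bound[OF assms(1)] by blast
  show ?thesis
  proof (rule bounded_on_IccI)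
    show "\<bar>f u * g u\<bar> \<le> C * \<bar>B\<bar>" for u
    proof (cases "u \<in> {-M..M}")
      case True
      then show ?thesis using C(2)[of u] C(1) assms(3)[of u] unfolding abs_mult by (intro mult_mono) auto
    next
      case False
      then show ?thesis using bounded_on_Icc_outside[OF assms(1) False] C(1) by simp
    qed
  qed (use bounded_on_Icc_outside[OF assms(1)] in auto)
qed

lemma bounded_on_Icc_add:
  assumes "bounded_on_Icc M f" "bounded_on_Icc M g"
  shows "bounded_on_Icc M (\<lambda>u. f u + g u)"
proof -
  have [measurable]: "f \<in> borel_measurable borel" "g \<in> borel_measurable borel"
    using assms bounded_on_Icc_measurable by auto
  obtain C D where b: "\<And>u. \<bar>f u\<bar> \<le> C" "\<And>u. \<bar>g u\<bar> \<le> D" using assms bounded_on_Icc_bound by metis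
  have "\<bar>f u + g u\<bar> \<le> C + D" for u
    by (rule order_trans[OF abs_triangle_ineq add_mono[OF b]])
  then show ?thesis
    by (rule bounded_on_IccI[rotated]) (use bounded_on_Icc_outside[OF assms(1)] bounded_on_Icc_outside[OF assms(2)] in auto)
qed

lemma bounded_on_Icc_cmult:
  assumes "bounded_on_Icc M f" shows "bounded_on_Icc M (\<lambda>u. c * f u)"
  using bounded_on_Icc_mult[OF assms, of "\<lambda>_. c" "\<bar>c\<bar>"] by (simp add: mult.commute)

lemma bounded_on_Icc_zero: "bounded_on_Icc M (\<lambda>_. 0)"
  by (rule bounded_on_IccI[where B=0]) auto

lemma bounded_on_Icc_sum:
  "finite J \<Longrightarrow> (\<And>j. j \<in> J \<Longrightarrow> bounded_on_Icc M (f j)) \<Longrightarrow> bounded_on_Icc M (\<lambda>u. \<Sum>j\<in>J. f j u)"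
  by (induction J rule: finite_induct) (auto intro: bounded_on_Icc_add bounded_on_Icc_zero)

lemma bounded_on_Icc_indicator:
  assumes "A \<in> sets borel" "A \<subseteq> {-M..M}" shows "bounded_on_Icc M (indicator A)"
  by (rule bounded_on_IccI[where B=1]) (use assms in \<open>auto simp: indicator_def\<close>)

lemma integrable_bounded_on_Icc_indicator:
  assumes "bounded_on_Icc M f" "A \<in> sets borel"
  shows "integrable lborel (\<lambda>u. f u * indicator A u)"
  by (rule bounded_on_Icc_integrable[OF bounded_on_Icc_mult[OF assms(1), where B=1]]) (use assms in \<open>auto simp: indicator_def\<close>)

lemma Lp_norm_indicator:
  assumes "1 \<le> r"
  shows "Lp_norm (ennreal r) (indicator A) = measure lborel A powr (1 / r)"
proof -
  have "\<bar>indicator A u\<bar> powr r = (indicator A u :: real)" for u by (auto simp: indicator_def)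
  then show ?thesis using assms by (simp add: Lp_norm_finite)
qed

lemma le_mult_if_le_add_mult_add:
  fixes a b X :: real
  assumes "\<And>\<epsilon>. \<epsilon> > 0 \<Longrightarrow> X \<le> (a + \<epsilon>) * (b + \<epsilon>)"
  shows "X \<le> a * b"
proof (rule tendsto_lowerbound)
  have "((\<lambda>\<epsilon>. (a + \<epsilon>) * (b + \<epsilon>)) \<longlongrightarrow> (a + 0) * (b + 0)) (at_right 0)"
    by (intro tendsto_intros)
  then show "((\<lambda>\<epsilon>. (a + \<epsilon>) * (b + \<epsilon>)) \<longlongrightarrow> a * b) (at_right 0)" by simp
  show "\<forall>\<^sub>F \<epsilon> in at_right 0. X \<le> (a + \<epsilon>) * (b + \<epsilon>)"
    using assms by (simp add: eventually_at_filter)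
qed simp

lemma Holder_bounded_factor:
  assumes f: "integrable lborel f" and h: "h \<in> Lp top"
  shows "integrable lborel (\<lambda>u. f u * h u)" "(LINT u|lborel. \<bar>f u * h u\<bar>) \<le> (LINT u|lborel. \<bar>f u\<bar>) * Lp_norm top h"
proof -
  have [measurable]: "f \<in> borel_measurable borel" "h \<in> borel_measurable borel"
    using f h by (auto intro: Lp_measurable)
  have le: "AE u in lborel. \<bar>f u * h u\<bar> \<le> \<bar>f u\<bar> * Lp_norm top h"
    using AE_le_Lp_norm_infty[OF h] by eventually_elim (auto simp: abs_mult intro: mult_left_mono)
  have i: "integrable lborel (\<lambda>u. \<bar>f u\<bar> * Lp_norm top h)" using f by auto
  show 1: "integrable lborel (\<lambda>u. f u * h u)"
    by (rule Bochner_Integration.integrable_bound[OF i]) (use le Lp_norm_nonneg[of \<infinity> h] in auto)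
  have "(LINT u|lborel. \<bar>f u * h u\<bar>) \<le> (LINT u|lborel. \<bar>f u\<bar> * Lp_norm top h)"
    by (rule integral_mono_AE[OF _ i le]) (use 1 in auto)
  then show "(LINT u|lborel. \<bar>f u * h u\<bar>) \<le> (LINT u|lborel. \<bar>f u\<bar>) * Lp_norm top h" by simp
qed

text \<open>Young's inequality after scaling both factors to norm one.\<close>

lemma Holder:
  assumes pq: "conjugate p q" and f: "f \<in> Lp p" and h: "h \<in> Lp q"
  shows "integrable lborel (\<lambda>u. f u * h u)" "(LINT u|lborel. \<bar>f u * h u\<bar>) \<le> Lp_norm p f * Lp_norm q h"
proof -
  have "integrable lborel (\<lambda>u. f u * h u) \<and> (LINT u|lborel. \<bar>f u * h u\<bar>) \<le> Lp_norm p f * Lp_norm q h"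
    using pq
  proof (cases rule: conjugate_cases)
    case (finite r s)
    have [measurable]: "f \<in> borel_measurable borel" "h \<in> borel_measurable borel"
      using f h by (auto intro: Lp_measurable)
    have if': "integrable lborel (\<lambda>u. \<bar>f u\<bar> powr r)" and ih: "integrable lborel (\<lambda>u. \<bar>h u\<bar> powr s)"
      using f h finite by (auto simp: Lp_finite_iff)
    have Y: "\<bar>f u * h u\<bar> \<le> (a * b) * (\<bar>f u\<bar> powr r / (a powr r * r) + \<bar>h u\<bar> powr s / (b powr s * s))"
      if "a > 0" "b > 0" for a b u
    proof -
      have "(\<bar>f u\<bar> / a) * (\<bar>h u\<bar> / b) \<le> (\<bar>f u\<bar> / a) powr r / r + (\<bar>h u\<bar> / b) powr s / s"
        using finite that by (intro Youngs_inequality) auto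
      also have "\<dots> = \<bar>f u\<bar> powr r / (a powr r * r) + \<bar>h u\<bar> powr s / (b powr s * s)"
        using that by (simp add: powr_divide)
      finally have "(\<bar>f u\<bar> * \<bar>h u\<bar>) / (a * b) \<le> \<bar>f u\<bar> powr r / (a powr r * r) + \<bar>h u\<bar> powr s / (b powr s * s)" by simp
      then show ?thesis using that by (simp add: pos_divide_le_eq abs_mult mult.commute)
    qed
    have i: "integrable lborel (\<lambda>u. (a * b) * (\<bar>f u\<bar> powr r / (a powr r * r) + \<bar>h u\<bar> powr s / (b powr s * s)))" for a b
      using if' ih by auto
    have 1: "integrable lborel (\<lambda>u. f u * h u)"
      by (rule Bochner_Integration.integrable_bound[OF i[of 1 1]]) (use Y[of 1 1] finite in \<open>auto intro!: AE_I2 order_trans[OF _ abs_ge_self]\<close>)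
    have "(LINT u|lborel. \<bar>f u * h u\<bar>) \<le> (Lp_norm p f + \<epsilon>) * (Lp_norm q h + \<epsilon>)" if e: "\<epsilon> > 0" for \<epsilon>
    proof -
      \<comment> \<open>The norms are enlarged by \<open>\<epsilon>\<close> since they may vanish.\<close>
      define a where "a = Lp_norm p f + \<epsilon>"
      define b where "b = Lp_norm q h + \<epsilon>"
      have ab: "a > 0" "b > 0" using e Lp_norm_nonneg[of p f] Lp_norm_nonneg[of q h] by (auto simp: a_def b_def)
      have fa: "(LINT u|lborel. \<bar>f u\<bar> powr r) \<le> a powr r"
        using Lp_norm_powr[of r f] finite e Lp_norm_nonneg[of p f] by (auto simp: a_def intro!: powr_mono2 simp flip: Lp_norm_powr)
      have hb: "(LINT u|lborel. \<bar>h u\<bar> powr s) \<le> b powr s"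
        using finite e Lp_norm_nonneg[of q h] by (auto simp: b_def intro!: powr_mono2 simp flip: Lp_norm_powr)
      have "(LINT u|lborel. \<bar>f u * h u\<bar>) \<le> (LINT u|lborel. (a * b) * (\<bar>f u\<bar> powr r / (a powr r * r) + \<bar>h u\<bar> powr s / (b powr s * s)))"
        by (rule integral_mono[OF _ i Y[OF ab]]) (use 1 in auto)
      also have "\<dots> = (a * b) * ((LINT u|lborel. \<bar>f u\<bar> powr r) / (a powr r * r) + (LINT u|lborel. \<bar>h u\<bar> powr s) / (b powr s * s))"
        using if' ih by simp
      also have "\<dots> \<le> (a * b) * (a powr r / (a powr r * r) + b powr s / (b powr s * s))"
        using fa hb ab finite by (intro mult_left_mono add_mono divide_right_mono) auto
      also have "\<dots> = (a * b) * (1 / r + 1 / s)" using ab by simp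
      also have "\<dots> = a * b" using finite by simp
      finally show ?thesis by (simp add: a_def b_def)
    qed
    then show ?thesis using 1 le_mult_if_le_add_mult_add by blast
  next
    case infinite
    then show ?thesis using Holder_bounded_factor[of h f] f h by (simp add: Lp_1_iff Lp_norm_1 mult.commute)
  next
    case one
    then show ?thesis using Holder_bounded_factor[of f h] f h by (simp add: Lp_1_iff Lp_norm_1)
  qed
  then show "integrable lborel (\<lambda>u. f u * h u)" "(LINT u|lborel. \<bar>f u * h u\<bar>) \<le> Lp_norm p f * Lp_norm q h" by auto
qed

lemma Holder_abs:
  assumes "conjugate p q" "f \<in> Lp p" "h \<in> Lp q"
  shows "\<bar>LINT u|lborel. f u * h u\<bar> \<le> Lp_norm p f * Lp_norm q h"
  using Holder(2)[OF assms] integral_abs_bound[of lborel "\<lambda>u. f u * h u"] by linarith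

lemma integral_in_Lp_dual:
  assumes pq: "conjugate p q" and h: "h \<in> Lp q"
  shows "(\<lambda>f. LINT u|lborel. f u * h u) \<in> Lp_dual p"
  unfolding Lp_dual_def
proof (intro CollectI conjI ballI allI exI[of _ "Lp_norm q h"])
  fix f g assume "f \<in> Lp p" "g \<in> Lp p"
  then show "(LINT u|lborel. (f u + g u) * h u) = (LINT u|lborel. f u * h u) + (LINT u|lborel. g u * h u)"
    using Holder(1)[OF pq _ h] by (simp add: distrib_right)
next
  fix f assume f: "f \<in> Lp p"
  then show "\<bar>LINT u|lborel. f u * h u\<bar> \<le> Lp_norm q h * Lp_norm p f"
    using Holder_abs[OF pq f h] by (simp add: mult.commute)
qed (simp add: mult.assoc)

lemma Lp_norm_truncation_tendsto_0:
  assumes p: "1 \<le> p" and f: "f \<in> Lp p"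
  shows "(\<lambda>k::nat. Lp_norm p (\<lambda>u. f u * indicator {u. \<bar>f u\<bar> > real k} u)) \<longlonglongrightarrow> 0"
proof -
  have [measurable]: "f \<in> borel_measurable borel" using f by (rule Lp_measurable)
  show ?thesis using p
  proof (cases rule: exponent_cases)
    case (finite r)
    have if': "integrable lborel (\<lambda>u. \<bar>f u\<bar> powr r)" using f finite by (auto simp: Lp_finite_iff)
    have "(\<lambda>k::nat. LINT u|lborel. \<bar>f u * indicator {u. \<bar>f u\<bar> > real k} u\<bar> powr r) \<longlonglongrightarrow> (LINT u|(lborel::real measure). (0::real))"
    proof (rule integral_dominated_convergence[where w="\<lambda>u. \<bar>f u\<bar> powr r" and f="\<lambda>_. 0" and
          s="\<lambda>k u. \<bar>f u * indicator {u. \<bar>f u\<bar> > real k} u\<bar> powr r"])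
      show "AE u in lborel. (\<lambda>k::nat. \<bar>f u * indicator {u. \<bar>f u\<bar> > real k} u\<bar> powr r) \<longlonglongrightarrow> 0"
      proof (rule AE_I2)
        fix u
        obtain N :: nat where "\<bar>f u\<bar> \<le> real N" using real_arch_simple by blast
        then have "eventually (\<lambda>k. \<bar>f u * indicator {u. \<bar>f u\<bar> > real k} u\<bar> powr r = 0) sequentially"
          by (intro eventually_sequentiallyI[of N]) (auto simp: indicator_def)
        then show "(\<lambda>k::nat. \<bar>f u * indicator {u. \<bar>f u\<bar> > real k} u\<bar> powr r) \<longlonglongrightarrow> 0"
          by (rule tendsto_eventually)
      qed
    qed (use if' in \<open>auto simp: indicator_def\<close>)
    then have "(\<lambda>k::nat. LINT u|lborel. \<bar>f u * indicator {u. \<bar>f u\<bar> > real k} u\<bar> powr r) \<longlonglongrightarrow> 0" by simp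
    then have "(\<lambda>k::nat. (LINT u|lborel. \<bar>f u * indicator {u. \<bar>f u\<bar> > real k} u\<bar> powr r) powr (1/r)) \<longlonglongrightarrow> 0 powr (1/r)"
      using finite by (intro tendsto_powr') auto
    then show ?thesis using finite by (simp add: Lp_norm_finite)
  next
    case infinite
    then obtain C where C: "AE u in lborel. \<bar>f u\<bar> \<le> C" using f by (auto simp: Lp_infty_iff)
    obtain N :: nat where N: "C \<le> real N" using real_arch_simple by blast
    have "Lp_norm p (\<lambda>u. f u * indicator {u. \<bar>f u\<bar> > real k} u) = 0" if "k \<ge> N" for k
    proof -
      have "AE u in lborel. \<bar>f u * indicator {u. \<bar>f u\<bar> > real k} u\<bar> \<le> 0"
        using C by eventually_elim (use N that in \<open>auto simp: indicator_def\<close>)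
      then have "Lp_norm p (\<lambda>u. f u * indicator {u. \<bar>f u\<bar> > real k} u) \<le> 0"
        unfolding infinite by (intro Lp_norm_infty_le) auto
      then show ?thesis using Lp_norm_nonneg by (simp add: antisym)
    qed
    then show ?thesis by (intro tendsto_eventually eventually_sequentiallyI[of N]) blast
  qed
qed

text \<open>A criterion for membership in \<open>L\<^sup>p\<close> that tests bounded functions of bounded
  support only: Fatou's lemma if \<open>p\<close> is finite, and a countable union of null sets if
  \<open>p\<close> is infinite.\<close>

lemma Lp_Fatou:
  assumes p: "1 \<le> p" and f [measurable]: "f \<in> borel_measurable borel"
    and C: "\<And>k::nat. Lp_norm p (\<lambda>u. f u * indicator {u. \<bar>f u\<bar> \<le> real k \<and> \<bar>u\<bar> \<le> real k} u) \<le> C"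
  shows "f \<in> Lp p"
proof -
  let ?f = "\<lambda>k::nat. \<lambda>u. f u * indicator {u. \<bar>f u\<bar> \<le> real k \<and> \<bar>u\<bar> \<le> real k} u"
  have bd: "bounded_on_Icc (real k) (?f k)" for k
    by (rule bounded_on_IccI[where B="real k"]) (auto simp: indicator_def)
  have ev: "eventually (\<lambda>k. ?f k u = f u) sequentially" for u
  proof -
    obtain N :: nat where "max \<bar>f u\<bar> \<bar>u\<bar> \<le> real N" using real_arch_simple by blast
    then show ?thesis by (intro eventually_sequentiallyI[of N]) (auto simp: indicator_def)
  qed
  show ?thesis using p
  proof (cases rule: exponent_cases)
    case (finite r)
    have int: "integrable lborel (\<lambda>u. \<bar>?f k u\<bar> powr r)" for k
      using bounded_on_Icc_Lp[OF p bd[of k]] finite by (auto simp: Lp_finite_iff)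
    have C0: "C \<ge> 0" using C[of 0] Lp_norm_nonneg order_trans by blast
    have le: "(LINT u|lborel. \<bar>?f k u\<bar> powr r) \<le> C powr r" for k
      using finite C[of k] Lp_norm_nonneg[of p "?f k"] by (auto intro!: powr_mono2 simp flip: Lp_norm_powr)
    have "(\<integral>\<^sup>+u. ennreal (\<bar>f u\<bar> powr r) \<partial>lborel) = (\<integral>\<^sup>+u. liminf (\<lambda>k. ennreal (\<bar>?f k u\<bar> powr r)) \<partial>lborel)"
    proof (rule nn_integral_cong)
      fix u
      have "(\<lambda>k. ennreal (\<bar>?f k u\<bar> powr r)) \<longlonglongrightarrow> ennreal (\<bar>f u\<bar> powr r)"
        using ev[of u] by (intro tendsto_eventually) (auto elim: eventually_mono)
      then show "ennreal (\<bar>f u\<bar> powr r) = liminf (\<lambda>k. ennreal (\<bar>?f k u\<bar> powr r))"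
        by (intro lim_imp_Liminf[symmetric]) auto
    qed
    also have "\<dots> \<le> liminf (\<lambda>k. \<integral>\<^sup>+u. ennreal (\<bar>?f k u\<bar> powr r) \<partial>lborel)"
      by (rule nn_integral_liminf) auto
    also have "\<dots> \<le> liminf (\<lambda>k::nat. ennreal (C powr r))"
    proof (rule Liminf_mono, rule always_eventually, rule allI)
      fix k show "(\<integral>\<^sup>+u. ennreal (\<bar>?f k u\<bar> powr r) \<partial>lborel) \<le> ennreal (C powr r)"
        using le[of k] by (subst nn_integral_eq_integral[OF int]) (auto intro: ennreal_leI)
    qed
    also have "\<dots> = ennreal (C powr r)" by (simp add: Liminf_const)
    finally have "(\<integral>\<^sup>+u. ennreal (\<bar>f u\<bar> powr r) \<partial>lborel) < \<infinity>" by (auto simp: top.not_eq_extremum intro: le_less_trans)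
    then have "integrable lborel (\<lambda>u. \<bar>f u\<bar> powr r)"
      by (intro integrableI_bounded) auto
    then show ?thesis using finite by (simp add: Lp_finite_iff)
  next
    case infinite
    have "AE u in lborel. \<forall>k. \<bar>?f k u\<bar> \<le> C"
      unfolding AE_all_countable
    proof
      fix k
      have "?f k \<in> Lp top" using bounded_on_Icc_Lp[OF p bd[of k]] infinite by simp
      from AE_le_Lp_norm_infty[OF this] show "AE u in lborel. \<bar>?f k u\<bar> \<le> C"
        by eventually_elim (use C[of k] infinite in auto)
    qed
    then have "AE u in lborel. \<bar>f u\<bar> \<le> C"
    proof eventually_elim
      case (elim u)
      obtain k where "?f k u = f u" using ev[of u] by (auto simp: eventually_sequentially)
      then show ?case using elim by metis
    qed
    then show ?thesis using infinite by (auto simp: Lp_infty_iff)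
  qed
qed

text \<open>Weights which nearly realise the norm of \<open>G\<close>. The factor \<open>2\<close> is there
  for \<open>p = \<infinity>\<close>, where the supremum need not be attained and is approached on
  the set where \<open>G\<close> exceeds half its norm. That \<open>h\<close> is nonnegative and
  bounded with bounded support makes it usable together with monotonicity in time.\<close>

lemma converse_Holder:
  assumes pq: "conjugate p q" and G: "bounded_on_Icc M G" and pos: "\<And>u. 0 \<le> G u"
  obtains h where "bounded_on_Icc M h" "\<And>u. 0 \<le> h u" "Lp_norm q h \<le> 1" "Lp_norm p G \<le> 2 * (LINT u|lborel. G u * h u)"
proof -
  have [measurable]: "G \<in> borel_measurable borel" using G by (rule bounded_on_Icc_measurable)
  obtain B where B: "B > 0" "\<And>u. \<bar>G u\<bar> \<le> B" using bounded_on_Icc_bound[OF G] by blast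
  have out: "\<And>u. u \<notin> {-M..M} \<Longrightarrow> G u = 0" using bounded_on_Icc_outside[OF G] .
  show thesis
  proof (cases "Lp_norm p G = 0")
    case True
    have "bounded_on_Icc M (\<lambda>_. 0)" by (rule bounded_on_IccI[where B=0]) auto
    moreover have "Lp_norm q (\<lambda>_. 0) \<le> 1"
    proof -
      have "Lp_norm q (\<lambda>_. 0) \<le> 0" using conjugate_ge_1(2)[OF pq]
        by (cases rule: exponent_cases) (auto simp: Lp_norm_finite intro: Lp_norm_infty_le)
      then show ?thesis by linarith
    qed
    ultimately show ?thesis using that[of "\<lambda>_. 0"] True by simp
  next
    case False
    then have N0: "Lp_norm p G > 0" using Lp_norm_nonneg[of p G] by linarith
    define N where "N = Lp_norm p G"
    have N: "N > 0" using N0 by (simp add: N_def)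
    show ?thesis using pq
    proof (cases rule: conjugate_cases)
      case (finite r s)
      \<comment> \<open>the case of equality in Hoelder's inequality\<close>
      define h where "h u = (G u / N) powr (r - 1)" for u
      have [measurable]: "h \<in> borel_measurable borel" unfolding h_def by measurable
      have Nr: "(LINT u|lborel. G u powr r) = N powr r"
        using Lp_norm_powr[of r G] finite pos by (simp add: N_def)
      have rs: "(r - 1) * s = r" using finite by (simp add: field_simps)
      have "\<bar>h u\<bar> powr s = G u powr r / N powr r" for u
        using rs pos[of u] N by (simp add: h_def powr_powr powr_divide)
      then have "Lp_norm q h = 1" using finite N Nr by (simp add: Lp_norm_finite)
      moreover have "(LINT u|lborel. G u * h u) = N"
      proof -
        have "G u * h u = N * (G u powr r / N powr r)" for u
        proof (cases "G u = 0")
          case False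
          then have "G u > 0" using pos[of u] by linarith
          then have "G u * h u = N * ((G u / N) powr 1 * (G u / N) powr (r - 1))"
            using N \<open>G u > 0\<close> by (simp add: h_def)
          also have "\<dots> = N * (G u / N) powr r" by (subst powr_add[symmetric]) simp
          finally show ?thesis using \<open>G u > 0\<close> N by (simp add: powr_divide)
        qed (use finite in \<open>auto simp: h_def\<close>)
        then show ?thesis using Nr N by simp
      qed
      moreover have "bounded_on_Icc M h"
      proof (rule bounded_on_IccI)
        show "\<bar>h u\<bar> \<le> (B / N) powr (r - 1)" for u
          using B(2)[of u] pos[of u] N finite by (auto simp: h_def intro!: powr_mono2 divide_right_mono)
      qed (use out in \<open>auto simp: h_def\<close>)
      ultimately show ?thesis using that[of h] N by (simp add: h_def N_def)
    next
      case infinite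
      define A where "A = {u. G u > N / 2}"
      have [measurable]: "A \<in> sets borel" unfolding A_def by measurable
      have AM: "A \<subseteq> {-M..M}" using out N by (force simp: A_def)
      have finA: "emeasure lborel A \<noteq> \<infinity>"
        using emeasure_mono[OF AM, of lborel] emeasure_lborel_Icc_finite[of "-M" M] by (auto simp: top_unique)
      have mA: "measure lborel A > 0"
      proof (rule ccontr)
        assume "\<not> ?thesis"
        then have "measure lborel A = 0" by (simp add: measure_le_0_iff not_less)
        then have "emeasure lborel A = 0" using finA by (metis emeasure_eq_ennreal_measure ennreal_0 infinity_ennreal_def)
        then have "AE u in lborel. u \<notin> A" by (intro AE_not_in) (auto simp: null_sets_def)
        then have "AE u in lborel. \<bar>G u\<bar> \<le> N / 2"
          by eventually_elim (use pos in \<open>auto simp: A_def\<close>)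
        then have "N \<le> N / 2" unfolding N_def infinite by (intro Lp_norm_infty_le) (auto simp: N_def infinite)
        then show False using N by simp
      qed
      define h where "h u = indicator A u / measure lborel A" for u
      have [measurable]: "h \<in> borel_measurable borel" unfolding h_def by measurable
      have 1: "bounded_on_Icc M h"
        by (rule bounded_on_IccI[where B="1 / measure lborel A"]) (use AM mA in \<open>auto simp: h_def indicator_def\<close>)
      have 2: "Lp_norm q h \<le> 1" using infinite mA by (simp add: Lp_norm_1 h_def)
      have "(LINT u|lborel. N / 2 * h u) \<le> (LINT u|lborel. G u * h u)"
      proof (rule integral_mono)
        show "integrable lborel (\<lambda>u. N / 2 * h u)" using bounded_on_Icc_integrable[OF 1] by simp
        have "h \<in> Lp q" using bounded_on_Icc_Lp[OF conjugate_ge_1(2)[OF pq] 1] .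
        then show "integrable lborel (\<lambda>u. G u * h u)"
          using Holder(1)[OF pq bounded_on_Icc_Lp[OF conjugate_ge_1(1)[OF pq] G]] by blast
      qed (use mA in \<open>auto simp: h_def indicator_def A_def field_simps\<close>)
      moreover have "(LINT u|lborel. h u) = 1" using mA finA by (simp add: h_def)
      ultimately have 3: "N \<le> 2 * (LINT u|lborel. G u * h u)" by simp
      show ?thesis using that[OF 1 _ 2] 3 by (auto simp: h_def N_def)
    next
      case one
      \<comment> \<open>The weight \<open>1\<close> is extremal for \<open>p = 1\<close>; cutting it off outside the
        support of \<open>G\<close> changes nothing.\<close>
      have 1: "bounded_on_Icc M (indicator {-M..M})" by (rule bounded_on_IccI[where B=1]) auto
      have 2: "Lp_norm q (indicator {-M..M}) \<le> 1" unfolding one by (rule Lp_norm_infty_le) auto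
      have "G u * indicator {-M..M} u = \<bar>G u\<bar>" for u using out[of u] pos[of u] by (cases "u \<in> {-M..M}") auto
      then have "(LINT u|lborel. G u * indicator {-M..M} u) = N" by (simp add: N_def one Lp_norm_1)
      then show ?thesis using that[OF 1 _ 2] N by (auto simp: N_def)
    qed
  qed
qed

section \<open>Densities\<close>

text \<open>Uniform absolute continuity on a set of finite measure turns finite additivity into countable
  additivity, because sets decreasing to the empty set have Lebesgue measure tending to zero. The
  Radon--Nikodym theorem then provides the density.\<close>

lemma set_function_density:
  fixes \<nu> :: "real set \<Rightarrow> real"
  assumes nonneg: "\<And>A. A \<in> sets borel \<Longrightarrow> 0 \<le> \<nu> A"
    and add: "\<And>A B. A \<in> sets borel \<Longrightarrow> B \<in> sets borel \<Longrightarrow> A \<inter> B = {} \<Longrightarrow> \<nu> (A \<union> B) = \<nu> A + \<nu> B"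
    and supp: "\<And>A. A \<in> sets borel \<Longrightarrow> A \<inter> {-M..M} = {} \<Longrightarrow> \<nu> A = 0"
    and uac: "\<And>\<epsilon>. \<epsilon> > 0 \<Longrightarrow> \<exists>\<delta>>0. \<forall>A\<in>sets borel. emeasure lborel A < ennreal \<delta> \<longrightarrow> \<nu> A < \<epsilon>"
  obtains L where "integrable lborel L" "\<And>u. 0 \<le> L u" "\<And>u. u \<notin> {-M..M} \<Longrightarrow> L u = 0"
    "\<And>A. A \<in> sets borel \<Longrightarrow> \<nu> A = (LINT u|lborel. L u * indicator A u)"
proof -
  have \<nu>0: "\<nu> {} = 0" using supp[of "{}"] by simp
  have restrict: "\<nu> A = \<nu> (A \<inter> {-M..M})" if "A \<in> sets borel" for A
  proof -
    have "\<nu> ((A \<inter> {-M..M}) \<union> (A - {-M..M})) = \<nu> (A \<inter> {-M..M}) + \<nu> (A - {-M..M})"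
      using that by (intro add) auto
    moreover have "\<nu> (A - {-M..M}) = 0" using that by (intro supp) auto
    moreover have "(A \<inter> {-M..M}) \<union> (A - {-M..M}) = A" by auto
    ultimately show ?thesis by simp
  qed
  have cadd: "countably_additive (sets (borel :: real measure)) (\<lambda>A. ennreal (\<nu> A))"
  proof (rule sets.empty_continuous_imp_countably_additive)
    show "positive (sets (borel :: real measure)) (\<lambda>A. ennreal (\<nu> A))" by (simp add: positive_def \<nu>0)
    show "additive (sets (borel :: real measure)) (\<lambda>A. ennreal (\<nu> A))"
      by (auto simp: additive_def add ennreal_plus nonneg)
    show "\<forall>A\<in>sets (borel :: real measure). ennreal (\<nu> A) \<noteq> \<infinity>" by simp
    fix A :: "nat \<Rightarrow> real set"
    assume A: "range A \<subseteq> sets borel" "decseq A" "(\<Inter>i. A i) = {}"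
    then have Ai: "\<And>i. A i \<in> sets borel" by auto
    have "(\<lambda>i. emeasure lborel (A i \<inter> {-M..M})) \<longlonglongrightarrow> emeasure lborel (\<Inter>i. A i \<inter> {-M..M})"
    proof (rule Lim_emeasure_decseq)
      show "range (\<lambda>i. A i \<inter> {- M..M}) \<subseteq> sets lborel" using A by auto
      show "decseq (\<lambda>i. A i \<inter> {- M..M})" using A(2) by (auto simp: decseq_def)
      show "emeasure lborel (A i \<inter> {- M..M}) \<noteq> \<infinity>" for i
        using emeasure_mono[of "A i \<inter> {-M..M}" "{-M..M}" lborel] emeasure_lborel_Icc_finite[of "-M" M]
        by (auto simp: top_unique)
    qed
    moreover have "(\<Inter>i. A i \<inter> {-M..M}) = {}" using A(3) by auto
    ultimately have lim: "(\<lambda>i. emeasure lborel (A i \<inter> {-M..M})) \<longlonglongrightarrow> 0" by simp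
    have "(\<lambda>i. \<nu> (A i)) \<longlonglongrightarrow> 0"
    proof (rule order_tendstoI)
      fix a :: real assume "a < 0"
      then show "\<forall>\<^sub>F i in sequentially. a < \<nu> (A i)"
        by (intro always_eventually allI less_le_trans[OF \<open>a < 0\<close>] nonneg Ai)
    next
      fix a :: real assume "0 < a"
      then obtain \<delta> where \<delta>: "\<delta> > 0" "\<forall>A\<in>sets borel. emeasure lborel A < ennreal \<delta> \<longrightarrow> \<nu> A < a"
        using uac by blast
      have "\<forall>\<^sub>F i in sequentially. emeasure lborel (A i \<inter> {-M..M}) < ennreal \<delta>"
        using lim \<delta>(1) by (intro order_tendstoD(2)) auto
      then show "\<forall>\<^sub>F i in sequentially. \<nu> (A i) < a"
      proof eventually_elim
        case (elim i)
        then have "\<nu> (A i \<inter> {-M..M}) < a" using \<delta>(2) Ai by auto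
        then show ?case using restrict[OF Ai[of i]] by simp
      qed
    qed
    then show "(\<lambda>i. ennreal (\<nu> (A i))) \<longlonglongrightarrow> 0"
      using tendsto_ennrealI by fastforce
  qed
  define N where "N = measure_of (UNIV :: real set) (sets borel) (\<lambda>A. ennreal (\<nu> A))"
  have sN: "sets N = sets borel" unfolding N_def by (metis sets.sigma_algebra_axioms sets.sets_measure_of_eq space_borel)
  have eN: "emeasure N A = ennreal (\<nu> A)" if "A \<in> sets borel" for A
    unfolding N_def
  proof (rule emeasure_measure_of_sigma)
    show "sigma_algebra UNIV (sets (borel :: real measure))" using sets.sigma_algebra_axioms[of borel] by simp
    show "positive (sets (borel :: real measure)) (\<lambda>A. ennreal (\<nu> A))" by (simp add: positive_def \<nu>0)
  qed (use cadd that in auto)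
  have ac: "absolutely_continuous lborel N"
    unfolding absolutely_continuous_def
  proof
    fix A assume A: "A \<in> null_sets (lborel :: real measure)"
    then have [measurable]: "A \<in> sets borel" and A0: "emeasure lborel A = 0" by auto
    have "\<nu> A \<le> 0"
    proof (rule field_le_epsilon)
      fix e :: real assume "e > 0"
      then obtain \<delta> where \<delta>: "\<delta> > 0" "\<forall>A\<in>sets borel. emeasure lborel A < ennreal \<delta> \<longrightarrow> \<nu> A < e"
        using uac by blast
      then have "\<nu> A < e" using A0 by simp
      then show "\<nu> A \<le> 0 + e" by simp
    qed
    then have "\<nu> A = 0" using nonneg[of A] by simp
    then show "A \<in> null_sets N" using eN[of A] sN by (auto simp: null_sets_def)
  qed
  obtain f where f [measurable]: "f \<in> borel_measurable lborel" and fN: "density lborel f = N"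
    using sigma_finite_measure.Radon_Nikodym[OF sigma_finite_lborel ac] sN by auto
  have f_int: "(\<integral>\<^sup>+u. f u * indicator A u \<partial>lborel) = ennreal (\<nu> A)" if [measurable]: "A \<in> sets borel" for A
    using eN[OF that] emeasure_density[of f lborel A] fN by simp
  have "(\<integral>\<^sup>+u. f u \<partial>lborel) \<noteq> \<infinity>" using f_int[of UNIV] by simp
  then have fin: "AE u in lborel. f u \<noteq> \<infinity>" by (intro nn_integral_PInf_AE) auto
  have "(\<integral>\<^sup>+u. f u * indicator (-{-M..M}) u \<partial>lborel) = 0"
    using f_int[of "- {-M..M}"] supp[of "- {-M..M}"] by simp
  then have out: "AE u in lborel. f u * indicator (-{-M..M}) u = 0"
    by (subst (asm) nn_integral_0_iff_AE) auto
  define L where "L u = enn2real (f u) * indicator {-M..M} u" for u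
  have [measurable]: "L \<in> borel_measurable borel" unfolding L_def using f by measurable
  have L_int: "(\<integral>\<^sup>+u. ennreal (L u * indicator A u) \<partial>lborel) = ennreal (\<nu> A)" if [measurable]: "A \<in> sets borel" for A
  proof -
    have "(\<integral>\<^sup>+u. ennreal (L u * indicator A u) \<partial>lborel) = (\<integral>\<^sup>+u. f u * indicator A u \<partial>lborel)"
    proof (rule nn_integral_cong_AE)
      show "AE u in lborel. ennreal (L u * indicator A u) = f u * indicator A u"
        using fin out by eventually_elim (auto simp: L_def indicator_def top.not_eq_extremum split: if_splits)
    qed
    then show ?thesis using f_int[OF that] by simp
  qed
  have L0: "0 \<le> L u" for u by (simp add: L_def)
  show thesis
  proof
    show "integrable lborel L"
      using L_int[of UNIV] L0 by (intro integrableI_nonneg) auto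
    show "\<nu> A = (LINT u|lborel. L u * indicator A u)" if "A \<in> sets borel" for A
      using L_int[OF that] L0 that nonneg[OF that] by (subst integral_eq_nn_integral) auto
  qed (auto simp: L_def)
qed

section \<open>Step function approximation\<close>

text \<open>Rounding \<open>f\<close> down to a multiple of \<open>\<epsilon>\<close>; the sets \<open>A
  j\<close> are the level sets of the rounded function.\<close>

lemma bounded_on_Icc_step_approximation:
  assumes f: "bounded_on_Icc M f" and e: "0 < \<epsilon>"
  shows "\<exists>(J :: int set) c A. finite J \<and> (\<forall>j. A j \<in> sets borel) \<and> (\<forall>j. A j \<subseteq> {-M..M}) \<and>
    (\<forall>u. \<bar>f u - (\<Sum>j\<in>J. c j * indicator (A j) u)\<bar> \<le> \<epsilon> * indicator {-M..M} u)"
proof -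
  have [measurable]: "f \<in> borel_measurable borel" using f by (rule bounded_on_Icc_measurable)
  obtain B where B: "B > 0" "\<And>u. \<bar>f u\<bar> \<le> B" using bounded_on_Icc_bound[OF f] by blast
  define K where "K = \<lceil>B / \<epsilon>\<rceil> + 1"
  define A where "A j = {u. \<lfloor>f u / \<epsilon>\<rfloor> = j} \<inter> {-M..M}" for j
  have 1: "\<bar>f u - (\<Sum>j\<in>{-K..K}. (\<epsilon> * of_int j) * indicator (A j) u)\<bar> \<le> \<epsilon> * indicator {-M..M} u" for u
  proof (cases "u \<in> {-M..M}")
    case True
    have "\<bar>f u / \<epsilon>\<bar> \<le> B / \<epsilon>" using B(2)[of u] e by (simp add: divide_right_mono)
    then have "\<lfloor>f u / \<epsilon>\<rfloor> \<in> {-K..K}" unfolding K_def by (simp, linarith)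
    moreover have "(\<epsilon> * of_int j) * indicator (A j) u = (if j = \<lfloor>f u / \<epsilon>\<rfloor> then \<epsilon> * of_int j else 0)" for j
      using True by (auto simp: A_def indicator_def)
    ultimately have eq: "(\<Sum>j\<in>{-K..K}. (\<epsilon> * of_int j) * indicator (A j) u) = \<epsilon> * of_int \<lfloor>f u / \<epsilon>\<rfloor>" by simp
    define y where "y = f u / \<epsilon>"
    have fy: "f u = \<epsilon> * y" using e by (simp add: y_def)
    have "\<epsilon> * of_int \<lfloor>y\<rfloor> \<le> \<epsilon> * y" using e by (intro mult_left_mono) auto
    moreover have "\<epsilon> * y < \<epsilon> * (of_int \<lfloor>y\<rfloor> + 1)" using e by (intro mult_strict_left_mono) auto
    ultimately have "\<epsilon> * of_int \<lfloor>f u / \<epsilon>\<rfloor> \<le> f u" "f u < \<epsilon> * of_int \<lfloor>f u / \<epsilon>\<rfloor> + \<epsilon>"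
      unfolding fy using e by (simp_all add: algebra_simps)
    then show ?thesis using True eq by simp
  next
    case False
    then show ?thesis using bounded_on_Icc_outside[OF f False] by (simp add: A_def)
  qed
  have "\<forall>j. A j \<in> sets borel" "\<forall>j. A j \<subseteq> {-M..M}" by (auto simp: A_def)
  then show ?thesis using 1
    by (intro exI[of _ "{-K..K}"] exI[of _ "\<lambda>j. \<epsilon> * of_int j"] exI[of _ A]) blast
qed

section \<open>The Vitali--Hahn--Saks theorem\<close>

text \<open>The definition is meant for nonnegative \<open>F n\<close>, so that no absolute value is taken.\<close>

definition uniformly_abs_continuous :: "(nat \<Rightarrow> real \<Rightarrow> real) \<Rightarrow> bool" where
  "uniformly_abs_continuous F \<longleftrightarrow> (\<forall>\<epsilon>>0. \<exists>\<delta>>0. \<forall>A\<in>sets borel. emeasure lborel A < ennreal \<delta> \<longrightarrow>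
      (\<forall>n. (LINT u|lborel. F n u * indicator A u) < \<epsilon>))"

text \<open>A gliding hump. Borel subsets of the interval form a metric space under the measure
  \<open>d\<close> of the symmetric difference, on which each \<open>\<mu> n\<close> is Lipschitz
  with a constant \<open>B n\<close> that depends on \<open>n\<close>. If uniform absolute
  continuity failed, then any set \<open>A\<close> could be changed by a very small set, on which
  some \<open>\<mu> n\<close> with large \<open>n\<close> has mass \<open>\<epsilon>\<close>, so
  as to make \<open>\<mu> n\<close> and some \<open>\<mu> m\<close> differ by
  \<open>\<epsilon>/4\<close> on a whole ball around the new set. Iterating with larger and larger
  indices and rapidly shrinking balls, the sets converge to a set \<open>X\<close> inside all the
  balls, on which \<open>\<mu> n X\<close> is not a Cauchy sequence.\<close>

lemma Vitali_Hahn_Saks: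
  assumes F: "\<And>n. bounded_on_Icc M (F n)" and pos: "\<And>n u. 0 \<le> F n u"
    and conv: "\<And>A. A \<in> sets borel \<Longrightarrow> A \<subseteq> {-M..M} \<Longrightarrow> convergent (\<lambda>n. LINT u|lborel. F n u * indicator A u)"
  shows "uniformly_abs_continuous F"
proof (rule ccontr)
  define \<mu> where "\<mu> n A = (LINT u|lborel. F n u * indicator A u)" for n A
  define S where "S = {A. A \<in> sets borel \<and> A \<subseteq> {-M..M}}"
  define d where "d A B = measure lborel ((A - B) \<union> (B - A))" for A B :: "real set"
  have finS: "emeasure lborel A < top" if "A \<in> S" for A
    using that emeasure_mono[of A "{-M..M}" lborel] emeasure_lborel_Icc_finite[of "-M" M]
    by (auto simp: S_def intro: le_less_trans)
  have intF: "integrable lborel (\<lambda>u. F n u * indicator A u)" if "A \<in> sets borel" for n A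
    using integrable_bounded_on_Icc_indicator[OF F that] .
  have "\<exists>B>0. \<forall>u. \<bar>F n u\<bar> \<le> B" for n using bounded_on_Icc_bound[OF F] .
  then obtain B where B: "\<And>n. B n > 0" "\<And>n u. \<bar>F n u\<bar> \<le> B n" by metis
  have Lip: "\<bar>\<mu> n A - \<mu> n A'\<bar> \<le> B n * d A A'" if A: "A \<in> S" "A' \<in> S" for n A A'
  proof -
    have [measurable]: "A \<in> sets borel" "A' \<in> sets borel" using A by (auto simp: S_def)
    define D where "D = (A - A') \<union> (A' - A)"
    have D: "D \<in> S" using A by (auto simp: S_def D_def)
    then have [measurable]: "D \<in> sets borel" by (simp add: S_def)
    have "\<mu> n A - \<mu> n A' = (LINT u|lborel. F n u * indicator A u - F n u * indicator A' u)"
      unfolding \<mu>_def by (rule Bochner_Integration.integral_diff[symmetric]) (auto intro: intF)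
    also have "\<bar>\<dots>\<bar> \<le> (LINT u|lborel. \<bar>F n u * indicator A u - F n u * indicator A' u\<bar>)"
      by (rule integral_abs_bound)
    also have "\<dots> \<le> (LINT u|lborel. B n * indicator D u)"
    proof (rule integral_mono)
      show "integrable lborel (\<lambda>u. \<bar>F n u * indicator A u - F n u * indicator A' u\<bar>)"
        by (intro Bochner_Integration.integrable_abs Bochner_Integration.integrable_diff intF) auto
      show "integrable lborel (\<lambda>u. B n * indicator D u)"
        by (intro integrable_mult_right integrable_real_indicator) (use finS[OF D] in auto)
      show "\<bar>F n u * indicator A u - F n u * indicator A' u\<bar> \<le> B n * indicator D u" for u
        using B(2)[of n u] B(1)[of n] by (auto simp: D_def indicator_def)
    qed
    also have "\<dots> = B n * d A A'" by (simp add: d_def D_def)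
    finally show ?thesis .
  qed
  assume "\<not> uniformly_abs_continuous F"
  then obtain \<epsilon> where e: "\<epsilon> > 0"
    and bad: "\<And>\<delta>. \<delta> > 0 \<Longrightarrow> \<exists>A\<in>sets borel. emeasure lborel A < ennreal \<delta> \<and> (\<exists>n. \<epsilon> \<le> (LINT u|lborel. F n u * indicator A u))"
    unfolding uniformly_abs_continuous_def by (metis not_less)
  have bad: "\<exists>A\<in>S. \<exists>n. measure lborel A < \<delta> \<and> \<epsilon> \<le> \<mu> n A" if \<delta>: "\<delta> > 0" for \<delta>
  proof -
    obtain A n where A [measurable]: "A \<in> sets borel" and l: "emeasure lborel A < ennreal \<delta>" and m: "\<epsilon> \<le> (LINT u|lborel. F n u * indicator A u)"
      using bad[OF \<delta>] by blast
    have "(LINT u|lborel. F n u * indicator A u) = \<mu> n (A \<inter> {-M..M})"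
      unfolding \<mu>_def using bounded_on_Icc_outside[OF F] by (intro Bochner_Integration.integral_cong) (auto simp: indicator_def)
    moreover have AS: "A \<inter> {-M..M} \<in> S" by (simp add: S_def)
    moreover have "measure lborel (A \<inter> {-M..M}) < \<delta>"
    proof -
      have "emeasure lborel (A \<inter> {-M..M}) < ennreal \<delta>"
        using l emeasure_mono[of "A \<inter> {-M..M}" A lborel] by auto
      then show ?thesis using finS[OF AS] \<delta>
        by (subst (asm) emeasure_eq_ennreal_measure) (auto simp: ennreal_less_iff)
    qed
    ultimately show ?thesis using m by auto
  qed
  \<comment> \<open>\<open>good N A \<delta>\<close>: on the ball of radius \<open>\<delta>\<close> around
    \<open>A\<close> two indices beyond \<open>N\<close> disagree by \<open>\<epsilon> / 4\<close>\<close>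
  define good where "good = (\<lambda>N A \<delta>. \<exists>m\<ge>N. \<exists>n\<ge>N. \<forall>A''\<in>S. d A'' A \<le> \<delta> \<longrightarrow> \<epsilon> / 4 \<le> \<bar>\<mu> n A'' - \<mu> m A''\<bar>)"
  have step: "\<exists>A' \<delta>'. A' \<in> S \<and> 0 < \<delta>' \<and> \<delta>' \<le> \<delta> / 2 \<and> d A' A \<le> \<delta> / 2 \<and> good N A' \<delta>'"
    if A: "A \<in> S" and \<delta>: "\<delta> > 0" for A \<delta> N
  proof -
    have "Cauchy (\<lambda>n. \<mu> n A)" using conv[of A] A unfolding \<mu>_def S_def by (simp add: Cauchy_convergent_iff)
    then obtain N0 where N0: "\<And>m n. m \<ge> N0 \<Longrightarrow> n \<ge> N0 \<Longrightarrow> \<bar>\<mu> m A - \<mu> n A\<bar> < \<epsilon> / 16"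
      using e unfolding Cauchy_def dist_real_def by (metis divide_pos_pos zero_less_numeral)
    define m where "m = max N N0"
    define S0 where "S0 = (\<Sum>i\<le>m. B i)"
    have S0: "B i \<le> S0" if "i \<le> m" for i
      unfolding S0_def using that B(1) by (intro member_le_sum) (auto intro: less_imp_le)
    have S0p: "S0 > 0" using S0[of m] B(1)[of m] by simp
    \<comment> \<open>The bound \<open>S0\<close> controls the Lipschitz constants up to index \<open>m\<close>. It
      makes \<open>D\<close> invisible for these indices, so that \<open>n > m\<close>, and keeps
      \<open>\<mu> m\<close> nearly unchanged below.\<close>
    define \<delta>1 where "\<delta>1 = min (\<delta> / 2) (\<epsilon> / (32 * S0))"
    have \<delta>1: "\<delta>1 > 0" using \<delta> e S0p by (simp add: \<delta>1_def)
    obtain D n where D: "D \<in> S" "measure lborel D < \<delta>1" "\<epsilon> \<le> \<mu> n D" using bad[OF \<delta>1] by blast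
    have \<mu>0: "\<mu> n {} = 0" for n by (simp add: \<mu>_def)
    have emS: "{} \<in> S" by (simp add: S_def)
    have n: "n > m"
    proof (rule ccontr)
      assume "\<not> n > m"
      then have "B n \<le> S0" using S0 by simp
      have "\<mu> n D \<le> B n * measure lborel D" using Lip[OF D(1) emS, of n] \<mu>0 by (simp add: d_def)
      also have "\<dots> \<le> S0 * \<delta>1" using D(2) \<open>B n \<le> S0\<close> B(1)[of n] by (intro mult_mono) auto
      also have "\<dots> \<le> S0 * (\<epsilon> / (32 * S0))" using S0p by (intro mult_left_mono) (auto simp: \<delta>1_def)
      also have "\<dots> < \<epsilon>" using S0p e by simp
      finally show False using D(3) by simp
    qed
    have [measurable]: "A \<in> sets borel" "D \<in> sets borel" using A D by (auto simp: S_def)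
    have "\<mu> n (A \<union> D) - \<mu> n (A - D) = \<mu> n D"
    proof -
      have "\<mu> n (A \<union> D) = (LINT u|lborel. F n u * indicator (A - D) u + F n u * indicator D u)"
        unfolding \<mu>_def by (intro Bochner_Integration.integral_cong) (auto simp: indicator_def)
      also have "\<dots> = \<mu> n (A - D) + \<mu> n D"
        unfolding \<mu>_def by (rule Bochner_Integration.integral_add) (auto intro: intF)
      finally show ?thesis by simp
    qed
    \<comment> \<open>One of the two modifications of \<open>A\<close> by \<open>D\<close> must change \<open>\<mu>
      n\<close> by half of the mass of \<open>D\<close>.\<close>
    then have "\<bar>\<mu> n (A \<union> D) - \<mu> n A\<bar> \<ge> \<epsilon> / 2 \<or> \<bar>\<mu> n (A - D) - \<mu> n A\<bar> \<ge> \<epsilon> / 2"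
      using D(3) by linarith
    then obtain A' where A': "A' = A \<union> D \<or> A' = A - D" and far: "\<bar>\<mu> n A' - \<mu> n A\<bar> \<ge> \<epsilon> / 2" by blast
    have A'S: "A' \<in> S" using A' A D by (auto simp: S_def)
    then have [measurable]: "A' \<in> sets borel" by (simp add: S_def)
    have dA': "d A' A \<le> \<delta>1"
    proof -
      have "d A' A \<le> measure lborel D" unfolding d_def
        by (rule measure_mono_fmeasurable) (use A' finS[OF D(1)] in \<open>auto simp: fmeasurable_def\<close>)
      then show ?thesis using D(2) by simp
    qed
    \<comment> \<open>On the new ball \<open>\<mu> n\<close> varies by at most \<open>\<epsilon> / 32\<close> and
      \<open>\<mu> m\<close> stays within \<open>\<epsilon> / 16\<close> of its value at
      \<open>A\<close>; since also \<open>\<mu> n A\<close> and \<open>\<mu> m A\<close> differ by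
      less than \<open>\<epsilon> / 16\<close>, more than \<open>\<epsilon> / 4\<close> of the gap
      \<open>\<epsilon> / 2\<close> is left.\<close>
    define \<delta>' where "\<delta>' = min (\<delta> / 2) (\<epsilon> / (32 * (S0 + B n)))"
    have \<delta>': "\<delta>' > 0" using \<delta> e S0p B(1)[of n] by (simp add: \<delta>'_def)
    have tri: "d A'' A \<le> d A'' A' + d A' A" if "A'' \<in> S" for A''
    proof -
      have [measurable]: "A'' \<in> sets borel" using that by (simp add: S_def)
      have s1: "(A'' - A') \<union> (A' - A'') \<in> S" and s2: "(A' - A) \<union> (A - A') \<in> S" using that A'S A by (auto simp: S_def)
      have "d A'' A \<le> measure lborel (((A'' - A') \<union> (A' - A'')) \<union> ((A' - A) \<union> (A - A')))"
        unfolding d_def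
      proof (rule measure_mono_fmeasurable)
        have "((A'' - A') \<union> (A' - A'')) \<union> ((A' - A) \<union> (A - A')) \<in> S" using s1 s2 by (auto simp: S_def)
        then show "((A'' - A') \<union> (A' - A'')) \<union> ((A' - A) \<union> (A - A')) \<in> fmeasurable lborel"
          using finS by (auto simp: fmeasurable_def S_def)
      qed auto
      also have "\<dots> \<le> d A'' A' + d A' A"
        unfolding d_def by (rule measure_Un_le) (use s1 s2 in \<open>auto simp: S_def\<close>)
      finally show ?thesis .
    qed
    have apart: "\<forall>A''\<in>S. d A'' A' \<le> \<delta>' \<longrightarrow> \<epsilon> / 4 \<le> \<bar>\<mu> n A'' - \<mu> m A''\<bar>"
    proof (intro ballI impI)
      fix A'' assume A'': "A'' \<in> S" "d A'' A' \<le> \<delta>'"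
      have dn: "0 \<le> d X Y" for X Y by (simp add: d_def)
      have "\<bar>\<mu> n A'' - \<mu> n A'\<bar> \<le> B n * \<delta>'"
        using Lip[OF A''(1) A'S, of n] A''(2) B(1)[of n] by (smt (verit) mult_left_mono)
      also have "\<dots> \<le> (S0 + B n) * (\<epsilon> / (32 * (S0 + B n)))"
        using S0p B(1)[of n] \<delta>' by (intro mult_mono) (auto simp: \<delta>'_def)
      also have "\<dots> = \<epsilon> / 32" using S0p B(1)[of n] by (simp add: field_simps)
      finally have 1: "\<bar>\<mu> n A'' - \<mu> n A'\<bar> \<le> \<epsilon> / 32" .
      have "\<bar>\<mu> m A'' - \<mu> m A\<bar> \<le> B m * d A'' A" by (rule Lip[OF A''(1) A])
      also have "\<dots> \<le> S0 * (\<epsilon> / (32 * S0) + \<epsilon> / (32 * S0))"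
      proof (rule mult_mono)
        have "\<epsilon> / (32 * (S0 + B n)) \<le> \<epsilon> / (32 * S0)" using S0p B(1)[of n] e by (intro divide_left_mono) auto
        then show "d A'' A \<le> \<epsilon> / (32 * S0) + \<epsilon> / (32 * S0)"
          using tri[OF A''(1)] A''(2) dA' by (auto simp: \<delta>1_def \<delta>'_def)
      qed (use S0[of m] S0p dn in auto)
      also have "\<dots> = \<epsilon> / 16" using S0p by (simp add: field_simps)
      finally have 2: "\<bar>\<mu> m A'' - \<mu> m A\<bar> \<le> \<epsilon> / 16" .
      have "\<bar>\<mu> n A - \<mu> m A\<bar> < \<epsilon> / 16" using N0[of n m] n by (simp add: m_def)
      then show "\<epsilon> / 4 \<le> \<bar>\<mu> n A'' - \<mu> m A''\<bar>" using 1 2 far e by linarith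
    qed
    have "N \<le> m" "N \<le> n" using n by (auto simp: m_def)
    with apart have "good N A' \<delta>'" unfolding good_def by blast
    moreover have "\<delta>' \<le> \<delta> / 2" unfolding \<delta>'_def by (rule min.cobounded1)
    moreover have "d A' A \<le> \<delta> / 2" using dA' by (simp add: \<delta>1_def)
    ultimately show ?thesis using A'S \<delta>' by blast
  qed
  have "\<exists>f. \<forall>k. (fst (f k) \<in> S \<and> 0 < snd (f k)) \<and>
     (snd (f (Suc k)) \<le> snd (f k) / 2 \<and> d (fst (f (Suc k))) (fst (f k)) \<le> snd (f k) / 2 \<and> good k (fst (f (Suc k))) (snd (f (Suc k))))"
  proof (rule dependent_nat_choice[where P="\<lambda>_ y. fst y \<in> S \<and> 0 < snd y" and
        Q="\<lambda>k z y. snd y \<le> snd z / 2 \<and> d (fst y) (fst z) \<le> snd z / 2 \<and> good k (fst y) (snd y)"])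
    show "\<exists>x. fst x \<in> S \<and> (0::real) < snd x" by (intro exI[of _ "({}, 1)"]) (simp add: S_def)
    fix z :: "real set \<times> real" and k assume "fst z \<in> S \<and> 0 < snd z"
    then obtain A' \<delta>' where "A' \<in> S \<and> 0 < \<delta>' \<and> \<delta>' \<le> snd z / 2 \<and> d A' (fst z) \<le> snd z / 2 \<and> good k A' \<delta>'"
      using step[of "fst z" "snd z" k] by blast
    then show "\<exists>y. (fst y \<in> S \<and> 0 < snd y) \<and> snd y \<le> snd z / 2 \<and> d (fst y) (fst z) \<le> snd z / 2 \<and> good k (fst y) (snd y)"
      by (intro exI[of _ "(A', \<delta>')"]) simp
  qed
  then obtain f where f: "\<And>k. fst (f k) \<in> S" "\<And>k. 0 < snd (f k)" "\<And>k. snd (f (Suc k)) \<le> snd (f k) / 2"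
      "\<And>k. d (fst (f (Suc k))) (fst (f k)) \<le> snd (f k) / 2" "\<And>k. good k (fst (f (Suc k))) (snd (f (Suc k)))" by blast
  define E where "E k = fst (f k)" for k
  define r where "r k = snd (f k)" for k
  have E: "\<And>k. E k \<in> S" "\<And>k. 0 < r k" "\<And>k. r (Suc k) \<le> r k / 2" "\<And>k. d (E (Suc k)) (E k) \<le> r k / 2" "\<And>k. good k (E (Suc k)) (r (Suc k))"
    using f unfolding E_def r_def by auto
  have [measurable]: "E k \<in> sets borel" for k using E(1)[of k] by (simp add: S_def)
  have r: "r (k + i) \<le> r k * (1/2) ^ i" for k i
  proof (induction i)
    case (Suc i)
    then show ?case using E(3)[of "k+i"] by simp
  qed simp
  \<comment> \<open>Radii at least halve and steps are at most half of the current radius, so the lower limit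
    \<open>X\<close> of the sets lies within \<open>r k\<close> of \<open>E k\<close>.\<close>
  define X where "X = (\<Union>k. \<Inter>j\<in>{k..}. E j)"
  have XS: "X \<in> S" using E(1) unfolding X_def S_def by auto
  then have [measurable]: "X \<in> sets borel" by (simp add: S_def)
  have close: "d X (E k) \<le> r k" for k
  proof -
    define D where "D i = (E (Suc (k+i)) - E (k+i)) \<union> (E (k+i) - E (Suc (k+i)))" for i
    have DS: "D i \<in> S" for i using E(1) by (auto simp: D_def S_def)
    have [measurable]: "D i \<in> sets borel" for i using DS[of i] by (simp add: S_def)
    have sub: "(X - E k) \<union> (E k - X) \<subseteq> (\<Union>i. D i)"
    proof
      fix u assume u: "u \<in> (X - E k) \<union> (E k - X)"
      show "u \<in> (\<Union>i. D i)"
      proof (rule ccontr)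
        assume "u \<notin> (\<Union>i. D i)"
        then have eq: "u \<in> E (Suc (k+i)) \<longleftrightarrow> u \<in> E (k+i)" for i by (auto simp: D_def)
        have all: "u \<in> E (k+i) \<longleftrightarrow> u \<in> E k" for i by (induction i) (use eq in auto)
        have all': "u \<in> E j \<longleftrightarrow> u \<in> E k" if "j \<ge> k" for j using all[of "j-k"] that by simp
        have "u \<in> X \<longleftrightarrow> u \<in> E k"
        proof
          assume "u \<in> X"
          then obtain l where "\<forall>j\<ge>l. u \<in> E j" by (auto simp: X_def)
          then show "u \<in> E k" using all'[of "max k l"] by auto
        next
          assume "u \<in> E k"
          then have "u \<in> E j" if "j \<ge> k" for j using all'[OF that] by blast
          then have "u \<in> (\<Inter>j\<in>{k..}. E j)" by auto
          then show "u \<in> X" unfolding X_def by blast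
        qed
        then show False using u by auto
      qed
    qed
    have "emeasure lborel ((X - E k) \<union> (E k - X)) \<le> emeasure lborel (\<Union>i. D i)"
      by (rule emeasure_mono[OF sub]) auto
    also have "\<dots> \<le> (\<Sum>i. emeasure lborel (D i))"
      by (rule emeasure_subadditive_countably) auto
    also have "\<dots> \<le> (\<Sum>i. ennreal (r k / 2 * (1/2) ^ i))"
    proof (rule suminf_le)
      fix i
      have "measure lborel (D i) \<le> r k / 2 * (1/2) ^ i" using E(4)[of "k+i"] r[of k i] by (simp add: d_def D_def)
      then show "emeasure lborel (D i) \<le> ennreal (r k / 2 * (1/2) ^ i)"
        using finS[OF DS[of i]] by (subst emeasure_eq_ennreal_measure) (auto intro: ennreal_leI)
    qed auto
    also have "\<dots> = ennreal (\<Sum>i. r k / 2 * (1/2) ^ i)"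
      using E(2)[of k] by (intro suminf_ennreal2) (auto intro!: summable_mult less_imp_le)
    also have "(\<Sum>i. r k / 2 * (1/2) ^ i) = r k"
      by (subst suminf_mult) (auto simp: suminf_geometric)
    finally have *: "emeasure lborel ((X - E k) \<union> (E k - X)) \<le> ennreal (r k)" .
    have "(X - E k) \<union> (E k - X) \<in> S" using XS E(1)[of k] by (auto simp: S_def)
    from finS[OF this] show ?thesis using * E(2)[of k] unfolding d_def
      by (subst (asm) emeasure_eq_ennreal_measure) auto
  qed
  have "Cauchy (\<lambda>n. \<mu> n X)" using conv[of X] XS unfolding \<mu>_def S_def by (simp add: Cauchy_convergent_iff)
  then obtain N where N: "\<And>m n. m \<ge> N \<Longrightarrow> n \<ge> N \<Longrightarrow> \<bar>\<mu> m X - \<mu> n X\<bar> < \<epsilon> / 4"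
    using e unfolding Cauchy_def dist_real_def by (metis divide_pos_pos zero_less_numeral)
  obtain m n where "m \<ge> N" "n \<ge> N" "\<epsilon> / 4 \<le> \<bar>\<mu> n X - \<mu> m X\<bar>"
    using E(5)[of N] close[of "Suc N"] XS unfolding good_def by blast
  then show False using N[of n m] by simp
qed

section \<open>Uniform boundedness\<close>

lemma powr_midpoint_convex:
  fixes a b s :: real
  assumes s: "1 \<le> s" and ab: "0 \<le> a" "0 \<le> b"
  shows "((a + b) / 2) powr s \<le> (a powr s + b powr s) / 2"
proof -
  have half: "(c / 2) powr s \<le> c powr s / 2" if "0 \<le> c" for c :: real
  proof -
    have "(1/2) powr s \<le> (1/2 :: real) powr 1" using s by (intro powr_mono') auto
    then have "c powr s * (1/2) powr s \<le> c powr s * (1/2)" by (intro mult_left_mono) auto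
    moreover have "(c / 2) powr s = c powr s * (1/2) powr s" using that by (simp add: powr_divide)
    ultimately show ?thesis by simp
  qed
  show ?thesis
  proof (cases "a = 0 \<or> b = 0")
    case True
    then show ?thesis using half[of a] half[of b] ab s by auto
  next
    case False
    then have "((1 - 1/2) *\<^sub>R a + (1/2) *\<^sub>R b) powr s \<le> (1 - 1/2) * a powr s + (1/2) * b powr s"
      using ab by (intro convex_onD[OF powr_convex[OF s]]) auto
    then show ?thesis by (simp add: add_divide_distrib)
  qed
qed

lemma powr_dyadic_sum_le:
  fixes y :: "nat \<Rightarrow> real"
  assumes s: "1 \<le> s" and y: "\<And>k. 0 \<le> y k"
  shows "(\<Sum>k<n. (1/2) ^ Suc k * y k) powr s \<le> (\<Sum>k<n. (1/2) ^ Suc k * y k powr s)"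
  using y
proof (induction n arbitrary: y)
  case (Suc n)
  have eq: "(\<Sum>k<Suc n. (1/2) ^ Suc k * y k) = (y 0 + (\<Sum>k<n. (1/2) ^ Suc k * y (Suc k))) / 2"
    by (subst sum.lessThan_Suc_shift) (simp add: sum_distrib_left sum_divide_distrib add_divide_distrib)
  have "(\<Sum>k<Suc n. (1/2) ^ Suc k * y k) powr s \<le> (y 0 powr s + (\<Sum>k<n. (1/2) ^ Suc k * y (Suc k)) powr s) / 2"
    unfolding eq using Suc.prems by (intro powr_midpoint_convex[OF s] sum_nonneg) auto
  also have "\<dots> \<le> (y 0 powr s + (\<Sum>k<n. (1/2) ^ Suc k * y (Suc k) powr s)) / 2"
    using Suc.IH[of "\<lambda>k. y (Suc k)"] Suc.prems by (intro divide_right_mono add_left_mono) auto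
  also have "\<dots> = (\<Sum>k<Suc n. (1/2) ^ Suc k * y k powr s)"
    by (subst sum.lessThan_Suc_shift) (simp add: sum_distrib_left sum_divide_distrib add_divide_distrib)
  finally show ?case .
qed simp

text \<open>Convexity of \<open>y powr s\<close> bounds the integral of the partial sums by that of
  \<open>\<Sum> (1/2) ^ Suc k * h k u powr s\<close>, and monotone convergence passes to the whole
  series. Nonnegativity keeps each single term below the sum.\<close>

lemma dyadic_series_in_Lp:
  assumes s: "1 \<le> s" and bd: "\<And>k. bounded_on_Icc M (h k)" and pos: "\<And>k u. 0 \<le> h k u"
    and norm: "\<And>k. Lp_norm (ennreal s) (h k) \<le> 1"
  obtains H where "H \<in> Lp (ennreal s)" "\<And>u. 0 \<le> H u" "\<And>k. AE u in lborel. (1/2) ^ Suc k * h k u \<le> H u"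
proof -
  have [measurable]: "h k \<in> borel_measurable borel" for k using bd by (rule bounded_on_Icc_measurable)
  define S where "S n u = (\<Sum>k<n. (1/2) ^ Suc k * h k u)" for n u
  have [measurable]: "S n \<in> borel_measurable borel" for n unfolding S_def by measurable
  have S0: "0 \<le> S n u" for n u unfolding S_def using pos by (intro sum_nonneg mult_nonneg_nonneg) auto
  have S_mono: "S m u \<le> S n u" if "m \<le> n" for m n u
    unfolding S_def using that pos by (intro sum_mono2) (auto intro!: mult_nonneg_nonneg)
  have int_h: "integrable lborel (\<lambda>u. h k u powr s)" for k
    using bounded_on_Icc_Lp[of "ennreal s" M "h k"] bd s pos by (simp add: Lp_finite_iff)
  have h1: "(LINT u|lborel. h k u powr s) \<le> 1" for k
    using Lp_norm_powr[OF s, of "h k"] norm[of k] Lp_norm_nonneg[of "ennreal s" "h k"] pos s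
    by (metis (no_types, lifting) Bochner_Integration.integral_cong abs_of_nonneg powr_le1 order_trans zero_le_one)
  have int_S: "(\<integral>\<^sup>+u. ennreal (S n u powr s) \<partial>lborel) \<le> 1" for n
  proof -
    have "(\<integral>\<^sup>+u. ennreal (S n u powr s) \<partial>lborel) \<le> (\<integral>\<^sup>+u. ennreal (\<Sum>k<n. (1/2) ^ Suc k * h k u powr s) \<partial>lborel)"
      unfolding S_def by (intro nn_integral_mono ennreal_leI powr_dyadic_sum_le[OF s] pos)
    also have "\<dots> = ennreal (LINT u|lborel. (\<Sum>k<n. (1/2) ^ Suc k * h k u powr s))"
      by (rule nn_integral_eq_integral) (auto intro!: Bochner_Integration.integrable_sum integrable_mult_right int_h sum_nonneg mult_nonneg_nonneg)
    also have "(LINT u|lborel. (\<Sum>k<n. (1/2) ^ Suc k * h k u powr s)) = (\<Sum>k<n. (1/2) ^ Suc k * (LINT u|lborel. h k u powr s))"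
      by (subst Bochner_Integration.integral_sum) (auto intro!: integrable_mult_right int_h)
    also have "\<dots> \<le> (\<Sum>k<n. (1/2) ^ Suc k * 1)"
      using h1 by (intro sum_mono mult_left_mono) auto
    also have "\<dots> \<le> (\<Sum>k. (1/2::real) ^ Suc k * 1)"
      by (intro sum_le_suminf) (auto intro!: summable_mult summable_geometric simp: summable_Suc_iff)
    also have "\<dots> = 1" using suminf_mult[of "\<lambda>k. (1/2::real)^k" "1/2"] by (simp add: suminf_geometric summable_geometric)
    finally show ?thesis by (simp add: ennreal_leI)
  qed
  have int_sup: "(\<integral>\<^sup>+u. (SUP n. ennreal (S n u powr s)) \<partial>lborel) \<le> 1"
  proof -
    have "(\<integral>\<^sup>+u. (SUP n. ennreal (S n u powr s)) \<partial>lborel) = (SUP n. \<integral>\<^sup>+u. ennreal (S n u powr s) \<partial>lborel)"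
      by (rule nn_integral_monotone_convergence_SUP)
         (use S_mono S0 s in \<open>auto simp: incseq_def le_fun_def intro!: ennreal_leI powr_mono2\<close>)
    also have "\<dots> \<le> 1" using int_S by (rule SUP_least)
    finally show ?thesis .
  qed
  have fin: "AE u in lborel. (SUP n. ennreal (S n u powr s)) \<noteq> \<infinity>"
    by (rule nn_integral_PInf_AE) (use int_sup in \<open>auto simp: top_unique\<close>)
  \<comment> \<open>The absolute value makes \<open>H\<close> nonnegative also where the series diverges.\<close>
  define H where "H u = \<bar>\<Sum>k. (1/2) ^ Suc k * h k u\<bar>" for u
  have [measurable]: "H \<in> borel_measurable borel" unfolding H_def by measurable
  have sm: "AE u in lborel. summable (\<lambda>k. (1/2) ^ Suc k * h k u)"
    using fin
  proof eventually_elim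
    case (elim u)
    then obtain K where K: "K \<ge> 0" "(SUP n. ennreal (S n u powr s)) = ennreal K"
      by (cases "SUP n. ennreal (S n u powr s)") auto
    show ?case
    proof (rule summableI_nonneg_bounded)
      show "0 \<le> (1/2) ^ Suc k * h k u" for k using pos by simp
      fix n
      have "ennreal (S n u powr s) \<le> ennreal K" unfolding K(2)[symmetric] by (rule SUP_upper) simp
      then have "S n u powr s \<le> K" using K(1) by simp
      then have "(S n u powr s) powr (1/s) \<le> K powr (1/s)" using s by (intro powr_mono2) auto
      then show "(\<Sum>k<n. (1/2) ^ Suc k * h k u) \<le> K powr (1/s)"
        using s S0[of n u] by (simp add: powr_powr S_def)
    qed
  qed
  have H_eq: "H u = (\<Sum>k. (1/2) ^ Suc k * h k u)" if "summable (\<lambda>k. (1/2) ^ Suc k * h k u)" for u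
    unfolding H_def using that pos by (intro abs_of_nonneg suminf_nonneg) auto
  have "AE u in lborel. ennreal (H u powr s) \<le> (SUP n. ennreal (S n u powr s))"
    using sm
  proof eventually_elim
    case (elim u)
    have "(\<lambda>n. S n u) \<longlonglongrightarrow> H u"
      unfolding S_def H_eq[OF elim] using elim by (rule summable_LIMSEQ)
    then have "(\<lambda>n. S n u powr s) \<longlonglongrightarrow> H u powr s"
      using s S0 by (intro tendsto_powr') auto
    then have "(\<lambda>n. ennreal (S n u powr s)) \<longlonglongrightarrow> ennreal (H u powr s)" by (rule tendsto_ennrealI)
    then show ?case by (rule LIMSEQ_le_const2) (intro exI allI impI SUP_upper, simp)
  qed
  then have "(\<integral>\<^sup>+u. ennreal (H u powr s) \<partial>lborel) \<le> (\<integral>\<^sup>+u. (SUP n. ennreal (S n u powr s)) \<partial>lborel)"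
    by (rule nn_integral_mono_AE)
  also have "\<dots> \<le> 1" by (rule int_sup)
  finally have "(\<integral>\<^sup>+u. ennreal (H u powr s) \<partial>lborel) < \<infinity>" by (auto intro: le_less_trans)
  then have "integrable lborel (\<lambda>u. \<bar>H u\<bar> powr s)"
    by (intro integrableI_bounded) (auto simp: H_def)
  then have 1: "H \<in> Lp (ennreal s)" using s by (simp add: Lp_finite_iff)
  have 2: "AE u in lborel. (1/2) ^ Suc k * h k u \<le> H u" for k
    using sm
  proof eventually_elim
    case (elim u)
    have "(\<Sum>j\<in>{k}. (1/2) ^ Suc j * h j u) \<le> (\<Sum>j. (1/2) ^ Suc j * h j u)"
      by (rule sum_le_suminf[OF elim]) (auto simp: pos)
    then show ?case using H_eq[OF elim] by simp
  qed
  show thesis by (rule that[OF 1 _ 2]) (simp add: H_def)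
qed

text \<open>Nonnegativity turns the uniform boundedness principle into a summation: with near-extremal
  weights \<open>h k\<close> for densities of norm above \<open>4 ^ k\<close>, the single weight
  \<open>H = \<Sum> (1/2) ^ Suc k * h k\<close> would have unbounded pairings, since no
  cancellation can occur.\<close>

lemma Banach_Steinhaus_nonneg:
  assumes pq: "conjugate p q" and F: "\<And>n. bounded_on_Icc M (F n)" and pos: "\<And>n u. 0 \<le> F n u"
    and conv: "\<And>h. h \<in> Lp q \<Longrightarrow> convergent (\<lambda>n. LINT u|lborel. F n u * h u)"
  shows "\<exists>C. \<forall>n. Lp_norm p (F n) \<le> C"
proof (cases "q = top")
  case True
  have p: "p = 1" using pq True by (cases rule: conjugate_cases) auto
  have "indicator {-M..M} \<in> Lp q" by (rule bounded_on_Icc_Lp[OF conjugate_ge_1(2)[OF pq] bounded_on_Icc_indicator]) auto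
  from convergent_imp_Bseq[OF conv[OF this]] obtain C where C: "\<And>n. \<bar>LINT u|lborel. F n u * indicator {-M..M} u\<bar> \<le> C"
    unfolding Bseq_def by auto
  have "F n u * indicator {-M..M} u = \<bar>F n u\<bar>" for n u
    using bounded_on_Icc_outside[OF F, of u n] pos[of n u] by (cases "u \<in> {-M..M}") auto
  then have "Lp_norm p (F n) \<le> C" for n using C[of n] by (simp add: p Lp_norm_1)
  then show ?thesis by blast
next
  case False
  obtain s where s: "1 \<le> s" "q = ennreal s"
    using conjugate_ge_1(2)[OF pq] False by (cases rule: exponent_cases) auto
  show ?thesis
  proof (rule ccontr)
    assume "\<not> ?thesis"
    then have "\<forall>k::nat. \<exists>n. 4 ^ k < Lp_norm p (F n)" by (metis not_le)
    then obtain n where n: "\<And>k::nat. 4 ^ k < Lp_norm p (F (n k))" by metis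
    have "\<exists>h. bounded_on_Icc M h \<and> (\<forall>u. 0 \<le> h u) \<and> Lp_norm q h \<le> 1 \<and> Lp_norm p (F (n k)) \<le> 2 * (LINT u|lborel. F (n k) u * h u)" for k
      by (rule converse_Holder[OF pq F pos, of "n k"]) blast
    then obtain h where h: "\<And>k. bounded_on_Icc M (h k)" "\<And>k u. 0 \<le> h k u" "\<And>k. Lp_norm q (h k) \<le> 1"
      "\<And>k. Lp_norm p (F (n k)) \<le> 2 * (LINT u|lborel. F (n k) u * h k u)" by metis
    have "\<exists>H. H \<in> Lp q \<and> (\<forall>u. 0 \<le> H u) \<and> (\<forall>k. AE u in lborel. (1/2) ^ Suc k * h k u \<le> H u)"
      unfolding s(2) by (rule dyadic_series_in_Lp[of s M h, OF s(1) h(1,2) h(3)[unfolded s(2)]]) blast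
    then obtain H where H: "H \<in> Lp q" "\<And>u. 0 \<le> H u" "\<And>k. AE u in lborel. (1/2) ^ Suc k * h k u \<le> H u" by blast
    obtain C where C: "\<And>n. \<bar>LINT u|lborel. F n u * H u\<bar> \<le> C"
      using convergent_imp_Bseq[OF conv[OF H(1)]] unfolding Bseq_def by auto
    have FL: "F n \<in> Lp p" for n using bounded_on_Icc_Lp[OF conjugate_ge_1(1)[OF pq] F] .
    have hL: "h k \<in> Lp q" for k using bounded_on_Icc_Lp[OF conjugate_ge_1(2)[OF pq] h(1)] .
    have low: "2 ^ k / 4 \<le> C" for k :: nat
    proof -
      have "4 ^ k / 2 \<le> (LINT u|lborel. F (n k) u * h k u)" using n[of k] h(4)[of k] by linarith
      then have "(1/2) ^ Suc k * (4 ^ k / 2) \<le> (1/2) ^ Suc k * (LINT u|lborel. F (n k) u * h k u)"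
        by (intro mult_left_mono) auto
      also have "\<dots> = (LINT u|lborel. F (n k) u * ((1/2) ^ Suc k * h k u))"
        by (simp add: mult.left_commute flip: integral_mult_right_zero)
      also have "\<dots> \<le> (LINT u|lborel. F (n k) u * H u)"
      proof (rule integral_mono_AE)
        show "integrable lborel (\<lambda>u. F (n k) u * ((1/2) ^ Suc k * h k u))"
          by (rule Holder(1)[OF pq FL Lp_cmult[OF conjugate_ge_1(2)[OF pq] hL]])
        show "integrable lborel (\<lambda>u. F (n k) u * H u)" by (rule Holder(1)[OF pq FL H(1)])
        show "AE u in lborel. F (n k) u * ((1/2) ^ Suc k * h k u) \<le> F (n k) u * H u"
          using H(3)[of k] by eventually_elim (rule mult_left_mono[OF _ pos])
      qed
      also have "\<dots> \<le> C" using C[of "n k"] by linarith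
      also have "(1/2) ^ Suc k * (4 ^ k / 2) = (2 ^ k / 4 :: real)"
      proof -
        have "(4::real) ^ k = 2 ^ k * 2 ^ k" by (simp flip: power_mult_distrib)
        then show ?thesis by (simp add: power_divide)
      qed
      finally show ?thesis .
    qed
    obtain k :: nat where "4 * C < 2 ^ k" using real_arch_pow[of 2 "4*C"] by auto
    then show False using low[of k] by simp
  qed
qed

section \<open>The dual of a Lebesgue space\<close>

lemma Lp_dualD:
  assumes "\<phi> \<in> Lp_dual p"
  shows "f \<in> Lp p \<Longrightarrow> g \<in> Lp p \<Longrightarrow> \<phi> (\<lambda>u. f u + g u) = \<phi> f + \<phi> g"
    "f \<in> Lp p \<Longrightarrow> \<phi> (\<lambda>u. c * f u) = c * \<phi> f"
  using assms by (auto simp: Lp_dual_def)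

lemma Lp_dual_bound:
  assumes "\<phi> \<in> Lp_dual p"
  obtains C where "C \<ge> 0" "\<And>f. f \<in> Lp p \<Longrightarrow> \<bar>\<phi> f\<bar> \<le> C * Lp_norm p f"
proof -
  obtain C where C: "\<forall>f\<in>Lp p. \<bar>\<phi> f\<bar> \<le> C * Lp_norm p f" using assms by (auto simp: Lp_dual_def)
  show thesis
  proof (rule that[of "\<bar>C\<bar>"])
    fix f assume "f \<in> Lp p"
    then have "\<bar>\<phi> f\<bar> \<le> C * Lp_norm p f" using C by blast
    also have "\<dots> \<le> \<bar>C\<bar> * Lp_norm p f" by (intro mult_right_mono Lp_norm_nonneg) simp
    finally show "\<bar>\<phi> f\<bar> \<le> \<bar>C\<bar> * Lp_norm p f" .
  qed simp
qed

lemma Lp_dual_sum: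
  assumes p: "1 \<le> p" and \<phi>: "\<phi> \<in> Lp_dual p" and J: "finite J" and f: "\<And>j. j \<in> J \<Longrightarrow> bounded_on_Icc M (f j)"
  shows "\<phi> (\<lambda>u. \<Sum>j\<in>J. f j u) = (\<Sum>j\<in>J. \<phi> (f j))"
  using J f
proof (induction J rule: finite_induct)
  case empty
  have "(\<lambda>_. 0) \<in> Lp p" using bounded_on_Icc_Lp[OF p bounded_on_Icc_zero] .
  from Lp_dualD(2)[OF \<phi> this, of 0] show ?case by simp
next
  case (insert j J)
  have 1: "f j \<in> Lp p" using bounded_on_Icc_Lp[OF p insert.prems[of j]] by simp
  have 2: "(\<lambda>u. \<Sum>j\<in>J. f j u) \<in> Lp p"
    using bounded_on_Icc_Lp[OF p bounded_on_Icc_sum[of J M f]] insert by simp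
  show ?case using insert Lp_dualD(1)[OF \<phi> 1 2] by simp
qed

lemma small_if_le_all_multiples:
  fixes X C :: real
  assumes "\<And>\<epsilon>. \<epsilon> > 0 \<Longrightarrow> X \<le> C * \<epsilon>" and "C \<ge> 0"
  shows "X \<le> 0"
proof (rule field_le_epsilon)
  fix e :: real assume e: "e > 0"
  have "X \<le> C * (e / (C + 1))" using assms e by (intro assms(1)) auto
  also have "\<dots> \<le> e" using assms(2) e by (simp add: field_simps)
  finally show "X \<le> 0 + e" by simp
qed

text \<open>A functional that is integration against \<open>g\<close> on indicators is so on bounded
  functions, by uniform approximation with step functions. Testing it with near-extremal weights
  for truncations of \<open>\<bar>g\<bar>\<close> bounds their norms by the norm of the
  functional, whence \<open>g \<in> L\<^sup>q\<close>; only then can bounded functions be replaced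
  by general ones, by truncation. The latter step works for \<open>p = \<infinity>\<close>, too,
  where the truncations are eventually exact.\<close>

lemma Lp_dual_representation:
  assumes pq: "conjugate p q" and \<phi>: "\<phi> \<in> Lp_dual p"
    and g: "integrable lborel g" and out: "\<And>u. u \<notin> {-M..M} \<Longrightarrow> g u = 0"
    and ind: "\<And>A. A \<in> sets borel \<Longrightarrow> A \<subseteq> {-M..M} \<Longrightarrow> \<phi> (indicator A) = (LINT u|lborel. g u * indicator A u)"
  shows "g \<in> Lp q" "\<And>f. f \<in> Lp p \<Longrightarrow> (\<And>u. u \<notin> {-M..M} \<Longrightarrow> f u = 0) \<Longrightarrow> \<phi> f = (LINT u|lborel. f u * g u)"
proof -
  have p: "1 \<le> p" and q: "1 \<le> q" using conjugate_ge_1[OF pq] by auto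
  have [measurable]: "g \<in> borel_measurable borel" using g by auto
  obtain C where C: "C \<ge> 0" "\<And>f. f \<in> Lp p \<Longrightarrow> \<bar>\<phi> f\<bar> \<le> C * Lp_norm p f" using Lp_dual_bound[OF \<phi>] by blast
  have int_bd: "integrable lborel (\<lambda>u. f u * g u)" if f: "bounded_on_Icc M f" for f
  proof -
    obtain B where "\<And>u. \<bar>f u\<bar> \<le> B" using bounded_on_Icc_bound[OF f] by blast
    moreover have [measurable]: "f \<in> borel_measurable borel" using f by (rule bounded_on_Icc_measurable)
    ultimately have "f \<in> Lp top" by (auto simp: Lp_infty_iff)
    from Holder_bounded_factor(1)[OF g this] show ?thesis by (simp add: mult.commute)
  qed
  define K where "K = Lp_norm p (indicator {-M..M})"
  have bdd: "\<phi> f = (LINT u|lborel. f u * g u)" if f: "bounded_on_Icc M f" for f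
  proof -
    have "\<bar>\<phi> f - (LINT u|lborel. f u * g u)\<bar> \<le> (C * K + (LINT u|lborel. \<bar>g u\<bar>)) * \<epsilon>" if e: "\<epsilon> > 0" for \<epsilon>
    proof -
      obtain J :: "int set" and c A where J: "finite J" "\<And>j. A j \<in> sets borel" "\<And>j. A j \<subseteq> {-M..M}"
        "\<And>u. \<bar>f u - (\<Sum>j\<in>J. c j * indicator (A j) u)\<bar> \<le> \<epsilon> * indicator {-M..M} u"
        using bounded_on_Icc_step_approximation[OF f e] by blast
      define S where "S u = (\<Sum>j\<in>J. c j * indicator (A j) u)" for u
      have bi: "bounded_on_Icc M (indicator (A j))" for j by (rule bounded_on_Icc_indicator[OF J(2,3)])
      have bS: "bounded_on_Icc M S" unfolding S_def
        by (intro bounded_on_Icc_sum[OF J(1)] bounded_on_Icc_cmult bi)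
      have "\<phi> S = (\<Sum>j\<in>J. \<phi> (\<lambda>u. c j * indicator (A j) u))"
        unfolding S_def by (rule Lp_dual_sum[OF p \<phi> J(1), where M=M]) (intro bounded_on_Icc_cmult bi)
      also have "\<dots> = (\<Sum>j\<in>J. c j * (LINT u|lborel. g u * indicator (A j) u))"
        using Lp_dualD(2)[OF \<phi> bounded_on_Icc_Lp[OF p bi]] ind[OF J(2,3)] by simp
      also have "\<dots> = (LINT u|lborel. (\<Sum>j\<in>J. c j * (indicator (A j) u * g u)))"
        using int_bd[OF bi] by (subst Bochner_Integration.integral_sum) (auto simp: mult.commute)
      also have "\<dots> = (LINT u|lborel. S u * g u)"
        unfolding S_def by (simp add: sum_distrib_right mult.assoc)
      finally have \<phi>S: "\<phi> S = (LINT u|lborel. S u * g u)" .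
      \<comment> \<open>The error of the approximation is \<open>\<epsilon> * D\<close> with \<open>\<bar>D\<bar>
        \<le> 1\<close> on the interval.\<close>
      define D where "D u = (f u - S u) / \<epsilon>" for u
      have bD: "bounded_on_Icc M D"
        using bounded_on_Icc_cmult[OF bounded_on_Icc_add[OF f bounded_on_Icc_cmult[OF bS, of "-1"]], of "1/\<epsilon>"] by (simp add: D_def[abs_def])
      have D1: "\<bar>D u\<bar> \<le> \<bar>indicator {-M..M} u\<bar>" for u
        using J(4)[of u] e by (simp add: D_def S_def field_simps)
      have fS: "f u = S u + \<epsilon> * D u" for u using e by (simp add: D_def)
      have LS: "S \<in> Lp p" and LD: "D \<in> Lp p" using bounded_on_Icc_Lp[OF p] bS bD by auto
      have "\<phi> f = \<phi> (\<lambda>u. S u + \<epsilon> * D u)" using fS by presburger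
      also have "\<dots> = \<phi> S + \<epsilon> * \<phi> D"
        using Lp_dualD(1)[OF \<phi> LS Lp_cmult[OF p LD]] Lp_dualD(2)[OF \<phi> LD] by simp
      finally have 1: "\<phi> f = \<phi> S + \<epsilon> * \<phi> D" .
      have "(LINT u|lborel. f u * g u) = (LINT u|lborel. S u * g u + \<epsilon> * (D u * g u))"
        by (intro Bochner_Integration.integral_cong) (auto simp: fS algebra_simps)
      also have "\<dots> = (LINT u|lborel. S u * g u) + \<epsilon> * (LINT u|lborel. D u * g u)"
        using int_bd[OF bS] int_bd[OF bD] by simp
      finally have 2: "\<phi> f - (LINT u|lborel. f u * g u) = \<epsilon> * (\<phi> D - (LINT u|lborel. D u * g u))"
        using 1 \<phi>S by (simp add: algebra_simps)
      have ind_L: "indicator {-M..M} \<in> Lp p" by (rule bounded_on_Icc_Lp[OF p bounded_on_Icc_indicator[where M=M]]) auto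
      have "Lp_norm p D \<le> K" unfolding K_def
        by (rule Lp_mono(2)[OF p ind_L]) (use D1 bD bounded_on_Icc_measurable in auto)
      then have 3: "\<bar>\<phi> D\<bar> \<le> C * K" using C(2)[OF LD] C(1) by (meson mult_left_mono order_trans)
      have "\<bar>LINT u|lborel. D u * g u\<bar> \<le> (LINT u|lborel. \<bar>D u * g u\<bar>)" by (rule integral_abs_bound)
      also have "\<dots> \<le> (LINT u|lborel. \<bar>g u\<bar>)"
      proof (rule integral_mono)
        show "\<bar>D u * g u\<bar> \<le> \<bar>g u\<bar>" for u
        proof -
          have "\<bar>D u\<bar> \<le> 1" using D1[of u] by (cases "u \<in> {-M..M}") auto
          then show ?thesis using mult_left_le_one_le[of "\<bar>g u\<bar>" "\<bar>D u\<bar>"] by (simp add: abs_mult)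
        qed
      qed (use int_bd[OF bD] g in auto)
      finally have 4: "\<bar>LINT u|lborel. D u * g u\<bar> \<le> (LINT u|lborel. \<bar>g u\<bar>)" .
      have "\<bar>\<phi> D - (LINT u|lborel. D u * g u)\<bar> \<le> C * K + (LINT u|lborel. \<bar>g u\<bar>)" using 3 4 by linarith
      then show ?thesis unfolding 2 using e by (simp add: abs_mult mult.commute)
    qed
    moreover have "C * K + (LINT u|lborel. \<bar>g u\<bar>) \<ge> 0"
      using C(1) Lp_norm_nonneg by (simp add: K_def)
    ultimately have "\<bar>\<phi> f - (LINT u|lborel. f u * g u)\<bar> \<le> 0" by (rule small_if_le_all_multiples)
    then show ?thesis by simp
  qed
  show gq: "g \<in> Lp q"
  proof (rule Lp_Fatou[OF q, where C="2 * C"])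
    fix k :: nat
    define G where "G u = \<bar>g u\<bar> * indicator {u. \<bar>g u\<bar> \<le> real k \<and> \<bar>u\<bar> \<le> real k} u" for u
    have [measurable]: "G \<in> borel_measurable borel" unfolding G_def by measurable
    have bG: "bounded_on_Icc M G"
      by (rule bounded_on_IccI[where B="real k"]) (auto simp: G_def indicator_def out)
    have G0: "0 \<le> G u" for u by (simp add: G_def)
    obtain h where h: "bounded_on_Icc M h" "\<And>u. 0 \<le> h u" "Lp_norm p h \<le> 1" "Lp_norm q G \<le> 2 * (LINT u|lborel. G u * h u)"
      using converse_Holder[OF conjugate_sym[OF pq] bG G0] by blast
    have [measurable]: "h \<in> borel_measurable borel" using h(1) by (rule bounded_on_Icc_measurable)
    \<comment> \<open>The sign of \<open>g\<close> turns the extremal weight for the truncation of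
      \<open>\<bar>g\<bar>\<close> into one for that of \<open>g\<close>.\<close>
    define f where "f u = h u * (sgn (g u) * indicator {u. \<bar>g u\<bar> \<le> real k \<and> \<bar>u\<bar> \<le> real k} u)" for u
    have bf: "bounded_on_Icc M f" unfolding f_def
      by (rule bounded_on_Icc_mult[OF h(1), where B=1]) (auto simp: indicator_def sgn_if)
    have [measurable]: "f \<in> borel_measurable borel" using bf by (rule bounded_on_Icc_measurable)
    have fL: "f \<in> Lp p" using bounded_on_Icc_Lp[OF p bf] .
    have "G u * h u = f u * g u" for u by (auto simp: G_def f_def indicator_def sgn_if)
    then have "(LINT u|lborel. G u * h u) = \<phi> f" using bdd[OF bf] by simp
    also have "\<dots> \<le> C * Lp_norm p f" using C(2)[OF fL] by linarith
    also have "\<dots> \<le> C * 1"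
    proof (rule mult_left_mono[OF _ C(1)])
      have "Lp_norm p f \<le> Lp_norm p h"
        by (rule Lp_mono(2)[OF p bounded_on_Icc_Lp[OF p h(1)]]) (auto simp: f_def indicator_def sgn_if)
      then show "Lp_norm p f \<le> 1" using h(3) by simp
    qed
    finally have 1: "Lp_norm q G \<le> 2 * C" using h(4) by simp
    have "Lp_norm q (\<lambda>u. g u * indicator {u. \<bar>g u\<bar> \<le> real k \<and> \<bar>u\<bar> \<le> real k} u) \<le> Lp_norm q G"
      by (rule Lp_mono(2)[OF q bounded_on_Icc_Lp[OF q bG]]) (auto simp: G_def abs_mult)
    then show "Lp_norm q (\<lambda>u. g u * indicator {u. \<bar>g u\<bar> \<le> real k \<and> \<bar>u\<bar> \<le> real k} u) \<le> 2 * C" using 1 by simp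
  qed simp
  fix f assume f: "f \<in> Lp p" and fout: "\<And>u. u \<notin> {-M..M} \<Longrightarrow> f u = 0"
  have [measurable]: "f \<in> borel_measurable borel" using f by (rule Lp_measurable)
  let ?t = "\<lambda>k::nat. \<lambda>u. f u * indicator {u. \<bar>f u\<bar> > real k} u"
  have "\<bar>\<phi> f - (LINT u|lborel. f u * g u)\<bar> \<le> (C + Lp_norm q g) * Lp_norm p (?t k)" for k
  proof -
    define fk where "fk u = f u * indicator {u. \<bar>f u\<bar> \<le> real k} u" for u
    have [measurable]: "fk \<in> borel_measurable borel" unfolding fk_def by measurable
    have bk: "bounded_on_Icc M fk" by (rule bounded_on_IccI[where B="real k"]) (auto simp: fk_def indicator_def fout)
    have split: "f u = fk u + ?t k u" for u by (auto simp: fk_def indicator_def)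
    have fkL: "fk \<in> Lp p" using bounded_on_Icc_Lp[OF p bk] .
    have tL: "?t k \<in> Lp p" by (rule Lp_mono(1)[OF p f]) (auto simp: indicator_def)
    have "\<phi> f = \<phi> (\<lambda>u. fk u + ?t k u)" using split by presburger
    also have "\<dots> = \<phi> fk + \<phi> (?t k)" by (rule Lp_dualD(1)[OF \<phi> fkL tL])
    finally have 1: "\<phi> f = (LINT u|lborel. fk u * g u) + \<phi> (?t k)" using bdd[OF bk] by simp
    have "(LINT u|lborel. f u * g u) = (LINT u|lborel. fk u * g u + ?t k u * g u)"
      by (intro Bochner_Integration.integral_cong) (auto simp: fk_def indicator_def)
    also have "\<dots> = (LINT u|lborel. fk u * g u) + (LINT u|lborel. ?t k u * g u)"
      using Holder(1)[OF pq fkL gq] Holder(1)[OF pq tL gq] by (rule Bochner_Integration.integral_add)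
    finally have "\<phi> f - (LINT u|lborel. f u * g u) = \<phi> (?t k) - (LINT u|lborel. ?t k u * g u)" using 1 by simp
    moreover have "\<bar>\<phi> (?t k)\<bar> \<le> C * Lp_norm p (?t k)" by (rule C(2)[OF tL])
    moreover have "\<bar>LINT u|lborel. ?t k u * g u\<bar> \<le> Lp_norm q g * Lp_norm p (?t k)"
      using Holder_abs[OF pq tL gq] by (simp add: mult.commute)
    ultimately show ?thesis unfolding distrib_right by linarith
  qed
  moreover have "(\<lambda>k. (C + Lp_norm q g) * Lp_norm p (?t k)) \<longlonglongrightarrow> (C + Lp_norm q g) * 0"
    by (intro tendsto_mult_left Lp_norm_truncation_tendsto_0[OF p f])
  ultimately have "\<bar>\<phi> f - (LINT u|lborel. f u * g u)\<bar> \<le> (C + Lp_norm q g) * 0"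
    by (intro LIMSEQ_le_const) auto
  then show "\<phi> f = (LINT u|lborel. f u * g u)" by simp
qed

lemma indicator_in_Lp: "1 \<le> p \<Longrightarrow> A \<in> sets borel \<Longrightarrow> A \<subseteq> {-M..M} \<Longrightarrow> indicator A \<in> Lp p"
  by (rule bounded_on_Icc_Lp[OF _ bounded_on_Icc_indicator])

lemma emeasure_less_imp_measure_less:
  assumes "emeasure M A < ennreal \<delta>" shows "measure M A < \<delta>"
proof -
  have "emeasure M A = ennreal (measure M A)" using assms by (intro emeasure_eq_ennreal_measure) auto
  then show ?thesis using assms by (metis ennreal_leI not_less)
qed

lemma powr_inverse_less:
  fixes x r c :: real
  assumes "0 \<le> x" "1 \<le> r" "0 < c" "x < c powr r" shows "x powr (1 / r) < c"
proof -
  have "x powr (1/r) < (c powr r) powr (1/r)" using assms by (intro powr_less_mono2) auto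
  then show ?thesis using assms by (simp add: powr_powr)
qed

text \<open>The values of the functional on indicators form a signed set function, which is absolutely
  continuous because \<open>p\<close> is finite. Its upper variation \<open>V\<close> and \<open>V
  - \<nu>\<close> are nonnegative, so that both have densities (the Jordan decomposition).\<close>

theorem Riesz_representation_Icc:
  assumes pq: "conjugate p q" and fin: "p \<noteq> top" and \<phi>: "\<phi> \<in> Lp_dual p"
  obtains h where "h \<in> Lp q" "\<And>f. f \<in> Lp p \<Longrightarrow> (\<And>u. u \<notin> {-M..M} \<Longrightarrow> f u = 0) \<Longrightarrow> \<phi> f = (LINT u|lborel. f u * h u)"
proof -
  have p: "1 \<le> p" using conjugate_ge_1[OF pq] by auto
  obtain r where r: "1 \<le> r" "p = ennreal r" using p fin by (cases rule: exponent_cases) auto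
  obtain C where C: "C \<ge> 0" "\<And>f. f \<in> Lp p \<Longrightarrow> \<bar>\<phi> f\<bar> \<le> C * Lp_norm p f" using Lp_dual_bound[OF \<phi>] by blast
  define I where "I = {-M..M}"
  define \<nu> where "\<nu> A = \<phi> (indicator (A \<inter> I))" for A
  have iL: "indicator (A \<inter> I) \<in> Lp p" if "A \<in> sets borel" for A
    by (rule indicator_in_Lp[OF p, where M=M]) (use that in \<open>auto simp: I_def\<close>)
  have \<nu>_bd: "\<bar>\<nu> A\<bar> \<le> C * measure lborel (A \<inter> I) powr (1 / r)" if "A \<in> sets borel" for A
    using C(2)[OF iL[OF that]] r by (simp add: \<nu>_def Lp_norm_indicator)
  have "(\<lambda>u. 0 * indicator ({} \<inter> I) u) = (indicator {} :: real \<Rightarrow> real)" by (auto simp: fun_eq_iff)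
  then have \<nu>_0: "\<nu> A = 0" if "A \<inter> I = {}" for A
    using Lp_dualD(2)[OF \<phi> iL[of "{}"], of 0] that by (simp add: \<nu>_def)
  have \<nu>_add: "\<nu> (A \<union> B) = \<nu> A + \<nu> B" if "A \<in> sets borel" "B \<in> sets borel" "A \<inter> B = {}" for A B
  proof -
    have "indicator ((A \<union> B) \<inter> I) = (\<lambda>u. indicator (A \<inter> I) u + indicator (B \<inter> I) u :: real)"
      using that by (auto simp: indicator_def fun_eq_iff)
    then show ?thesis unfolding \<nu>_def using Lp_dualD(1)[OF \<phi> iL[OF that(1)] iL[OF that(2)]] by simp
  qed
  have emI: "emeasure lborel (A \<inter> I) < top" for A
    using emeasure_mono[of "A \<inter> I" I lborel] emeasure_lborel_Icc_finite[of "-M" M]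
    by (auto simp: I_def intro: le_less_trans)
  have \<nu>_uac: "\<exists>\<delta>>0. \<forall>A\<in>sets borel. emeasure lborel A < ennreal \<delta> \<longrightarrow> \<bar>\<nu> A\<bar> < \<epsilon>" if e: "\<epsilon> > 0" for \<epsilon>
  proof (intro exI[of _ "(\<epsilon> / (C + 1)) powr r"] conjI ballI impI)
    show "0 < (\<epsilon> / (C + 1)) powr r" using e C(1) by simp
    fix A :: "real set" assume A: "A \<in> sets borel" "emeasure lborel A < ennreal ((\<epsilon> / (C + 1)) powr r)"
    then have "emeasure lborel (A \<inter> I) < ennreal ((\<epsilon> / (C + 1)) powr r)"
      using emeasure_mono[of "A \<inter> I" A lborel] by (auto intro: le_less_trans)
    then have "measure lborel (A \<inter> I) < (\<epsilon> / (C + 1)) powr r" by (rule emeasure_less_imp_measure_less)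
    then have "measure lborel (A \<inter> I) powr (1 / r) < \<epsilon> / (C + 1)"
      using e C(1) r by (intro powr_inverse_less) auto
    then have "(C + 1) * measure lborel (A \<inter> I) powr (1 / r) < \<epsilon>" using C(1) by (simp add: pos_less_divide_eq mult.commute)
    moreover have "C * measure lborel (A \<inter> I) powr (1 / r) \<le> (C + 1) * measure lborel (A \<inter> I) powr (1 / r)"
      by (intro mult_right_mono) auto
    ultimately show "\<bar>\<nu> A\<bar> < \<epsilon>" using \<nu>_bd[OF A(1)] by linarith
  qed
  define V where "V A = (SUP B\<in>{B\<in>sets borel. B \<subseteq> A}. \<nu> B)" for A
  define K where "K = C * measure lborel I powr (1 / r)"
  have \<nu>_K: "\<nu> B \<le> K" if "B \<in> sets borel" for B
  proof -
    have "measure lborel (B \<inter> I) \<le> measure lborel I"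
      using that emI[of UNIV] by (intro measure_mono_fmeasurable) (auto simp: fmeasurable_def I_def)
    then have "C * measure lborel (B \<inter> I) powr (1 / r) \<le> K"
      unfolding K_def using C(1) r by (intro mult_left_mono powr_mono2) auto
    then show ?thesis using \<nu>_bd[OF that] by linarith
  qed
  have V_upper: "\<nu> B \<le> V A" if "B \<in> sets borel" "B \<subseteq> A" for A B
    unfolding V_def by (rule cSUP_upper) (use that \<nu>_K in \<open>auto intro!: bdd_aboveI2\<close>)
  have V_least: "V A \<le> c" if "\<And>B. B \<in> sets borel \<Longrightarrow> B \<subseteq> A \<Longrightarrow> \<nu> B \<le> c" for A c
    unfolding V_def by (rule cSUP_least) (use that in auto)
  have V_pos: "0 \<le> V A" for A using V_upper[of "{}" A] \<nu>_0[of "{}"] by simp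
  have V_add: "V (A \<union> B) = V A + V B" if AB [measurable]: "A \<in> sets borel" "B \<in> sets borel" and dis: "A \<inter> B = {}" for A B
  proof (rule antisym)
    show "V (A \<union> B) \<le> V A + V B"
    proof (rule V_least)
      fix X assume X [measurable]: "X \<in> sets borel" and sub: "X \<subseteq> A \<union> B"
      have "\<nu> ((X \<inter> A) \<union> (X \<inter> B)) = \<nu> (X \<inter> A) + \<nu> (X \<inter> B)" using dis by (intro \<nu>_add) auto
      moreover have "(X \<inter> A) \<union> (X \<inter> B) = X" using sub by auto
      moreover have "\<nu> (X \<inter> A) \<le> V A" "\<nu> (X \<inter> B) \<le> V B" by (auto intro!: V_upper)
      ultimately show "\<nu> X \<le> V A + V B" by simp
    qed
    have "V A \<le> V (A \<union> B) - V B"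
    proof (rule V_least)
      fix X assume X [measurable]: "X \<in> sets borel" and XA: "X \<subseteq> A"
      have "V B \<le> V (A \<union> B) - \<nu> X"
      proof (rule V_least)
        fix Y assume Y [measurable]: "Y \<in> sets borel" and YB: "Y \<subseteq> B"
        have "\<nu> (X \<union> Y) = \<nu> X + \<nu> Y" using XA YB dis by (intro \<nu>_add) auto
        moreover have "\<nu> (X \<union> Y) \<le> V (A \<union> B)" using XA YB by (intro V_upper) auto
        ultimately show "\<nu> Y \<le> V (A \<union> B) - \<nu> X" by simp
      qed
      then show "\<nu> X \<le> V (A \<union> B) - V B" by simp
    qed
    then show "V A + V B \<le> V (A \<union> B)" by simp
  qed
  have V_0: "V A = 0" if "A \<inter> I = {}" for A
  proof (rule antisym[OF V_least V_pos])
    fix B assume "B \<subseteq> A"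
    then have "\<nu> B = 0" using that by (intro \<nu>_0) auto
    then show "\<nu> B \<le> 0" by simp
  qed
  have V_uac: "\<exists>\<delta>>0. \<forall>A\<in>sets borel. emeasure lborel A < ennreal \<delta> \<longrightarrow> V A < \<epsilon>" if e: "\<epsilon> > 0" for \<epsilon>
  proof -
    have "\<epsilon> / 2 > 0" using e by simp
    from \<nu>_uac[OF this] obtain \<delta> where \<delta>: "\<delta> > 0" "\<And>A. A \<in> sets borel \<Longrightarrow> emeasure lborel A < ennreal \<delta> \<Longrightarrow> \<bar>\<nu> A\<bar> < \<epsilon> / 2" by blast
    have "V A < \<epsilon>" if A: "A \<in> sets borel" "emeasure lborel A < ennreal \<delta>" for A
    proof -
      have "V A \<le> \<epsilon> / 2"
      proof (rule V_least)
        fix B assume B: "B \<in> sets borel" "B \<subseteq> A"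
        have "emeasure lborel B \<le> emeasure lborel A" using B A by (intro emeasure_mono) auto
        then have "\<bar>\<nu> B\<bar> < \<epsilon> / 2" using \<delta>(2)[OF B(1)] A(2) by (auto intro: le_less_trans)
        then show "\<nu> B \<le> \<epsilon> / 2" by linarith
      qed
      then show ?thesis using e by linarith
    qed
    then show ?thesis using \<delta>(1) by blast
  qed
  have "\<exists>L. integrable lborel L \<and> (\<forall>u. u \<notin> {-M..M} \<longrightarrow> L u = 0) \<and> (\<forall>A\<in>sets borel. V A = (LINT u|lborel. L u * indicator A u))"
    by (rule set_function_density[of V M, OF V_pos V_add _ V_uac]) (use V_0 in \<open>auto simp: I_def\<close>)
  then obtain L1 where L1: "integrable lborel L1" "\<And>u. u \<notin> {-M..M} \<Longrightarrow> L1 u = 0" "\<And>A. A \<in> sets borel \<Longrightarrow> V A = (LINT u|lborel. L1 u * indicator A u)" by blast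
  define W where "W A = V A - \<nu> A" for A
  have W_uac: "\<exists>\<delta>>0. \<forall>A\<in>sets borel. emeasure lborel A < ennreal \<delta> \<longrightarrow> W A < \<epsilon>" if e: "\<epsilon> > 0" for \<epsilon>
  proof -
    have e2: "\<epsilon> / 2 > 0" using e by simp
    obtain \<delta>1 where 1: "\<delta>1 > 0" "\<And>A. A \<in> sets borel \<Longrightarrow> emeasure lborel A < ennreal \<delta>1 \<Longrightarrow> \<bar>\<nu> A\<bar> < \<epsilon> / 2" using \<nu>_uac[OF e2] by blast
    obtain \<delta>2 where 2: "\<delta>2 > 0" "\<And>A. A \<in> sets borel \<Longrightarrow> emeasure lborel A < ennreal \<delta>2 \<Longrightarrow> V A < \<epsilon> / 2" using V_uac[OF e2] by blast
    show ?thesis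
    proof (intro exI[of _ "min \<delta>1 \<delta>2"] conjI ballI impI)
      show "0 < min \<delta>1 \<delta>2" using 1 2 by simp
      fix A :: "real set" assume A: "A \<in> sets borel" "emeasure lborel A < ennreal (min \<delta>1 \<delta>2)"
      have "emeasure lborel A < ennreal \<delta>1" by (rule less_le_trans[OF A(2)]) (simp add: ennreal_leI)
      moreover have "emeasure lborel A < ennreal \<delta>2" by (rule less_le_trans[OF A(2)]) (simp add: ennreal_leI)
      ultimately show "W A < \<epsilon>" using 1(2)[OF A(1)] 2(2)[OF A(1)] by (simp add: W_def)
    qed
  qed
  have "\<exists>L. integrable lborel L \<and> (\<forall>u. u \<notin> {-M..M} \<longrightarrow> L u = 0) \<and> (\<forall>A\<in>sets borel. W A = (LINT u|lborel. L u * indicator A u))"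
    by (rule set_function_density[of W M, OF _ _ _ W_uac])
       (use V_0 \<nu>_0 V_upper V_add \<nu>_add in \<open>auto simp: I_def W_def\<close>)
  then obtain L2 where L2: "integrable lborel L2" "\<And>u. u \<notin> {-M..M} \<Longrightarrow> L2 u = 0" "\<And>A. A \<in> sets borel \<Longrightarrow> W A = (LINT u|lborel. L2 u * indicator A u)" by blast
  define h where "h u = L1 u - L2 u" for u
  have h_int: "integrable lborel h" unfolding h_def using L1 L2 by auto
  have h_out: "h u = 0" if "u \<notin> {-M..M}" for u using L1(2)[OF that] L2(2)[OF that] by (simp add: h_def)
  have ind: "\<phi> (indicator A) = (LINT u|lborel. h u * indicator A u)" if A: "A \<in> sets borel" "A \<subseteq> {-M..M}" for A
  proof -
    have "A \<inter> I = A" using A(2) by (auto simp: I_def)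
    then have "\<phi> (indicator A) = V A - W A" by (simp add: W_def \<nu>_def)
    also have "\<dots> = (LINT u|lborel. L1 u * indicator A u - L2 u * indicator A u)"
      using L1 L2 A by (subst Bochner_Integration.integral_diff) (auto intro: integrable_real_mult_indicator)
    also have "\<dots> = (LINT u|lborel. h u * indicator A u)" by (simp add: h_def left_diff_distrib)
    finally show ?thesis .
  qed
  show thesis
  proof (rule that)
    show "h \<in> Lp q" by (rule Lp_dual_representation(1)[where M=M, OF pq \<phi> h_int]) (use h_out ind in auto)
    show "\<phi> f = (LINT u|lborel. f u * h u)" if "f \<in> Lp p" "\<And>u. u \<notin> {-M..M} \<Longrightarrow> f u = 0" for f
      by (rule Lp_dual_representation(2)[where M=M, OF pq \<phi> h_int]) (use h_out ind that in auto)
  qed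
qed

section \<open>Weak limits\<close>

text \<open>The limits of the pairings with indicators form a set function that inherits absolute continuity
  from the sequence by the Vitali--Hahn--Saks theorem, and its density represents the limit
  functional, which is bounded by the uniform boundedness principle.\<close>

theorem weak_limit_exists:
  assumes pq: "conjugate p q" and F: "\<And>n. bounded_on_Icc M (F n)" and pos: "\<And>n u. 0 \<le> F n u"
    and conv: "\<And>h. h \<in> Lp q \<Longrightarrow> convergent (\<lambda>n. LINT u|lborel. F n u * h u)"
  obtains L where "L \<in> Lp p" "\<And>u. 0 \<le> L u" "\<And>u. u \<notin> {-M..M} \<Longrightarrow> L u = 0"
    "\<And>h. h \<in> Lp q \<Longrightarrow> (\<lambda>n. LINT u|lborel. F n u * h u) \<longlonglongrightarrow> (LINT u|lborel. L u * h u)"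
proof -
  have p: "1 \<le> p" and q: "1 \<le> q" using conjugate_ge_1[OF pq] by auto
  have FL: "F n \<in> Lp p" for n using bounded_on_Icc_Lp[OF p F] .
  define I where "I = {-M..M}"
  have F_I: "F n u * indicator (A \<inter> I) u = F n u * indicator A u" for n u A
    using bounded_on_Icc_outside[OF F, of u n] by (auto simp: I_def indicator_def)
  have conv_ind: "convergent (\<lambda>n. LINT u|lborel. F n u * indicator A u)" if "A \<in> sets borel" for A
    using conv[OF indicator_in_Lp[OF q, of "A \<inter> I" M]] that by (simp add: F_I) (simp add: I_def)
  have uac: "uniformly_abs_continuous F" by (rule Vitali_Hahn_Saks[OF F pos conv_ind])
  obtain C where C: "\<And>n. Lp_norm p (F n) \<le> C" using Banach_Steinhaus_nonneg[OF pq F pos conv] by blast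
  define \<Lambda> where "\<Lambda> h = lim (\<lambda>n. LINT u|lborel. F n u * h u)" for h
  have lim: "(\<lambda>n. LINT u|lborel. F n u * h u) \<longlonglongrightarrow> \<Lambda> h" if "h \<in> Lp q" for h
    unfolding \<Lambda>_def using conv[OF that] by (simp add: convergent_LIMSEQ_iff)
  have lim_ind: "(\<lambda>n. LINT u|lborel. F n u * indicator A u) \<longlonglongrightarrow> \<Lambda> (indicator (A \<inter> I))" if "A \<in> sets borel" for A
    using lim[OF indicator_in_Lp[OF q, of "A \<inter> I" M]] that by (simp add: F_I) (simp add: I_def)
  have int_ind: "integrable lborel (\<lambda>u. F n u * indicator A u)" if "A \<in> sets borel" for n A
    by (rule integrable_bounded_on_Icc_indicator[OF F that])
  define \<nu> where "\<nu> A = \<Lambda> (indicator (A \<inter> I))" for A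
  have "\<exists>L. integrable lborel L \<and> (\<forall>u. 0 \<le> L u) \<and> (\<forall>u. u \<notin> {-M..M} \<longrightarrow> L u = 0) \<and> (\<forall>A\<in>sets borel. \<nu> A = (LINT u|lborel. L u * indicator A u))"
  proof (rule set_function_density[of \<nu> M])
    show "0 \<le> \<nu> A" if "A \<in> sets borel" for A
      unfolding \<nu>_def by (rule LIMSEQ_le_const[OF lim_ind[OF that]]) (auto intro!: exI[of _ 0] integral_nonneg_AE AE_I2 mult_nonneg_nonneg pos)
    show "\<nu> (A \<union> B) = \<nu> A + \<nu> B" if AB: "A \<in> sets borel" "B \<in> sets borel" "A \<inter> B = {}" for A B
    proof (rule LIMSEQ_unique)
      show "(\<lambda>n. LINT u|lborel. F n u * indicator (A \<union> B) u) \<longlonglongrightarrow> \<nu> (A \<union> B)"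
        unfolding \<nu>_def using AB by (intro lim_ind) auto
      have "(LINT u|lborel. F n u * indicator (A \<union> B) u) = (LINT u|lborel. F n u * indicator A u) + (LINT u|lborel. F n u * indicator B u)" for n
      proof -
        have "F n u * indicator (A \<union> B) u = F n u * indicator A u + F n u * indicator B u" for u
          using AB(3) by (auto simp: indicator_def)
        then show ?thesis using int_ind[OF AB(1), of n] int_ind[OF AB(2), of n] by simp
      qed
      then show "(\<lambda>n. LINT u|lborel. F n u * indicator (A \<union> B) u) \<longlonglongrightarrow> \<nu> A + \<nu> B"
        unfolding \<nu>_def using tendsto_add[OF lim_ind[OF AB(1)] lim_ind[OF AB(2)]] by simp
    qed
    show "\<nu> A = 0" if "A \<in> sets borel" "A \<inter> {-M..M} = {}" for A
      using lim_ind[of "{}"] that(2) by (simp add: \<nu>_def I_def LIMSEQ_const_iff)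
    show "\<exists>\<delta>>0. \<forall>A\<in>sets borel. emeasure lborel A < ennreal \<delta> \<longrightarrow> \<nu> A < \<epsilon>" if e: "\<epsilon> > 0" for \<epsilon>
    proof -
      have "\<epsilon> / 2 > 0" using e by simp
      then obtain \<delta> where \<delta>: "\<delta> > 0" "\<And>A n. A \<in> sets borel \<Longrightarrow> emeasure lborel A < ennreal \<delta> \<Longrightarrow> (LINT u|lborel. F n u * indicator A u) < \<epsilon> / 2"
        using uac unfolding uniformly_abs_continuous_def by blast
      have "\<nu> A < \<epsilon>" if A: "A \<in> sets borel" "emeasure lborel A < ennreal \<delta>" for A
      proof -
        have "\<nu> A \<le> \<epsilon> / 2" unfolding \<nu>_def
          by (rule LIMSEQ_le_const2[OF lim_ind[OF A(1)]]) (use \<delta>(2)[OF A] in \<open>auto intro: less_imp_le\<close>)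
        then show ?thesis using e by linarith
      qed
      then show ?thesis using \<delta>(1) by blast
    qed
  qed blast
  then obtain L where L: "integrable lborel L" "\<And>u. 0 \<le> L u" "\<And>u. u \<notin> {-M..M} \<Longrightarrow> L u = 0"
    "\<And>A. A \<in> sets borel \<Longrightarrow> \<nu> A = (LINT u|lborel. L u * indicator A u)" by blast
  have \<Lambda>: "\<Lambda> \<in> Lp_dual q"
    unfolding Lp_dual_def
  proof (intro CollectI conjI ballI allI exI[of _ C])
    fix f g assume f: "f \<in> Lp q" and g: "g \<in> Lp q"
    show "\<Lambda> (\<lambda>u. f u + g u) = \<Lambda> f + \<Lambda> g"
    proof (rule LIMSEQ_unique[OF lim[OF Lp_add[OF q f g]]])
      show "(\<lambda>n. LINT u|lborel. F n u * (f u + g u)) \<longlonglongrightarrow> \<Lambda> f + \<Lambda> g"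
        using tendsto_add[OF lim[OF f] lim[OF g]] Holder(1)[OF pq FL f] Holder(1)[OF pq FL g] by (simp add: distrib_left)
    qed
  next
    fix c f assume f: "f \<in> Lp q"
    show "\<Lambda> (\<lambda>u. c * f u) = c * \<Lambda> f"
    proof (rule LIMSEQ_unique[OF lim[OF Lp_cmult[OF q f]]])
      show "(\<lambda>n. LINT u|lborel. F n u * (c * f u)) \<longlonglongrightarrow> c * \<Lambda> f"
        using tendsto_mult_left[OF lim[OF f], of c] by (simp add: mult.left_commute)
    qed
  next
    fix f assume f: "f \<in> Lp q"
    have "\<bar>LINT u|lborel. F n u * f u\<bar> \<le> C * Lp_norm q f" for n
      using Holder_abs[OF pq FL[of n] f] mult_right_mono[OF C[of n] Lp_norm_nonneg[of q f]] by linarith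
    then show "\<bar>\<Lambda> f\<bar> \<le> C * Lp_norm q f"
      by (intro LIMSEQ_le_const2[OF tendsto_rabs[OF lim[OF f]]]) auto
  qed
  have ind: "\<Lambda> (indicator A) = (LINT u|lborel. L u * indicator A u)" if "A \<in> sets borel" "A \<subseteq> {-M..M}" for A
  proof -
    have "A \<inter> I = A" using that(2) by (auto simp: I_def)
    then show ?thesis using L(4)[OF that(1)] by (simp add: \<nu>_def)
  qed
  have rep1: "L \<in> Lp p"
    by (rule Lp_dual_representation(1)[where M=M, OF conjugate_sym[OF pq] \<Lambda> L(1)]) (use L(3) ind in auto)
  have rep2: "\<Lambda> f = (LINT u|lborel. f u * L u)" if "f \<in> Lp q" "\<And>u. u \<notin> {-M..M} \<Longrightarrow> f u = 0" for f
    by (rule Lp_dual_representation(2)[where M=M, OF conjugate_sym[OF pq] \<Lambda> L(1)]) (use L(3) ind that in auto)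
  have "(\<lambda>n. LINT u|lborel. F n u * h u) \<longlonglongrightarrow> (LINT u|lborel. L u * h u)" if h: "h \<in> Lp q" for h
  proof -
    have [measurable]: "h \<in> borel_measurable borel" using h by (rule Lp_measurable)
    define g where "g u = h u * indicator I u" for u
    have [measurable]: "g \<in> borel_measurable borel" unfolding g_def I_def by measurable
    have gL: "g \<in> Lp q" by (rule Lp_mono(1)[OF q h]) (auto simp: g_def I_def indicator_def)
    have "\<Lambda> g = (LINT u|lborel. g u * L u)" by (rule rep2[OF gL]) (auto simp: g_def I_def)
    also have "\<dots> = (LINT u|lborel. L u * h u)"
      using L(3) by (intro Bochner_Integration.integral_cong) (auto simp: g_def I_def indicator_def)
    finally have "\<Lambda> g = (LINT u|lborel. L u * h u)" .
    moreover have "(LINT u|lborel. F n u * g u) = (LINT u|lborel. F n u * h u)" for n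
      using bounded_on_Icc_outside[OF F, of _ n]
      by (intro Bochner_Integration.integral_cong) (auto simp: g_def I_def indicator_def)
    ultimately show ?thesis using lim[OF gL] by simp
  qed
  then show thesis using that[OF rep1 L(2,3)] by blast
qed

lemma convergent_if_approximable:
  fixes X :: "nat \<Rightarrow> real"
  assumes "\<And>\<epsilon>. \<epsilon> > 0 \<Longrightarrow> \<exists>Y. convergent Y \<and> (\<forall>n. \<bar>X n - Y n\<bar> \<le> \<epsilon>)"
  shows "convergent X"
  unfolding Cauchy_convergent_iff[symmetric]
proof (rule metric_CauchyI)
  fix e :: real assume e: "e > 0"
  obtain Y where Y: "convergent Y" "\<And>n. \<bar>X n - Y n\<bar> \<le> e / 4" using assms[of "e/4"] e by auto
  have "Cauchy Y" using Y(1) by (simp add: Cauchy_convergent_iff)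
  then obtain N where N: "\<And>m n. m \<ge> N \<Longrightarrow> n \<ge> N \<Longrightarrow> dist (Y m) (Y n) < e / 4"
    unfolding Cauchy_def using e by (metis divide_pos_pos zero_less_numeral)
  show "\<exists>N. \<forall>m\<ge>N. \<forall>n\<ge>N. dist (X m) (X n) < e"
  proof (intro exI[of _ N] allI impI)
    fix m n assume "N \<le> m" "N \<le> n"
    then have "\<bar>Y m - Y n\<bar> < e / 4" using N by (simp add: dist_real_def)
    then show "dist (X m) (X n) < e" using Y(2)[of m] Y(2)[of n] unfolding dist_real_def by linarith
  qed
qed

text \<open>Weights are exhausted in three rounds: indicators are approximated by continuous functions up to
  sets of small measure, where uniform absolute continuity applies; bounded weights by step
  functions in the uniform norm; and general weights by their truncations in
  \<open>L\<^sup>q\<close>.\<close>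

theorem convergent_if_convergent_continuous:
  assumes pq: "conjugate p q" and F: "\<And>n. bounded_on_Icc M (F n)" and pos: "\<And>n u. 0 \<le> F n u"
    and uac: "uniformly_abs_continuous F" and C: "\<And>n. Lp_norm p (F n) \<le> C"
    and conv: "\<And>g. continuous_on UNIV g \<Longrightarrow> convergent (\<lambda>n. LINT u|lborel. F n u * g u)"
    and h: "h \<in> Lp q"
  shows "convergent (\<lambda>n. LINT u|lborel. F n u * h u)"
proof -
  have p: "1 \<le> p" and q: "1 \<le> q" using conjugate_ge_1[OF pq] by auto
  have FL: "F n \<in> Lp p" for n using bounded_on_Icc_Lp[OF p F] .
  have int_F: "integrable lborel (F n)" for n by (rule bounded_on_Icc_integrable[OF F])
  have ind: "convergent (\<lambda>n. LINT u|lborel. F n u * indicator A u)" if A [measurable]: "A \<in> sets borel" for A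
  proof (rule convergent_if_approximable)
    fix \<epsilon> :: real assume e: "\<epsilon> > 0"
    then obtain \<delta> where \<delta>: "\<delta> > 0" "\<And>A n. A \<in> sets borel \<Longrightarrow> emeasure lborel A < ennreal \<delta> \<Longrightarrow> (LINT u|lborel. F n u * indicator A u) < \<epsilon>"
      using uac unfolding uniformly_abs_continuous_def by blast
    have \<delta>2: "\<delta> / 2 > 0" using \<delta>(1) by simp
    obtain U where U: "open U" "A \<subseteq> U" "emeasure lborel (U - A) < ennreal (\<delta> / 2)"
      using outer_regular_lborel[OF A \<delta>2] by blast
    have "- A \<in> sets borel" by auto
    then obtain V where V: "open V" "- A \<subseteq> V" "emeasure lborel (V - (- A)) < ennreal (\<delta> / 2)"
      using outer_regular_lborel[OF _ \<delta>2] by blast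
    have [measurable]: "U \<in> sets borel" "V \<in> sets borel" using U V by auto
    have "closed (- U)" "closed (- V)" "(- U) \<inter> (- V) = {}" using U V by auto
    \<comment> \<open>\<open>U\<close> and \<open>V\<close> are open neighbourhoods of \<open>A\<close> and of its
      complement with small overlap, and \<open>g\<close> agrees with the indicator of
      \<open>A\<close> outside the overlap.\<close>
    then obtain g :: "real \<Rightarrow> real" where g: "continuous_on UNIV g" "\<And>u. g u \<in> closed_segment 0 1"
        "\<And>u. u \<in> - U \<Longrightarrow> g u = 0" "\<And>u. u \<in> - V \<Longrightarrow> g u = 1"
      using Urysohn[of "- U" "- V" "0::real" 1] by blast
    have g01: "0 \<le> g u \<and> g u \<le> 1" for u using g(2)[of u] by (simp add: closed_segment_eq_real_ivl)
    have [measurable]: "g \<in> borel_measurable borel" using g(1) by (rule borel_measurable_continuous_onI)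
    have "emeasure lborel (U \<inter> V) \<le> emeasure lborel ((U - A) \<union> (V - (- A)))"
      by (rule emeasure_mono) auto
    also have "\<dots> \<le> emeasure lborel (U - A) + emeasure lborel (V - (- A))"
      by (rule emeasure_subadditive) auto
    also have "\<dots> < ennreal (\<delta> / 2) + ennreal (\<delta> / 2)" using U(3) V(3) by (rule add_strict_mono)
    also have "\<dots> = ennreal \<delta>" using \<delta>(1) by (simp flip: ennreal_plus)
    finally have small: "(LINT u|lborel. F n u * indicator (U \<inter> V) u) < \<epsilon>" for n by (intro \<delta>(2)) auto
    have ig: "integrable lborel (\<lambda>u. F n u * g u)" for n
      by (rule bounded_on_Icc_integrable[OF bounded_on_Icc_mult[OF F, where B=1]]) (use g01 in auto)
    have iA: "integrable lborel (\<lambda>u. F n u * indicator A u)" for n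
      by (rule integrable_bounded_on_Icc_indicator[OF F A])
    have "\<bar>(LINT u|lborel. F n u * indicator A u) - (LINT u|lborel. F n u * g u)\<bar> \<le> \<epsilon>" for n
    proof -
      have "\<bar>(LINT u|lborel. F n u * indicator A u) - (LINT u|lborel. F n u * g u)\<bar> = \<bar>LINT u|lborel. F n u * indicator A u - F n u * g u\<bar>"
        using iA ig by simp
      also have "\<dots> \<le> (LINT u|lborel. \<bar>F n u * indicator A u - F n u * g u\<bar>)" by (rule integral_abs_bound)
      also have "\<dots> \<le> (LINT u|lborel. F n u * indicator (U \<inter> V) u)"
      proof (rule integral_mono)
        show "integrable lborel (\<lambda>u. \<bar>F n u * indicator A u - F n u * g u\<bar>)" using iA ig by auto
        show "integrable lborel (\<lambda>u. F n u * indicator (U \<inter> V) u)" by (rule integrable_bounded_on_Icc_indicator[OF F]) auto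
        fix u
        have "\<bar>indicator A u - g u\<bar> \<le> indicator (U \<inter> V) u"
          using U(2) V(2) g(3)[of u] g(4)[of u] g01[of u] by (auto simp: indicator_def)
        then have "F n u * \<bar>indicator A u - g u\<bar> \<le> F n u * indicator (U \<inter> V) u" by (rule mult_left_mono[OF _ pos])
        then show "\<bar>F n u * indicator A u - F n u * g u\<bar> \<le> F n u * indicator (U \<inter> V) u"
          using pos[of n u] by (simp add: abs_mult flip: right_diff_distrib)
      qed
      finally show ?thesis using small[of n] by linarith
    qed
    then show "\<exists>Y. convergent Y \<and> (\<forall>n. \<bar>(LINT u|lborel. F n u * indicator A u) - Y n\<bar> \<le> \<epsilon>)"
      using conv[OF g(1)] by blast
  qed
  obtain C1 where C1: "\<And>n. \<bar>LINT u|lborel. F n u\<bar> \<le> C1"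
    using convergent_imp_Bseq[OF conv[of "\<lambda>_. 1"]] unfolding Bseq_def by auto
  have C1_0: "0 \<le> C1" using C1[of 0] by linarith
  have bdd: "convergent (\<lambda>n. LINT u|lborel. F n u * f u)" if f: "bounded_on_Icc M f" for f
  proof (rule convergent_if_approximable)
    fix \<epsilon> :: real assume e: "\<epsilon> > 0"
    then have e': "\<epsilon> / (C1 + 1) > 0" using C1_0 by simp
    obtain J :: "int set" and c A where J: "finite J" "\<And>j. A j \<in> sets borel" "\<And>j. A j \<subseteq> {-M..M}"
        "\<And>u. \<bar>f u - (\<Sum>j\<in>J. c j * indicator (A j) u)\<bar> \<le> \<epsilon> / (C1 + 1) * indicator {-M..M} u"
      using bounded_on_Icc_step_approximation[OF f e'] by blast
    define S where "S u = (\<Sum>j\<in>J. c j * indicator (A j) u)" for u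
    have bS: "bounded_on_Icc M S" unfolding S_def
      by (intro bounded_on_Icc_sum[OF J(1)] bounded_on_Icc_cmult bounded_on_Icc_indicator[OF J(2,3)])
    have i: "integrable lborel (\<lambda>u. F n u * g u)" if "bounded_on_Icc M g" for n g
      by (rule Holder(1)[OF pq FL bounded_on_Icc_Lp[OF q that]])
    have "(LINT u|lborel. F n u * S u) = (\<Sum>j\<in>J. c j * (LINT u|lborel. F n u * indicator (A j) u))" for n
    proof -
      have "(LINT u|lborel. F n u * S u) = (LINT u|lborel. (\<Sum>j\<in>J. c j * (F n u * indicator (A j) u)))"
        by (simp add: S_def sum_distrib_left mult.left_commute)
      also have "\<dots> = (\<Sum>j\<in>J. LINT u|lborel. c j * (F n u * indicator (A j) u))"
        by (rule Bochner_Integration.integral_sum) (intro integrable_mult_right integrable_bounded_on_Icc_indicator[OF F J(2)])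
      finally show ?thesis by simp
    qed
    moreover have "convergent (\<lambda>n. \<Sum>j\<in>J. c j * (LINT u|lborel. F n u * indicator (A j) u))"
      by (intro convergent_sum convergent_mult convergent_const ind J(2))
    ultimately have "convergent (\<lambda>n. LINT u|lborel. F n u * S u)" by simp
    moreover have "\<bar>(LINT u|lborel. F n u * f u) - (LINT u|lborel. F n u * S u)\<bar> \<le> \<epsilon>" for n
    proof -
      have "\<bar>(LINT u|lborel. F n u * f u) - (LINT u|lborel. F n u * S u)\<bar> = \<bar>LINT u|lborel. F n u * f u - F n u * S u\<bar>"
        using i[OF f] i[OF bS] by simp
      also have "\<dots> \<le> (LINT u|lborel. \<bar>F n u * f u - F n u * S u\<bar>)" by (rule integral_abs_bound)
      also have "\<dots> \<le> (LINT u|lborel. F n u * (\<epsilon> / (C1 + 1)))"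
      proof (rule integral_mono)
        show "integrable lborel (\<lambda>u. \<bar>F n u * f u - F n u * S u\<bar>)" using i[OF f] i[OF bS] by auto
        show "integrable lborel (\<lambda>u. F n u * (\<epsilon> / (C1 + 1)))" using int_F by simp
        fix u
        have "\<bar>f u - S u\<bar> \<le> \<epsilon> / (C1 + 1)" using J(4)[of u] e' by (cases "u \<in> {-M..M}") (auto simp: S_def)
        then have "F n u * \<bar>f u - S u\<bar> \<le> F n u * (\<epsilon> / (C1 + 1))" by (rule mult_left_mono[OF _ pos])
        then show "\<bar>F n u * f u - F n u * S u\<bar> \<le> F n u * (\<epsilon> / (C1 + 1))"
          using pos[of n u] by (simp add: abs_mult flip: right_diff_distrib)
      qed
      also have "\<dots> = (LINT u|lborel. F n u) * (\<epsilon> / (C1 + 1))" by simp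
      also have "\<dots> \<le> C1 * (\<epsilon> / (C1 + 1))" using C1[of n] e' by (intro mult_right_mono) auto
      also have "\<dots> \<le> \<epsilon>" using C1_0 e by (simp add: field_simps)
      finally show ?thesis .
    qed
    ultimately show "\<exists>Y. convergent Y \<and> (\<forall>n. \<bar>(LINT u|lborel. F n u * f u) - Y n\<bar> \<le> \<epsilon>)" by blast
  qed
  have [measurable]: "h \<in> borel_measurable borel" using h by (rule Lp_measurable)
  have C0: "0 \<le> C" using C[of 0] Lp_norm_nonneg[of p "F 0"] by linarith
  show ?thesis
  proof (rule convergent_if_approximable)
    fix \<epsilon> :: real assume e: "\<epsilon> > 0"
    let ?t = "\<lambda>k::nat. \<lambda>u. h u * indicator {u. \<bar>h u\<bar> > real k} u"
    have "eventually (\<lambda>k. Lp_norm q (?t k) < \<epsilon> / (C + 1)) sequentially"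
      using Lp_norm_truncation_tendsto_0[OF q h] e C0 by (intro order_tendstoD(2)) auto
    then obtain k where k: "Lp_norm q (?t k) < \<epsilon> / (C + 1)" by (auto simp: eventually_sequentially)
    define g where "g u = h u * indicator {u. \<bar>h u\<bar> \<le> real k} u * indicator {-M..M} u" for u
    have [measurable]: "g \<in> borel_measurable borel" unfolding g_def by measurable
    have bg: "bounded_on_Icc M g" by (rule bounded_on_IccI[where B="real k"]) (auto simp: g_def indicator_def)
    have tL: "?t k \<in> Lp q" by (rule Lp_mono(1)[OF q h]) (auto simp: indicator_def)
    have "\<bar>(LINT u|lborel. F n u * h u) - (LINT u|lborel. F n u * g u)\<bar> \<le> \<epsilon>" for n
    proof -
      have "(LINT u|lborel. F n u * h u) - (LINT u|lborel. F n u * g u) = (LINT u|lborel. F n u * h u - F n u * g u)"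
        by (rule Bochner_Integration.integral_diff[symmetric]) (rule Holder(1)[OF pq FL h], rule Holder(1)[OF pq FL bounded_on_Icc_Lp[OF q bg]])
      also have "\<dots> = (LINT u|lborel. F n u * ?t k u)"
      proof (rule Bochner_Integration.integral_cong[OF refl])
        fix u show "F n u * h u - F n u * g u = F n u * ?t k u"
          using bounded_on_Icc_outside[OF F, of u n] by (auto simp: g_def indicator_def)
      qed
      finally have "\<bar>(LINT u|lborel. F n u * h u) - (LINT u|lborel. F n u * g u)\<bar> \<le> Lp_norm p (F n) * Lp_norm q (?t k)"
        using Holder_abs[OF pq FL tL, of n] by simp
      also have "\<dots> \<le> C * (\<epsilon> / (C + 1))" using C[of n] k C0 Lp_norm_nonneg by (intro mult_mono) auto
      also have "\<dots> \<le> \<epsilon>" using C0 e by (simp add: field_simps)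
      finally show ?thesis .
    qed
    then show "\<exists>Y. convergent Y \<and> (\<forall>n. \<bar>(LINT u|lborel. F n u * h u) - Y n\<bar> \<le> \<epsilon>)"
      using bdd[OF bg] by blast
  qed
qed

section \<open>Equi-integrability\<close>

lemma uniformly_abs_continuous_if_bounded:
  assumes pq: "conjugate p q" and p1: "p \<noteq> 1" and F: "\<And>n. F n \<in> Lp p" and C: "\<And>n. Lp_norm p (F n) \<le> C"
  shows "uniformly_abs_continuous F"
  unfolding uniformly_abs_continuous_def
proof (intro allI impI)
  fix \<epsilon> :: real assume e: "\<epsilon> > 0"
  have q: "1 \<le> q" using conjugate_ge_1[OF pq] by auto
  have "q \<noteq> top" using pq p1 by (cases rule: conjugate_cases) auto
  then obtain s where s: "1 \<le> s" "q = ennreal s" using q by (cases rule: exponent_cases[OF q]) auto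
  have C0: "0 \<le> C" using C[of 0] Lp_norm_nonneg[of p "F 0"] by linarith
  show "\<exists>\<delta>>0. \<forall>A\<in>sets borel. emeasure lborel A < ennreal \<delta> \<longrightarrow> (\<forall>n. (LINT u|lborel. F n u * indicator A u) < \<epsilon>)"
  proof (intro exI[of _ "(\<epsilon> / (C + 1)) powr s"] conjI ballI impI allI)
    show "0 < (\<epsilon> / (C + 1)) powr s" using e C0 by simp
    fix A :: "real set" and n assume A [measurable]: "A \<in> sets borel" and l: "emeasure lborel A < ennreal ((\<epsilon> / (C + 1)) powr s)"
    have m: "measure lborel A powr (1 / s) < \<epsilon> / (C + 1)"
      using e C0 s by (intro powr_inverse_less emeasure_less_imp_measure_less[OF l]) auto
    have "\<bar>indicator A u\<bar> powr s = (indicator A u :: real)" for u by (auto simp: indicator_def)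
    then have AL: "indicator A \<in> Lp q"
      using l s by (simp add: Lp_finite_iff) (auto intro!: integrable_real_indicator intro: less_trans)
    have "(LINT u|lborel. F n u * indicator A u) \<le> Lp_norm p (F n) * Lp_norm q (indicator A)"
      using Holder_abs[OF pq F AL, of n] by linarith
    also have "\<dots> \<le> C * (\<epsilon> / (C + 1))"
      using C[of n] m s C0 by (intro mult_mono Lp_norm_nonneg) (auto simp: Lp_norm_indicator)
    also have "\<dots> < \<epsilon>" using C0 e by (simp add: field_simps)
    finally show "(LINT u|lborel. F n u * indicator A u) < \<epsilon>" .
  qed
qed

text \<open>The support in a fixed interval is what makes equi-integrability imply boundedness in
  \<open>L\<^sup>1\<close>; the converse implication applies uniform absolute continuity to the
  sets \<open>{u. F n u > K}\<close>, which are small by Markov's inequality.\<close>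

lemma equi_integrable_iff:
  assumes F: "\<And>n. bounded_on_Icc M (F n)" and pos: "\<And>n u. 0 \<le> F n u"
  shows "equi_integrable F \<longleftrightarrow> uniformly_abs_continuous F \<and> (\<exists>C. \<forall>n. Lp_norm 1 (F n) \<le> C)"
proof -
  have [measurable]: "F n \<in> borel_measurable borel" for n using F by (rule bounded_on_Icc_measurable)
  have iF: "integrable lborel (F n)" for n by (rule bounded_on_Icc_integrable[OF F])
  have FL: "F n \<in> Lp 1" for n using iF by (simp add: Lp_1_iff)
  have N1: "Lp_norm 1 (F n) = (LINT u|lborel. F n u)" for n using pos by (simp add: Lp_norm_1)
  have iA: "integrable lborel (\<lambda>u. F n u * indicator A u)" if "A \<in> sets borel" for n A
    by (rule integrable_bounded_on_Icc_indicator[OF F that])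
  have set_eq: "(LINT u:{u. \<bar>F n u\<bar> > K}|lborel. \<bar>F n u\<bar>) = (LINT u|lborel. F n u * indicator {u. F n u > K} u)" for n K
    unfolding set_lebesgue_integral_def using pos by (intro Bochner_Integration.integral_cong) (auto simp: indicator_def)
  have split: "F n u \<le> F n u * indicator {u. F n u > K} u + \<bar>K\<bar>" for n u K
    using pos[of n u] by (auto simp: indicator_def)
  show ?thesis
  proof
    assume ei: "equi_integrable F"
    have K: "\<exists>K. \<forall>n. (LINT u|lborel. F n u * indicator {u. F n u > K} u) \<le> \<epsilon>" if "\<epsilon> > 0" for \<epsilon>
      using ei that unfolding equi_integrable_def set_eq by blast
    have UAC: "uniformly_abs_continuous F"
      unfolding uniformly_abs_continuous_def
    proof (intro allI impI)
      fix \<epsilon> :: real assume e: "\<epsilon> > 0"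
      then obtain K where K: "\<And>n. (LINT u|lborel. F n u * indicator {u. F n u > K} u) \<le> \<epsilon> / 2" using K[of "\<epsilon>/2"] by auto
      show "\<exists>\<delta>>0. \<forall>A\<in>sets borel. emeasure lborel A < ennreal \<delta> \<longrightarrow> (\<forall>n. (LINT u|lborel. F n u * indicator A u) < \<epsilon>)"
      proof (intro exI[of _ "\<epsilon> / (2 * (\<bar>K\<bar> + 1))"] conjI ballI impI allI)
        show "0 < \<epsilon> / (2 * (\<bar>K\<bar> + 1))" using e by simp
        fix A :: "real set" and n assume A [measurable]: "A \<in> sets borel" and l: "emeasure lborel A < ennreal (\<epsilon> / (2 * (\<bar>K\<bar> + 1)))"
        have m: "measure lborel A < \<epsilon> / (2 * (\<bar>K\<bar> + 1))" by (rule emeasure_less_imp_measure_less[OF l])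
        have iK: "integrable lborel (\<lambda>u. \<bar>K\<bar> * indicator A u)"
          by (intro integrable_mult_right integrable_real_indicator) (use l in \<open>auto intro: less_trans\<close>)
        have "(LINT u|lborel. F n u * indicator A u) \<le> (LINT u|lborel. F n u * indicator {u. F n u > K} u + \<bar>K\<bar> * indicator A u)"
        proof (rule integral_mono)
          show "integrable lborel (\<lambda>u. F n u * indicator {u. F n u > K} u + \<bar>K\<bar> * indicator A u)"
            by (rule Bochner_Integration.integrable_add[OF iA iK]) simp
          show "F n u * indicator A u \<le> F n u * indicator {u. F n u > K} u + \<bar>K\<bar> * indicator A u" for u
            using split[of n u K] pos[of n u] by (auto simp: indicator_def)
        qed (rule iA, simp)
        also have "\<dots> = (LINT u|lborel. F n u * indicator {u. F n u > K} u) + \<bar>K\<bar> * measure lborel A"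
          using iK by (subst Bochner_Integration.integral_add) (auto intro: iA)
        also have "\<dots> \<le> \<epsilon> / 2 + \<bar>K\<bar> * (\<epsilon> / (2 * (\<bar>K\<bar> + 1)))"
          using K[of n] m by (intro add_mono mult_left_mono) auto
        also have "\<dots> < \<epsilon>" using e by (simp add: field_simps)
        finally show "(LINT u|lborel. F n u * indicator A u) < \<epsilon>" .
      qed
    qed
    obtain K where K: "\<And>n. (LINT u|lborel. F n u * indicator {u. F n u > K} u) \<le> 1" using K[of 1] by auto
    have "Lp_norm 1 (F n) \<le> 1 + \<bar>K\<bar> * measure lborel {-M..M}" for n
    proof -
      have iK: "integrable lborel (\<lambda>u. \<bar>K\<bar> * indicator {-M..M} u)" using integrable_indicator_Icc by (rule integrable_mult_right)
      have "(LINT u|lborel. F n u) \<le> (LINT u|lborel. F n u * indicator {u. F n u > K} u + \<bar>K\<bar> * indicator {-M..M} u)"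
      proof (rule integral_mono[OF iF])
        show "integrable lborel (\<lambda>u. F n u * indicator {u. F n u > K} u + \<bar>K\<bar> * indicator {-M..M} u)"
          by (rule Bochner_Integration.integrable_add[OF iA iK]) simp
        show "F n u \<le> F n u * indicator {u. F n u > K} u + \<bar>K\<bar> * indicator {-M..M} u" for u
          using split[of n u K] bounded_on_Icc_outside[OF F, of u n] by (cases "u \<in> {-M..M}") auto
      qed
      also have "\<dots> = (LINT u|lborel. F n u * indicator {u. F n u > K} u) + \<bar>K\<bar> * measure lborel {-M..M}"
        using iK by (subst Bochner_Integration.integral_add) (auto intro: iA)
      finally show ?thesis using K[of n] by (simp add: N1)
    qed
    then show "uniformly_abs_continuous F \<and> (\<exists>C. \<forall>n. Lp_norm 1 (F n) \<le> C)" using UAC by blast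
  next
    assume "uniformly_abs_continuous F \<and> (\<exists>C. \<forall>n. Lp_norm 1 (F n) \<le> C)"
    then obtain C where uac: "uniformly_abs_continuous F" and C: "\<And>n. (LINT u|lborel. F n u) \<le> C" unfolding N1 by blast
    have "0 \<le> (LINT u|lborel. F 0 u)" by (rule integral_nonneg_AE) (simp add: pos)
    then have C0: "0 \<le> C" using C[of 0] by linarith
    show "equi_integrable F"
      unfolding equi_integrable_def set_eq
    proof (intro conjI allI impI FL)
      fix \<epsilon> :: real assume e: "\<epsilon> > 0"
      then obtain \<delta> where \<delta>: "\<delta> > 0" "\<And>A n. A \<in> sets borel \<Longrightarrow> emeasure lborel A < ennreal \<delta> \<Longrightarrow> (LINT u|lborel. F n u * indicator A u) < \<epsilon>"
        using uac unfolding uniformly_abs_continuous_def by blast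
      \<comment> \<open>Markov's inequality gives measure at most \<open>C / K\<close>, which is below
        \<open>\<delta>\<close>.\<close>
      define K where "K = (C + 1) / \<delta>"
      have K0: "K > 0" using C0 \<delta>(1) by (simp add: K_def)
      have "(LINT u|lborel. F n u * indicator {u. F n u > K} u) \<le> \<epsilon>" for n
      proof -
        define A where "A = {u. F n u > K}"
        have [measurable]: "A \<in> sets borel" unfolding A_def by measurable
        have AM: "A \<subseteq> {-M..M}" using bounded_on_Icc_outside[OF F, of _ n] K0 by (force simp: A_def)
        have fin: "emeasure lborel A < top"
          using emeasure_mono[OF AM, of lborel] emeasure_lborel_Icc_finite[of "-M" M] by (auto intro: le_less_trans)
        have iKA: "integrable lborel (\<lambda>u. K * indicator A u)"
          by (intro integrable_mult_right integrable_real_indicator) (use fin in auto)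
        have "K * measure lborel A = (LINT u|lborel. K * indicator A u)" using fin by simp
        also have "\<dots> \<le> (LINT u|lborel. F n u)"
          by (rule integral_mono[OF iKA iF]) (use pos[of n] in \<open>auto simp: A_def indicator_def\<close>)
        finally have "K * measure lborel A \<le> C" using C[of n] by linarith
        then have le: "(C + 1) * measure lborel A \<le> C * \<delta>" using \<delta>(1) by (simp add: K_def pos_divide_le_eq)
        have "measure lborel A < \<delta>"
        proof (rule ccontr)
          assume "\<not> measure lborel A < \<delta>"
          then have "(C + 1) * \<delta> \<le> (C + 1) * measure lborel A" using C0 by (intro mult_left_mono) auto
          then show False using le \<delta>(1) by (simp add: algebra_simps)
        qed
        then have "emeasure lborel A < ennreal \<delta>"
          using fin \<delta>(1) by (subst emeasure_eq_ennreal_measure) (auto simp: ennreal_less_iff)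
        then show ?thesis using \<delta>(2)[of A n] by (simp add: A_def)
      qed
      then show "\<exists>K. \<forall>n. (LINT u|lborel. F n u * indicator {u. F n u > K} u) \<le> \<epsilon>" by blast
    qed
  qed
qed

section \<open>The kernel in Taylor's formula\<close>

lemma locally_abs_continuous_imp_continuous_on:
  assumes "locally_abs_continuous g"
  shows "continuous_on UNIV g"
  unfolding continuous_on_iff
proof (intro ballI allI impI)
  fix x e :: real assume e: "0 < e"
  obtain \<delta> where \<delta>: "\<delta> > 0" and D: "\<forall>D. finite D \<and> (\<forall>(c, d)\<in>D. x - 1 \<le> c \<and> c \<le> d \<and> d \<le> x + 1) \<and>
        disjoint_family_on (\<lambda>(c, d). {c<..<d}) D \<and> (\<Sum>(c, d)\<in>D. d - c) < \<delta> \<longrightarrow>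
        (\<Sum>(c, d)\<in>D. \<bar>g d - g c\<bar>) < e"
    using locally_abs_continuousD[OF assms e] by blast
  show "\<exists>d>0. \<forall>y\<in>UNIV. dist y x < d \<longrightarrow> dist (g y) (g x) < e"
  proof (intro exI[of _ "min 1 \<delta>"] conjI ballI impI)
    show "0 < min 1 \<delta>" using \<delta> by simp
    fix y assume y: "dist y x < min 1 \<delta>"
    have *: "x - 1 \<le> c \<and> c \<le> d \<and> d \<le> x + 1 \<Longrightarrow> d - c < \<delta> \<Longrightarrow> \<bar>g d - g c\<bar> < e" for c d
      using D[rule_format, of "{(c,d)}"] by (simp add: disjoint_family_on_def)
    show "dist (g y) (g x) < e"
      using *[of x y] *[of y x] y by (cases "x \<le> y") (auto simp: dist_real_def abs_minus_commute)
  qed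
qed

lemma antiderivative_has_derivative:
  assumes g: "continuous_on UNIV g"
  shows "(antiderivative g has_real_derivative g x) (at x)"
proof -
  have [measurable]: "g \<in> borel_measurable borel" using g by (rule borel_measurable_continuous_onI)
  have li: "locally_integrable g"
    unfolding locally_integrable_def using g
    by (auto intro!: borel_integrable_atLeastAtMost' continuous_on_subset[OF g])
  have "((\<lambda>u. integral {x-1..u} g) has_real_derivative g x) (at x within {x-1..x+1})"
    by (rule integral_has_real_derivative) (auto intro: continuous_on_subset[OF g])
  then have "((\<lambda>u. integral {x-1..u} g) has_real_derivative g x) (at x)"
    by (subst (asm) at_within_interior) auto
  then have "((\<lambda>u. antiderivative g (x-1) + integral {x-1..u} g) has_real_derivative g x) (at x)"
    by (auto intro!: derivative_eq_intros)
  then show ?thesis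
  proof (rule DERIV_cong_ev[THEN iffD1, OF refl _ refl, rotated])
    have "eventually (\<lambda>u. u \<in> {x-1<..}) (nhds x)" by (intro eventually_nhds_in_open) auto
    then show "\<forall>\<^sub>F u in nhds x. antiderivative g (x-1) + integral {x-1..u} g = antiderivative g u"
    proof eventually_elim
      case (elim u)
      then show ?case using antiderivative_diff[OF li, of "x-1" u] locally_integrable_integrable_on(2)[OF li, of "x-1" u] by simp
    qed
  qed
qed

text \<open>One summand of the discrete local time, for a step of the path from \<open>a\<close> to
  \<open>b\<close>.\<close>

definition step_kernel :: "real \<Rightarrow> real \<Rightarrow> real \<Rightarrow> real" where
  "step_kernel a b u = 2 * (indicator (oriented_Ico a b) u * \<bar>b - u\<bar>)"

lemma oriented_Ico_measurable [measurable]: "oriented_Ico a b \<in> sets borel"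
  by (simp add: oriented_Ico_def)

lemma step_kernel_measurable [measurable]: "step_kernel a b \<in> borel_measurable borel"
  unfolding step_kernel_def[abs_def] by measurable

lemma step_kernel_nonneg: "0 \<le> step_kernel a b u"
  by (simp add: step_kernel_def)

lemma step_kernel_same [simp]: "step_kernel a a u = 0"
  by (simp add: step_kernel_def oriented_Ico_def)

lemma step_kernel_le: "step_kernel a b u \<le> 2 * \<bar>b - a\<bar>"
  by (auto simp: step_kernel_def oriented_Ico_def indicator_def)

lemma step_kernel_nonzeroD: "step_kernel a b u \<noteq> 0 \<Longrightarrow> min a b \<le> u \<and> u \<le> max a b"
  by (auto simp: step_kernel_def oriented_Ico_def indicator_def split: if_splits)

lemma bounded_on_Icc_step_kernel:
  assumes "\<bar>a\<bar> \<le> M" "\<bar>b\<bar> \<le> M" shows "bounded_on_Icc M (step_kernel a b)"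
proof (rule bounded_on_IccI)
  show "\<bar>step_kernel a b u\<bar> \<le> 2 * \<bar>b - a\<bar>" for u using step_kernel_le step_kernel_nonneg by simp
  show "step_kernel a b u = 0" if "u \<notin> {-M..M}" for u
    using step_kernel_nonzeroD[of a b u] assms that by (cases "step_kernel a b u = 0") auto
qed simp

lemma integrable_bounded_on_Icc_mult:
  assumes k: "bounded_on_Icc M k" and h: "locally_integrable h"
  shows "integrable lborel (\<lambda>u. k u * h u)"
proof -
  have [measurable]: "k \<in> borel_measurable borel" "h \<in> borel_measurable borel"
    using k h by (auto simp: locally_integrable_def bounded_on_Icc_measurable)
  obtain B where B: "\<And>u. \<bar>k u\<bar> \<le> B" using bounded_on_Icc_bound[OF k] by blast
  have "integrable lborel (\<lambda>u. indicator {-M..M} u * h u)" using h by (auto simp: locally_integrable_def set_integrable_def)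
  moreover have "k \<in> Lp top" using B by (auto simp: Lp_infty_iff)
  ultimately have "integrable lborel (\<lambda>u. (indicator {-M..M} u * h u) * k u)" by (rule Holder_bounded_factor(1))
  moreover have "(indicator {-M..M} u * h u) * k u = k u * h u" for u
    using bounded_on_Icc_outside[OF k, of u] by (auto simp: indicator_def)
  ultimately show ?thesis by simp
qed

lemma Lp_locally_integrable:
  assumes pq: "conjugate p q" and h: "h \<in> Lp q" shows "locally_integrable h"
  unfolding locally_integrable_def
proof (intro conjI allI)
  show "h \<in> borel_measurable borel" using h by (rule Lp_measurable)
  fix a b :: real
  have "{a..b} \<subseteq> {- max \<bar>a\<bar> \<bar>b\<bar>..max \<bar>a\<bar> \<bar>b\<bar>}" by auto
  then have "indicator {a..b} \<in> Lp p" by (intro indicator_in_Lp[OF conjugate_ge_1(1)[OF pq]]) auto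
  from Holder(1)[OF pq this h] show "set_integrable lborel {a..b} h" by (simp add: set_integrable_def)
qed

lemma continuous_locally_integrable:
  assumes "continuous_on UNIV g" shows "locally_integrable g"
  unfolding locally_integrable_def using borel_measurable_continuous_onI[OF assms]
  by (auto intro!: borel_integrable_atLeastAtMost' continuous_on_subset[OF assms])

text \<open>The integral form of the remainder in Taylor's formula, \<open>\<integral>\<^sub>a\<^sup>b (b -
  u) h u du\<close>, whatever the order of \<open>a\<close> and \<open>b\<close>: the orientation
  of the integral cancels against the sign of \<open>b - u\<close>. It comes from the fundamental
  theorem of calculus for \<open>\<Phi> u = F u + (b - u) g u\<close>, in whose derivative the
  terms with \<open>g\<close> cancel.\<close>

lemma Taylor_step_kernel:
  assumes F: "\<And>u. (F has_real_derivative g u) (at u)" and g: "locally_abs_continuous g"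
    and gh: "AE u in lborel. (g has_real_derivative h u) (at u)" and h: "locally_integrable h"
  shows "F b - F a = g a * (b - a) + 1 / 2 * (LINT u|lborel. step_kernel a b u * h u)"
proof -
  have [measurable]: "h \<in> borel_measurable borel" using h by (simp add: locally_integrable_def)
  have gc: "continuous_on UNIV g" by (rule locally_abs_continuous_imp_continuous_on[OF g])
  define \<Phi> where "\<Phi> u = F u + (b - u) * g u" for u
  have \<Phi>_ac: "locally_abs_continuous \<Phi>"
  proof (rule locally_abs_continuous_if_dominated[OF g])
    fix l r :: real
    have "compact (g ` {l..r})" by (intro compact_continuous_image continuous_on_subset[OF gc]) auto
    then obtain G where G: "G > 0" "\<And>u. u \<in> {l..r} \<Longrightarrow> \<bar>g u\<bar> \<le> G"
      using compact_imp_bounded[of "g ` {l..r}"] unfolding bounded_pos by auto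
    define K where "K = 2 * G + \<bar>b\<bar> + \<bar>l\<bar> + \<bar>r\<bar>"
    have "\<bar>\<Phi> d - \<Phi> c\<bar> \<le> K * (\<bar>g d - g c\<bar> + (d - c))" if cd: "l \<le> c" "c \<le> d" "d \<le> r" for c d
    proof (cases "c = d")
      case False
      then have "c < d" using cd by simp
      then obtain z where z: "c < z" "z < d" "F d - F c = (d - c) * g z"
        using MVT2[of c d F g] F by auto
      have 1: "\<bar>F d - F c\<bar> \<le> (d - c) * G"
        unfolding z(3) abs_mult using G(2)[of z] z cd by (simp add: mult_left_mono)
      have 2: "\<bar>(b - d) * (g d - g c)\<bar> \<le> (\<bar>b\<bar> + \<bar>l\<bar> + \<bar>r\<bar>) * \<bar>g d - g c\<bar>"
        unfolding abs_mult using cd by (intro mult_right_mono) auto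
      have 3: "\<bar>(d - c) * g c\<bar> \<le> (d - c) * G"
        unfolding abs_mult using G(2)[of c] cd by (simp add: mult_left_mono)
      have "\<Phi> d - \<Phi> c = (F d - F c) + (b - d) * (g d - g c) - (d - c) * g c"
        by (simp add: \<Phi>_def algebra_simps)
      then have "\<bar>\<Phi> d - \<Phi> c\<bar> \<le> (d - c) * G + (\<bar>b\<bar> + \<bar>l\<bar> + \<bar>r\<bar>) * \<bar>g d - g c\<bar> + (d - c) * G"
        using order_trans[OF abs_triangle_ineq4 add_mono[OF order_trans[OF abs_triangle_ineq add_mono[OF 1 2]] 3]] by simp
      also have "\<dots> \<le> K * (\<bar>g d - g c\<bar> + (d - c))"
      proof -
        have "0 \<le> 2 * G * \<bar>g d - g c\<bar>" "0 \<le> (\<bar>b\<bar> + \<bar>l\<bar> + \<bar>r\<bar>) * (d - c)" using G(1) cd by auto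
        then show ?thesis by (simp add: K_def algebra_simps)
      qed
      finally show ?thesis .
    qed simp
    moreover have "K \<ge> 0" using G(1) by (simp add: K_def)
    ultimately show "\<exists>K\<ge>0. \<forall>c d. l \<le> c \<and> c \<le> d \<and> d \<le> r \<longrightarrow> \<bar>\<Phi> d - \<Phi> c\<bar> \<le> K * (\<bar>g d - g c\<bar> + (d - c))" by blast
  qed
  have \<Phi>_der: "AE u in lborel. (\<Phi> has_real_derivative (b - u) * h u) (at u)"
    using gh
  proof eventually_elim
    case (elim u)
    show ?case unfolding \<Phi>_def
      by (rule DERIV_cong[OF DERIV_add[OF F DERIV_mult[OF DERIV_diff[OF DERIV_const DERIV_ident] elim]]])
         (simp add: algebra_simps)
  qed
  have int: "set_integrable lborel {l..r} (\<lambda>u. (b - u) * h u)" for l r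
  proof -
    have "bounded_on_Icc (\<bar>l\<bar> + \<bar>r\<bar>) (\<lambda>u. indicator {l..r} u * (b - u))"
      by (rule bounded_on_IccI[where B="\<bar>b\<bar> + \<bar>l\<bar> + \<bar>r\<bar>"]) (auto simp: indicator_def)
    from integrable_bounded_on_Icc_mult[OF this h] show ?thesis by (simp add: set_integrable_def mult.assoc)
  qed
  have FTC: "(LINT u:{l..r}|lborel. (b - u) * h u) = \<Phi> r - \<Phi> l" if "l \<le> r" for l r
    using has_integral_ae_derivative[OF \<Phi>_ac that \<Phi>_der] set_borel_integral_eq_integral(2)[OF int[of l r]]
    by (simp add: integral_unique)
  show ?thesis
  proof (cases "a \<le> b")
    case True
    have "(LINT u|lborel. step_kernel a b u * h u) = (LINT u|lborel. 2 * (indicator {a..b} u * ((b - u) * h u)))"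
      using True by (intro Bochner_Integration.integral_cong) (auto simp: step_kernel_def oriented_Ico_def indicator_def)
    also have "\<dots> = 2 * (LINT u:{a..b}|lborel. (b - u) * h u)" by (simp add: set_lebesgue_integral_def)
    also have "\<dots> = 2 * (F b - F a - (b - a) * g a)" using FTC[OF True] by (simp add: \<Phi>_def)
    finally have eq: "(LINT u|lborel. step_kernel a b u * h u) = 2 * (F b - F a - (b - a) * g a)" .
    show ?thesis unfolding eq by (simp add: algebra_simps)
  next
    case False
    have "(LINT u|lborel. step_kernel a b u * h u) = (LINT u|lborel. (-2) * (indicator {b..a} u * ((b - u) * h u)))"
    proof (rule integral_cong_AE)
      show "AE u in lborel. step_kernel a b u * h u = (-2) * (indicator {b..a} u * ((b - u) * h u))"
        using AE_lborel_singleton[of a]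
      proof eventually_elim
        case (elim u)
        show ?case
        proof (cases "b \<le> u \<and> u < a")
          case True
          then show ?thesis using False by (simp add: step_kernel_def oriented_Ico_def algebra_simps)
        next
          case out: False
          then have "u \<notin> {b..<a}" "u \<notin> {b..a}" using elim by auto
          then show ?thesis using False by (simp add: step_kernel_def oriented_Ico_def)
        qed
      qed
    qed simp_all
    also have "\<dots> = (-2) * (LINT u:{b..a}|lborel. (b - u) * h u)" by (simp add: set_lebesgue_integral_def)
    also have "\<dots> = 2 * (F b - F a - (b - a) * g a)" using FTC[of b a] False by (simp add: \<Phi>_def algebra_simps)
    finally have eq: "(LINT u|lborel. step_kernel a b u * h u) = 2 * (F b - F a - (b - a) * g a)" .
    show ?thesis unfolding eq by (simp add: algebra_simps)
  qed
qed

lemma locally_abs_continuous_id: "locally_abs_continuous (\<lambda>u. u)"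
  unfolding locally_abs_continuous_def
proof (intro allI impI)
  fix a b \<epsilon> :: real assume "\<epsilon> > 0"
  then show "\<exists>\<delta>>0. \<forall>D. finite D \<and> (\<forall>(c, d)\<in>D. a \<le> c \<and> c \<le> d \<and> d \<le> b) \<and>
        disjoint_family_on (\<lambda>(c, d). {c<..<d}) D \<and> (\<Sum>(c, d)\<in>D. d - c) < \<delta> \<longrightarrow>
        (\<Sum>(c, d)\<in>D. \<bar>d - c\<bar>) < \<epsilon>"
  proof (intro exI[of _ \<epsilon>] conjI allI impI)
    fix D :: "(real \<times> real) set" assume *: "finite D \<and> (\<forall>(c, d)\<in>D. a \<le> c \<and> c \<le> d \<and> d \<le> b) \<and>
        disjoint_family_on (\<lambda>(c, d). {c<..<d}) D \<and> (\<Sum>(c, d)\<in>D. d - c) < \<epsilon>"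
    have "(\<Sum>(c, d)\<in>D. \<bar>d - c\<bar>) = (\<Sum>(c, d)\<in>D. d - c)" by (rule sum.cong) (use * in auto)
    then show "(\<Sum>(c, d)\<in>D. \<bar>d - c\<bar>) < \<epsilon>" using * by simp
  qed
qed

text \<open>Taylor's formula for \<open>u\<^sup>2 / 2\<close>.\<close>

lemma integral_step_kernel: "(LINT u|lborel. step_kernel a b u) = (b - a)\<^sup>2"
proof -
  have "b\<^sup>2 / 2 - a\<^sup>2 / 2 = a * (b - a) + 1 / 2 * (LINT u|lborel. step_kernel a b u * 1)"
  proof (rule Taylor_step_kernel[where F="\<lambda>u. u\<^sup>2 / 2" and g="\<lambda>u. u" and h="\<lambda>_. 1"])
    show "((\<lambda>u. u\<^sup>2 / 2) has_real_derivative u) (at u)" for u :: real by (auto intro!: derivative_eq_intros)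
    show "AE u in lborel. ((\<lambda>u. u) has_real_derivative 1) (at u)" by simp
    show "locally_integrable (\<lambda>_. 1)" by (rule continuous_locally_integrable) simp
  qed (rule locally_abs_continuous_id)
  then show ?thesis by (simp add: field_simps power2_eq_square)
qed

section \<open>Paths sampled along a partition\<close>

text \<open>The time \<open>\<pi> j \<and> t\<close>, which is finite even if \<open>\<pi> j\<close> is not.\<close>

definition stop_time :: "(nat \<Rightarrow> ennreal) \<Rightarrow> nat \<Rightarrow> real \<Rightarrow> real" where
  "stop_time \<pi> j t = enn2real (min (\<pi> j) (ennreal t))"

lemma ennreal_stop_time: "ennreal (stop_time \<pi> j t) = min (\<pi> j) (ennreal t)"
  unfolding stop_time_def by (rule ennreal_enn2real) (simp add: min_less_iff_disj)

lemma stopped_eq: "stopped x (\<pi> j) t = x (stop_time \<pi> j t)"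
proof -
  have "min (\<pi> j) (ennreal t) < top" by (rule le_less_trans[OF min.cobounded2 ennreal_less_top])
  then show ?thesis by (simp add: stopped_def path_at_def stop_time_def)
qed

lemma stop_time_nonneg: "0 \<le> stop_time \<pi> j t" by (simp add: stop_time_def)

lemma stop_time_le: "0 \<le> t \<Longrightarrow> stop_time \<pi> j t \<le> t"
  using ennreal_stop_time[of \<pi> j t] by (metis ennreal_le_iff min.cobounded2)

lemma stop_time_late: "0 \<le> t \<Longrightarrow> ennreal t \<le> \<pi> j \<Longrightarrow> stop_time \<pi> j t = t"
  by (simp add: stop_time_def min_absorb2)

locale partitioned =
  fixes \<pi> :: "nat \<Rightarrow> ennreal"
  assumes partition: "partition \<pi>"
begin

lemma \<pi>_0: "\<pi> 0 = 0" and \<pi>_lim: "\<pi> \<longlonglongrightarrow> \<infinity>"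
  using partition by (auto simp: partition_def)

lemma \<pi>_Suc: "\<pi> j \<le> \<pi> (Suc j)"
  using partition unfolding partition_def by (metis infinity_ennreal_def less_imp_le linorder_not_less top.not_eq_extremum top_greatest)

lemma \<pi>_mono: "i \<le> j \<Longrightarrow> \<pi> i \<le> \<pi> j"
  by (rule lift_Suc_mono_le[of \<pi>, OF \<pi>_Suc])

lemma \<pi>_eventually: "\<exists>N. ennreal t \<le> \<pi> N"
proof -
  have "eventually (\<lambda>j. ennreal t < \<pi> j) sequentially"
    using \<pi>_lim by (rule order_tendstoD(1)) simp
  then show ?thesis by (auto simp: eventually_sequentially intro: less_imp_le)
qed

lemma stop_time_0: "stop_time \<pi> 0 t = 0"
  by (simp add: stop_time_def \<pi>_0)

lemma stop_time_Suc: "0 \<le> t \<Longrightarrow> stop_time \<pi> j t \<le> stop_time \<pi> (Suc j) t"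
  unfolding stop_time_def by (rule enn2real_mono) (auto simp: min_le_iff_disj \<pi>_Suc min_less_iff_disj intro: min.mono)

text \<open>All three kinds of series in question are finite sums, since a step that starts after time
  \<open>t\<close> is trivial.\<close>

lemma sums_stopped:
  fixes G :: "nat \<Rightarrow> real"
  assumes t: "0 \<le> t" and N: "ennreal t \<le> \<pi> N"
    and G: "\<And>j. stop_time \<pi> j t = t \<Longrightarrow> stop_time \<pi> (Suc j) t = t \<Longrightarrow> G j = 0"
  shows "(\<Sum>j. G j) = (\<Sum>j<N. G j)"
proof (rule suminf_finite)
  fix j assume "j \<notin> {..<N}"
  then have "ennreal t \<le> \<pi> j" "ennreal t \<le> \<pi> (Suc j)" using N \<pi>_mono[of N j] \<pi>_mono[of N "Suc j"] by (auto intro: order_trans)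
  then show "G j = 0" by (intro G stop_time_late t)
qed simp

lemma discrete_local_time_eq:
  assumes "0 \<le> t" "ennreal t \<le> \<pi> N"
  shows "discrete_local_time x \<pi> t u = (\<Sum>j<N. step_kernel (x (stop_time \<pi> j t)) (x (stop_time \<pi> (Suc j) t)) u)"
  unfolding discrete_local_time_def stopped_eq step_kernel_def sum_distrib_left[symmetric]
  by (rule arg_cong[where f="\<lambda>s. 2 * s", OF sums_stopped[OF assms]]) (simp add: oriented_Ico_def)

lemma discrete_qv_eq:
  assumes "0 \<le> t" "ennreal t \<le> \<pi> N"
  shows "discrete_qv x \<pi> t = (\<Sum>j<N. (x (stop_time \<pi> (Suc j) t) - x (stop_time \<pi> j t))\<^sup>2)"
  unfolding discrete_qv_def stopped_eq by (rule sums_stopped[OF assms]) simp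

text \<open>The integrand may be sampled at stopped times as well: it is changed only where the increment
  vanishes.\<close>

lemma riemann_sum_eq:
  assumes t: "0 \<le> t" and N: "ennreal t \<le> \<pi> N"
  shows "riemann_sum x \<pi> g t = (\<Sum>j<N. g (x (stop_time \<pi> j t)) * (x (stop_time \<pi> (Suc j) t) - x (stop_time \<pi> j t)))"
proof -
  have "g (path_at x (\<pi> j)) * (x (stop_time \<pi> (Suc j) t) - x (stop_time \<pi> j t)) =
      g (x (stop_time \<pi> j t)) * (x (stop_time \<pi> (Suc j) t) - x (stop_time \<pi> j t))" for j
  proof (cases "ennreal t \<le> \<pi> j")
    case True
    then have "ennreal t \<le> \<pi> (Suc j)" using \<pi>_Suc[of j] by (rule order_trans)
    then show ?thesis using True stop_time_late[of t \<pi> j, OF t] stop_time_late[of t \<pi> "Suc j", OF t] by simp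
  next
    case False
    then have "min (\<pi> j) (ennreal t) = \<pi> j" "\<pi> j \<noteq> \<infinity>" by (auto simp: min_def top_unique)
    then show ?thesis by (simp add: stop_time_def path_at_def)
  qed
  then show ?thesis
    unfolding riemann_sum_def stopped_eq by (simp only:) (rule sums_stopped[OF t N], simp)
qed

text \<open>The oscillation is defined with half-open partition intervals; by left continuity it controls
  increments up to the right endpoint, too.\<close>

lemma oscillation_upper:
  assumes x: "continuous_on {0..} x" and ab: "0 \<le> a" "a \<le> b" "b \<le> T"
    and cell: "\<pi> j \<le> ennreal a" "ennreal b \<le> \<pi> (Suc j)"
  shows "\<bar>x b - x a\<bar> \<le> oscillation x \<pi> T"
proof -
  let ?S = "{\<bar>x b - x a\<bar> | a b. a \<in> {0..T} \<and> b \<in> {0..T} \<and>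
       (\<exists>k. ennreal a \<in> {\<pi> k..<\<pi> (Suc k)} \<and> ennreal b \<in> {\<pi> k..<\<pi> (Suc k)})}"
  have "compact (x ` {0..T})" by (intro compact_continuous_image continuous_on_subset[OF x]) auto
  then have "bounded (x ` {0..T})" by (rule compact_imp_bounded)
  then obtain B where "\<forall>y\<in>x ` {0..T}. norm y \<le> B" unfolding bounded_iff by blast
  then have B: "\<bar>x u\<bar> \<le> B" if "u \<in> {0..T}" for u using that by auto
  have "bdd_above ?S"
  proof (rule bdd_aboveI)
    fix y assume "y \<in> ?S"
    then obtain a b where "y = \<bar>x b - x a\<bar>" "a \<in> {0..T}" "b \<in> {0..T}" by blast
    then show "y \<le> B + B" using B[of a] B[of b] by linarith
  qed
  then have upper: "\<bar>x d - x c\<bar> \<le> oscillation x \<pi> T"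
    if "c \<in> {0..T}" "d \<in> {0..T}" "ennreal c \<in> {\<pi> k..<\<pi> (Suc k)}" "ennreal d \<in> {\<pi> k..<\<pi> (Suc k)}" for c d k
    unfolding oscillation_def by (rule cSup_upper[rotated]) (use that in blast)
  show ?thesis
  proof (cases "a = b")
    case True
    have "0 < \<pi> (Suc 0)" using partition unfolding partition_def by (cases "\<pi> (Suc 0) < \<infinity>") (auto simp: less_top[symmetric])
    then have "\<bar>x 0 - x 0\<bar> \<le> oscillation x \<pi> T" using ab by (intro upper[of _ _ 0]) (auto simp: \<pi>_0)
    then show ?thesis using True by simp
  next
    case False
    then have "a < b" using ab by simp
    have "continuous (at b within {a..b}) x"
      using x ab by (meson continuous_on_eq_continuous_within continuous_on_subset atLeastAtMost_iff atLeast_iff order_trans subsetI order_refl)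
    then have "(x \<longlongrightarrow> x b) (at b within {a..b})" by (simp add: continuous_within)
    then have "(x \<longlongrightarrow> x b) (at_left b)"
      using \<open>a < b\<close> by (simp add: at_within_Icc_at_left)
    then have "((\<lambda>c. \<bar>x c - x a\<bar>) \<longlongrightarrow> \<bar>x b - x a\<bar>) (at_left b)"
      by (intro tendsto_intros)
    moreover have "eventually (\<lambda>c. \<bar>x c - x a\<bar> \<le> oscillation x \<pi> T) (at_left b)"
    proof -
      have "eventually (\<lambda>c. c \<in> {a<..<b}) (at_left b)" using \<open>a < b\<close> by (rule eventually_at_left_real)
      then show ?thesis
      proof eventually_elim
        case (elim c)
        have "ennreal c < ennreal b" using elim ab by (auto simp: ennreal_less_iff)
        moreover have "ennreal a \<le> ennreal c" "ennreal a < ennreal b" using elim \<open>a < b\<close> ab by (auto simp: ennreal_leI ennreal_less_iff)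
        ultimately show ?case using cell elim ab by (intro upper[of _ _ j]) (auto intro: order_trans less_le_trans)
      qed
    qed
    ultimately show ?thesis by (intro tendsto_upperbound) auto
  qed
qed

lemma stop_time_increment:
  assumes x: "continuous_on {0..} x" and t: "0 \<le> t" "t \<le> T"
  shows "\<bar>x (stop_time \<pi> (Suc j) t) - x (stop_time \<pi> j t)\<bar> \<le> oscillation x \<pi> T"
proof (cases "\<pi> j \<le> ennreal t")
  case True
  show ?thesis
    by (rule oscillation_upper[OF x stop_time_nonneg stop_time_Suc])
       (use t True stop_time_le[OF t(1)] in \<open>auto simp: ennreal_stop_time min_absorb1 intro: order_trans\<close>)
next
  case False
  then have "ennreal t \<le> \<pi> j" by simp
  moreover from this have "ennreal t \<le> \<pi> (Suc j)" using \<pi>_Suc[of j] by (rule order_trans)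
  ultimately have "stop_time \<pi> (Suc j) t = t" "stop_time \<pi> j t = t" using stop_time_late[of t \<pi> j] stop_time_late[of t \<pi> "Suc j"] t(1) by auto
  moreover have "\<bar>x 0 - x 0\<bar> \<le> oscillation x \<pi> T" by (rule oscillation_upper[OF x, of _ _ _ 0]) (use t \<pi>_0 in auto)
  ultimately show ?thesis by simp
qed

lemma oscillation_nonneg:
  assumes x: "continuous_on {0..} x" and "0 \<le> T" shows "0 \<le> oscillation x \<pi> T"
  using stop_time_increment[OF x, of T T 0] assms(2) by (meson abs_ge_zero order_refl order_trans)

lemma discrete_local_time_nonneg:
  assumes t: "0 \<le> t"
  shows "0 \<le> discrete_local_time x \<pi> t u"
proof -
  obtain N where N: "ennreal t \<le> \<pi> N" using \<pi>_eventually by blast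
  show ?thesis unfolding discrete_local_time_eq[OF t(1) N] by (intro sum_nonneg step_kernel_nonneg)
qed

context
  fixes x :: "real \<Rightarrow> real" and T M :: real
  assumes x: "continuous_on {0..} x" and M: "\<And>s. 0 \<le> s \<Longrightarrow> s \<le> T \<Longrightarrow> \<bar>x s\<bar> \<le> M"
begin

lemma bounded_on_Icc_step:
  assumes t: "0 \<le> t" "t \<le> T"
  shows "bounded_on_Icc M (step_kernel (x (stop_time \<pi> j t)) (x (stop_time \<pi> k t)))"
  using t stop_time_le[OF t(1)] by (intro bounded_on_Icc_step_kernel M stop_time_nonneg) (auto intro: order_trans)

lemma bounded_on_Icc_discrete_local_time:
  assumes t: "0 \<le> t" "t \<le> T"
  shows "bounded_on_Icc M (discrete_local_time x \<pi> t)"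
proof -
  obtain N where N: "ennreal t \<le> \<pi> N" using \<pi>_eventually by blast
  have "discrete_local_time x \<pi> t = (\<lambda>u. \<Sum>j<N. step_kernel (x (stop_time \<pi> j t)) (x (stop_time \<pi> (Suc j) t)) u)"
    using discrete_local_time_eq[OF t(1) N] by blast
  then show ?thesis by (simp only:) (intro bounded_on_Icc_sum bounded_on_Icc_step t, simp)
qed

lemma integral_discrete_local_time:
  assumes t: "0 \<le> t" "t \<le> T" and N: "ennreal t \<le> \<pi> N" and h: "locally_integrable h"
  shows "(LINT u|lborel. discrete_local_time x \<pi> t u * h u) =
    (\<Sum>j<N. LINT u|lborel. step_kernel (x (stop_time \<pi> j t)) (x (stop_time \<pi> (Suc j) t)) u * h u)"
  unfolding discrete_local_time_eq[OF t(1) N] sum_distrib_right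
  by (rule Bochner_Integration.integral_sum) (intro integrable_bounded_on_Icc_mult[OF bounded_on_Icc_step[OF t] h])

lemma discrete_qv_eq_integral:
  assumes t: "0 \<le> t" "t \<le> T"
  shows "discrete_qv x \<pi> t = (LINT u|lborel. discrete_local_time x \<pi> t u * 1)"
proof -
  obtain N where N: "ennreal t \<le> \<pi> N" using \<pi>_eventually by blast
  have "locally_integrable (\<lambda>_. 1)" by (rule continuous_locally_integrable) simp
  from integral_discrete_local_time[OF t N this] show ?thesis
    unfolding discrete_qv_eq[OF t(1) N] by (simp add: integral_step_kernel)
qed

text \<open>Taylor's formula on each step, summed by telescoping.\<close>

lemma discrete_Tanaka:
  assumes t: "0 \<le> t" "t \<le> T"
    and F: "\<And>u. (F has_real_derivative g u) (at u)" and g: "locally_abs_continuous g"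
    and gh: "AE u in lborel. (g has_real_derivative h u) (at u)" and h: "locally_integrable h"
  shows "F (x t) - F (x 0) = riemann_sum x \<pi> g t + 1 / 2 * (LINT u|lborel. discrete_local_time x \<pi> t u * h u)"
proof -
  obtain N where N: "ennreal t \<le> \<pi> N" using \<pi>_eventually by blast
  let ?y = "\<lambda>j. x (stop_time \<pi> j t)"
  have "F (x t) - F (x 0) = F (?y N) - F (?y 0)" using stop_time_late[of t \<pi> N, OF t(1) N] stop_time_0 by simp
  also have "\<dots> = (\<Sum>j<N. F (?y (Suc j)) - F (?y j))" by (rule sum_lessThan_telescope[symmetric])
  also have "\<dots> = (\<Sum>j<N. g (?y j) * (?y (Suc j) - ?y j) + 1 / 2 * (LINT u|lborel. step_kernel (?y j) (?y (Suc j)) u * h u))"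
    by (intro sum.cong refl Taylor_step_kernel[OF F g gh h])
  also have "\<dots> = riemann_sum x \<pi> g t + 1 / 2 * (LINT u|lborel. discrete_local_time x \<pi> t u * h u)"
    unfolding riemann_sum_eq[OF t(1) N] integral_discrete_local_time[OF t N h] by (simp add: sum.distrib sum_distrib_left)
  finally show ?thesis .
qed

text \<open>Partition intervals that end before \<open>s\<close> contribute the same at both times, those
  beginning after \<open>s\<close> contribute only at time \<open>t\<close>. The interval
  straddling \<open>s\<close> carries a partial step at time \<open>s\<close> which may be lost at
  time \<open>t\<close>; its kernel is at most twice the oscillation. Positivity of
  \<open>h\<close> is asked only near the range of the path between \<open>s\<close> and
  \<open>t\<close>, so that the lemma applies to \<open>h = \<epsilon> \<plusminus> (\<phi> -
  c)\<close> where \<open>\<phi>\<close> is close to \<open>c\<close> on that range.\<close>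

lemma discrete_local_time_almost_mono:
  assumes s: "0 \<le> s" "s \<le> t" "t \<le> T" and h: "locally_integrable h"
    and pos: "\<And>r u. s \<le> r \<Longrightarrow> r \<le> t \<Longrightarrow> \<bar>u - x r\<bar> \<le> oscillation x \<pi> T \<Longrightarrow> 0 \<le> h u"
  shows "(LINT u|lborel. discrete_local_time x \<pi> s u * h u) \<le> (LINT u|lborel. discrete_local_time x \<pi> t u * h u)
     + 2 * oscillation x \<pi> T * (LINT u|lborel. indicator {-M..M} u * \<bar>h u\<bar>)"
proof -
  have t: "0 \<le> t" and sT: "s \<le> T" using s by auto
  obtain N where N: "ennreal t \<le> \<pi> N" using \<pi>_eventually by blast
  have Ns: "ennreal s \<le> \<pi> N" using N s by (meson ennreal_leI order_trans)
  define e where "e = 2 * oscillation x \<pi> T * (LINT u|lborel. indicator {-M..M} u * \<bar>h u\<bar>)"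
  have osc0: "0 \<le> oscillation x \<pi> T" using oscillation_nonneg[OF x] s by simp
  have e0: "0 \<le> e" unfolding e_def using osc0 by (intro mult_nonneg_nonneg integral_nonneg_AE) auto
  define k where "k r j = (LINT u|lborel. step_kernel (x (stop_time \<pi> j r)) (x (stop_time \<pi> (Suc j) r)) u * h u)" for r j
  \<comment> \<open>the interval straddling \<open>s\<close>\<close>
  define P where "P j \<longleftrightarrow> \<pi> j < ennreal s \<and> ennreal s < \<pi> (Suc j)" for j
  \<comment> \<open>The kernel of such a step lives within one oscillation of the path at the end of the step, which
    is a time between \<open>s\<close> and \<open>t\<close>.\<close>
  have k_pos: "0 \<le> k t j" if j: "ennreal s < \<pi> (Suc j)" for j
  proof -
    have r: "s \<le> stop_time \<pi> (Suc j) t" "stop_time \<pi> (Suc j) t \<le> t"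
    proof -
      have "ennreal s \<le> ennreal (stop_time \<pi> (Suc j) t)" unfolding ennreal_stop_time using j s by (auto intro: ennreal_leI less_imp_le)
      then show "s \<le> stop_time \<pi> (Suc j) t" by (simp add: stop_time_nonneg)
    qed (rule stop_time_le[OF t])
    have "0 \<le> step_kernel (x (stop_time \<pi> j t)) (x (stop_time \<pi> (Suc j) t)) u * h u" for u
    proof (cases "step_kernel (x (stop_time \<pi> j t)) (x (stop_time \<pi> (Suc j) t)) u = 0")
      case False
      then have "\<bar>u - x (stop_time \<pi> (Suc j) t)\<bar> \<le> \<bar>x (stop_time \<pi> (Suc j) t) - x (stop_time \<pi> j t)\<bar>"
        using step_kernel_nonzeroD[OF False] by linarith
      also have "\<dots> \<le> oscillation x \<pi> T" by (rule stop_time_increment[OF x t s(3)])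
      finally have "0 \<le> h u" by (rule pos[OF r])
      then show ?thesis by (intro mult_nonneg_nonneg step_kernel_nonneg)
    qed simp
    then show ?thesis unfolding k_def by (intro integral_nonneg_AE) simp
  qed
  have one_step: "k s j \<le> k t j + (if P j then e else 0)" for j
  proof -
    consider "\<pi> (Suc j) \<le> ennreal s" | "ennreal s \<le> \<pi> j" "ennreal s < \<pi> (Suc j)" | "P j"
      unfolding P_def by force
    then show ?thesis
    proof cases
      case 1
      then have "\<pi> (Suc j) \<le> ennreal t" "\<pi> j \<le> ennreal s" "\<pi> j \<le> ennreal t"
        using \<pi>_Suc[of j] s by (auto intro: order_trans ennreal_leI)
      then have "stop_time \<pi> j s = stop_time \<pi> j t" "stop_time \<pi> (Suc j) s = stop_time \<pi> (Suc j) t"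
        using 1 by (auto simp: stop_time_def min_absorb1)
      then show ?thesis using e0 by (simp add: k_def)
    next
      case 2
      then have "stop_time \<pi> j s = s" "stop_time \<pi> (Suc j) s = s"
        using s by (auto intro!: stop_time_late)
      then have "k s j = 0" by (simp add: k_def)
      then show ?thesis using k_pos[OF 2(2)] e0 by simp
    next
      case 3
      have [measurable]: "h \<in> borel_measurable borel" using h by (simp add: locally_integrable_def)
      have "k s j \<le> (LINT u|lborel. 2 * oscillation x \<pi> T * (indicator {-M..M} u * \<bar>h u\<bar>))"
        unfolding k_def
      proof (rule integral_mono)
        show "integrable lborel (\<lambda>u. step_kernel (x (stop_time \<pi> j s)) (x (stop_time \<pi> (Suc j) s)) u * h u)"
          by (rule integrable_bounded_on_Icc_mult[OF bounded_on_Icc_step[OF s(1) sT] h])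
        have "integrable lborel (\<lambda>u. indicator {-M..M} u * h u)" using h by (simp add: locally_integrable_def set_integrable_def)
        then have "integrable lborel (\<lambda>u. \<bar>indicator {-M..M} u * h u\<bar>)" by (rule Bochner_Integration.integrable_abs)
        then show "integrable lborel (\<lambda>u. 2 * oscillation x \<pi> T * (indicator {-M..M} u * \<bar>h u\<bar>))"
          by (simp add: abs_mult)
        fix u
        let ?k = "step_kernel (x (stop_time \<pi> j s)) (x (stop_time \<pi> (Suc j) s)) u"
        have "?k \<le> 2 * oscillation x \<pi> T * indicator {-M..M} u"
        proof (cases "u \<in> {-M..M}")
          case True
          have "?k \<le> 2 * oscillation x \<pi> T"
            by (rule order_trans[OF step_kernel_le mult_left_mono[OF stop_time_increment[OF x s(1) sT]]]) simp
          then show ?thesis using True by simp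
        qed (use bounded_on_Icc_outside[OF bounded_on_Icc_step[OF s(1) sT]] in auto)
        then have "?k * \<bar>h u\<bar> \<le> (2 * oscillation x \<pi> T * indicator {-M..M} u) * \<bar>h u\<bar>" by (intro mult_right_mono) auto
        moreover have "?k * h u \<le> ?k * \<bar>h u\<bar>" by (intro mult_left_mono step_kernel_nonneg) simp
        ultimately show "?k * h u \<le> 2 * oscillation x \<pi> T * (indicator {-M..M} u * \<bar>h u\<bar>)" by (simp add: mult.assoc)
      qed
      then have "k s j \<le> e" by (simp add: e_def)
      moreover have "0 \<le> k t j" using 3 by (intro k_pos) (simp add: P_def)
      ultimately show ?thesis using 3 by simp
    qed
  qed
  have "(\<Sum>j<N. k s j) \<le> (\<Sum>j<N. k t j + (if P j then e else 0))" by (intro sum_mono one_step)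
  also have "\<dots> = (\<Sum>j<N. k t j) + (\<Sum>j<N. (if P j then e else 0))" by (simp add: sum.distrib)
  also have "(\<Sum>j<N. (if P j then e else 0)) \<le> e"
  proof -
    have "(\<Sum>j<N. (if P j then e else 0)) = real (card {j\<in>{..<N}. P j}) * e"
      by (subst sum.inter_filter[symmetric]) auto
    also have "card {j\<in>{..<N}. P j} \<le> Suc 0"
    proof (subst card_le_Suc0_iff_eq, simp, intro ballI)
      have less: "\<not> i < j" if "P i" "P j" for i j
      proof
        assume "i < j"
        then have "\<pi> (Suc i) \<le> \<pi> j" by (intro \<pi>_mono) simp
        then show False using that unfolding P_def by (metis less_le_trans less_asym)
      qed
      fix i j assume "i \<in> {j\<in>{..<N}. P j}" "j \<in> {j\<in>{..<N}. P j}"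
      then show "i = j" using less[of i j] less[of j i] by auto
    qed
    then have "real (card {j\<in>{..<N}. P j}) * e \<le> 1 * e" using e0 by (intro mult_right_mono) auto
    finally show ?thesis by simp
  qed
  finally show ?thesis
    unfolding integral_discrete_local_time[OF s(1) sT Ns h] integral_discrete_local_time[OF t s(3) N h]
    by (simp add: k_def e_def)
qed

end

end

section \<open>Almost monotone sequences of functions\<close>

text \<open>As in Polya's theorem on distribution functions: between two points of a fine grid an almost
  monotone function is squeezed between its values at these points, up to the error.\<close>

lemma uniform_limit_almost_mono:
  fixes A :: "nat \<Rightarrow> real \<Rightarrow> real"
  assumes T: "0 \<le> T" and mono: "\<And>n s t. 0 \<le> s \<Longrightarrow> s \<le> t \<Longrightarrow> t \<le> T \<Longrightarrow> A n s \<le> A n t + e n"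
    and e: "e \<longlonglongrightarrow> 0" and lim: "\<And>t. 0 \<le> t \<Longrightarrow> t \<le> T \<Longrightarrow> (\<lambda>n. A n t) \<longlonglongrightarrow> B t"
    and cont: "continuous_on {0..T} B"
  shows "uniform_limit {0..T} A B sequentially"
proof (rule uniform_limitI)
  fix \<epsilon> :: real assume \<epsilon>: "\<epsilon> > 0"
  have "uniformly_continuous_on {0..T} B" using cont by (rule compact_uniformly_continuous) simp
  then obtain \<delta> where \<delta>: "\<delta> > 0" "\<And>s t. s \<in> {0..T} \<Longrightarrow> t \<in> {0..T} \<Longrightarrow> \<bar>t - s\<bar> < \<delta> \<Longrightarrow> \<bar>B t - B s\<bar> < \<epsilon> / 4"
    using \<epsilon> unfolding uniformly_continuous_on_def dist_real_def by (metis divide_pos_pos zero_less_numeral)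
  obtain m :: nat where m: "m > 0" "T / real m < \<delta>"
  proof -
    obtain m :: nat where "T / \<delta> < real m" using reals_Archimedean2 by blast
    have "m > 0"
    proof (rule ccontr)
      assume "\<not> m > 0"
      then show False using \<open>T / \<delta> < real m\<close> \<delta>(1) T by (simp add: divide_less_0_iff)
    qed
    moreover from this have "T / real m < \<delta>"
      using \<open>T / \<delta> < real m\<close> \<delta>(1) by (simp add: pos_divide_less_eq mult.commute)
    ultimately show ?thesis using that by blast
  qed
  define p where "p i = T * real i / real m" for i :: nat
  have p: "0 \<le> p i" "p i \<le> T" if "i \<le> m" for i
    using that T m by (auto simp: p_def divide_le_eq mult_left_mono)
  have "eventually (\<lambda>n. (\<forall>i\<in>{..m}. \<bar>A n (p i) - B (p i)\<bar> < \<epsilon> / 4) \<and> \<bar>e n\<bar> < \<epsilon> / 4) sequentially"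
  proof (intro eventually_conj eventually_ball_finite ballI)
    fix i assume "i \<in> {..m}"
    then have "(\<lambda>n. A n (p i)) \<longlonglongrightarrow> B (p i)" using lim p by simp
    then show "\<forall>\<^sub>F n in sequentially. \<bar>A n (p i) - B (p i)\<bar> < \<epsilon> / 4"
      using \<epsilon> tendstoD[of _ "B (p i)" sequentially "\<epsilon> / 4"] by (simp add: dist_real_def)
  next
    show "\<forall>\<^sub>F n in sequentially. \<bar>e n\<bar> < \<epsilon> / 4"
      using \<epsilon> tendstoD[OF e, of "\<epsilon> / 4"] by (simp add: dist_real_def)
  qed simp
  then show "\<forall>\<^sub>F n in sequentially. \<forall>t\<in>{0..T}. dist (A n t) (B t) < \<epsilon>"
  proof eventually_elim
    case (elim n)
    show ?case
    proof
      fix t assume t: "t \<in> {0..T}"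
      have "\<exists>i<m. p i \<le> t \<and> t \<le> p (Suc i)"
      proof (cases "t = T")
        case True
        then show ?thesis using m(1) T by (intro exI[of _ "m - 1"]) (auto simp: p_def divide_le_eq mult_left_mono of_nat_diff)
      next
        case False
        then have tT: "t < T" "0 \<le> t" "0 < T" using t by auto
        define i where "i = nat \<lfloor>t * real m / T\<rfloor>"
        have i: "real i \<le> t * real m / T" "t * real m / T < real i + 1"
          unfolding i_def using tT m(1) by (auto simp: of_nat_nat)
        have "t * real m / T < real m" using tT m(1) by (simp add: divide_less_eq)
        then have "i < m" using i(1) by linarith
        moreover have "p i \<le> t" "t \<le> p (Suc i)"
          using i tT m(1) by (auto simp: p_def field_simps)
        ultimately show ?thesis by blast
      qed
      then obtain i where i: "i < m" "p i \<le> t" "t \<le> p (Suc i)" by blast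
      have pi: "p i \<in> {0..T}" "p (Suc i) \<in> {0..T}" using p[of i] p[of "Suc i"] i(1) by auto
      have step: "p (Suc i) - p i < \<delta>" using m by (simp add: p_def field_simps)
      have "\<bar>B t - B (p i)\<bar> < \<epsilon> / 4" "\<bar>B t - B (p (Suc i))\<bar> < \<epsilon> / 4"
        using \<delta>(2)[OF pi(1) t] \<delta>(2)[OF pi(2) t] i step by auto
      moreover have "A n t \<le> A n (p (Suc i)) + e n" "A n (p i) \<le> A n t + e n"
        using mono[of t "p (Suc i)" n] mono[of "p i" t n] i pi t by auto
      moreover have "\<bar>A n (p i) - B (p i)\<bar> < \<epsilon> / 4" "\<bar>A n (p (Suc i)) - B (p (Suc i))\<bar> < \<epsilon> / 4" "\<bar>e n\<bar> < \<epsilon> / 4"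
        using elim i(1) by auto
      ultimately show "dist (A n t) (B t) < \<epsilon>" unfolding dist_real_def by linarith
    qed
  qed
qed

lemma continuous_on_Ici_if_Icc:
  fixes f :: "real \<Rightarrow> 'a::topological_space"
  assumes "\<And>T. 0 \<le> T \<Longrightarrow> continuous_on {0..T} f"
  shows "continuous_on {0..} f"
  unfolding continuous_on_eq_continuous_within
proof
  fix t :: real assume t: "t \<in> {0..}"
  have "continuous (at t within {0..t+1}) f"
    using assms[of "t+1"] t by (auto simp: continuous_on_eq_continuous_within)
  moreover have "at t within {0..} = at t within {0..t+1}"
    by (rule at_within_nhd[of _ "{..<t+1}"]) auto
  ultimately show "continuous (at t within {0..}) f" by (simp add: continuous_within)
qed

section \<open>Riemann--Stieltjes sums\<close>

locale stieltjes =
  fixes Q :: "real \<Rightarrow> real" and \<mu> :: "real measure"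
  assumes Q_mono: "\<And>s t. 0 \<le> s \<Longrightarrow> s \<le> t \<Longrightarrow> Q s \<le> Q t"
    and Q_cont: "continuous_on {0..} Q"
    and \<mu>_def: "\<mu> = interval_measure (\<lambda>s. Q (max 0 s))"
begin

lemma sets_\<mu> [measurable_cong, simp]: "sets \<mu> = sets borel" by (simp add: \<mu>_def)

lemma extended_cont: "continuous_on UNIV (\<lambda>s. Q (max 0 s))"
  by (rule continuous_on_compose2[OF Q_cont]) (auto intro!: continuous_intros)

lemma emeasure_Ioc: "0 \<le> a \<Longrightarrow> a \<le> b \<Longrightarrow> emeasure \<mu> {a<..b} = ennreal (Q b - Q a)"
  unfolding \<mu>_def using extended_cont
  by (subst emeasure_interval_measure_Ioc) (auto intro!: Q_mono simp: continuous_on_eq_continuous_within continuous_at_imp_continuous_within)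

lemma emeasure_Icc: "0 \<le> b \<Longrightarrow> emeasure \<mu> {0..b} = ennreal (Q b - Q 0)"
  unfolding \<mu>_def using extended_cont
  by (subst emeasure_interval_measure_Icc) (auto intro!: Q_mono continuous_on_subset)

lemma set_integrable_bounded:
  fixes f :: "real \<Rightarrow> real"
  assumes A: "A \<in> sets borel" "A \<subseteq> {0..T}" and f: "set_borel_measurable \<mu> A f"
    and B: "\<And>s. s \<in> A \<Longrightarrow> \<bar>f s\<bar> \<le> B"
  shows "set_integrable \<mu> A f"
proof -
  have "emeasure \<mu> {0..T} < top" by (cases "0 \<le> T") (auto simp: emeasure_Icc)
  then have fin: "emeasure \<mu> A < top" using emeasure_mono[OF A(2), of \<mu>] by (auto intro: le_less_trans)
  show ?thesis unfolding set_integrable_def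
  proof (rule Bochner_Integration.integrable_bound)
    show "integrable \<mu> (\<lambda>s. B * indicator A s)"
      using fin A by (intro integrable_mult_right integrable_real_indicator) auto
    show "(\<lambda>x. indicat_real A x *\<^sub>R f x) \<in> borel_measurable \<mu>" using f by (simp add: set_borel_measurable_def)
    show "AE x in \<mu>. norm (indicat_real A x *\<^sub>R f x) \<le> norm (B * indicat_real A x)"
      using B by (intro AE_I2) (fastforce simp: indicator_def)
  qed
qed

text \<open>In the limit theorem for occupation integrals the Stieltjes integral is compared with these
  sums, in which \<open>c i\<close> is the frozen value of the integrand on the
  \<open>i\<close>-th time interval.\<close>

lemma Riemann_sum_error:
  assumes p: "p 0 = 0" "\<And>i. p i \<le> p (Suc i)" and f: "continuous_on {0..} f"
    and c: "\<And>i s. i < k \<Longrightarrow> p i \<le> s \<Longrightarrow> s \<le> p (Suc i) \<Longrightarrow> \<bar>f s - c i\<bar> \<le> \<epsilon>"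
  shows "\<bar>(LINT s:{0..p k}|\<mu>. f s) - (\<Sum>i<k. c i * (Q (p (Suc i)) - Q (p i)))\<bar> \<le> \<epsilon> * (Q (p k) - Q 0)"
  using c
proof (induction k)
  case 0
  have "emeasure \<mu> {0} = 0" using emeasure_Icc[of 0] by simp
  then have "AE s in \<mu>. s \<notin> {0}" by (intro AE_not_in) (simp add: null_sets_def)
  then have "AE s in \<mu>. indicat_real {0} s *\<^sub>R f s = 0" by eventually_elim simp
  then have "(LINT s:{0}|\<mu>. f s) = 0"
    unfolding set_lebesgue_integral_def by (rule integral_eq_zero_AE)
  then show ?case using p(1) by simp
next
  case (Suc k)
  have pm: "p i \<le> p j" if "i \<le> j" for i j using that by (rule lift_Suc_mono_le[of p, OF p(2)])
  have p0: "0 \<le> p i" for i using pm[of 0 i] p(1) by simp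
  have meas: "set_borel_measurable \<mu> A f" if "A \<in> sets borel" "A \<subseteq> {0..}" for A
  proof -
    have "set_borel_measurable borel A f"
      using borel_measurable_continuous_on_indicator[OF that(1) continuous_on_subset[OF f that(2)]] by (simp add: set_borel_measurable_def)
    then show ?thesis by (simp add: set_borel_measurable_def)
  qed
  have "bounded (f ` {0..p (Suc k)})"
    by (intro compact_imp_bounded compact_continuous_image continuous_on_subset[OF f]) auto
  then obtain B where "\<forall>y\<in>f ` {0..p (Suc k)}. norm y \<le> B" unfolding bounded_iff by blast
  then have B: "\<bar>f s\<bar> \<le> B" if "s \<in> {0..p (Suc k)}" for s using that by auto
  have si1: "set_integrable \<mu> {0..p k} f"
    by (rule set_integrable_bounded[of _ "p (Suc k)" _ B]) (use p(2)[of k] B in \<open>auto intro!: meas\<close>)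
  have si2: "set_integrable \<mu> {p k<..p (Suc k)} f"
    by (rule set_integrable_bounded[of _ "p (Suc k)" _ B]) (use p0[of k] B in \<open>auto intro!: meas\<close>)
  have un: "{0..p (Suc k)} = {0..p k} \<union> {p k<..p (Suc k)}" using p0[of k] p(2)[of k] by auto
  have dis: "{0..p k} \<inter> {p k<..p (Suc k)} = {}" by auto
  have split: "(LINT s:{0..p (Suc k)}|\<mu>. f s) = (LINT s:{0..p k}|\<mu>. f s) + (LINT s:{p k<..p (Suc k)}|\<mu>. f s)"
    unfolding un by (rule set_integral_Un[OF dis si1 si2])
  let ?I = "{p k<..p (Suc k)}"
  have em: "emeasure \<mu> ?I = ennreal (Q (p (Suc k)) - Q (p k))" using emeasure_Ioc[OF p0 p(2)] by simp
  then have ms: "measure \<mu> ?I = Q (p (Suc k)) - Q (p k)" using Q_mono[OF p0 p(2)] by (simp add: measure_def)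
  have ii: "integrable \<mu> (\<lambda>s. indicator ?I s :: real)" using em by (intro integrable_real_indicator) auto
  have "(LINT s:?I|\<mu>. f s) - c k * (Q (p (Suc k)) - Q (p k)) = (LINT s|\<mu>. indicator ?I s * f s - c k * indicator ?I s)"
    using si2 ii ms by (subst Bochner_Integration.integral_diff) (auto simp: set_integrable_def set_lebesgue_integral_def)
  also have "\<bar>\<dots>\<bar> \<le> (LINT s|\<mu>. \<bar>indicator ?I s * f s - c k * indicator ?I s\<bar>)" by (rule integral_abs_bound)
  also have "\<dots> \<le> (LINT s|\<mu>. \<epsilon> * indicator ?I s)"
  proof (rule integral_mono)
    show "integrable \<mu> (\<lambda>s. \<bar>indicator ?I s * f s - c k * indicator ?I s\<bar>)"
      using si2 ii by (intro Bochner_Integration.integrable_abs Bochner_Integration.integrable_diff integrable_mult_right) (simp_all add: set_integrable_def)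
    show "integrable \<mu> (\<lambda>s. \<epsilon> * indicator ?I s)" using ii by (rule integrable_mult_right)
    show "\<bar>indicator ?I s * f s - c k * indicator ?I s\<bar> \<le> \<epsilon> * indicator ?I s" for s
      using Suc.prems[of k s] by (auto simp: indicator_def)
  qed
  also have "\<dots> = \<epsilon> * (Q (p (Suc k)) - Q (p k))" using ms by simp
  finally have 2: "\<bar>(LINT s:?I|\<mu>. f s) - c k * (Q (p (Suc k)) - Q (p k))\<bar> \<le> \<epsilon> * (Q (p (Suc k)) - Q (p k))" .
  have 1: "\<bar>(LINT s:{0..p k}|\<mu>. f s) - (\<Sum>i<k. c i * (Q (p (Suc i)) - Q (p i)))\<bar> \<le> \<epsilon> * (Q (p k) - Q 0)"
    by (rule Suc.IH) (rule Suc.prems, auto)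
  have "\<epsilon> * (Q (p (Suc k)) - Q 0) = \<epsilon> * (Q (p k) - Q 0) + \<epsilon> * (Q (p (Suc k)) - Q (p k))" by (simp add: algebra_simps)
  then show ?case unfolding split sum.lessThan_Suc using 1 2 by linarith
qed

end

section \<open>Sequences of partitions\<close>

locale pathwise =
  fixes x :: "real \<Rightarrow> real" and \<P> :: "nat \<Rightarrow> nat \<Rightarrow> ennreal"
  assumes x: "continuous_on {0..} x"
    and partitions: "\<And>n. partition (\<P> n)"
    and osc: "\<And>t. 0 \<le> t \<Longrightarrow> (\<lambda>n. oscillation x (\<P> n) t) \<longlonglongrightarrow> 0"
begin

lemma partitioned: "partitioned (\<P> n)" by (rule partitioned.intro) (rule partitions)

abbreviation LT :: "nat \<Rightarrow> real \<Rightarrow> real \<Rightarrow> real" where "LT n \<equiv> discrete_local_time x (\<P> n)"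

text \<open>Named for its limit, the integral of \<open>h (x s)\<close> with respect to the quadratic
  variation, which weighs the time spent by the path at each level.\<close>

definition occupation :: "nat \<Rightarrow> (real \<Rightarrow> real) \<Rightarrow> real \<Rightarrow> real" where
  "occupation n h t = (LINT u|lborel. LT n t u * h u)"

text \<open>A bound of the path on \<open>{0..T}\<close> that is monotone in \<open>T\<close> and always
  positive; \<open>max 0 T\<close> keeps the supremum over a nonempty set.\<close>

definition range_bound :: "real \<Rightarrow> real" where
  "range_bound T = 1 + (SUP s\<in>{0..max 0 T}. \<bar>x s\<bar>)"

lemma bdd_above_path: "bdd_above ((\<lambda>s. \<bar>x s\<bar>) ` {0..T})"
  by (intro compact_imp_bounded[THEN bounded_imp_bdd_above] compact_continuous_image continuous_on_rabs continuous_on_subset[OF x]) auto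

lemma range_bound: "0 < range_bound T" "0 \<le> s \<Longrightarrow> s \<le> T \<Longrightarrow> \<bar>x s\<bar> \<le> range_bound T"
proof -
  have "\<bar>x s\<bar> \<le> (SUP s\<in>{0..max 0 T}. \<bar>x s\<bar>)" if "s \<in> {0..max 0 T}" for s
    using that by (rule cSUP_upper[OF _ bdd_above_path])
  from this[of 0] this[of s] show "0 < range_bound T" "0 \<le> s \<Longrightarrow> s \<le> T \<Longrightarrow> \<bar>x s\<bar> \<le> range_bound T"
    unfolding range_bound_def by auto
qed

lemma range_bound_mono: "s \<le> t \<Longrightarrow> range_bound s \<le> range_bound t"
  unfolding range_bound_def by (intro add_left_mono cSUP_subset_mono bdd_above_path) auto

lemma LT_bounded_on_Icc: "0 \<le> t \<Longrightarrow> t \<le> T \<Longrightarrow> bounded_on_Icc (range_bound T) (LT n t)"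
  by (rule partitioned.bounded_on_Icc_discrete_local_time[OF partitioned x range_bound(2)])

lemma LT_nonneg: "0 \<le> t \<Longrightarrow> 0 \<le> LT n t u"
  by (rule partitioned.discrete_local_time_nonneg[OF partitioned])

text \<open>The size of a weight in the error term of almost monotonicity.\<close>

definition local_integral :: "real \<Rightarrow> (real \<Rightarrow> real) \<Rightarrow> real" where
  "local_integral T h = (LINT u|lborel. indicator {- range_bound T..range_bound T} u * \<bar>h u\<bar>)"

lemma occupation_almost_mono:
  assumes "0 \<le> s" "s \<le> t" "t \<le> T" "locally_integrable h"
    and "\<And>r u. s \<le> r \<Longrightarrow> r \<le> t \<Longrightarrow> \<bar>u - x r\<bar> \<le> oscillation x (\<P> n) T \<Longrightarrow> 0 \<le> h u"
  shows "occupation n h s \<le> occupation n h t + 2 * oscillation x (\<P> n) T * local_integral T h"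
  unfolding occupation_def local_integral_def
  by (rule partitioned.discrete_local_time_almost_mono[OF partitioned x range_bound(2) assms])

lemma integrable_LT_mult: "0 \<le> t \<Longrightarrow> locally_integrable h \<Longrightarrow> integrable lborel (\<lambda>u. LT n t u * h u)"
  by (rule integrable_bounded_on_Icc_mult[OF LT_bounded_on_Icc[OF _ order_refl]])

lemma occupation_linear:
  assumes "0 \<le> t" "locally_integrable f" "locally_integrable g"
  shows "occupation n (\<lambda>u. a * f u + b * g u) t = a * occupation n f t + b * occupation n g t"
proof -
  have "occupation n (\<lambda>u. a * f u + b * g u) t = (LINT u|lborel. a * (LT n t u * f u) + b * (LT n t u * g u))"
    unfolding occupation_def by (intro Bochner_Integration.integral_cong) (auto simp: algebra_simps)
  also have "\<dots> = a * occupation n f t + b * occupation n g t"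
    unfolding occupation_def using integrable_LT_mult[OF assms(1,2)] integrable_LT_mult[OF assms(1,3)] by simp
  finally show ?thesis .
qed

lemma locally_integrable_const: "locally_integrable (\<lambda>_. c)"
  by (rule continuous_locally_integrable) simp

lemma discrete_qv_eq_occupation: "0 \<le> t \<Longrightarrow> discrete_qv x (\<P> n) t = occupation n (\<lambda>_. 1) t"
  unfolding occupation_def
  by (rule partitioned.discrete_qv_eq_integral[OF partitioned x range_bound(2) _ order_refl])

lemma Tanaka:
  assumes "0 \<le> t" "\<And>u. (F has_real_derivative g u) (at u)" "locally_abs_continuous g"
    "AE u in lborel. (g has_real_derivative h u) (at u)" "locally_integrable h"
  shows "F (x t) - F (x 0) = riemann_sum x (\<P> n) g t + 1 / 2 * occupation n h t"
  unfolding occupation_def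
  by (rule partitioned.discrete_Tanaka[OF partitioned x range_bound(2) assms(1) order_refl assms(2-)])

lemma occupation_0: "occupation n h 0 = 0"
proof -
  have "LT n 0 u = 0" for u
    using partitioned.discrete_local_time_eq[OF partitioned, of 0 n 0] partitioned.\<pi>_0[OF partitioned] by simp
  then show ?thesis by (simp add: occupation_def)
qed

lemma occupation_uniform_limit:
  assumes h: "locally_integrable h" and pos: "\<And>u. 0 \<le> h u"
    and lim: "\<And>t. 0 \<le> t \<Longrightarrow> (\<lambda>n. occupation n h t) \<longlonglongrightarrow> B t" and cont: "continuous_on {0..} B" and T: "0 \<le> T"
  shows "uniform_limit {0..T} (\<lambda>n. occupation n h) B sequentially"
proof (rule uniform_limit_almost_mono[OF T])
  show "occupation n h s \<le> occupation n h t + 2 * oscillation x (\<P> n) T * local_integral T h"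
    if "0 \<le> s" "s \<le> t" "t \<le> T" for n s t using that h pos by (intro occupation_almost_mono) auto
  show "(\<lambda>n. 2 * oscillation x (\<P> n) T * local_integral T h) \<longlonglongrightarrow> 0"
    using tendsto_mult_right[OF tendsto_mult_left[OF osc[OF T], of 2], of "local_integral T h"] by simp
  show "continuous_on {0..T} B" by (rule continuous_on_subset[OF cont]) auto
qed (use lim in auto)

lemma occupation_limit_mono:
  assumes h: "locally_integrable h" and pos: "\<And>u. 0 \<le> h u"
    and lim: "(\<lambda>n. occupation n h s) \<longlonglongrightarrow> a" "(\<lambda>n. occupation n h t) \<longlonglongrightarrow> b" and st: "0 \<le> s" "s \<le> t"
  shows "a \<le> b"
proof (rule LIMSEQ_le[OF lim(1)])
  have "(\<lambda>n. occupation n h t + 2 * oscillation x (\<P> n) t * local_integral t h) \<longlonglongrightarrow> b + 2 * 0 * local_integral t h"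
    using st by (intro tendsto_intros lim osc) auto
  then show "(\<lambda>n. occupation n h t + 2 * oscillation x (\<P> n) t * local_integral t h) \<longlonglongrightarrow> b" by simp
  show "\<exists>N. \<forall>n\<ge>N. occupation n h s \<le> occupation n h t + 2 * oscillation x (\<P> n) t * local_integral t h"
    using st h pos by (intro exI[of _ 0] allI impI occupation_almost_mono) auto
qed

lemma local_integral_le:
  assumes "locally_integrable h" "\<And>u. u \<in> {- range_bound T..range_bound T} \<Longrightarrow> \<bar>h u\<bar> \<le> B"
  shows "local_integral T h \<le> B * (2 * range_bound T)"
proof -
  let ?I = "{- range_bound T..range_bound T}"
  have "integrable lborel (\<lambda>u. indicator ?I u * h u)" using assms(1) by (simp add: locally_integrable_def set_integrable_def)
  then have "integrable lborel (\<lambda>u. \<bar>indicator ?I u * h u\<bar>)" by (rule Bochner_Integration.integrable_abs)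
  then have "local_integral T h \<le> (LINT u|lborel. B * indicator ?I u)"
    unfolding local_integral_def
    by (intro integral_mono integrable_mult_right integrable_indicator_Icc) (use assms(2) in \<open>auto simp: abs_mult indicator_def\<close>)
  also have "\<dots> = B * (2 * range_bound T)" using range_bound(1)[of T] by simp
  finally show ?thesis .
qed

lemma local_integral_nonneg: "0 \<le> local_integral T h"
  unfolding local_integral_def by (intro integral_nonneg_AE) auto

text \<open>Almost monotonicity for the weights \<open>\<epsilon> + (\<phi> - c)\<close> and
  \<open>\<epsilon> - (\<phi> - c)\<close>, which are nonnegative near the path on \<open>[s,
  t]\<close>. It bounds the increment for \<open>\<phi>\<close> between the increments for the
  constants \<open>c - \<epsilon>\<close> and \<open>c + \<epsilon>\<close>, and thus by the
  discrete quadratic variation.\<close>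

lemma occupation_block:
  assumes st: "0 \<le> s" "s \<le> t" "t \<le> T" and \<phi>: "continuous_on UNIV \<phi>" and e: "0 \<le> \<epsilon>"
    and close: "\<And>r u. s \<le> r \<Longrightarrow> r \<le> t \<Longrightarrow> \<bar>u - x r\<bar> \<le> oscillation x (\<P> n) T \<Longrightarrow> \<bar>\<phi> u - c\<bar> \<le> \<epsilon>"
    and B: "\<And>u. u \<in> {- range_bound T..range_bound T} \<Longrightarrow> \<bar>\<phi> u\<bar> \<le> B"
  shows "\<bar>occupation n \<phi> t - occupation n \<phi> s - c * (occupation n (\<lambda>_. 1) t - occupation n (\<lambda>_. 1) s)\<bar>
    \<le> \<epsilon> * (occupation n (\<lambda>_. 1) t - occupation n (\<lambda>_. 1) s) + 2 * oscillation x (\<P> n) T * ((B + \<bar>c\<bar> + \<epsilon>) * (2 * range_bound T))"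
proof -
  note li = continuous_locally_integrable[OF \<phi>] locally_integrable_const
  have main: "\<sigma> * (occupation n \<phi> s - occupation n \<phi> t) + (\<epsilon> - \<sigma> * c) * (occupation n (\<lambda>_. 1) s - occupation n (\<lambda>_. 1) t)
      \<le> 2 * oscillation x (\<P> n) T * ((B + \<bar>c\<bar> + \<epsilon>) * (2 * range_bound T))" if \<sigma>: "\<bar>\<sigma>\<bar> = 1" for \<sigma>
  proof -
    define h where "h u = \<sigma> * \<phi> u + (\<epsilon> - \<sigma> * c) * 1" for u
    have hl: "locally_integrable h" unfolding h_def
      by (intro continuous_locally_integrable continuous_intros \<phi>)
    have "occupation n h s \<le> occupation n h t + 2 * oscillation x (\<P> n) T * local_integral T h"
    proof (rule occupation_almost_mono[OF st hl])
      fix r u assume "s \<le> r" "r \<le> t" "\<bar>u - x r\<bar> \<le> oscillation x (\<P> n) T"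
      then have "\<bar>\<sigma> * (\<phi> u - c)\<bar> \<le> \<epsilon>" using close \<sigma> by (simp add: abs_mult)
      then show "0 \<le> h u" by (simp add: h_def algebra_simps abs_le_iff)
    qed
    also have "2 * oscillation x (\<P> n) T * local_integral T h \<le> 2 * oscillation x (\<P> n) T * ((B + \<bar>c\<bar> + \<epsilon>) * (2 * range_bound T))"
    proof (rule mult_left_mono)
      show "local_integral T h \<le> (B + \<bar>c\<bar> + \<epsilon>) * (2 * range_bound T)"
      proof (rule local_integral_le[OF hl])
        fix u assume "u \<in> {- range_bound T..range_bound T}"
        then have "\<bar>\<sigma> * \<phi> u\<bar> \<le> B" "\<bar>\<sigma> * c\<bar> = \<bar>c\<bar>" using B \<sigma> by (auto simp: abs_mult)
        moreover have "\<bar>h u\<bar> \<le> \<bar>\<sigma> * \<phi> u\<bar> + \<bar>\<epsilon>\<bar> + \<bar>\<sigma> * c\<bar>"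
          unfolding h_def by (rule order_trans[OF abs_triangle_ineq]) (simp add: abs_triangle_ineq4)
        ultimately show "\<bar>h u\<bar> \<le> B + \<bar>c\<bar> + \<epsilon>" using e by linarith
      qed
      show "0 \<le> 2 * oscillation x (\<P> n) T" using partitioned.oscillation_nonneg[OF partitioned x, of T n] st by simp
    qed
    finally have "occupation n h s - occupation n h t \<le> 2 * oscillation x (\<P> n) T * ((B + \<bar>c\<bar> + \<epsilon>) * (2 * range_bound T))" by simp
    moreover have "occupation n h r = \<sigma> * occupation n \<phi> r + (\<epsilon> - \<sigma> * c) * occupation n (\<lambda>_. 1) r" if "0 \<le> r" for r
      unfolding h_def by (rule occupation_linear[OF that li])
    ultimately show ?thesis using st by (simp add: algebra_simps)
  qed
  show ?thesis using main[of 1] main[of "-1"] by (simp add: abs_le_iff algebra_simps)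
qed

end

section \<open>Initial topologies\<close>

lemma topspace_initial_topology:
  assumes "\<Phi> \<noteq> {}" shows "topspace (initial_topology S \<Phi>) = S"
proof -
  obtain \<phi> where "\<phi> \<in> \<Phi>" using assms by blast
  then have "{f \<in> S. \<phi> f \<in> UNIV} \<in> {{f \<in> S. \<phi> f \<in> U} | \<phi> U. \<phi> \<in> \<Phi> \<and> open U}" by blast
  then show ?thesis unfolding initial_topology_def topology_generated_by_topspace by blast
qed

text \<open>The sets on which convergence is eventually captured are closed under the operations that
  generate the topology, so that the subbasis suffices.\<close>

lemma limitin_initial_topology_iff:
  assumes \<Phi>: "\<Phi> \<noteq> {}" and f: "\<And>n. f n \<in> S"
  shows "limitin (initial_topology S \<Phi>) f l sequentially \<longleftrightarrow> l \<in> S \<and> (\<forall>\<phi>\<in>\<Phi>. (\<lambda>n. \<phi> (f n)) \<longlonglongrightarrow> \<phi> l)"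
proof
  assume l: "limitin (initial_topology S \<Phi>) f l sequentially"
  then have "l \<in> S" by (simp add: limitin_def topspace_initial_topology[OF \<Phi>])
  moreover have "(\<lambda>n. \<phi> (f n)) \<longlonglongrightarrow> \<phi> l" if \<phi>: "\<phi> \<in> \<Phi>" for \<phi>
  proof (rule topological_tendstoI)
    fix U assume U: "open U" "\<phi> l \<in> U"
    have "openin (initial_topology S \<Phi>) {f \<in> S. \<phi> f \<in> U}"
      unfolding initial_topology_def by (rule topology_generated_by_Basis) (use \<phi> U in blast)
    then have "\<forall>\<^sub>F n in sequentially. f n \<in> {f \<in> S. \<phi> f \<in> U}"
      using l U \<open>l \<in> S\<close> unfolding limitin_def by blast
    then show "\<forall>\<^sub>F n in sequentially. \<phi> (f n) \<in> U" by eventually_elim simp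
  qed
  ultimately show "l \<in> S \<and> (\<forall>\<phi>\<in>\<Phi>. (\<lambda>n. \<phi> (f n)) \<longlonglongrightarrow> \<phi> l)" by blast
next
  assume a: "l \<in> S \<and> (\<forall>\<phi>\<in>\<Phi>. (\<lambda>n. \<phi> (f n)) \<longlonglongrightarrow> \<phi> l)"
  show "limitin (initial_topology S \<Phi>) f l sequentially"
    unfolding limitin_def
  proof (intro conjI allI impI)
    show "l \<in> topspace (initial_topology S \<Phi>)" using a by (simp add: topspace_initial_topology[OF \<Phi>])
    fix U assume U: "openin (initial_topology S \<Phi>) U \<and> l \<in> U"
    then have "generate_topology_on {{f \<in> S. \<phi> f \<in> U} | \<phi> U. \<phi> \<in> \<Phi> \<and> open U} U"
      by (simp add: initial_topology_def openin_topology_generated_by_iff)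
    moreover have "l \<in> U" using U by blast
    ultimately show "\<forall>\<^sub>F n in sequentially. f n \<in> U"
    proof (induction rule: generate_topology_on.induct)
      case (UN K)
      then obtain k where "k \<in> K" "l \<in> k" by blast
      with UN.IH have "\<forall>\<^sub>F n in sequentially. f n \<in> k" by blast
      then show ?case by eventually_elim (use \<open>k \<in> K\<close> in blast)
    next
      case (Basis s)
      then obtain \<phi> V where s: "s = {f \<in> S. \<phi> f \<in> V}" "\<phi> \<in> \<Phi>" "open V" by blast
      then have lim: "(\<lambda>n. \<phi> (f n)) \<longlonglongrightarrow> \<phi> l" using a by blast
      have "\<phi> l \<in> V" using Basis s by blast
      then have "\<forall>\<^sub>F n in sequentially. \<phi> (f n) \<in> V" by (rule topological_tendstoD[OF lim s(3)])
      then show ?case by eventually_elim (use f s in blast)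
    qed (auto intro: eventually_conj)
  qed
qed

lemma continuous_map_initial_topology_iff:
  fixes A :: "'b::topological_space set"
  assumes \<Phi>: "\<Phi> \<noteq> {}"
  shows "continuous_map (top_of_set A) (initial_topology S \<Phi>) L \<longleftrightarrow>
    (\<forall>t\<in>A. L t \<in> S) \<and> (\<forall>\<phi>\<in>\<Phi>. continuous_on A (\<lambda>t. \<phi> (L t)))"
proof -
  have un: "(\<Union>{{f \<in> S. \<phi> f \<in> U} | \<phi> U. \<phi> \<in> \<Phi> \<and> open U}) = S"
    using topspace_initial_topology[OF \<Phi>, of S] unfolding initial_topology_def topology_generated_by_topspace .
  let ?X = "top_of_set A"
  have gen: "(\<forall>W. W \<in> {{f \<in> S. \<phi> f \<in> U} | \<phi> U. \<phi> \<in> \<Phi> \<and> open U} \<longrightarrow> openin ?X (L -` W \<inter> A)) \<longleftrightarrow>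
      (\<forall>\<phi>\<in>\<Phi>. \<forall>U. open U \<longrightarrow> openin ?X (L -` {f \<in> S. \<phi> f \<in> U} \<inter> A))"
    by blast
  have cont: "continuous_on A g \<longleftrightarrow> (\<forall>U. open U \<longrightarrow> openin ?X (A \<inter> g -` U))" for g :: "'b \<Rightarrow> real"
    by (simp add: continuous_on_open_gen[of _ A UNIV])
  have vim: "L -` {f \<in> S. \<phi> f \<in> U} \<inter> A = A \<inter> (\<lambda>t. \<phi> (L t)) -` U" if "L ` A \<subseteq> S" for \<phi> U
    using that by auto
  have img: "L ` A \<subseteq> S \<longleftrightarrow> (\<forall>t\<in>A. L t \<in> S)" by blast
  show ?thesis
    unfolding initial_topology_def continuous_on_generated_topo_iff un topspace_euclidean_subtopology gen cont
  proof (cases "L ` A \<subseteq> S")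
    case True
    show "((\<forall>\<phi>\<in>\<Phi>. \<forall>U. open U \<longrightarrow> openin ?X (L -` {f \<in> S. \<phi> f \<in> U} \<inter> A)) \<and> L ` A \<subseteq> S) \<longleftrightarrow>
      (\<forall>t\<in>A. L t \<in> S) \<and> (\<forall>\<phi>\<in>\<Phi>. \<forall>U. open U \<longrightarrow> openin ?X (A \<inter> (\<lambda>t. \<phi> (L t)) -` U))"
      unfolding vim[OF True] img by blast
  qed (use img in blast)
qed

section \<open>Occupation measures\<close>

context pathwise begin

lemma occupation_1_tendsto:
  assumes qv: "has_quadratic_variation x \<P>" and t: "0 \<le> t"
  shows "(\<lambda>n. occupation n (\<lambda>_. 1) t) \<longlonglongrightarrow> quadratic_variation x \<P> t"
  using qv t unfolding has_quadratic_variation_def quadratic_variation_def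
  by (simp add: convergent_LIMSEQ_iff discrete_qv_eq_occupation)

lemma stieltjes_qv:
  assumes qv: "has_quadratic_variation x \<P>"
  shows "stieltjes (quadratic_variation x \<P>) (qv_measure x \<P>)"
proof
  show "quadratic_variation x \<P> s \<le> quadratic_variation x \<P> t" if "0 \<le> s" "s \<le> t" for s t
    by (rule occupation_limit_mono[OF locally_integrable_const _ occupation_1_tendsto[OF qv] occupation_1_tendsto[OF qv]])
       (use that in auto)
  show "continuous_on {0..} (quadratic_variation x \<P>)" using qv by (simp add: has_quadratic_variation_def)
qed (simp add: qv_measure_def)

text \<open>On short time intervals \<open>\<phi> (x s)\<close> is nearly a constant \<open>c i\<close>. By
  \<open>occupation_block\<close> the occupation integral of \<open>\<phi>\<close> over such an
  interval is then \<open>c i\<close> times the increment of the discrete quadratic variation, up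
  to a relative error \<open>\<epsilon>\<close> and a vanishing absolute one; the number of
  intervals is fixed while \<open>n\<close> tends to infinity.\<close>

lemma occupation_continuous_limit:
  assumes qv: "has_quadratic_variation x \<P>" and \<phi>: "continuous_on UNIV \<phi>" and t: "0 \<le> t"
  shows "(\<lambda>n. occupation n \<phi> t) \<longlonglongrightarrow> (LINT s:{0..t}|qv_measure x \<P>. \<phi> (x s))"
proof -
  let ?Q = "quadratic_variation x \<P>"
  let ?I = "LINT s:{0..t}|qv_measure x \<P>. \<phi> (x s)"
  let ?q = "\<lambda>n. occupation n (\<lambda>_. 1)"
  interpret stieltjes ?Q "qv_measure x \<P>" by (rule stieltjes_qv[OF qv])
  have qlim: "(\<lambda>n. ?q n s) \<longlonglongrightarrow> ?Q s" if "0 \<le> s" for s by (rule occupation_1_tendsto[OF qv that])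
  have Q0: "?Q 0 = 0" using qlim[of 0] by (simp add: occupation_0 LIMSEQ_const_iff)
  define M where "M = range_bound t"
  have M: "\<bar>x s\<bar> \<le> M" if "0 \<le> s" "s \<le> t" for s unfolding M_def by (rule range_bound(2)[OF that])
  have "bounded (\<phi> ` {-M..M})" by (intro compact_imp_bounded compact_continuous_image continuous_on_subset[OF \<phi>]) auto
  then obtain B where "B > 0" "\<forall>y\<in>\<phi> ` {-M..M}. norm y \<le> B" unfolding bounded_pos by blast
  then have B: "B > 0" "\<And>u. u \<in> {-M..M} \<Longrightarrow> \<bar>\<phi> u\<bar> \<le> B" by auto
  show ?thesis
  proof (rule LIMSEQ_I)
    fix \<eta> :: real assume \<eta>: "0 < \<eta>"
    have Qt: "0 \<le> ?Q t" using Q_mono[of 0 t] t Q0 by simp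
    \<comment> \<open>The relative error enters twice: for the occupation integrals and for the Stieltjes integral.\<close>
    define \<epsilon> where "\<epsilon> = \<eta> / (2 * (?Q t + 1))"
    have \<epsilon>: "\<epsilon> > 0" using \<eta> Qt by (simp add: \<epsilon>_def)
    have "uniformly_continuous_on {-M-1..M+1} \<phi>" by (intro compact_uniformly_continuous continuous_on_subset[OF \<phi>]) auto
    then obtain \<delta> where \<delta>: "\<delta> > 0" "\<And>u v. u \<in> {-M-1..M+1} \<Longrightarrow> v \<in> {-M-1..M+1} \<Longrightarrow> \<bar>v - u\<bar> < \<delta> \<Longrightarrow> \<bar>\<phi> v - \<phi> u\<bar> < \<epsilon>"
      using \<epsilon> unfolding uniformly_continuous_on_def dist_real_def by metis
    have "uniformly_continuous_on {0..t} x" by (intro compact_uniformly_continuous continuous_on_subset[OF x]) auto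
    moreover have "\<delta> / 2 > 0" using \<delta>(1) by simp
    ultimately obtain d where d: "d > 0" "\<And>r s. r \<in> {0..t} \<Longrightarrow> s \<in> {0..t} \<Longrightarrow> \<bar>s - r\<bar> < d \<Longrightarrow> \<bar>x s - x r\<bar> < \<delta> / 2"
      unfolding uniformly_continuous_on_def dist_real_def by metis
    obtain m :: nat where "t / d < real m" using reals_Archimedean2 by blast
    then have m: "t / real (Suc m) < d" using d(1) t by (simp add: pos_divide_less_eq field_simps)
    define p where "p i = t * real i / real (Suc m)" for i
    have p0: "p 0 = 0" and pS: "p i \<le> p (Suc i)" and pm: "p (Suc m) = t" for i
      using t by (auto simp: p_def divide_right_mono mult_left_mono)
    have pmono: "p i \<le> p j" if "i \<le> j" for i j by (rule lift_Suc_mono_le[of p, OF pS that])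
    have prange: "0 \<le> p i" "p i \<le> t" if "i \<le> Suc m" for i
      using pmono[of 0 i] pmono[OF that] p0 pm by auto
    have pstep: "p (Suc i) - p i < d" for i
    proof -
      have "p (Suc i) - p i = t / real (Suc m)"
        by (simp only: p_def diff_divide_distrib[symmetric] right_diff_distrib[symmetric]) simp
      then show ?thesis using m by simp
    qed
    define c where "c i = \<phi> (x (p i))" for i
    \<comment> \<open>Half of \<open>\<delta>\<close> is spent on the movement of the path and half on the distance of
      \<open>u\<close> to the path; the bound \<open>1\<close> keeps \<open>u\<close> in the interval
      where \<open>\<delta>\<close> was chosen.\<close>
    have near: "\<bar>\<phi> u - c i\<bar> \<le> \<epsilon>" if i: "i < Suc m" and r: "p i \<le> r" "r \<le> p (Suc i)" and u: "\<bar>u - x r\<bar> < min (\<delta> / 2) 1" for i r u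
    proof -
      have ri: "r \<in> {0..t}" "p i \<in> {0..t}" using prange[of i] prange[of "Suc i"] r i by auto
      have "\<bar>x r - x (p i)\<bar> < \<delta> / 2" using pstep[of i] r by (intro d(2) ri) auto
      then have "\<bar>u - x (p i)\<bar> < \<delta>" using u by linarith
      moreover have "x (p i) \<in> {-M-1..M+1}" "u \<in> {-M-1..M+1}" using M[of "p i"] M[of r] ri u by (auto simp: abs_le_iff abs_less_iff)
      ultimately show ?thesis unfolding c_def using \<delta>(2) by (simp add: less_imp_le)
    qed
    have cB: "\<bar>c i\<bar> \<le> B" if "i < Suc m" for i
      unfolding c_def using M[of "p i"] prange[of i] that by (intro B(2)) (auto simp: abs_le_iff)
    have RS: "\<bar>?I - (\<Sum>i<Suc m. c i * (?Q (p (Suc i)) - ?Q (p i)))\<bar> \<le> \<epsilon> * ?Q t"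
    proof -
      have "\<bar>(LINT s:{0..p (Suc m)}|qv_measure x \<P>. \<phi> (x s)) - (\<Sum>i<Suc m. c i * (?Q (p (Suc i)) - ?Q (p i)))\<bar> \<le> \<epsilon> * (?Q (p (Suc m)) - ?Q 0)"
      proof (rule Riemann_sum_error[OF p0 pS])
        show "continuous_on {0..} (\<lambda>s. \<phi> (x s))" by (rule continuous_on_compose2[OF \<phi> x]) auto
        show "\<bar>\<phi> (x s) - c i\<bar> \<le> \<epsilon>" if "i < Suc m" "p i \<le> s" "s \<le> p (Suc i)" for i s
          using near[OF that, of "x s"] \<delta>(1) by simp
      qed
      then show ?thesis by (simp add: pm Q0)
    qed
    define b where "b n = 2 * oscillation x (\<P> n) t * ((B + B + \<epsilon>) * (2 * M))" for n
    have blim: "b \<longlonglongrightarrow> 0"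
      using tendsto_mult_right[OF tendsto_mult_left[OF osc[OF t], of 2], of "(B + B + \<epsilon>) * (2 * M)"] by (simp add: b_def[abs_def])
    have disc: "\<bar>occupation n \<phi> (p k) - (\<Sum>i<k. c i * (?q n (p (Suc i)) - ?q n (p i)))\<bar> \<le> \<epsilon> * ?q n (p k) + real k * b n"
      if osc_n: "oscillation x (\<P> n) t < min (\<delta> / 2) 1" and k: "k \<le> Suc m" for n k
      using k
    proof (induction k)
      case 0
      show ?case by (simp add: p0 occupation_0)
    next
      case (Suc k)
      then have k: "k < Suc m" by simp
      have "\<bar>occupation n \<phi> (p (Suc k)) - occupation n \<phi> (p k) - c k * (?q n (p (Suc k)) - ?q n (p k))\<bar>
        \<le> \<epsilon> * (?q n (p (Suc k)) - ?q n (p k)) + 2 * oscillation x (\<P> n) t * ((B + \<bar>c k\<bar> + \<epsilon>) * (2 * range_bound t))"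
      proof (rule occupation_block[OF _ pS _ \<phi>])
        show "0 \<le> p k" "p (Suc k) \<le> t" "0 \<le> \<epsilon>" using prange[of k] prange[of "Suc k"] Suc.prems \<epsilon> by auto
        show "\<bar>\<phi> u - c k\<bar> \<le> \<epsilon>" if "p k \<le> r" "r \<le> p (Suc k)" "\<bar>u - x r\<bar> \<le> oscillation x (\<P> n) t" for r u
          using that osc_n by (intro near[OF k that(1,2)]) linarith
      qed (use B(2) in \<open>auto simp: M_def\<close>)
      also have "2 * oscillation x (\<P> n) t * ((B + \<bar>c k\<bar> + \<epsilon>) * (2 * range_bound t)) \<le> b n"
        unfolding b_def M_def
        using partitioned.oscillation_nonneg[OF partitioned x t, of n] cB[OF k] range_bound(1)[of t]
        by (intro mult_left_mono mult_right_mono add_mono) auto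
      finally have 1: "\<bar>occupation n \<phi> (p (Suc k)) - occupation n \<phi> (p k) - c k * (?q n (p (Suc k)) - ?q n (p k))\<bar>
        \<le> \<epsilon> * (?q n (p (Suc k)) - ?q n (p k)) + b n" by simp
      have 2: "\<bar>occupation n \<phi> (p k) - (\<Sum>i<k. c i * (?q n (p (Suc i)) - ?q n (p i)))\<bar> \<le> \<epsilon> * ?q n (p k) + real k * b n"
        using Suc by simp
      have "\<epsilon> * ?q n (p (Suc k)) + real (Suc k) * b n = (\<epsilon> * ?q n (p k) + real k * b n) + (\<epsilon> * (?q n (p (Suc k)) - ?q n (p k)) + b n)"
        by (simp add: algebra_simps)
      then show ?case unfolding sum.lessThan_Suc using 1 2 by linarith
    qed
    define R where "R n = \<epsilon> * ?q n t + real (Suc m) * b n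
        + \<bar>(\<Sum>i<Suc m. c i * (?q n (p (Suc i)) - ?q n (p i))) - (\<Sum>i<Suc m. c i * (?Q (p (Suc i)) - ?Q (p i)))\<bar> + \<epsilon> * ?Q t" for n
    have "R \<longlonglongrightarrow> \<epsilon> * ?Q t + real (Suc m) * 0
        + \<bar>(\<Sum>i<Suc m. c i * (?Q (p (Suc i)) - ?Q (p i))) - (\<Sum>i<Suc m. c i * (?Q (p (Suc i)) - ?Q (p i)))\<bar> + \<epsilon> * ?Q t"
      unfolding R_def[abs_def] using prange t by (intro tendsto_intros blim qlim) auto
    moreover have "\<epsilon> * ?Q t + \<epsilon> * ?Q t < \<eta>"
    proof -
      have "0 < 2 * (?Q t + 1)" using Qt by simp
      then have "\<epsilon> * (2 * (?Q t + 1)) = \<eta>" using \<epsilon>_def nonzero_eq_divide_eq by (metis less_irrefl)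
      then have "\<eta> = \<epsilon> * ?Q t + \<epsilon> * ?Q t + 2 * \<epsilon>" by (simp add: algebra_simps)
      then show ?thesis using \<epsilon> by linarith
    qed
    ultimately have "\<forall>\<^sub>F n in sequentially. R n < \<eta>" by (intro order_tendstoD(2)) auto
    moreover have "\<forall>\<^sub>F n in sequentially. oscillation x (\<P> n) t < min (\<delta> / 2) 1"
      using \<delta>(1) by (intro order_tendstoD(2)[OF osc[OF t]]) auto
    ultimately have "\<forall>\<^sub>F n in sequentially. norm (occupation n \<phi> t - ?I) < \<eta>"
    proof eventually_elim
      case (elim n)
      show ?case using disc[OF elim(2) order_refl] RS elim(1) unfolding pm R_def real_norm_def by linarith
    qed
    then show "\<exists>N. \<forall>n\<ge>N. norm (occupation n \<phi> t - ?I) < \<eta>" by (simp add: eventually_sequentially)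
  qed
qed

text \<open>Both sides integrate \<open>h\<close> against a finite measure on the line: the image of
  \<open>d\<langle>x\<rangle>\<close> on \<open>{0..t}\<close> under the path, and the measure
  with density \<open>L\<close>. They agree on bounded continuous functions, hence on half-lines,
  hence as measures.\<close>

lemma occupation_formula:
  assumes qv: "has_quadratic_variation x \<P>" and t: "0 \<le> t"
    and L: "integrable lborel L" "\<And>u. 0 \<le> L u"
    and lim: "\<And>\<phi>. continuous_on UNIV \<phi> \<Longrightarrow> bounded (range \<phi>) \<Longrightarrow> (\<lambda>n. occupation n \<phi> t) \<longlonglongrightarrow> (LINT u|lborel. L u * \<phi> u)"
    and h: "h \<in> borel_measurable borel"
  shows "(LINT s:{0..t}|qv_measure x \<P>. h (x s)) = (LINT u|lborel. L u * h u)"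
proof -
  interpret stieltjes "quadratic_variation x \<P>" "qv_measure x \<P>" by (rule stieltjes_qv[OF qv])
  let ?\<mu> = "qv_measure x \<P>"
  \<comment> \<open>The path is extended to a measurable function on the whole line.\<close>
  define y where "y s = x (max 0 s)" for s
  have "continuous_on UNIV y" unfolding y_def by (rule continuous_on_compose2[OF x]) (auto intro!: continuous_intros)
  then have y [measurable]: "y \<in> borel_measurable borel" by (rule borel_measurable_continuous_onI)
  have [measurable]: "L \<in> borel_measurable borel" using L(1) by auto
  define N1 where "N1 = distr (density ?\<mu> (\<lambda>s. ennreal (indicator {0..t} s))) borel y"
  define N2 where "N2 = density lborel (\<lambda>u. ennreal (L u))"
  have I1: "integral\<^sup>L N1 f = (LINT s:{0..t}|?\<mu>. f (x s))" if [measurable]: "f \<in> borel_measurable borel" for f :: "real \<Rightarrow> real"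
  proof -
    have "integral\<^sup>L N1 f = (LINT s|density ?\<mu> (\<lambda>s. ennreal (indicator {0..t} s)). f (y s))"
      unfolding N1_def by (rule integral_distr) (auto simp: measurable_cong_sets[OF sets_density refl])
    also have "\<dots> = (LINT s|?\<mu>. indicator {0..t} s *\<^sub>R f (y s))"
      by (rule integral_density) auto
    also have "\<dots> = (LINT s:{0..t}|?\<mu>. f (x s))"
      unfolding set_lebesgue_integral_def by (intro Bochner_Integration.integral_cong) (auto simp: y_def indicator_def)
    finally show ?thesis .
  qed
  have I2: "integral\<^sup>L N2 f = (LINT u|lborel. L u * f u)" if [measurable]: "f \<in> borel_measurable borel" for f :: "real \<Rightarrow> real"
    unfolding N2_def by (subst integral_density) (auto simp: L(2))
  have sets: "sets N1 = sets borel" "sets N2 = sets borel" by (auto simp: N1_def N2_def)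
  have "emeasure N1 UNIV < top"
  proof -
    have sp: "space ?\<mu> = UNIV" using sets_eq_imp_space_eq[OF sets_\<mu>] by simp
    have "emeasure N1 UNIV = emeasure (density ?\<mu> (\<lambda>s. ennreal (indicator {0..t} s))) UNIV"
      unfolding N1_def by (subst emeasure_distr) (auto simp: measurable_cong_sets[OF sets_density refl] sp)
    also have "\<dots> = (\<integral>\<^sup>+s. indicator {0..t} s \<partial>?\<mu>)"
      by (subst emeasure_density) (auto simp: ennreal_indicator)
    also have "\<dots> = emeasure ?\<mu> {0..t}" by simp
    finally show ?thesis using emeasure_Icc[OF t] by simp
  qed
  moreover have "emeasure N2 UNIV < top"
    unfolding N2_def using L by (subst emeasure_density) (auto simp: nn_integral_eq_integral)
  ultimately have finite: "finite_measure N1" "finite_measure N2"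
    using sets by (auto intro!: finite_measureI simp: sets_eq_imp_space_eq[of _ borel] less_top)
  \<comment> \<open>continuous functions converging to the indicator of \<open>{a<..}\<close>\<close>
  define \<phi> where "\<phi> k a u = min 1 (max 0 (real k * (u - a)))" for k a u
  have \<phi>c: "continuous_on UNIV (\<phi> k a)" for k a unfolding \<phi>_def by (intro continuous_intros)
  have \<phi>b: "\<bar>\<phi> k a u\<bar> \<le> 1" for k a u by (simp add: \<phi>_def)
  have \<phi>m [measurable]: "\<phi> k a \<in> borel_measurable borel" for k a using \<phi>c by (rule borel_measurable_continuous_onI)
  have \<phi>_lim: "(\<lambda>k. \<phi> k a u) \<longlonglongrightarrow> indicator {a<..} u" for a u
  proof (cases "a < u")
    case True
    obtain K :: nat where K: "1 / (u - a) < real K" using reals_Archimedean2 by blast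
    have "\<phi> k a u = 1" if "k \<ge> K" for k
    proof -
      have "1 < real K * (u - a)" using K True by (simp add: pos_divide_less_eq)
      also have "\<dots> \<le> real k * (u - a)" using that True by (intro mult_right_mono) auto
      finally show ?thesis by (simp add: \<phi>_def)
    qed
    then show ?thesis using True by (intro tendsto_eventually eventually_sequentiallyI[of K]) auto
  next
    case False
    then have "real k * (u - a) \<le> 0" for k by (simp add: mult_nonneg_nonpos)
    then have "\<phi> k a u = 0" for k by (simp add: \<phi>_def max_absorb1)
    then show ?thesis using False by simp
  qed
  have conv: "(\<lambda>k. integral\<^sup>L N (\<phi> k a)) \<longlonglongrightarrow> measure N {a<..}" if N: "finite_measure N" "sets N = sets borel" for N a
  proof -
    interpret finite_measure N by fact
    have [measurable]: "{a<..} \<in> sets N" using N by simp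
    have "(\<lambda>k. integral\<^sup>L N (\<phi> k a)) \<longlonglongrightarrow> integral\<^sup>L N (indicator {a<..})"
    proof (rule integral_dominated_convergence[where w="\<lambda>_. 1"])
      show "(indicator {a<..} :: real \<Rightarrow> real) \<in> borel_measurable N" by simp
      show "\<phi> i a \<in> borel_measurable N" for i by (subst measurable_cong_sets[OF N(2) refl]) (rule \<phi>m)
    qed (auto simp: \<phi>_lim \<phi>b)
    then show ?thesis by simp
  qed
  have "N1 = N2"
  proof (rule measure_eqI_lessThan[OF sets])
    fix a
    have "integral\<^sup>L N1 (\<phi> k a) = integral\<^sup>L N2 (\<phi> k a)" for k
    proof -
      have "bounded (range (\<phi> k a))" using \<phi>b by (auto simp: bounded_iff)
      then show ?thesis unfolding I1[OF \<phi>m] I2[OF \<phi>m]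
        using LIMSEQ_unique[OF occupation_continuous_limit[OF qv \<phi>c t] lim[OF \<phi>c]] by blast
    qed
    then have "measure N1 {a<..} = measure N2 {a<..}"
      using LIMSEQ_unique[OF conv[OF finite(1) sets(1)], of a] conv[OF finite(2) sets(2), of a] by simp
    then show "emeasure N1 {a<..} = emeasure N2 {a<..}"
      using finite by (simp add: finite_measure.emeasure_eq_measure)
    show "emeasure N1 {a<..} < \<infinity>" using finite(1) by (simp add: finite_measure.emeasure_finite less_top[symmetric])
  qed
  then show ?thesis using I1[OF h] I2[OF h] by simp
qed

end

section \<open>Convergence of occupation integrals\<close>

lemma positive_negative_parts:
  assumes "1 \<le> q" "h \<in> Lp q"
  shows "(\<lambda>u. max 0 (h u)) \<in> Lp q" "(\<lambda>u. max 0 (- h u)) \<in> Lp q"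
proof -
  have [measurable]: "h \<in> borel_measurable borel" using assms(2) by (rule Lp_measurable)
  show "(\<lambda>u. max 0 (h u)) \<in> Lp q" "(\<lambda>u. max 0 (- h u)) \<in> Lp q"
    by (rule Lp_mono(1)[OF assms]; auto)+
qed

lemma compact_subset_Icc:
  assumes "compact K" "K \<subseteq> {0::real..}" obtains T where "0 \<le> T" "K \<subseteq> {0..T}"
proof -
  obtain B where B: "B > 0" "\<forall>s\<in>K. norm s \<le> B"
    using compact_imp_bounded[OF assms(1)] unfolding bounded_pos by blast
  have "K \<subseteq> {0..B}"
  proof
    fix s assume s: "s \<in> K"
    then have "0 \<le> s" using assms(2) by auto
    moreover have "norm s \<le> B" using B(2) s by blast
    ultimately show "s \<in> {0..B}" by simp
  qed
  then show ?thesis using B(1) by (intro that[of B]) auto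
qed

text \<open>What the weak topology on \<open>L\<^sup>p\<close> and the weak-star topology on
  \<open>L\<^sup>\<infinity>\<close> have in common: on functions supported by a fixed compact
  interval, the functionals in \<open>\<Phi>\<close> that generate the topology are the pairings
  with weights in \<open>L\<^sup>q\<close>. The weight may depend on the interval.\<close>

locale weak_duality =
  fixes p q :: ennreal and \<Phi> :: "((real \<Rightarrow> real) \<Rightarrow> real) set"
  assumes pq: "conjugate p q"
    and pairing: "\<And>h. h \<in> Lp q \<Longrightarrow> (\<lambda>f. LINT u|lborel. f u * h u) \<in> \<Phi>"
    and represented: "\<And>\<phi> M. \<phi> \<in> \<Phi> \<Longrightarrow> \<exists>h\<in>Lp q. \<forall>f\<in>Lp p. (\<forall>u. u \<notin> {-M..M} \<longrightarrow> f u = 0) \<longrightarrow> \<phi> f = (LINT u|lborel. f u * h u)"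
begin

lemma nonempty: "\<Phi> \<noteq> {}"
  using pairing[OF bounded_on_Icc_Lp[OF conjugate_ge_1(2)[OF pq] bounded_on_Icc_zero]] by blast

end

lemma weak_duality_weak_topology:
  assumes pq: "conjugate p q" and "p \<noteq> top" shows "weak_duality p q (Lp_dual p)"
proof
  show "conjugate p q" by fact
  show "(\<lambda>f. LINT u|lborel. f u * h u) \<in> Lp_dual p" if "h \<in> Lp q" for h
    by (rule integral_in_Lp_dual[OF pq that])
  show "\<exists>h\<in>Lp q. \<forall>f\<in>Lp p. (\<forall>u. u \<notin> {-M..M} \<longrightarrow> f u = 0) \<longrightarrow> \<phi> f = (LINT u|lborel. f u * h u)"
    if "\<phi> \<in> Lp_dual p" for \<phi> M
    by (rule Riesz_representation_Icc[OF assms that, of M]) blast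
qed

lemma weak_duality_weak_star_topology:
  "weak_duality top 1 {\<lambda>f. LINT u|lborel. f u * h u | h. h \<in> Lp 1}"
proof
  show "conjugate top 1" by (simp add: conjugate_def)
qed auto

locale pathwise_duality = pathwise + weak_duality
begin

lemma p_ge_1: "1 \<le> p" and q_ge_1: "1 \<le> q" using conjugate_ge_1[OF pq] by auto

lemma Lq_locally_integrable: "h \<in> Lp q \<Longrightarrow> locally_integrable h"
  by (rule Lp_locally_integrable[OF pq])

lemma LT_in_Lp: "0 \<le> t \<Longrightarrow> LT n t \<in> Lp p"
  by (rule bounded_on_Icc_Lp[OF p_ge_1 LT_bounded_on_Icc[OF _ order_refl]])

text \<open>The Tanaka formula for \<open>g\<close> as integrand, with \<open>F\<close> an antiderivative of
  \<open>g\<close>: the Riemann sum and half the occupation integral of \<open>g'\<close> add up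
  to a continuous function of time that is the same for all \<open>n\<close>.\<close>

lemma W1_cases:
  assumes g: "g \<in> W1 q"
  obtains h F where "h \<in> Lp q" "AE u in lborel. (g has_real_derivative h u) (at u)" "continuous_on UNIV g" "continuous_on UNIV F"
    "\<And>n t. 0 \<le> t \<Longrightarrow> F (x t) - F (x 0) = riemann_sum x (\<P> n) g t + 1 / 2 * occupation n h t"
proof -
  obtain h where h: "h \<in> Lp q" "ae_derivative g h" and ac: "locally_abs_continuous g" using g by (auto simp: W1_def)
  have gc: "continuous_on UNIV g" by (rule locally_abs_continuous_imp_continuous_on[OF ac])
  have d: "\<And>u. (antiderivative g has_real_derivative g u) (at u)" by (rule antiderivative_has_derivative[OF gc])
  have gh: "AE u in lborel. (g has_real_derivative h u) (at u)" using h(2) by (simp add: ae_derivative_def)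
  have Fc: "continuous_on UNIV (antiderivative g)"
    using d by (intro continuous_at_imp_continuous_on ballI DERIV_isCont) blast
  show thesis
    by (rule that[OF h(1) gh gc Fc]) (rule Tanaka[OF _ d ac gh Lq_locally_integrable[OF h(1)]])
qed

lemma antiderivative_in_W1:
  assumes "h \<in> Lp q" shows "antiderivative h \<in> W1 q"
  using assms Lq_locally_integrable[OF assms] unfolding W1_def
  by (auto intro!: locally_abs_continuous_antiderivative ae_derivative_antiderivative bexI[of _ h])

text \<open>The Tanaka formula with a prescribed weight \<open>h\<close> instead of a prescribed integrand.\<close>

lemma antiderivative_Tanaka:
  assumes h: "h \<in> Lp q"
  obtains F where "continuous_on UNIV F"
    "\<And>n t. 0 \<le> t \<Longrightarrow> F (x t) - F (x 0) = riemann_sum x (\<P> n) (antiderivative h) t + 1 / 2 * occupation n h t"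
proof -
  note li = Lq_locally_integrable[OF h]
  have ac: "locally_abs_continuous (antiderivative h)" by (rule locally_abs_continuous_antiderivative[OF li])
  have d: "\<And>u. (antiderivative (antiderivative h) has_real_derivative antiderivative h u) (at u)"
    by (rule antiderivative_has_derivative[OF locally_abs_continuous_imp_continuous_on[OF ac]])
  have gh: "AE u in lborel. (antiderivative h has_real_derivative h u) (at u)"
    using ae_derivative_antiderivative[OF li] by (simp add: ae_derivative_def)
  have Fc: "continuous_on UNIV (antiderivative (antiderivative h))"
    using d by (intro continuous_at_imp_continuous_on ballI DERIV_isCont) blast
  show thesis by (rule that[OF Fc]) (rule Tanaka[OF _ d ac gh li])
qed

lemma continuous_on_path: "continuous_on UNIV F \<Longrightarrow> continuous_on {0..} (\<lambda>t. F (x t))"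
  by (rule continuous_on_compose2[OF _ x]) auto

text \<open>The condition through which all equivalences are proved.\<close>

definition occupations_converge :: bool where
  "occupations_converge \<longleftrightarrow> (\<forall>h\<in>Lp q. (\<forall>t\<ge>0. convergent (\<lambda>n. occupation n h t)) \<and>
     continuous_on {0..} (\<lambda>t. lim (\<lambda>n. occupation n h t)))"

lemma occupations_converge_lim:
  "occupations_converge \<Longrightarrow> h \<in> Lp q \<Longrightarrow> 0 \<le> t \<Longrightarrow> (\<lambda>n. occupation n h t) \<longlonglongrightarrow> lim (\<lambda>n. occupation n h t)"
  unfolding occupations_converge_def by (simp add: convergent_LIMSEQ_iff)

lemma occupations_convergeI:
  assumes "\<And>h. h \<in> Lp q \<Longrightarrow> \<exists>B. (\<forall>t\<ge>0. (\<lambda>n. occupation n h t) \<longlonglongrightarrow> B t) \<and> continuous_on {0..} B"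
  shows occupations_converge
  unfolding occupations_converge_def
proof (intro ballI)
  fix h assume "h \<in> Lp q"
  then obtain B where B: "\<And>t. 0 \<le> t \<Longrightarrow> (\<lambda>n. occupation n h t) \<longlonglongrightarrow> B t" "continuous_on {0..} B" using assms by blast
  have "continuous_on {0..} (\<lambda>t. lim (\<lambda>n. occupation n h t)) = continuous_on {0..} B"
    by (rule continuous_on_cong[OF refl]) (use B(1) limI in auto)
  then show "(\<forall>t\<ge>0. convergent (\<lambda>n. occupation n h t)) \<and> continuous_on {0..} (\<lambda>t. lim (\<lambda>n. occupation n h t))"
    using B by (auto simp: convergent_def)
qed

text \<open>By the Tanaka formula Riemann sums and occupation integrals determine each other, and weights in
  \<open>L\<^sup>q\<close> correspond to integrands in \<open>W\<^sup>1\<^sup>,\<^sup>q\<close> by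
  differentiation.\<close>

lemma integrals_converge_iff:
  "(\<forall>g\<in>W1 q. (\<forall>t\<ge>0. convergent (\<lambda>n. riemann_sum x (\<P> n) g t)) \<and> continuous_on {0..} (pathwise_integral x \<P> g))
    \<longleftrightarrow> occupations_converge" (is "?C1 \<longleftrightarrow> _")
proof
  assume C1: ?C1
  show occupations_converge
  proof (rule occupations_convergeI)
    fix h assume h: "h \<in> Lp q"
    let ?g = "antiderivative h"
    obtain F where F: "continuous_on UNIV F"
      "\<And>n t. 0 \<le> t \<Longrightarrow> F (x t) - F (x 0) = riemann_sum x (\<P> n) ?g t + 1 / 2 * occupation n h t"
      using antiderivative_Tanaka[OF h] by blast
    let ?B = "\<lambda>t. 2 * (F (x t) - F (x 0) - pathwise_integral x \<P> ?g t)"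
    have lim: "(\<lambda>n. occupation n h t) \<longlonglongrightarrow> ?B t" if t: "0 \<le> t" for t
    proof -
      have "convergent (\<lambda>n. riemann_sum x (\<P> n) ?g t)" using C1 antiderivative_in_W1[OF h] t by blast
      then have "(\<lambda>n. riemann_sum x (\<P> n) ?g t) \<longlonglongrightarrow> pathwise_integral x \<P> ?g t"
        unfolding pathwise_integral_def by (simp add: convergent_LIMSEQ_iff)
      then have "(\<lambda>n. 2 * (F (x t) - F (x 0) - riemann_sum x (\<P> n) ?g t)) \<longlonglongrightarrow> ?B t" by (intro tendsto_intros)
      moreover have "2 * (F (x t) - F (x 0) - riemann_sum x (\<P> n) ?g t) = occupation n h t" for n
        using F(2)[OF t, of n] by simp
      ultimately show ?thesis by simp
    qed
    have cont: "continuous_on {0..} ?B"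
      using C1 antiderivative_in_W1[OF h] by (intro continuous_intros continuous_on_path[OF F(1)]) blast
    show "\<exists>B. (\<forall>t\<ge>0. (\<lambda>n. occupation n h t) \<longlonglongrightarrow> B t) \<and> continuous_on {0..} B"
      by (intro exI[of _ ?B] conjI allI impI lim cont)
  qed
next
  assume H: occupations_converge
  show ?C1
  proof
    fix g assume "g \<in> W1 q"
    then obtain h F where h: "h \<in> Lp q" and F: "continuous_on UNIV F"
      "\<And>n t. 0 \<le> t \<Longrightarrow> F (x t) - F (x 0) = riemann_sum x (\<P> n) g t + 1 / 2 * occupation n h t"
      by (rule W1_cases) blast
    let ?B = "\<lambda>t. F (x t) - F (x 0) - 1 / 2 * lim (\<lambda>n. occupation n h t)"
    have lim: "(\<lambda>n. riemann_sum x (\<P> n) g t) \<longlonglongrightarrow> ?B t" if t: "0 \<le> t" for t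
    proof -
      have "(\<lambda>n. F (x t) - F (x 0) - 1 / 2 * occupation n h t) \<longlonglongrightarrow> ?B t"
        by (intro tendsto_intros occupations_converge_lim[OF H h t])
      moreover have "F (x t) - F (x 0) - 1 / 2 * occupation n h t = riemann_sum x (\<P> n) g t" for n
        using F(2)[OF t, of n] by simp
      ultimately show ?thesis by simp
    qed
    have "continuous_on {0..} (pathwise_integral x \<P> g) = continuous_on {0..} ?B"
      by (rule continuous_on_cong[OF refl]) (use lim limI in \<open>auto simp: pathwise_integral_def\<close>)
    moreover have "continuous_on {0..} ?B"
      using H h unfolding occupations_converge_def by (intro continuous_intros continuous_on_path[OF F(1)]) blast
    ultimately show "(\<forall>t\<ge>0. convergent (\<lambda>n. riemann_sum x (\<P> n) g t)) \<and> continuous_on {0..} (pathwise_integral x \<P> g)"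
      using lim by (auto simp: convergent_def)
  qed
qed

text \<open>Almost monotonicity applies to the positive and the negative part of \<open>h\<close>.\<close>

lemma occupations_converge_uniformly:
  assumes H: occupations_converge and h: "h \<in> Lp q" and T: "0 \<le> T"
  shows "uniform_limit {0..T} (\<lambda>n. occupation n h) (\<lambda>t. lim (\<lambda>n. occupation n h t)) sequentially"
proof -
  let ?hp = "\<lambda>u. max 0 (h u)" and ?hn = "\<lambda>u. max 0 (- h u)"
  note hL = positive_negative_parts[OF q_ge_1 h]
  have ul: "uniform_limit {0..T} (\<lambda>n. occupation n f) (\<lambda>t. lim (\<lambda>n. occupation n f t)) sequentially"
    if "f \<in> Lp q" "\<And>u. 0 \<le> f u" for f
    using that H T
    by (intro occupation_uniform_limit Lq_locally_integrable occupations_converge_lim) (auto simp: occupations_converge_def)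
  have split: "occupation n h t = occupation n ?hp t - occupation n ?hn t" if "0 \<le> t" for n t
  proof -
    have "h = (\<lambda>u. 1 * ?hp u + (-1) * ?hn u)" by (auto simp: fun_eq_iff max_def)
    then show ?thesis
      using occupation_linear[OF that Lq_locally_integrable[OF hL(1)] Lq_locally_integrable[OF hL(2)], of n 1 "-1"] by simp
  qed
  have ul2: "uniform_limit {0..T} (\<lambda>n t. occupation n ?hp t - occupation n ?hn t)
      (\<lambda>t. lim (\<lambda>n. occupation n ?hp t) - lim (\<lambda>n. occupation n ?hn t)) sequentially"
    by (rule uniform_limit_minus[OF ul[OF hL(1)] ul[OF hL(2)]]) auto
  have lim_eq: "lim (\<lambda>n. occupation n ?hp t) - lim (\<lambda>n. occupation n ?hn t) = lim (\<lambda>n. occupation n h t)" if t: "0 \<le> t" for t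
  proof -
    have "(\<lambda>n. occupation n h t) \<longlonglongrightarrow> lim (\<lambda>n. occupation n ?hp t) - lim (\<lambda>n. occupation n ?hn t)"
      unfolding split[OF t] by (intro tendsto_diff occupations_converge_lim[OF H _ t] hL)
    then show ?thesis by (simp add: limI)
  qed
  show ?thesis
  proof (rule uniform_limit_cong'[THEN iffD1, OF _ _ ul2])
    fix n t assume "t \<in> {0..T}"
    then have "0 \<le> t" by simp
    then show "occupation n ?hp t - occupation n ?hn t = occupation n h t"
      "lim (\<lambda>n. occupation n ?hp t) - lim (\<lambda>n. occupation n ?hn t) = lim (\<lambda>n. occupation n h t)"
      by (rule split[symmetric], rule lim_eq)
  qed
qed

lemma continuous_on_stop_time: "continuous_on {0..} (\<lambda>t. stop_time \<pi> j t)"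
proof (cases "\<pi> j")
  case (real r)
  have "stop_time \<pi> j t = min r t" if "0 \<le> t" for t
    using that real by (simp add: stop_time_def min_def)
  then show ?thesis by (subst continuous_on_cong[OF refl, where g="\<lambda>t. min r t"]) (auto intro!: continuous_intros)
next
  case top
  have "stop_time \<pi> j t = t" if "0 \<le> t" for t using that top by (simp add: stop_time_def min_absorb2)
  then show ?thesis by (subst continuous_on_cong[OF refl, where g="\<lambda>t. t"]) auto
qed

lemma continuous_on_riemann_sum: "continuous_on {0..} (riemann_sum x (\<P> n) g)"
proof (rule continuous_on_Ici_if_Icc)
  fix T :: real assume T: "0 \<le> T"
  obtain N where N: "ennreal T \<le> \<P> n N" using partitioned.\<pi>_eventually[OF partitioned] by blast
  have c: "continuous_on {0..T} (\<lambda>t. stopped x (\<P> n j) t)" for j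
    unfolding stopped_eq
    by (rule continuous_on_compose2[OF x continuous_on_subset[OF continuous_on_stop_time]]) (auto simp: stop_time_nonneg)
  have "riemann_sum x (\<P> n) g t = (\<Sum>j<N. g (path_at x (\<P> n j)) * (stopped x (\<P> n (Suc j)) t - stopped x (\<P> n j) t))"
    if t: "t \<in> {0..T}" for t
    unfolding riemann_sum_def
  proof (rule partitioned.sums_stopped[OF partitioned])
    show "0 \<le> t" "ennreal t \<le> \<P> n N" using t N by (auto intro: order_trans[OF ennreal_leI])
  qed (simp add: stopped_eq)
  then show "continuous_on {0..T} (riemann_sum x (\<P> n) g)"
    by (subst continuous_on_cong[OF refl, where g="\<lambda>t. \<Sum>j<N. g (path_at x (\<P> n j)) * (stopped x (\<P> n (Suc j)) t - stopped x (\<P> n j) t)"])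
       (auto intro!: continuous_intros c)
qed

text \<open>Uniformity is automatic for occupation integrals and passes to Riemann sums by the Tanaka
  formula; conversely, uniform limits of the Riemann sums, which are continuous in time, are
  continuous.\<close>

lemma integrals_converge_uniformly_iff:
  "(\<forall>g\<in>W1 q. \<forall>K. compact K \<and> K \<subseteq> {0..} \<longrightarrow> uniformly_convergent_on K (\<lambda>n t. riemann_sum x (\<P> n) g t))
    \<longleftrightarrow> occupations_converge" (is "?C2 \<longleftrightarrow> _")
proof
  assume H: occupations_converge
  show ?C2
  proof (intro ballI allI impI)
    fix g K assume "g \<in> W1 q" and K: "compact K \<and> K \<subseteq> {0::real..}"
    then obtain h F where h: "h \<in> Lp q"
      and F: "\<And>n t. 0 \<le> t \<Longrightarrow> F (x t) - F (x 0) = riemann_sum x (\<P> n) g t + 1 / 2 * occupation n h t"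
      by (metis W1_cases)
    obtain T where T: "0 \<le> T" "K \<subseteq> {0..T}" using compact_subset_Icc K by blast
    have "uniform_limit {0..T} (\<lambda>n t. F (x t) - F (x 0) - 1 / 2 * occupation n h t)
       (\<lambda>t. F (x t) - F (x 0) - 1 / 2 * lim (\<lambda>n. occupation n h t)) sequentially"
      by (rule uniform_limit_minus[OF uniform_limit_const bounded_linear.uniform_limit[OF bounded_linear_mult_right
            occupations_converge_uniformly[OF H h T(1)]]])
    then have ul: "uniform_limit K (\<lambda>n t. F (x t) - F (x 0) - 1 / 2 * occupation n h t)
       (\<lambda>t. F (x t) - F (x 0) - 1 / 2 * lim (\<lambda>n. occupation n h t)) sequentially"
      using T(2) by (rule uniform_limit_on_subset)
    have eq: "F (x t) - F (x 0) - 1 / 2 * occupation n h t = riemann_sum x (\<P> n) g t" if "t \<in> K" for n t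
    proof -
      have "0 \<le> t" using that T(2) by auto
      from F[OF this, of n] show ?thesis by simp
    qed
    have "uniform_limit K (\<lambda>n t. riemann_sum x (\<P> n) g t)
       (\<lambda>t. F (x t) - F (x 0) - 1 / 2 * lim (\<lambda>n. occupation n h t)) sequentially"
      by (rule uniform_limit_cong'[THEN iffD1, OF eq refl ul])
    then show "uniformly_convergent_on K (\<lambda>n t. riemann_sum x (\<P> n) g t)" by (rule uniformly_convergentI)
  qed
next
  assume C2: ?C2
  show occupations_converge
    unfolding integrals_converge_iff[symmetric]
  proof (intro ballI conjI allI impI)
    fix g assume g: "g \<in> W1 q"
    have ul: "uniform_limit {0..T} (\<lambda>n t. riemann_sum x (\<P> n) g t) (pathwise_integral x \<P> g) sequentially" for T
    proof -
      have "uniformly_convergent_on {0..T} (\<lambda>n t. riemann_sum x (\<P> n) g t)" using C2 g by auto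
      then show ?thesis by (simp add: uniformly_convergent_uniform_limit_iff pathwise_integral_def[abs_def])
    qed
    show "convergent (\<lambda>n. riemann_sum x (\<P> n) g t)" if "0 \<le> t" for t
      using tendsto_uniform_limitI[OF ul[of t], of t] that by (auto simp: convergent_def)
    show "continuous_on {0..} (pathwise_integral x \<P> g)"
    proof (rule continuous_on_Ici_if_Icc)
      fix T :: real
      show "continuous_on {0..T} (pathwise_integral x \<P> g)"
        by (rule uniform_limit_theorem[OF _ ul])
           (auto intro!: always_eventually continuous_on_subset[OF continuous_on_riemann_sum])
    qed
  qed
qed

lemma limit_density:
  assumes H: occupations_converge and t: "0 \<le> t"
  obtains L where "L \<in> Lp p" "\<And>u. 0 \<le> L u" "\<And>u. u \<notin> {- range_bound t..range_bound t} \<Longrightarrow> L u = 0"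
    "\<And>h. h \<in> Lp q \<Longrightarrow> (\<lambda>n. occupation n h t) \<longlonglongrightarrow> (LINT u|lborel. L u * h u)"
proof -
  obtain L where "L \<in> Lp p" "\<And>u. 0 \<le> L u" "\<And>u. u \<notin> {- range_bound t..range_bound t} \<Longrightarrow> L u = 0"
    "\<And>h. h \<in> Lp q \<Longrightarrow> (\<lambda>n. LINT u|lborel. LT n t u * h u) \<longlonglongrightarrow> (LINT u|lborel. L u * h u)"
  proof (rule weak_limit_exists[OF pq LT_bounded_on_Icc[OF t order_refl] LT_nonneg[OF t]])
    show "convergent (\<lambda>n. LINT u|lborel. LT n t u * h u)" if "h \<in> Lp q" for h
      using occupations_converge_lim[OF H that t] by (auto simp: convergent_def occupation_def)
  qed blast
  then show thesis using that by (simp add: occupation_def)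
qed

section \<open>Weak convergence of discrete local times\<close>

lemma continuous_on_occupation:
  assumes h: "h \<in> Lp q" shows "continuous_on {0..} (occupation n h)"
proof -
  obtain F where F: "continuous_on UNIV F"
    "\<And>n t. 0 \<le> t \<Longrightarrow> F (x t) - F (x 0) = riemann_sum x (\<P> n) (antiderivative h) t + 1 / 2 * occupation n h t"
    using antiderivative_Tanaka[OF h] by blast
  have "occupation n h t = 2 * (F (x t) - F (x 0) - riemann_sum x (\<P> n) (antiderivative h) t)" if "t \<in> {0..}" for t
    using F(2)[of t n] that by simp
  then show ?thesis
    by (subst continuous_on_cong[OF refl]) (auto intro!: continuous_intros continuous_on_path F(1) continuous_on_riemann_sum)
qed

lemma limit_densities:
  assumes H: occupations_converge
  shows "\<exists>L. \<forall>t\<ge>0. L t \<in> Lp p \<and> (\<forall>u. 0 \<le> L t u) \<and> (\<forall>u. u \<notin> {- range_bound t..range_bound t} \<longrightarrow> L t u = 0) \<and>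
      (\<forall>h\<in>Lp q. (\<lambda>n. occupation n h t) \<longlonglongrightarrow> (LINT u|lborel. L t u * h u))"
proof -
  have "\<forall>t. \<exists>L. 0 \<le> t \<longrightarrow> L \<in> Lp p \<and> (\<forall>u. 0 \<le> L u) \<and> (\<forall>u. u \<notin> {- range_bound t..range_bound t} \<longrightarrow> L u = 0) \<and>
      (\<forall>h\<in>Lp q. (\<lambda>n. occupation n h t) \<longlonglongrightarrow> (LINT u|lborel. L u * h u))"
  proof (intro allI)
    fix t
    show "\<exists>L. 0 \<le> t \<longrightarrow> L \<in> Lp p \<and> (\<forall>u. 0 \<le> L u) \<and> (\<forall>u. u \<notin> {- range_bound t..range_bound t} \<longrightarrow> L u = 0) \<and>
      (\<forall>h\<in>Lp q. (\<lambda>n. occupation n h t) \<longlonglongrightarrow> (LINT u|lborel. L u * h u))"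
    proof (cases "0 \<le> t")
      case True
      then show ?thesis by (rule limit_density[OF H]) blast
    qed simp
  qed
  from choice[OF this] show ?thesis .
qed

text \<open>For the implication from right to left a functional is turned into a weight, which is possible
  for all times up to a given \<open>T\<close> simultaneously because all densities up to
  \<open>T\<close> live on one interval.\<close>

lemma weakly_convergent_iff:
  "(\<exists>L. (\<forall>t\<ge>0. limitin (initial_topology (Lp p) \<Phi>) (\<lambda>n. LT n t) (L t) sequentially) \<and>
      continuous_map (top_of_set {0..}) (initial_topology (Lp p) \<Phi>) L) \<longleftrightarrow> occupations_converge" (is "?C3 \<longleftrightarrow> _")
proof
  assume ?C3
  then obtain L where L: "\<And>t. 0 \<le> t \<Longrightarrow> limitin (initial_topology (Lp p) \<Phi>) (\<lambda>n. LT n t) (L t) sequentially"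
    and c: "continuous_map (top_of_set {0..}) (initial_topology (Lp p) \<Phi>) L" by blast
  show occupations_converge
  proof (rule occupations_convergeI)
    fix h assume h: "h \<in> Lp q"
    have lim: "(\<lambda>n. occupation n h t) \<longlonglongrightarrow> (LINT u|lborel. L t u * h u)" if t: "0 \<le> t" for t
      unfolding occupation_def
      by (rule bspec[OF conjunct2[OF L[OF t, unfolded limitin_initial_topology_iff[OF nonempty LT_in_Lp[OF t]]]] pairing[OF h]])
    have cont: "continuous_on {0..} (\<lambda>t. LINT u|lborel. L t u * h u)"
      by (rule bspec[OF conjunct2[OF c[unfolded continuous_map_initial_topology_iff[OF nonempty]]] pairing[OF h]])
    show "\<exists>B. (\<forall>t\<ge>0. (\<lambda>n. occupation n h t) \<longlonglongrightarrow> B t) \<and> continuous_on {0..} B"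
      by (intro exI[of _ "\<lambda>t. LINT u|lborel. L t u * h u"] conjI allI impI lim cont)
  qed
next
  assume H: occupations_converge
  obtain L where L: "\<forall>t\<ge>0. L t \<in> Lp p \<and> (\<forall>u. 0 \<le> L t u) \<and> (\<forall>u. u \<notin> {- range_bound t..range_bound t} \<longrightarrow> L t u = 0) \<and>
      (\<forall>h\<in>Lp q. (\<lambda>n. occupation n h t) \<longlonglongrightarrow> (LINT u|lborel. L t u * h u))"
    using limit_densities[OF H] ..
  have L: "L t \<in> Lp p" "u \<notin> {- range_bound t..range_bound t} \<Longrightarrow> L t u = 0"
    "h \<in> Lp q \<Longrightarrow> (\<lambda>n. occupation n h t) \<longlonglongrightarrow> (LINT u|lborel. L t u * h u)" if "0 \<le> t" for t u h
    using L that by simp_all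
  have rep: "\<exists>h\<in>Lp q. (\<forall>t\<in>{0..T}. \<phi> (L t) = (LINT u|lborel. L t u * h u) \<and> (\<forall>n. \<phi> (LT n t) = occupation n h t))"
    if \<phi>: "\<phi> \<in> \<Phi>" and T: "0 \<le> T" for \<phi> T
  proof -
    obtain h where h: "h \<in> Lp q" "\<And>f. f \<in> Lp p \<Longrightarrow> (\<And>u. u \<notin> {- range_bound T..range_bound T} \<Longrightarrow> f u = 0) \<Longrightarrow> \<phi> f = (LINT u|lborel. f u * h u)"
      using represented[OF \<phi>, of "range_bound T"] by blast
    show ?thesis
    proof (intro bexI[OF _ h(1)] ballI conjI allI)
      fix t n assume t: "t \<in> {0..T}"
      then have "range_bound t \<le> range_bound T" by (intro range_bound_mono) simp
      then show "\<phi> (L t) = (LINT u|lborel. L t u * h u)" using t by (intro h(2) L) auto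
      have "bounded_on_Icc (range_bound T) (LT n t)" using t by (intro LT_bounded_on_Icc) auto
      then show "\<phi> (LT n t) = occupation n h t"
        unfolding occupation_def using t by (intro h(2) LT_in_Lp bounded_on_Icc_outside) auto
    qed
  qed
  show ?C3
  proof (intro exI[of _ L] conjI allI impI)
    fix t :: real assume t: "0 \<le> t"
    show "limitin (initial_topology (Lp p) \<Phi>) (\<lambda>n. LT n t) (L t) sequentially"
      unfolding limitin_initial_topology_iff[OF nonempty LT_in_Lp[OF t]]
    proof (intro conjI ballI L(1)[OF t])
      fix \<phi> assume "\<phi> \<in> \<Phi>"
      from rep[OF this t] obtain h where "h \<in> Lp q" "\<phi> (L t) = (LINT u|lborel. L t u * h u)" "\<And>n. \<phi> (LT n t) = occupation n h t"
        using t by auto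
      then show "(\<lambda>n. \<phi> (LT n t)) \<longlonglongrightarrow> \<phi> (L t)" using L(3)[OF t] by simp
    qed
  next
    show "continuous_map (top_of_set {0..}) (initial_topology (Lp p) \<Phi>) L"
      unfolding continuous_map_initial_topology_iff[OF nonempty]
    proof (intro conjI ballI)
      show "L t \<in> Lp p" if "t \<in> {0..}" for t using that by (intro L) simp
      fix \<phi> assume \<phi>: "\<phi> \<in> \<Phi>"
      show "continuous_on {0..} (\<lambda>t. \<phi> (L t))"
      proof (rule continuous_on_Ici_if_Icc)
        fix T :: real assume T: "0 \<le> T"
        from rep[OF \<phi> T] obtain h where h: "h \<in> Lp q" "\<And>t. t \<in> {0..T} \<Longrightarrow> \<phi> (L t) = (LINT u|lborel. L t u * h u)" by blast
        have "lim (\<lambda>n. occupation n h t) = \<phi> (L t)" if "t \<in> {0..T}" for t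
          using L(3)[OF _ h(1), of t] h(2)[OF that] that by (simp add: limI)
        moreover have "continuous_on {0..T} (\<lambda>t. lim (\<lambda>n. occupation n h t))"
          using H h(1) unfolding occupations_converge_def by (auto intro: continuous_on_subset)
        ultimately show "continuous_on {0..T} (\<lambda>t. \<phi> (L t))"
          using continuous_on_cong[OF refl, of "{0..T}" "\<lambda>t. lim (\<lambda>n. occupation n h t)" "\<lambda>t. \<phi> (L t)"] by blast
      qed
    qed
  qed
qed

text \<open>Continuity in time of the limit comes from that of the occupation integrals and from uniformity.\<close>

lemma uniformly_weakly_convergent_iff:
  "(\<exists>L. (\<forall>t\<ge>0. L t \<in> Lp p) \<and> (\<forall>h\<in>Lp q. \<forall>K. compact K \<and> K \<subseteq> {0..} \<longrightarrow>
      uniform_limit K (\<lambda>n t. LINT u|lborel. LT n t u * h u) (\<lambda>t. LINT u|lborel. L t u * h u) sequentially))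
    \<longleftrightarrow> occupations_converge" (is "?C4 \<longleftrightarrow> _")
  unfolding occupation_def[symmetric]
proof
  assume "\<exists>L. (\<forall>t\<ge>0. L t \<in> Lp p) \<and> (\<forall>h\<in>Lp q. \<forall>K. compact K \<and> K \<subseteq> {0..} \<longrightarrow>
      uniform_limit K (\<lambda>n t. occupation n h t) (\<lambda>t. LINT u|lborel. L t u * h u) sequentially)"
  then obtain L where L: "\<And>h K. h \<in> Lp q \<Longrightarrow> compact K \<and> K \<subseteq> {0..} \<Longrightarrow>
      uniform_limit K (\<lambda>n t. occupation n h t) (\<lambda>t. LINT u|lborel. L t u * h u) sequentially" by blast
  show occupations_converge
  proof (rule occupations_convergeI)
    fix h assume h: "h \<in> Lp q"
    have ul: "uniform_limit {0..T} (\<lambda>n t. occupation n h t) (\<lambda>t. LINT u|lborel. L t u * h u) sequentially" for T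
      by (rule L[OF h]) auto
    have lim: "(\<lambda>n. occupation n h t) \<longlonglongrightarrow> (LINT u|lborel. L t u * h u)" if "0 \<le> t" for t
      by (rule tendsto_uniform_limitI[OF ul[of t]]) (use that in simp)
    have cont: "continuous_on {0..} (\<lambda>t. LINT u|lborel. L t u * h u)"
    proof (rule continuous_on_Ici_if_Icc)
      fix T :: real
      show "continuous_on {0..T} (\<lambda>t. LINT u|lborel. L t u * h u)"
        by (rule uniform_limit_theorem[OF _ ul]) (auto intro!: always_eventually continuous_on_subset[OF continuous_on_occupation[OF h]])
    qed
    show "\<exists>B. (\<forall>t\<ge>0. (\<lambda>n. occupation n h t) \<longlonglongrightarrow> B t) \<and> continuous_on {0..} B"
      by (intro exI[of _ "\<lambda>t. LINT u|lborel. L t u * h u"] conjI allI impI lim cont)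
  qed
next
  assume H: occupations_converge
  obtain L where L: "\<forall>t\<ge>0. L t \<in> Lp p \<and> (\<forall>u. 0 \<le> L t u) \<and> (\<forall>u. u \<notin> {- range_bound t..range_bound t} \<longrightarrow> L t u = 0) \<and>
      (\<forall>h\<in>Lp q. (\<lambda>n. occupation n h t) \<longlonglongrightarrow> (LINT u|lborel. L t u * h u))"
    using limit_densities[OF H] ..
  have L: "L t \<in> Lp p" "h \<in> Lp q \<Longrightarrow> (\<lambda>n. occupation n h t) \<longlonglongrightarrow> (LINT u|lborel. L t u * h u)" if "0 \<le> t" for t h
    using L that by simp_all
  show "\<exists>L. (\<forall>t\<ge>0. L t \<in> Lp p) \<and> (\<forall>h\<in>Lp q. \<forall>K. compact K \<and> K \<subseteq> {0..} \<longrightarrow>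
      uniform_limit K (\<lambda>n t. occupation n h t) (\<lambda>t. LINT u|lborel. L t u * h u) sequentially)"
  proof (intro exI[of _ L] conjI allI impI ballI)
    fix h K assume h: "h \<in> Lp q" and K: "compact K \<and> K \<subseteq> {0::real..}"
    obtain T where T: "0 \<le> T" "K \<subseteq> {0..T}" using compact_subset_Icc K by blast
    have "uniform_limit K (\<lambda>n. occupation n h) (\<lambda>t. lim (\<lambda>n. occupation n h t)) sequentially"
      using occupations_converge_uniformly[OF H h T(1)] T(2) by (rule uniform_limit_on_subset)
    then show "uniform_limit K (\<lambda>n t. occupation n h t) (\<lambda>t. LINT u|lborel. L t u * h u) sequentially"
    proof (rule uniform_limit_cong'[THEN iffD1, OF refl, rotated])
      fix t assume "t \<in> K"
      then have "0 \<le> t" using K by auto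
      from L(2)[OF this h] show "lim (\<lambda>n. occupation n h t) = (LINT u|lborel. L t u * h u)" by (rule limI)
    qed
  qed (rule L)
qed

section \<open>Quadratic variation and tightness\<close>

text \<open>The common form of boundedness in \<open>L\<^sup>p\<close> for \<open>p > 1\<close> and
  equi-integrability for \<open>p = 1\<close>, see \<open>tight_iff_bounded\<close> and
  \<open>tight_iff_equi_integrable\<close> below.\<close>

definition tight :: "real \<Rightarrow> bool" where
  "tight t \<longleftrightarrow> uniformly_abs_continuous (\<lambda>n. LT n t) \<and> (\<exists>C. \<forall>n. Lp_norm p (LT n t) \<le> C)"

lemma tight_if_occupations_converge:
  assumes H: occupations_converge and t: "0 \<le> t" shows "tight t"
proof -
  note bd = LT_bounded_on_Icc[OF t order_refl]
  have conv: "convergent (\<lambda>n. LINT u|lborel. LT n t u * h u)" if "h \<in> Lp q" for h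
    using occupations_converge_lim[OF H that t] by (auto simp: convergent_def occupation_def)
  have "uniformly_abs_continuous (\<lambda>n. LT n t)"
    by (rule Vitali_Hahn_Saks[OF bd LT_nonneg[OF t]]) (intro conv indicator_in_Lp[OF q_ge_1])
  moreover have "\<exists>C. \<forall>n. Lp_norm p (LT n t) \<le> C"
    by (rule Banach_Steinhaus_nonneg[OF pq bd LT_nonneg[OF t] conv])
  ultimately show ?thesis by (simp add: tight_def)
qed

text \<open>The weight \<open>1\<close>, whose occupation integral is the discrete quadratic variation, need
  not lie in \<open>L\<^sup>q\<close>; up to time \<open>T\<close> it can be replaced by the
  indicator of an interval containing the path.\<close>

lemma has_quadratic_variation_if_occupations_converge:
  assumes H: occupations_converge shows "has_quadratic_variation x \<P>"
proof -
  define w where "w T = (indicator {- range_bound T..range_bound T} :: real \<Rightarrow> real)" for T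
  have w: "w T \<in> Lp q" for T unfolding w_def by (rule indicator_in_Lp[OF q_ge_1]) auto
  have eq: "discrete_qv x (\<P> n) t = occupation n (w T) t" if t: "t \<in> {0..T}" for n t T
  proof -
    have "(LINT u|lborel. LT n t u * 1) = (LINT u|lborel. LT n t u * w T u)"
    proof (rule Bochner_Integration.integral_cong[OF refl])
      fix u show "LT n t u * 1 = LT n t u * w T u"
        using bounded_on_Icc_outside[OF LT_bounded_on_Icc, of t T u n] t by (cases "u \<in> {- range_bound T..range_bound T}") (auto simp: w_def)
    qed
    moreover have "0 \<le> t" using t by simp
    ultimately show ?thesis by (simp only: discrete_qv_eq_occupation occupation_def)
  qed
  have "convergent (\<lambda>n. discrete_qv x (\<P> n) t)" if "0 \<le> t" for t
    using occupations_converge_lim[OF H w that, of t] eq[of t t] that by (auto simp: convergent_def)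
  moreover have "continuous_on {0..} (quadratic_variation x \<P>)"
  proof (rule continuous_on_Ici_if_Icc)
    fix T :: real
    have "continuous_on {0..T} (\<lambda>t. lim (\<lambda>n. occupation n (w T) t))"
      using H w[of T] unfolding occupations_converge_def by (auto intro: continuous_on_subset)
    moreover have "quadratic_variation x \<P> t = lim (\<lambda>n. occupation n (w T) t)" if "t \<in> {0..T}" for t
      unfolding quadratic_variation_def eq[OF that] ..
    ultimately show "continuous_on {0..T} (quadratic_variation x \<P>)"
      using continuous_on_cong[OF refl, of "{0..T}" "quadratic_variation x \<P>" "\<lambda>t. lim (\<lambda>n. occupation n (w T) t)"] by blast
  qed
  ultimately show ?thesis by (simp add: has_quadratic_variation_def)
qed

lemma oscillation_bounded:
  assumes "0 \<le> T" obtains Z where "0 \<le> Z" "\<And>n. oscillation x (\<P> n) T \<le> Z" "\<And>n. 0 \<le> oscillation x (\<P> n) T"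
proof -
  have "Bseq (\<lambda>n. oscillation x (\<P> n) T)" using osc[OF assms] by (intro convergent_imp_Bseq) (auto simp: convergent_def)
  then obtain K where "K > 0" "\<And>n. norm (oscillation x (\<P> n) T) \<le> K" unfolding Bseq_def by blast
  then show thesis using partitioned.oscillation_nonneg[OF partitioned x assms]
    by (intro that[of K]) (auto simp: abs_le_iff)
qed

text \<open>Almost monotonicity in time, tested with near-extremal weights, transfers bounds in
  \<open>L\<^sup>p\<close> from \<open>T\<close> to all earlier times; this is why bounds at
  arbitrarily late times are enough.\<close>

lemma Lp_norm_LT_bound:
  assumes T: "0 \<le> T" and C: "\<And>n. Lp_norm p (LT n T) \<le> C"
  obtains C' where "\<And>n t. 0 \<le> t \<Longrightarrow> t \<le> T \<Longrightarrow> Lp_norm p (LT n t) \<le> C'"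
proof -
  obtain Z where Z: "0 \<le> Z" "\<And>n. oscillation x (\<P> n) T \<le> Z" "\<And>n. 0 \<le> oscillation x (\<P> n) T"
    using oscillation_bounded[OF T] by blast
  let ?I = "{- range_bound T..range_bound T}"
  have iL: "indicator ?I \<in> Lp p" by (rule indicator_in_Lp[OF p_ge_1]) auto
  define K where "K = Lp_norm p (indicator ?I)"
  have K: "0 \<le> K" by (simp add: K_def Lp_norm_nonneg)
  have "Lp_norm p (LT n t) \<le> 2 * (C + 2 * Z * K)" if t: "0 \<le> t" "t \<le> T" for n t
  proof -
    obtain h where h: "bounded_on_Icc (range_bound T) h" "\<And>u. 0 \<le> h u" "Lp_norm q h \<le> 1"
      "Lp_norm p (LT n t) \<le> 2 * (LINT u|lborel. LT n t u * h u)"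
      by (rule converse_Holder[OF pq LT_bounded_on_Icc[OF t] LT_nonneg[OF t(1)], of n]) blast
    have hL: "h \<in> Lp q" by (rule bounded_on_Icc_Lp[OF q_ge_1 h(1)])
    have "occupation n h t \<le> occupation n h T + 2 * oscillation x (\<P> n) T * local_integral T h"
      using t h(2) by (intro occupation_almost_mono Lq_locally_integrable[OF hL]) auto
    also have "occupation n h T \<le> C"
    proof -
      have "occupation n h T \<le> Lp_norm p (LT n T) * Lp_norm q h"
        using Holder_abs[OF pq LT_in_Lp[OF T] hL, of n] unfolding occupation_def by linarith
      also have "\<dots> \<le> Lp_norm p (LT n T) * 1" using h(3) by (intro mult_left_mono Lp_norm_nonneg)
      finally show ?thesis using C[of n] by simp
    qed
    also have "2 * oscillation x (\<P> n) T * local_integral T h \<le> 2 * Z * K"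
    proof (rule mult_mono)
      have "local_integral T h = (LINT u|lborel. indicator ?I u * h u)"
        unfolding local_integral_def using h(2) by simp
      also have "\<dots> \<le> K * Lp_norm q h" using Holder_abs[OF pq iL hL] unfolding K_def by linarith
      also have "\<dots> \<le> K * 1" using h(3) K by (intro mult_left_mono)
      finally show "local_integral T h \<le> K" by simp
    qed (use Z local_integral_nonneg in auto)
    finally show ?thesis using h(4) by (simp add: occupation_def)
  qed
  then show thesis by (rule that)
qed

text \<open>Almost monotonicity in time for indicators, whose error term is proportional to the measure of
  the set.\<close>

lemma uniformly_abs_continuous_LT:
  assumes t: "0 \<le> t" "t \<le> T" and uac: "uniformly_abs_continuous (\<lambda>n. LT n T)"
  shows "uniformly_abs_continuous (\<lambda>n. LT n t)"
  unfolding uniformly_abs_continuous_def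
proof (intro allI impI)
  fix \<epsilon> :: real assume e: "\<epsilon> > 0"
  have T: "0 \<le> T" using t by simp
  obtain Z where Z: "0 \<le> Z" "\<And>n. oscillation x (\<P> n) T \<le> Z" "\<And>n. 0 \<le> oscillation x (\<P> n) T"
    using oscillation_bounded[OF T] by blast
  have "\<epsilon> / 2 > 0" using e by simp
  then obtain \<delta> where \<delta>: "\<delta> > 0" "\<And>A n. A \<in> sets borel \<Longrightarrow> emeasure lborel A < ennreal \<delta> \<Longrightarrow> (LINT u|lborel. LT n T u * indicator A u) < \<epsilon> / 2"
    using uac unfolding uniformly_abs_continuous_def by blast
  define d where "d = min \<delta> (\<epsilon> / (4 * (Z + 1)))"
  have d: "d > 0" using \<delta>(1) e Z(1) by (simp add: d_def)
  show "\<exists>\<delta>>0. \<forall>A\<in>sets borel. emeasure lborel A < ennreal \<delta> \<longrightarrow> (\<forall>n. (LINT u|lborel. LT n t u * indicator A u) < \<epsilon>)"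
  proof (intro exI[of _ d] conjI ballI impI allI d)
    fix A :: "real set" and n assume A [measurable]: "A \<in> sets borel" and l: "emeasure lborel A < ennreal d"
    let ?I = "{- range_bound T..range_bound T}"
    have li: "locally_integrable (indicator A)"
    proof -
      have "indicator A \<in> Lp top" by (auto simp: Lp_infty_iff intro!: exI[of _ 1] AE_I2)
      then show ?thesis by (intro Lp_locally_integrable[of 1 top]) (auto simp: conjugate_def)
    qed
    have "occupation n (indicator A) t \<le> occupation n (indicator A) T + 2 * oscillation x (\<P> n) T * local_integral T (indicator A)"
      using t li by (intro occupation_almost_mono) auto
    also have "occupation n (indicator A) T < \<epsilon> / 2"
      unfolding occupation_def by (rule \<delta>(2)[OF A]) (rule less_le_trans[OF l], simp add: d_def ennreal_leI)
    also have "2 * oscillation x (\<P> n) T * local_integral T (indicator A) \<le> 2 * Z * (\<epsilon> / (4 * (Z + 1)))"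
    proof (rule mult_mono)
      have iA: "integrable lborel (indicator A :: real \<Rightarrow> real)" using l by (intro integrable_real_indicator) (auto intro: less_trans)
      have "local_integral T (indicator A) \<le> (LINT u|lborel. indicator A u)"
        unfolding local_integral_def
      proof (rule integral_mono[OF _ iA])
        show "integrable lborel (\<lambda>u. indicat_real ?I u * \<bar>indicat_real A u\<bar>)"
          by (rule Bochner_Integration.integrable_bound[OF iA]) (auto simp: indicator_def)
      qed (auto simp: indicator_def)
      also have "\<dots> = measure lborel A" by simp
      also have "\<dots> < d" by (rule emeasure_less_imp_measure_less[OF l])
      finally show "local_integral T (indicator A) \<le> \<epsilon> / (4 * (Z + 1))" by (simp add: d_def)
    qed (use Z local_integral_nonneg in auto)
    also have "2 * Z * (\<epsilon> / (4 * (Z + 1))) \<le> \<epsilon> / 2"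
      using Z(1) e by (simp add: pos_divide_le_eq algebra_simps)
    finally show "(LINT u|lborel. LT n t u * indicator A u) < \<epsilon>" by (simp add: occupation_def)
  qed
qed

text \<open>Convergence for each \<open>t\<close> is extended from continuous weights to
  \<open>L\<^sup>q\<close>. The limit is continuous in time: for weights bounded by
  \<open>k\<close> its increments are at most \<open>k\<close> times those of the quadratic
  variation, and truncations of \<open>h\<close> approximate the limit for \<open>h\<close>
  uniformly in time, thanks to the uniform bound in \<open>L\<^sup>p\<close>.\<close>

lemma occupations_converge_if_tight:
  assumes qv: "has_quadratic_variation x \<P>" and tight: "\<And>M. 0 \<le> M \<Longrightarrow> \<exists>t\<ge>M. tight t"
  shows occupations_converge
  unfolding occupations_converge_def
proof (intro ballI)
  fix h assume h: "h \<in> Lp q"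
  have [measurable]: "h \<in> borel_measurable borel" using h by (rule Lp_measurable)
  have conv: "convergent (\<lambda>n. occupation n f t)" if f: "f \<in> Lp q" and t: "0 \<le> t" for f t
  proof -
    obtain T where T: "T \<ge> t" "tight T" using tight[OF t] by blast
    then have T0: "0 \<le> T" using t by simp
    obtain C where C: "\<And>n. Lp_norm p (LT n T) \<le> C" using T(2) unfolding tight_def by blast
    obtain C' where C': "\<And>n t. 0 \<le> t \<Longrightarrow> t \<le> T \<Longrightarrow> Lp_norm p (LT n t) \<le> C'" using Lp_norm_LT_bound[OF T0 C] by blast
    have uac: "uniformly_abs_continuous (\<lambda>n. LT n t)"
      by (rule uniformly_abs_continuous_LT[OF t T(1)]) (use T(2) in \<open>simp add: tight_def\<close>)
    show ?thesis unfolding occupation_def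
    proof (rule convergent_if_convergent_continuous[OF pq LT_bounded_on_Icc[OF t order_refl] LT_nonneg[OF t] uac C'[OF t T(1)] _ f])
      show "convergent (\<lambda>n. LINT u|lborel. LT n t u * g u)" if "continuous_on UNIV g" for g
        using occupation_continuous_limit[OF qv that t] by (auto simp: convergent_def occupation_def)
    qed
  qed
  define B where "B f t = lim (\<lambda>n. occupation n f t)" for f t
  have lim: "(\<lambda>n. occupation n f t) \<longlonglongrightarrow> B f t" if "f \<in> Lp q" "0 \<le> t" for f t
    unfolding B_def using conv[OF that] by (simp add: convergent_LIMSEQ_iff)
  define hk where "hk k u = h u * indicator {u. \<bar>h u\<bar> \<le> real k} u" for k u
  define tk where "tk k u = h u * indicator {u. \<bar>h u\<bar> > real k} u" for k u
  have [measurable]: "hk k \<in> borel_measurable borel" "tk k \<in> borel_measurable borel" for k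
    unfolding hk_def tk_def by measurable
  have hkL: "hk k \<in> Lp q" and tkL: "tk k \<in> Lp q" for k
    by (rule Lp_mono(1)[OF q_ge_1 h]; auto simp: hk_def tk_def indicator_def)+
  have hk_bd: "\<bar>hk k u\<bar> \<le> real k" for k u by (auto simp: hk_def indicator_def)
  have h_split: "occupation n h t = occupation n (hk k) t + occupation n (tk k) t" if "0 \<le> t" for n t k
  proof -
    have "h = (\<lambda>u. 1 * hk k u + 1 * tk k u)" by (auto simp: fun_eq_iff hk_def tk_def indicator_def)
    then show ?thesis
      using occupation_linear[OF that Lq_locally_integrable[OF hkL] Lq_locally_integrable[OF tkL], of n 1 k 1 k] by simp
  qed
  have cont: "continuous_on {0..T0} (B h)" if T0: "0 \<le> T0" for T0
  proof -
    let ?Q = "quadratic_variation x \<P>"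
    obtain T where T: "T \<ge> T0" "tight T" using tight[OF T0] by blast
    then have T0': "0 \<le> T" using T0 by simp
    obtain C where C: "\<And>n. Lp_norm p (LT n T) \<le> C" using T(2) unfolding tight_def by blast
    obtain C' where C': "\<And>n t. 0 \<le> t \<Longrightarrow> t \<le> T \<Longrightarrow> Lp_norm p (LT n t) \<le> C'" using Lp_norm_LT_bound[OF T0' C] by blast
    have Bk_cont: "continuous_on {0..T0} (B (hk k))" for k
    proof -
      \<comment> \<open>The weights \<open>k \<plusminus> hk k\<close> are nonnegative, so that their occupation
        integrals increase in the limit.\<close>
      have mono: "real k * ?Q s + \<sigma> * B (hk k) s \<le> real k * ?Q t + \<sigma> * B (hk k) t" if st: "0 \<le> s" "s \<le> t" and \<sigma>: "\<bar>\<sigma>\<bar> = 1" for s t \<sigma>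
      proof -
        let ?f = "\<lambda>u. real k * 1 + \<sigma> * hk k u"
        note li = locally_integrable_const Lq_locally_integrable[OF hkL]
        have L: "(\<lambda>n. occupation n ?f r) \<longlonglongrightarrow> real k * ?Q r + \<sigma> * B (hk k) r" if "0 \<le> r" for r
          unfolding occupation_linear[OF that li] using that
          by (intro tendsto_intros lim hkL occupation_1_tendsto[OF qv])
        have t0: "0 \<le> t" using st by simp
        show ?thesis
        proof (rule occupation_limit_mono[OF _ _ L[OF st(1)] L[OF t0] st])
          have "integrable lborel (\<lambda>u. indicator {a..b} u * hk k u)" for a b
            using li(2)[of k] by (simp add: locally_integrable_def set_integrable_def)
          then have "set_integrable lborel {a..b} ?f" for a b
            using integrable_indicator_Icc[of a b] by (simp add: set_integrable_def distrib_left mult.left_commute[of _ \<sigma>] mult.commute[of _ "real k"])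
          then show "locally_integrable ?f" by (simp add: locally_integrable_def)
          show "0 \<le> ?f u" for u
          proof -
            have "\<bar>\<sigma> * hk k u\<bar> \<le> real k" using hk_bd[of k u] \<sigma> by (simp add: abs_mult)
            then show ?thesis by simp
          qed
        qed
      qed
      have Lip: "\<bar>B (hk k) t - B (hk k) s\<bar> \<le> real k * \<bar>?Q t - ?Q s\<bar>" if "0 \<le> s" "s \<le> t" for s t
      proof -
        have "real k * ?Q s + B (hk k) s \<le> real k * ?Q t + B (hk k) t" "real k * ?Q s - B (hk k) s \<le> real k * ?Q t - B (hk k) t"
          using mono[OF that, of 1] mono[OF that, of "-1"] by auto
        then have "\<bar>B (hk k) t - B (hk k) s\<bar> \<le> real k * ?Q t - real k * ?Q s" by (simp add: abs_le_iff)
        also have "\<dots> = real k * (?Q t - ?Q s)" by (simp add: right_diff_distrib)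
        also have "\<dots> \<le> real k * \<bar>?Q t - ?Q s\<bar>" by (intro mult_left_mono) auto
        finally show ?thesis .
      qed
      have Lip': "\<bar>B (hk k) t - B (hk k) s\<bar> \<le> real k * \<bar>?Q t - ?Q s\<bar>" if "0 \<le> s" "0 \<le> t" for s t
        using Lip[of s t] Lip[of t s] that by (cases "s \<le> t") (auto simp: abs_minus_commute)
      have Qc: "continuous_on {0..T0} ?Q" using qv unfolding has_quadratic_variation_def by (auto intro: continuous_on_subset)
      show ?thesis
        unfolding continuous_on_def
      proof
        fix s assume s: "s \<in> {0..T0}"
        have "(?Q \<longlongrightarrow> ?Q s) (at s within {0..T0})" using Qc s by (simp add: continuous_on_def)
        then have "((\<lambda>t. real k * \<bar>?Q t - ?Q s\<bar>) \<longlongrightarrow> real k * \<bar>?Q s - ?Q s\<bar>) (at s within {0..T0})"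
          by (intro tendsto_intros)
        then have z: "((\<lambda>t. real k * \<bar>?Q t - ?Q s\<bar>) \<longlongrightarrow> 0) (at s within {0..T0})" by simp
        have "((\<lambda>t. B (hk k) t - B (hk k) s) \<longlongrightarrow> 0) (at s within {0..T0})"
          by (rule Lim_null_comparison[OF _ z]) (use Lip' s in \<open>auto simp: eventually_at_filter\<close>)
        then show "(B (hk k) \<longlongrightarrow> B (hk k) s) (at s within {0..T0})" by (rule LIM_zero_cancel)
      qed
    qed
    have "uniform_limit {0..T0} (\<lambda>k. B (hk k)) (B h) sequentially"
    proof (rule uniform_limitI)
      fix e :: real assume e: "e > 0"
      have "(\<lambda>k. C' * Lp_norm q (tk k)) \<longlonglongrightarrow> C' * 0"
        unfolding tk_def by (intro tendsto_mult_left Lp_norm_truncation_tendsto_0[OF q_ge_1 h])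
      then have "\<forall>\<^sub>F k in sequentially. C' * Lp_norm q (tk k) < e" using e by (intro order_tendstoD(2)) auto
      then show "\<forall>\<^sub>F k in sequentially. \<forall>t\<in>{0..T0}. dist (B (hk k) t) (B h t) < e"
      proof eventually_elim
        case (elim k)
        show ?case
        proof
          fix t assume t: "t \<in> {0..T0}"
          then have t': "0 \<le> t" "t \<le> T" using T by auto
          have "(\<lambda>n. occupation n h t - occupation n (hk k) t) \<longlonglongrightarrow> B h t - B (hk k) t"
            by (intro tendsto_diff lim h hkL t')
          then have l: "(\<lambda>n. \<bar>occupation n (tk k) t\<bar>) \<longlonglongrightarrow> \<bar>B h t - B (hk k) t\<bar>"
            unfolding h_split[OF t'(1), of _ k] by (intro tendsto_rabs) simp
          have "\<bar>occupation n (tk k) t\<bar> \<le> C' * Lp_norm q (tk k)" for n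
            using Holder_abs[OF pq LT_in_Lp[OF t'(1)] tkL, of n k] mult_right_mono[OF C'[OF t', of n] Lp_norm_nonneg[of q "tk k"]]
            unfolding occupation_def by linarith
          then have "\<bar>B h t - B (hk k) t\<bar> \<le> C' * Lp_norm q (tk k)" by (intro LIMSEQ_le_const2[OF l]) auto
          then show "dist (B (hk k) t) (B h t) < e" using elim by (simp add: dist_real_def abs_minus_commute)
        qed
      qed
    qed
    then show ?thesis by (rule uniform_limit_theorem[rotated]) (auto intro!: always_eventually Bk_cont)
  qed
  have "continuous_on {0..} (B h)" by (rule continuous_on_Ici_if_Icc[OF cont])
  then show "(\<forall>t\<ge>0. convergent (\<lambda>n. occupation n h t)) \<and> continuous_on {0..} (\<lambda>t. lim (\<lambda>n. occupation n h t))"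
    using conv[OF h] by (simp add: B_def[abs_def])
qed

lemma quadratic_variation_and_tight_iff:
  "has_quadratic_variation x \<P> \<and> (\<forall>M\<ge>0. \<exists>t\<ge>M. tight t) \<longleftrightarrow> occupations_converge"
  using has_quadratic_variation_if_occupations_converge tight_if_occupations_converge occupations_converge_if_tight
  by (metis order_refl)

lemma bounded_in_Lp_iff:
  assumes t: "0 \<le> t"
  shows "bounded_in_Lp p (\<lambda>n. LT n t) \<longleftrightarrow> (\<exists>C. \<forall>n. Lp_norm p (LT n t) \<le> C)"
  using LT_in_Lp[OF t] by (simp add: bounded_in_Lp_def)

lemma tight_iff_bounded:
  assumes t: "0 \<le> t" and p: "p \<noteq> 1"
  shows "tight t \<longleftrightarrow> bounded_in_Lp p (\<lambda>n. LT n t)"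
proof -
  have "uniformly_abs_continuous (\<lambda>n. LT n t)" if "\<forall>n. Lp_norm p (LT n t) \<le> C" for C
    by (rule uniformly_abs_continuous_if_bounded[OF pq p LT_in_Lp[OF t]]) (use that in blast)
  then show ?thesis unfolding tight_def bounded_in_Lp_iff[OF t] by blast
qed

lemma tight_iff_equi_integrable:
  assumes t: "0 \<le> t" and p: "p = 1"
  shows "tight t \<longleftrightarrow> equi_integrable (\<lambda>n. LT n t)"
  unfolding tight_def unfolding p by (rule equi_integrable_iff[OF LT_bounded_on_Icc[OF t order_refl] LT_nonneg[OF t], symmetric])

section \<open>The Tanaka and occupation times formulas\<close>

text \<open>Weak limits are determined up to null sets only. Testing with the sign of \<open>f - g\<close>
  on bounded intervals shows equality almost everywhere.\<close>

lemma AE_eq_if_pairings_eq: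
  assumes f: "f \<in> Lp p" and g: "g \<in> Lp p"
    and eq: "\<And>h. h \<in> Lp q \<Longrightarrow> (LINT u|lborel. f u * h u) = (LINT u|lborel. g u * h u)"
  shows "AE u in lborel. f u = g u"
proof -
  have [measurable]: "f \<in> borel_measurable borel" "g \<in> borel_measurable borel"
    using f g by (auto intro: Lp_measurable)
  have "AE u in lborel. u \<in> {- real k..real k} \<longrightarrow> f u = g u" for k :: nat
  proof -
    define h where "h u = sgn (f u - g u) * indicator {- real k..real k} u" for u
    have h: "bounded_on_Icc (real k) h"
      unfolding h_def by (rule bounded_on_IccI[where B=1]) (auto simp: indicator_def sgn_if)
    have hL: "h \<in> Lp q" by (rule bounded_on_Icc_Lp[OF q_ge_1 h])
    have i: "integrable lborel (\<lambda>u. f u * h u - g u * h u)"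
      by (rule Bochner_Integration.integrable_diff[OF Holder(1)[OF pq f hL] Holder(1)[OF pq g hL]])
    have "(LINT u|lborel. f u * h u - g u * h u) = 0"
      using eq[OF hL] Holder(1)[OF pq f hL] Holder(1)[OF pq g hL] by simp
    moreover have nn: "0 \<le> f u * h u - g u * h u" for u
      by (auto simp: h_def indicator_def sgn_if)
    ultimately have "AE u in lborel. f u * h u - g u * h u = 0"
      using integral_nonneg_eq_0_iff_AE[OF i] by simp
    then show ?thesis by eventually_elim (auto simp: h_def indicator_def sgn_if split: if_splits)
  qed
  then have "AE u in lborel. \<forall>k. u \<in> {- real k..real k} \<longrightarrow> f u = g u" by (subst AE_all_countable) blast
  then show ?thesis
  proof eventually_elim
    case (elim u)
    obtain k :: nat where "\<bar>u\<bar> \<le> real k" using real_arch_simple by blast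
    then have "u \<in> {- real k..real k}" by (simp add: abs_le_iff)
    then show ?case using elim by blast
  qed
qed

context
  fixes L :: "real \<Rightarrow> real \<Rightarrow> real"
  assumes L: "\<And>t. 0 \<le> t \<Longrightarrow> limitin (initial_topology (Lp p) \<Phi>) (\<lambda>n. LT n t) (L t) sequentially"
begin

lemma weak_limit_in_Lp:
  assumes t: "0 \<le> t" shows "L t \<in> Lp p"
  by (rule conjunct1[OF L[OF t, unfolded limitin_initial_topology_iff[OF nonempty LT_in_Lp[OF t]]]])

lemma occupation_tendsto_weak_limit:
  assumes t: "0 \<le> t" and h: "h \<in> Lp q"
  shows "(\<lambda>n. occupation n h t) \<longlonglongrightarrow> (LINT u|lborel. L t u * h u)"
  unfolding occupation_def
  by (rule bspec[OF conjunct2[OF L[OF t, unfolded limitin_initial_topology_iff[OF nonempty LT_in_Lp[OF t]]]] pairing[OF h]])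

text \<open>The limit of the discrete Tanaka formula. An almost everywhere derivative of \<open>f'\<close>
  is a legitimate weight because it agrees almost everywhere with one in \<open>L\<^sup>q\<close>.\<close>

lemma Tanaka_formula:
  assumes f: "f \<in> W2 q" and f'': "ae_derivative (deriv f) f''" and t: "0 \<le> t"
  shows "f (x t) - f (x 0) = pathwise_integral x \<P> (deriv f) t + 1 / 2 * (LINT u|lborel. L t u * f'' u)"
proof -
  have d: "(f has_real_derivative deriv f u) (at u)" for u
    using f by (simp add: W2_def DERIV_deriv_iff_field_differentiable)
  obtain h where h: "h \<in> Lp q" "ae_derivative (deriv f) h" and ac: "locally_abs_continuous (deriv f)"
    using f by (auto simp: W2_def W1_def)
  have der: "AE u in lborel. (deriv f has_real_derivative f'' u) (at u)" using f'' by (simp add: ae_derivative_def)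
  moreover have "AE u in lborel. (deriv f has_real_derivative h u) (at u)" using h(2) by (simp add: ae_derivative_def)
  ultimately have eq: "AE u in lborel. \<bar>f'' u\<bar> \<le> \<bar>h u\<bar>"
    by eventually_elim (metis DERIV_unique order_refl)
  have f''L: "f'' \<in> Lp q"
    by (rule Lp_mono(1)[OF q_ge_1 h(1) _ eq]) (use f'' in \<open>simp add: ae_derivative_def\<close>)
  have "riemann_sum x (\<P> n) (deriv f) t = f (x t) - f (x 0) - 1 / 2 * occupation n f'' t" for n
    using Tanaka[OF t d ac der Lq_locally_integrable[OF f''L], of n] by simp
  then have "(\<lambda>n. riemann_sum x (\<P> n) (deriv f) t) \<longlonglongrightarrow> f (x t) - f (x 0) - 1 / 2 * (LINT u|lborel. L t u * f'' u)"
    by (simp only:) (intro tendsto_intros occupation_tendsto_weak_limit[OF t f''L])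
  then show ?thesis by (simp add: pathwise_integral_def limI)
qed

text \<open>The weak limit \<open>L t\<close> is given up to null sets; the occupation formula is proved for
  the version \<open>K\<close> which is nonnegative and vanishes outside an interval.\<close>

lemma occupation_times_formula:
  assumes H: occupations_converge and t: "0 \<le> t" and h: "h \<in> borel_measurable borel"
  shows "(LINT s:{0..t}|qv_measure x \<P>. h (x s)) = (LINT u|lborel. L t u * h u)"
proof -
  let ?I = "{- range_bound t..range_bound t}"
  obtain K where K: "K \<in> Lp p" "\<And>u. 0 \<le> K u" "\<And>u. u \<notin> ?I \<Longrightarrow> K u = 0"
    "\<And>g. g \<in> Lp q \<Longrightarrow> (\<lambda>n. occupation n g t) \<longlonglongrightarrow> (LINT u|lborel. K u * g u)"
    using limit_density[OF H t] by blast
  have [measurable]: "K \<in> borel_measurable borel" "L t \<in> borel_measurable borel"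
    using K(1) weak_limit_in_Lp[OF t] by (auto intro: Lp_measurable)
  have AE: "AE u in lborel. K u = L t u"
    by (rule AE_eq_if_pairings_eq[OF K(1) weak_limit_in_Lp[OF t]]) (rule LIMSEQ_unique[OF K(4) occupation_tendsto_weak_limit[OF t]])
  have "integrable lborel (\<lambda>u. K u * indicator ?I u)"
    by (rule Holder(1)[OF pq K(1) indicator_in_Lp[OF q_ge_1]]) auto
  moreover have "(\<lambda>u. K u * indicator ?I u) = K" using K(3) by (auto simp: fun_eq_iff indicator_def)
  ultimately have iK: "integrable lborel K" by simp
  have "(LINT s:{0..t}|qv_measure x \<P>. h (x s)) = (LINT u|lborel. K u * h u)"
  proof (rule occupation_formula[OF has_quadratic_variation_if_occupations_converge[OF H] t iK K(2) _ h])
    fix \<phi> :: "real \<Rightarrow> real" assume \<phi>: "continuous_on UNIV \<phi>" "bounded (range \<phi>)"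
    then obtain B where B: "\<And>u. \<bar>\<phi> u\<bar> \<le> B" by (auto simp: bounded_iff)
    have [measurable]: "\<phi> \<in> borel_measurable borel" using \<phi>(1) by (rule borel_measurable_continuous_onI)
    define g where "g u = indicator ?I u * \<phi> u" for u
    have "bounded_on_Icc (range_bound t) g"
      unfolding g_def by (rule bounded_on_Icc_mult[OF bounded_on_Icc_indicator, where B=B]) (use B in auto)
    then have gL: "g \<in> Lp q" by (rule bounded_on_Icc_Lp[OF q_ge_1])
    have "occupation n g t = occupation n \<phi> t" for n
      unfolding occupation_def g_def using bounded_on_Icc_outside[OF LT_bounded_on_Icc[OF t order_refl]]
      by (intro Bochner_Integration.integral_cong) (auto simp: indicator_def)
    moreover have "(LINT u|lborel. K u * g u) = (LINT u|lborel. K u * \<phi> u)"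
      unfolding g_def using K(3) by (intro Bochner_Integration.integral_cong) (auto simp: indicator_def)
    ultimately show "(\<lambda>n. occupation n \<phi> t) \<longlonglongrightarrow> (LINT u|lborel. K u * \<phi> u)" using K(4)[OF gL] by simp
  qed
  also have "\<dots> = (LINT u|lborel. L t u * h u)"
    by (rule integral_cong_AE) (use h AE in auto)
  finally show ?thesis .
qed

end

end

theorem theorem3p1:
  fixes x :: "real \<Rightarrow> real"
    and \<P> :: "nat \<Rightarrow> nat \<Rightarrow> ennreal"
    and p q :: ennreal
    and \<tau> :: "(real \<Rightarrow> real) topology"
    and Bdd :: "(nat \<Rightarrow> real \<Rightarrow> real) \<Rightarrow> bool"
  assumes x_cont: "continuous_on {0..} x"
    and partitions: "\<And>n. partition (\<P> n)"
    and osc: "\<And>t. 0 \<le> t \<Longrightarrow> (\<lambda>n. oscillation x (\<P> n) t) \<longlonglongrightarrow> 0"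
    and exponents:
      "(1 < p \<and> p < \<infinity> \<and> q = p / (p - 1) \<and> \<tau> = weak_topology p \<and> Bdd = bounded_in_Lp p) \<or>
       (p = \<infinity> \<and> q = 1 \<and> \<tau> = weak_star_topology \<and> Bdd = bounded_in_Lp p) \<or>
       (p = 1 \<and> q = \<infinity> \<and> \<tau> = weak_topology p \<and> Bdd = equi_integrable)"
  shows
    "let C1 = (\<forall>g\<in>W1 q.
           (\<forall>t\<ge>0. convergent (\<lambda>n. riemann_sum x (\<P> n) g t)) \<and>
           continuous_on {0..} (pathwise_integral x \<P> g));
         C2 = (\<forall>g\<in>W1 q. \<forall>K. compact K \<and> K \<subseteq> {0..} \<longrightarrow>
           uniformly_convergent_on K (\<lambda>n t. riemann_sum x (\<P> n) g t));
         C3 = (\<exists>L. (\<forall>t\<ge>0. limitin \<tau> (\<lambda>n. discrete_local_time x (\<P> n) t) (L t) sequentially) \<and>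
           continuous_map (top_of_set {0..}) \<tau> L);
         C4 = (\<exists>L. (\<forall>t\<ge>0. L t \<in> Lp p) \<and>
           (\<forall>h\<in>Lp q. \<forall>K. compact K \<and> K \<subseteq> {0..} \<longrightarrow>
             uniform_limit K (\<lambda>n t. LINT u|lborel. discrete_local_time x (\<P> n) t u * h u)
               (\<lambda>t. LINT u|lborel. L t u * h u) sequentially));
         C5 = (has_quadratic_variation x \<P> \<and>
           (\<forall>M\<ge>0. \<exists>t\<ge>M. Bdd (\<lambda>n. discrete_local_time x (\<P> n) t)))
     in (C1 \<longleftrightarrow> C2) \<and> (C2 \<longleftrightarrow> C3) \<and> (C3 \<longleftrightarrow> C4) \<and> (C4 \<longleftrightarrow> C5) \<and>
        (C1 \<longrightarrow>
          (\<forall>t\<ge>0. bounded_in_Lp p (\<lambda>n. discrete_local_time x (\<P> n) t)) \<and>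
          (\<forall>L. (\<forall>t\<ge>0. limitin \<tau> (\<lambda>n. discrete_local_time x (\<P> n) t) (L t) sequentially) \<longrightarrow>
            (\<forall>f\<in>W2 q. \<forall>f''. ae_derivative (deriv f) f'' \<longrightarrow>
              (\<forall>t\<ge>0. f (x t) - f (x 0) =
                 pathwise_integral x \<P> (deriv f) t + 1 / 2 * (LINT u|lborel. L t u * f'' u))) \<and>
            (\<forall>t\<ge>0. \<forall>h\<in>borel_measurable borel. bounded (range h) \<longrightarrow>
              (LINT s:{0..t}|qv_measure x \<P>. h (x s)) = (LINT u|lborel. L t u * h u))))"
proof -
  have pq: "conjugate p q"
    using exponents conjugate_divide[of p] by (auto simp: conjugate_def)
  obtain \<Phi> where \<tau>: "\<tau> = initial_topology (Lp p) \<Phi>" and \<Phi>: "weak_duality p q \<Phi>"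
  proof (cases "p = top")
    case True
    then have "q = 1" "\<tau> = weak_star_topology" using exponents by auto
    then show ?thesis
      using that[of "{\<lambda>f. LINT u|lborel. f u * h u | h. h \<in> Lp 1}"] weak_duality_weak_star_topology True
      by (simp add: weak_star_topology_def)
  next
    case False
    then have "\<tau> = weak_topology p" using exponents by auto
    then show ?thesis
      using that[of "Lp_dual p"] weak_duality_weak_topology[OF pq False] by (simp add: weak_topology_def)
  qed
  interpret pathwise_duality x \<P> p q \<Phi>
    by (intro pathwise_duality.intro pathwise.intro \<Phi> x_cont partitions osc)
  have Bdd: "Bdd (\<lambda>n. discrete_local_time x (\<P> n) t) \<longleftrightarrow> tight t" if t: "0 \<le> t" for t
  proof (cases "p = 1")
    case True
    then have "Bdd = equi_integrable" using exponents by auto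
    then show ?thesis using tight_iff_equi_integrable[OF t True] by simp
  next
    case False
    then have "Bdd = bounded_in_Lp p" using exponents by auto
    then show ?thesis using tight_iff_bounded[OF t False] by simp
  qed
  have C5: "(has_quadratic_variation x \<P> \<and> (\<forall>M\<ge>0. \<exists>t\<ge>M. Bdd (\<lambda>n. discrete_local_time x (\<P> n) t))) \<longleftrightarrow> occupations_converge"
    unfolding quadratic_variation_and_tight_iff[symmetric] using Bdd by (meson order_trans)
  show ?thesis
    unfolding Let_def \<tau> integrals_converge_iff integrals_converge_uniformly_iff weakly_convergent_iff
      uniformly_weakly_convergent_iff C5
  proof (intro conjI impI allI ballI refl)
    assume H: occupations_converge
    show "bounded_in_Lp p (\<lambda>n. discrete_local_time x (\<P> n) t)" if "0 \<le> t" for t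
      using tight_if_occupations_converge[OF H that] unfolding bounded_in_Lp_iff[OF that] tight_def by blast
    fix L assume "\<forall>t\<ge>0. limitin (initial_topology (Lp p) \<Phi>) (\<lambda>n. discrete_local_time x (\<P> n) t) (L t) sequentially"
    then have L: "\<And>t. 0 \<le> t \<Longrightarrow> limitin (initial_topology (Lp p) \<Phi>) (\<lambda>n. discrete_local_time x (\<P> n) t) (L t) sequentially"
      by blast
    show "f (x t) - f (x 0) = pathwise_integral x \<P> (deriv f) t + 1 / 2 * (LINT u|lborel. L t u * f'' u)"
      if "f \<in> W2 q" "ae_derivative (deriv f) f''" "0 \<le> t" for f f'' t
      using Tanaka_formula[OF L that] .
    show "(LINT s:{0..t}|qv_measure x \<P>. h (x s)) = (LINT u|lborel. L t u * h u)"
      if "0 \<le> t" "h \<in> borel_measurable borel" for t h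
      using occupation_times_formula[OF L H that] .
  qed
qed

end
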